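(* Fix integers $m,n\ge1$, $s\ge0$, $r\ge1$; let $V$, $\mathfrak h$ and the walls be as in the context. Fix $\emptyset\ne I\subsetneq[m]$, $\emptyset\ne J\subsetneq[n]$, $t\in\{0,\dots,s\}$, and let $\mathfrak c_1,\mathfrak c_2$ be two chambers bordering the wall $W_{I,J,t}$ on opposite sides, with $\delta:=x_I-y_J-tk>0$ on $\mathfrak c_1$ and $\delta<0$ on $\mathfrak c_2$. Let $P_1,P_2$ be the polynomials agreeing with $\mathfrak h$ on $\mathfrak c_1$, $\mathfrak c_2$ respectively, and $WC^{\wr,r}_{I,J,t}:=P_1-P_2$. Then for $(\mu,\nu,k)\in\mathfrak c_1$, with $\delta=\mu_I-\nu_J-tk$, $$WC^{\wr,r}_{I,J,t}(\mu,\nu)=[z_1^{r+1}\cdots z_s^{r+1}]\sum_{\substack{K\subset[s]\\|K|=t}}\delta^2\,\frac{\varsigma(z_K)\,\varsigma(z_{K^c})\,\varsigma(\delta z_{[s]})}{\varsigma(\delta z_K)\,\varsigma(\delta z_{K^c})\,\varsigma(z_{[s]})}\,H^{\wr,|K|}_{\mu_I,\nu_J+\delta}(\{z_p\}_{p\in K})\,H^{\wr,|K^c|}_{\mu_{I^c}+\delta,\nu_{J^c}}(\{z_p\}_{p\in K^c}),$$ where $z_K=\sum_{p\in K}z_p$, $K^c=[s]\setminus K$, $I^c=[m]\setminus I$, $J^c=[n]\setminus J$.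
   Context: Let $\varsigma(z)=e^{z/2}-e^{-z/2}$. Let $\mathcal V_0$ be the charge-zero sector of the semi-infinite wedge space with orthonormal basis $v_\lambda$ indexed by partitions; $\langle\mathcal O\rangle=(v_\emptyset,\mathcal O v_\emptyset)$. With $\psi_i$ ($i\in\mathbb Z+\tfrac12$) the operator wedging with $\underline i$ on the left, $\psi_i^\dagger$ its adjoint, $E_{i,j}=\psi_i\psi_j^\dagger$ if $j>0$ and $-\psi_j^\dagger\psi_i$ if $j<0$, define $\mathcal E_n(z)=\sum_{k\in\mathbb Z+1/2}e^{z(k-n/2)}E_{k-n,k}+\delta_{n,0}/\varsigma(z)$, $\alpha_n=\mathcal E_n(0)$ ($n\neq0$), $\tilde{\mathcal E}_0(z)=\sum_k e^{zk}E_{k,k}$; when $k=0$, $\tilde{\mathcal E}_0(z_p)$ is used in place of $\mathcal E_{-k}(z_p)$ below. For positive integer tuples $\mu=(\mu_1,\dots,\mu_m)$, $\nu=(\nu_1,\dots,\nu_n)$: $h^{\wr,k,r,s}_{\mu,\nu}=[z_1^{r+1}\cdots z_s^{r+1}]\frac{1}{\prod_i\mu_i\prod_j\nu_j}\langle\prod_{i=1}^m\alpha_{\mu_i}\prod_{p=1}^s\mathcal E_{-k}(z_p)\prod_{j=1}^n\alpha_{-\nu_j}\rangle$. Let $V=\{(x,y,k)\in\mathbb Z_{>0}^m\times\mathbb Z_{>0}^n\times\mathbb Z_{\ge0}:\sum x_i=\sum y_j+sk\}$ and $\mathfrak h(\mu,\nu,k)=h^{\wr,k,r,s}_{\mu,\nu}$.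 Walls: $W_{I,J,t}:x_I-y_J-kt=0$ ($\emptyset\ne I\subsetneq[m]$, $\emptyset\ne J\subsetneq[n]$, $t\in\{0,\dots,s\}$), $x_I=\sum_{i\in I}x_i$. Chambers: sets of points of $V$ in one connected component of the complement of the union of walls in $\{(x,y,k)\in\mathbb R_{>0}^m\times\mathbb R_{>0}^n\times\mathbb R_{\ge0}:\sum x_i=\sum y_j+sk\}$; on each chamber $\mathfrak h$ agrees with a polynomial. For tuples of nonzero integers $a=(a_1,\dots,a_p)$, $b=(b_1,\dots,b_q)$ and variables $w_1,\dots,w_{s'}$, set $$H^{\wr,s'}_{a,b}(w_1,\dots,w_{s'})=\frac{1}{\prod_i a_i\prod_j b_j}\Big\langle\prod_{i=1}^p\mathcal E_{a_i}(0)\prod_{l=1}^{s'}\mathcal E_{-k}(w_l)\prod_{j=1}^q\mathcal E_{-b_j}(0)\Big\rangle,$$ a formal power series. In the formula, $H^{\wr,|K|}_{\mu_I,\nu_J+\delta}(\{z_p\}_{p\in K})$ means $a=(\mu_i)_{i\in I}$, $b=(\nu_j)_{j\in J}$ followed by the extra last entry $\delta$, with variables $z_p$, $p\in K$ in increasing order; $H^{\wr,|K^c|}_{\mu_{I^c}+\delta,\nu_{J^c}}(\{z_p\}_{p\in K^c})$ means $a=\delta$ followed by $(\mu_i)_{i\notin I}$, $b=(\nu_j)_{j\notin J}$, with variables $z_p$, $p\in K^c$. *)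

theory Defs
  imports
    "HOL-Analysis.Analysis"
    "HOL-Library.Poly_Mapping"
    "HOL-Computational_Algebra.Formal_Power_Series"
begin

abbreviation (input) lookup where "lookup \<equiv> Poly_Mapping.lookup"
abbreviation (input) keys where "keys \<equiv> Poly_Mapping.keys"

section \<open>Formal power series in the variables \<open>z\<^sub>0, z\<^sub>1, z\<^sub>2, \<dots>\<close>\<close>

text \<open>A monomial is its exponent vector, of type \<open>nat \<Rightarrow>\<^sub>0 nat\<close>; a series is an arbitrary
  coefficient function on monomials.\<close>

typedef (overloaded) 'a mfps = "UNIV :: ((nat \<Rightarrow>\<^sub>0 nat) \<Rightarrow> 'a) set"
  morphisms mcoeff Abs_mfps by simp

setup_lifting type_definition_mfps

lemma mfps_eqI: "(\<And>m. mcoeff f m = mcoeff g m) \<Longrightarrow> f = g"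
  by (metis ext mcoeff_inject)

lemma mcoeff_Abs [simp]: "mcoeff (Abs_mfps f) m = f m"
  by (simp add: Abs_mfps_inverse)

definition splits :: "(nat \<Rightarrow>\<^sub>0 nat) \<Rightarrow> ((nat \<Rightarrow>\<^sub>0 nat) \<times> (nat \<Rightarrow>\<^sub>0 nat)) set" where
  "splits m = {(a, b). a + b = m}"

lemma mem_splits [simp]: "(a, b) \<in> splits m \<longleftrightarrow> a + b = m"
  by (simp add: splits_def)

lemma finite_splits: "finite (splits m)"
proof -
  define N where "N = (\<Sum>x\<in>keys m. lookup m x)"
  define F where "F = {f. \<forall>x. (x \<in> keys m \<longrightarrow> f x \<in> {..N}) \<and> (x \<notin> keys m \<longrightarrow> f x = (0::nat))}"
  have fin: "finite F"
    unfolding F_def by (intro finite_set_of_finite_funs) simp_all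
  have le: "lookup a \<in> F" if "\<And>x. lookup a x \<le> lookup m x" for a
  proof -
    have "lookup a x \<le> N" if "x \<in> keys m" for x
      using member_le_sum[OF that, of "lookup m"] \<open>lookup a x \<le> lookup m x\<close>
      unfolding N_def by simp
    moreover have "lookup a x = 0" if "x \<notin> keys m" for x
      using that \<open>lookup a x \<le> lookup m x\<close> by (simp add: in_keys_iff)
    ultimately show ?thesis unfolding F_def by simp
  qed
  let ?h = "\<lambda>p. (lookup (fst p), lookup (snd p))"
  have "inj_on ?h (splits m)"
    by (rule inj_onI) (simp add: poly_mapping.lookup_inject prod_eq_iff)
  moreover have "?h ` splits m \<subseteq> F \<times> F"
  proof (rule image_subsetI)
    fix p assume "p \<in> splits m"
    then have "lookup m x = lookup (fst p) x + lookup (snd p) x" for x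
      by (cases p) (auto simp: lookup_add)
    then show "?h p \<in> F \<times> F" using le[of "fst p"] le[of "snd p"] by simp
  qed
  ultimately show ?thesis
    using finite_cartesian_product[OF fin fin] by (rule inj_on_finite)
qed

instantiation mfps :: (comm_ring_1) comm_ring_1
begin

lift_definition zero_mfps :: "'a mfps" is "\<lambda>_. 0" .
lift_definition one_mfps :: "'a mfps" is "\<lambda>m. if m = 0 then 1 else 0" .
lift_definition plus_mfps :: "'a mfps \<Rightarrow> 'a mfps \<Rightarrow> 'a mfps" is "\<lambda>f g m. f m + g m" .
lift_definition minus_mfps :: "'a mfps \<Rightarrow> 'a mfps \<Rightarrow> 'a mfps" is "\<lambda>f g m. f m - g m" .
lift_definition uminus_mfps :: "'a mfps \<Rightarrow> 'a mfps" is "\<lambda>f m. - f m" .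
lift_definition times_mfps :: "'a mfps \<Rightarrow> 'a mfps \<Rightarrow> 'a mfps"
  is "\<lambda>f g m. \<Sum>(a, b)\<in>splits m. f a * g b" .

instance
proof
  fix f g h :: "'a mfps"
  show "f * g * h = f * (g * h)"
  proof (rule mfps_eqI)
    fix m
    let ?t = "\<lambda>a b c. mcoeff f a * mcoeff g b * mcoeff h c"
    have "mcoeff (f * g * h) m = (\<Sum>p\<in>splits m. \<Sum>q\<in>splits (fst p). ?t (fst q) (snd q) (snd p))"
      by (simp add: times_mfps.rep_eq sum_distrib_right case_prod_unfold)
    also have "\<dots> = (\<Sum>(p, q)\<in>(SIGMA p:splits m. splits (fst p)). ?t (fst q) (snd q) (snd p))"
      by (rule sum.Sigma) (simp_all add: finite_splits)
    also have "\<dots> = (\<Sum>(p, q)\<in>(SIGMA p:splits m. splits (snd p)). ?t (fst p) (fst q) (snd q))"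
      by (rule sum.reindex_bij_witness
            [where i = "\<lambda>((a, v), (b, c)). ((a + b, c), (a, b))"
               and j = "\<lambda>((u, c), (a, b)). ((a, b + c), (b, c))"])
         (auto simp: add.assoc)
    also have "\<dots> = (\<Sum>p\<in>splits m. \<Sum>q\<in>splits (snd p). ?t (fst p) (fst q) (snd q))"
      by (rule sum.Sigma[symmetric]) (simp_all add: finite_splits)
    also have "\<dots> = mcoeff (f * (g * h)) m"
      by (simp add: times_mfps.rep_eq sum_distrib_left case_prod_unfold mult.assoc)
    finally show "mcoeff (f * g * h) m = mcoeff (f * (g * h)) m" .
  qed
  show "f * g = g * f"
    by (rule mfps_eqI, unfold times_mfps.rep_eq,
        rule sum.reindex_bij_witness[where i = "\<lambda>(a, b). (b, a)" and j = "\<lambda>(a, b). (b, a)"])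
       (auto simp: add.commute mult.commute)
  show "1 * f = f"
  proof (rule mfps_eqI)
    fix m
    have "mcoeff (1 * f) m = (\<Sum>p\<in>splits m. if p = (0, m) then mcoeff f m else 0)"
      unfolding times_mfps.rep_eq by (rule sum.cong) (auto simp: one_mfps.rep_eq split: if_splits)
    also have "\<dots> = mcoeff f m"
      by (simp add: finite_splits)
    finally show "mcoeff (1 * f) m = mcoeff f m" .
  qed
  show "(f + g) * h = f * h + g * h"
    by (rule mfps_eqI)
       (simp add: times_mfps.rep_eq plus_mfps.rep_eq case_prod_unfold distrib_right sum.distrib)
  show "(0::'a mfps) \<noteq> 1"
    by (metis one_mfps.rep_eq zero_mfps.rep_eq zero_neq_one)
qed (rule mfps_eqI; simp add: plus_mfps.rep_eq zero_mfps.rep_eq minus_mfps.rep_eq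
       uminus_mfps.rep_eq algebra_simps)+

end

definition mconst :: "'a::comm_ring_1 \<Rightarrow> 'a mfps" where
  "mconst c = Abs_mfps (\<lambda>m. if m = 0 then c else 0)"

definition mvar :: "nat \<Rightarrow> 'a::comm_ring_1 mfps" where
  "mvar p = Abs_mfps (\<lambda>m. if m = Poly_Mapping.single p 1 then 1 else 0)"

definition mdeg :: "(nat \<Rightarrow>\<^sub>0 nat) \<Rightarrow> nat" where
  "mdeg m = (\<Sum>p\<in>keys m. lookup m p)"

text \<open>Substitution \<open>F(u)\<close> of a series \<open>u\<close> without constant term into a one-variable series \<open>F\<close>.
  Since \<open>u\<^sup>n\<close> then only has terms of degree \<open>\<ge> n\<close>, truncating the sum over \<open>n\<close> at the
  degree of the monomial loses nothing.\<close>

definition msubst :: "'a::comm_ring_1 fps \<Rightarrow> 'a mfps \<Rightarrow> 'a mfps" where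
  "msubst F u = Abs_mfps (\<lambda>m. \<Sum>n\<le>mdeg m. fps_nth F n * mcoeff (u ^ n) m)"

lemma mdeg_add: "mdeg (a + b) = mdeg a + mdeg b"
proof -
  have ext: "mdeg c = sum (lookup c) (keys a \<union> keys b)" if "keys c \<subseteq> keys a \<union> keys b" for c
    unfolding mdeg_def by (rule sum.mono_neutral_left) (use that in \<open>auto simp: in_keys_iff\<close>)
  have "keys (a + b) \<subseteq> keys a \<union> keys b" by (rule Poly_Mapping.keys_add)
  then show ?thesis by (simp add: ext lookup_add sum.distrib)
qed

lemma mdeg_eq_0_iff: "mdeg a = 0 \<longleftrightarrow> a = 0"
proof
  assume "mdeg a = 0"
  then have "lookup a p = 0" for p
    by (cases "p \<in> keys a") (auto simp: mdeg_def in_keys_iff)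
  then show "a = 0" by (intro poly_mapping_eqI) simp
qed (simp add: mdeg_def)

lemma mcoeff_power_eq_0:
  assumes "mcoeff u 0 = 0" "mdeg m < n"
  shows "mcoeff (u ^ n) m = 0"
  using assms(2)
proof (induction n arbitrary: m)
  case (Suc n)
  have "mcoeff u a * mcoeff (u ^ n) b = 0" if "a + b = m" for a b
  proof (cases "a = 0")
    case False
    then have "mdeg a > 0" using mdeg_eq_0_iff by blast
    then have "mdeg b < n" using Suc.prems mdeg_add[of a b] unfolding that by linarith
    then show ?thesis using Suc.IH by simp
  qed (simp add: assms(1))
  then show ?case by (auto simp: times_mfps.rep_eq intro!: sum.neutral)
qed simp

lemma mcoeff_msubst:
  assumes "mcoeff u 0 = 0" "mdeg m \<le> N"
  shows "mcoeff (msubst F u) m = (\<Sum>n\<le>N. fps_nth F n * mcoeff (u ^ n) m)"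
  unfolding msubst_def mcoeff_Abs
  by (rule sum.mono_neutral_left) (use assms in \<open>auto simp: mcoeff_power_eq_0\<close>)

lemma msubst_mult:
  assumes u: "mcoeff u 0 = 0"
  shows "msubst (F * G) u = msubst F u * msubst G u"
proof (rule mfps_eqI)
  fix m
  let ?N = "mdeg m"
  let ?c = "\<lambda>i j. fps_nth F i * fps_nth G j"
  have "mcoeff (msubst F u * msubst G u) m =
      (\<Sum>(a, b)\<in>splits m. (\<Sum>i\<le>?N. fps_nth F i * mcoeff (u ^ i) a) * (\<Sum>j\<le>?N. fps_nth G j * mcoeff (u ^ j) b))"
    unfolding times_mfps.rep_eq
    by (rule sum.cong) (auto simp: mcoeff_msubst[OF u, where N = ?N] mdeg_add)
  also have "\<dots> = (\<Sum>p\<in>splits m. \<Sum>i\<le>?N. \<Sum>j\<le>?N. ?c i j * (mcoeff (u ^ i) (fst p) * mcoeff (u ^ j) (snd p)))"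
    by (simp add: sum_product case_prod_unfold mult_ac)
  also have "\<dots> = (\<Sum>i\<le>?N. \<Sum>p\<in>splits m. \<Sum>j\<le>?N. ?c i j * (mcoeff (u ^ i) (fst p) * mcoeff (u ^ j) (snd p)))"
    by (rule sum.swap)
  also have "\<dots> = (\<Sum>i\<le>?N. \<Sum>j\<le>?N. \<Sum>p\<in>splits m. ?c i j * (mcoeff (u ^ i) (fst p) * mcoeff (u ^ j) (snd p)))"
    by (intro sum.cong refl sum.swap)
  also have "\<dots> = (\<Sum>i\<le>?N. \<Sum>j\<le>?N. ?c i j * mcoeff (u ^ (i + j)) m)"
    by (simp add: power_add times_mfps.rep_eq case_prod_unfold sum_distrib_left)
  also have "\<dots> = (\<Sum>(i, j)\<in>{..?N} \<times> {..?N}. ?c i j * mcoeff (u ^ (i + j)) m)"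
    by (simp add: sum.cartesian_product)
  also have "\<dots> = (\<Sum>(i, j)\<in>{(i, j). i + j \<le> ?N}. ?c i j * mcoeff (u ^ (i + j)) m)"
  proof (rule sum.mono_neutral_right)
    show "\<forall>p\<in>{..?N} \<times> {..?N} - {(i, j). i + j \<le> ?N}. (case p of (i, j) \<Rightarrow> ?c i j * mcoeff (u ^ (i + j)) m) = 0"
      using mcoeff_power_eq_0[OF u] by (simp add: case_prod_unfold not_le)
  qed auto
  also have "\<dots> = (\<Sum>(n, i)\<in>(SIGMA n:{..?N}. {..n}). ?c i (n - i) * mcoeff (u ^ n) m)"
    by (rule sum.reindex_bij_witness[where i = "\<lambda>(n, i). (i, n - i)" and j = "\<lambda>(i, j). (i + j, i)"]) auto
  also have "\<dots> = (\<Sum>n\<le>?N. \<Sum>i\<le>n. ?c i (n - i) * mcoeff (u ^ n) m)"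
    by (subst sum.Sigma) auto
  also have "\<dots> = mcoeff (msubst (F * G) u) m"
    by (simp add: msubst_def fps_mult_nth sum_distrib_right atLeast0AtMost)
  finally show "mcoeff (msubst (F * G) u) m = mcoeff (msubst F u * msubst G u) m" by simp
qed


section \<open>The semi-infinite wedge space\<close>

text \<open>Throughout, the half-integer \<open>i + 1/2\<close> is encoded by the integer \<open>i\<close>; it is positive
  iff \<open>i \<ge> 0\<close>. A basis vector \<open>s\<^sub>1 \<and> s\<^sub>2 \<and> \<dots>\<close> with \<open>s\<^sub>1 > s\<^sub>2 > \<dots>\<close> is encoded by the set of
  its entries, which contains finitely many positive and misses finitely many negative
  half-integers. The vectors \<open>v\<^sub>\<lambda>\<close> of the charge-zero sector are those with entries
  \<open>\<lambda>\<^sub>j - j + 1/2\<close>.\<close>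

definition is_maya :: "int set \<Rightarrow> bool" where
  "is_maya S \<longleftrightarrow> finite (S \<inter> {0..}) \<and> finite ({..<0} - S)"

lemma is_maya_vacuum: "is_maya {..<0}"
proof -
  have "{..<0::int} \<inter> {0..} = {}" by auto
  then show ?thesis by (simp add: is_maya_def)
qed

lemma is_maya_insert: "is_maya S \<Longrightarrow> is_maya (insert i S)"
proof -
  assume S: "is_maya S"
  have "insert i S \<inter> {0..} \<subseteq> insert i (S \<inter> {0..})" "{..<0} - insert i S \<subseteq> {..<0} - S" by blast+
  from this[THEN finite_subset] show ?thesis using S by (simp add: is_maya_def)
qed

lemma is_maya_remove: "is_maya S \<Longrightarrow> is_maya (S - {i})"
proof -
  assume S: "is_maya S"
  have "(S - {i}) \<inter> {0..} \<subseteq> S \<inter> {0..}" "{..<0} - (S - {i}) \<subseteq> insert i ({..<0} - S)" by blast+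
  from this[THEN finite_subset] show ?thesis using S by (simp add: is_maya_def)
qed

typedef maya = "{S. is_maya S}"
  morphisms entries Abs_maya
  using is_maya_vacuum by blast

setup_lifting type_definition_maya

lift_definition maya_insert :: "int \<Rightarrow> maya \<Rightarrow> maya" is "\<lambda>i S. insert i S"
  by (rule is_maya_insert)

lift_definition maya_remove :: "int \<Rightarrow> maya \<Rightarrow> maya" is "\<lambda>i S. S - {i}"
  by (rule is_maya_remove)

lift_definition vacuum_maya :: maya is "{..<0}"
  by (rule is_maya_vacuum)

type_synonym 'a wedge = "maya \<Rightarrow>\<^sub>0 'a"

definition wscale :: "'a::comm_ring_1 \<Rightarrow> 'a wedge \<Rightarrow> 'a wedge" where
  "wscale c v = Poly_Mapping.map (\<lambda>x. c * x) v"

definition linear_ext :: "(maya \<Rightarrow> 'a::comm_ring_1 wedge) \<Rightarrow> 'a wedge \<Rightarrow> 'a wedge" where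
  "linear_ext f v = (\<Sum>S\<in>keys v. wscale (lookup v S) (f S))"

definition wedge_inner :: "'a::comm_ring_1 wedge \<Rightarrow> 'a wedge \<Rightarrow> 'a" where
  "wedge_inner u v = (\<Sum>S\<in>keys u. lookup u S * lookup v S)"

text \<open>The sign that arises from moving \<open>i\<close> past all larger entries.\<close>

definition wedge_sign :: "int \<Rightarrow> maya \<Rightarrow> 'a::comm_ring_1" where
  "wedge_sign i S = (- 1) ^ card {j \<in> entries S. j > i}"

definition psi :: "int \<Rightarrow> 'a::comm_ring_1 wedge \<Rightarrow> 'a wedge" where
  "psi i = linear_ext (\<lambda>S.
     if i \<in> entries S then 0 else Poly_Mapping.single (maya_insert i S) (wedge_sign i S))"

definition psi_dag :: "int \<Rightarrow> 'a::comm_ring_1 wedge \<Rightarrow> 'a wedge" where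
  "psi_dag i = linear_ext (\<lambda>S.
     if i \<in> entries S then Poly_Mapping.single (maya_remove i S) (wedge_sign i S) else 0)"

lemma lookup_wscale [simp]: "lookup (wscale c v) S = c * lookup v S"
  by (simp add: wscale_def Poly_Mapping.map.rep_eq when_def)

lemma lookup_linear_ext: "lookup (linear_ext f v) T = (\<Sum>S\<in>keys v. lookup v S * lookup (f S) T)"
  by (simp add: linear_ext_def lookup_sum)

lemma psi_adjoint:
  fixes u v :: "'a::comm_ring_1 wedge"
  shows "wedge_inner (psi i u) v = wedge_inner u (psi_dag i v)"
proof -
  define f where "f = (\<lambda>S. if i \<in> entries S then 0
    else Poly_Mapping.single (maya_insert i S) (wedge_sign i S :: 'a))"
  define g where "g = (\<lambda>S. if i \<in> entries S
    then Poly_Mapping.single (maya_remove i S) (wedge_sign i S :: 'a) else 0)"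
  have sgn: "wedge_sign i (maya_insert i S) = (wedge_sign i S :: 'a)" for S
  proof -
    have "{j \<in> insert i (entries S). i < j} = {j \<in> entries S. i < j}" by auto
    then show ?thesis by (simp add: wedge_sign_def maya_insert.rep_eq)
  qed
  have swap: "i \<notin> entries S \<and> T = maya_insert i S \<longleftrightarrow> i \<in> entries T \<and> S = maya_remove i T" for S T
    unfolding entries_inject[symmetric] maya_insert.rep_eq maya_remove.rep_eq by blast
  have adj: "lookup (f S) T = lookup (g T) S" for S T
  proof (cases "i \<notin> entries S \<and> T = maya_insert i S")
    case True
    then have "lookup (f S) T = wedge_sign i S" by (simp add: f_def)
    moreover have "i \<in> entries T" "S = maya_remove i T" using True swap by blast+
    then have "lookup (g T) S = wedge_sign i T" by (simp add: g_def)
    ultimately show ?thesis using True sgn by simp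
  next
    case False
    then have "lookup (f S) T = 0" by (auto simp: f_def lookup_single when_def)
    moreover have "\<not> (i \<in> entries T \<and> S = maya_remove i T)" using False swap by blast
    then have "lookup (g T) S = 0" by (auto simp: g_def lookup_single when_def)
    ultimately show ?thesis by simp
  qed
  have inner: "wedge_inner x y = (\<Sum>S\<in>A. lookup x S * lookup y S)"
    if "finite A" "keys x \<subseteq> A \<or> keys y \<subseteq> A" for A and x y :: "'a wedge"
  proof -
    have "wedge_inner x y = (\<Sum>S\<in>keys x \<inter> A. lookup x S * lookup y S)"
      unfolding wedge_inner_def
    proof (rule sum.mono_neutral_right)
      show "\<forall>S\<in>keys x - keys x \<inter> A. lookup x S * lookup y S = 0"
        using that(2) by (metis DiffE IntI in_keys_iff mult_zero_right subsetD)
    qed simp_all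
    also have "\<dots> = (\<Sum>S\<in>A. lookup x S * lookup y S)"
    proof (rule sum.mono_neutral_left)
      show "\<forall>S\<in>A - keys x \<inter> A. lookup x S * lookup y S = 0"
        by (metis DiffE IntI in_keys_iff mult_zero_left)
    qed (use that(1) in simp_all)
    finally show ?thesis .
  qed
  have "wedge_inner (psi i u) v = (\<Sum>T\<in>keys v. (\<Sum>S\<in>keys u. lookup u S * lookup (f S) T) * lookup v T)"
    by (simp add: inner[of "keys v"] psi_def f_def[symmetric] lookup_linear_ext)
  also have "\<dots> = (\<Sum>T\<in>keys v. \<Sum>S\<in>keys u. lookup u S * (lookup v T * lookup (g T) S))"
    by (simp add: sum_distrib_right sum_distrib_left adj mult_ac)
  also have "\<dots> = (\<Sum>S\<in>keys u. lookup u S * (\<Sum>T\<in>keys v. lookup v T * lookup (g T) S))"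
    by (subst sum.swap) (simp add: sum_distrib_left)
  also have "\<dots> = wedge_inner u (psi_dag i v)"
    by (simp add: wedge_inner_def psi_dag_def g_def[symmetric] lookup_linear_ext)
  finally show ?thesis .
qed

definition E_unit :: "int \<Rightarrow> int \<Rightarrow> 'a::comm_ring_1 wedge \<Rightarrow> 'a wedge" where
  "E_unit i j v = (if j \<ge> 0 then psi i (psi_dag j v) else - psi_dag j (psi i v))"

lemma finite_E_unit_nonzero:
  fixes v :: "'a::comm_ring_1 wedge"
  shows "finite {k. E_unit (k - n) k v \<noteq> 0}"
proof -
  have lin0: "linear_ext f 0 = 0" for f :: "maya \<Rightarrow> 'a wedge"
    by (simp add: linear_ext_def)
  have ws0: "wscale c (0 :: 'a wedge) = 0" for c
    by (rule poly_mapping_eqI) simp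
  have sub: "{k. E_unit (k - n) k v \<noteq> 0} \<subseteq>
      (\<Union>S\<in>keys v. (entries S \<inter> {0..}) \<union> {k. k < 0 \<and> k - n \<notin> entries S})"
  proof (rule subsetI, rule ccontr)
    fix k assume k: "k \<in> {k. E_unit (k - n) k v \<noteq> 0}"
      and "k \<notin> (\<Union>S\<in>keys v. (entries S \<inter> {0..}) \<union> {k. k < 0 \<and> k - n \<notin> entries S})"
    then have out: "(k \<ge> 0 \<longrightarrow> k \<notin> entries S) \<and> (k < 0 \<longrightarrow> k - n \<in> entries S)" if "S \<in> keys v" for S
      using that by auto
    have "E_unit (k - n) k v = 0"
    proof (cases "k \<ge> 0")
      case True
      then have "psi_dag k v = 0"
        unfolding psi_dag_def linear_ext_def by (intro sum.neutral) (simp add: out ws0)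
      then show ?thesis using True by (simp add: E_unit_def psi_def lin0)
    next
      case False
      then have "psi (k - n) v = 0"
        unfolding psi_def linear_ext_def by (intro sum.neutral) (simp add: out ws0)
      then show ?thesis using False by (simp add: E_unit_def psi_dag_def lin0)
    qed
    then show False using k by simp
  qed
  have "finite {k. k < 0 \<and> k - n \<notin> entries S}" for S
  proof -
    have "finite ({..<0} - entries S)" using entries[of S] by (simp add: is_maya_def)
    moreover have "{k. k < 0 \<and> k - n \<notin> entries S} \<subseteq> (\<lambda>j. j + n) ` ({..<0} - entries S) \<union> {n..<0}"
    proof
      fix k assume "k \<in> {k. k < 0 \<and> k - n \<notin> entries S}"
      then have "k < 0" "k - n \<notin> entries S" by simp_all
      then show "k \<in> (\<lambda>j. j + n) ` ({..<0} - entries S) \<union> {n..<0}"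
        by (cases "k - n < 0") (auto intro: image_eqI[where x = "k - n"])
    qed
    ultimately show ?thesis by (meson finite_Un finite_atLeastLessThan_int finite_imageI finite_subset)
  qed
  moreover have "finite (entries S \<inter> {0..})" for S
    using entries[of S] by (simp add: is_maya_def)
  ultimately show ?thesis
    by (intro finite_subset[OF sub] finite_UN_I) simp_all
qed

text \<open>\<open>Eop n u\<close> is \<open>\<Sum>\<^sub>k e\<^bsup>u(k - n/2)\<^esup> E\<^bsub>k-n,k\<^esub>\<close>, without the term \<open>\<delta>\<^bsub>n,0\<^esub>/\<sigma>(u)\<close>
  (where \<open>\<sigma>(u) = e\<^bsup>u/2\<^esup> - e\<^bsup>-u/2\<^esup>\<close>): this is
  \<open>\<E>\<^sub>n(u)\<close> for \<open>n \<noteq> 0\<close> and the modified operator (with a tilde) for \<open>n = 0\<close>, which is how both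
  are used below. By \<open>finite_E_unit_nonzero\<close>, \<open>Sum_any\<close> is a genuine finite sum.\<close>

definition Eop :: "int \<Rightarrow> real mfps \<Rightarrow> real mfps wedge \<Rightarrow> real mfps wedge" where
  "Eop n u v = Sum_any (\<lambda>k :: int.
     wscale (msubst (fps_exp ((of_int k + 1/2) - of_int n / 2)) u) (E_unit (k - n) k v))"

definition vev :: "(real mfps wedge \<Rightarrow> real mfps wedge) list \<Rightarrow> real mfps" where
  "vev ops = (let vac = Poly_Mapping.single vacuum_maya 1 in wedge_inner vac (foldr (\<lambda>A v. A v) ops vac))"

text \<open>\<open>H\<^bsup>k,s'\<^esup>\<^bsub>a,b\<^esub>(w\<^sub>1, \<dots>, w\<^bsub>s'\<^esub>)\<close>, with \<open>w\<^sub>l\<close> the variable of index \<open>ps ! (l - 1)\<close>.\<close>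

definition H_series :: "int \<Rightarrow> int list \<Rightarrow> int list \<Rightarrow> nat list \<Rightarrow> real mfps" where
  "H_series k a b ps =
     mconst (1 / (real_of_int (prod_list a) * real_of_int (prod_list b))) *
     vev (map (\<lambda>x. Eop x 0) a @ map (\<lambda>p. Eop (- k) (mvar p)) ps @ map (\<lambda>y. Eop (- y) 0) b)"

definition zmonomial :: "nat \<Rightarrow> nat \<Rightarrow> nat \<Rightarrow>\<^sub>0 nat" where
  "zmonomial s r = (\<Sum>p\<in>{1..s}. Poly_Mapping.single p (r + 1))"

text \<open>\<open>sub_tuple x I\<close> is \<open>(x\<^sub>i)\<^bsub>i\<in>I\<^esub>\<close> in increasing order of \<open>i\<close>. A finite linearly ordered
  type plays the role of \<open>[m]\<close>.\<close>

definition sub_tuple :: "int ^ 'a::{finite,linorder} \<Rightarrow> 'a set \<Rightarrow> int list" where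
  "sub_tuple x I = map (\<lambda>i. x $ i) (sorted_list_of_set I)"

definition hurwitz :: "nat \<Rightarrow> nat \<Rightarrow> int ^ 'm::{finite,linorder} \<Rightarrow> int ^ 'n::{finite,linorder} \<Rightarrow> int \<Rightarrow> real"
  where "hurwitz r s \<mu> \<nu> k =
    mcoeff (H_series k (sub_tuple \<mu> UNIV) (sub_tuple \<nu> UNIV) [1..<Suc s]) (zmonomial s r)"


section \<open>Walls and chambers\<close>

definition region :: "nat \<Rightarrow> ((real ^ 'm) \<times> (real ^ 'n) \<times> real) set" where
  "region s = {(x, y, k). (\<forall>i. x $ i > 0) \<and> (\<forall>j. y $ j > 0) \<and> k \<ge> 0 \<and>
     (\<Sum>i\<in>UNIV. x $ i) = (\<Sum>j\<in>UNIV. y $ j) + real s * k}"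

definition wall :: "nat \<Rightarrow> 'm set \<Rightarrow> 'n set \<Rightarrow> nat \<Rightarrow> ((real ^ 'm) \<times> (real ^ 'n) \<times> real) set" where
  "wall s I J t = {(x, y, k) \<in> region s. (\<Sum>i\<in>I. x $ i) - (\<Sum>j\<in>J. y $ j) - k * real t = 0}"

definition walls :: "nat \<Rightarrow> ((real ^ 'm) \<times> (real ^ 'n) \<times> real) set set" where
  "walls s = {wall s I J t | I J t. I \<noteq> {} \<and> I \<noteq> UNIV \<and> J \<noteq> {} \<and> J \<noteq> UNIV \<and> t \<le> s}"

definition wall_complement_components :: "nat \<Rightarrow> ((real ^ 'm) \<times> (real ^ 'n) \<times> real) set set" where
  "wall_complement_components s = components (region s - \<Union> (walls s))"

definition V_lattice :: "nat \<Rightarrow> ((int ^ 'm) \<times> (int ^ 'n) \<times> int) set" where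
  "V_lattice s = {(x, y, k). (\<forall>i. x $ i > 0) \<and> (\<forall>j. y $ j > 0) \<and> k \<ge> 0 \<and>
     (\<Sum>i\<in>UNIV. x $ i) = (\<Sum>j\<in>UNIV. y $ j) + int s * k}"

definition real_point :: "(int ^ 'm) \<times> (int ^ 'n) \<times> int \<Rightarrow> (real ^ 'm) \<times> (real ^ 'n) \<times> real" where
  "real_point = (\<lambda>(x, y, k). (\<chi> i. real_of_int (x $ i), \<chi> j. real_of_int (y $ j), real_of_int k))"

definition chamber :: "nat \<Rightarrow> ((real ^ 'm) \<times> (real ^ 'n) \<times> real) set \<Rightarrow> ((int ^ 'm) \<times> (int ^ 'n) \<times> int) set"
  where "chamber s C = {p \<in> V_lattice s. real_point p \<in> C}"

text \<open>Two components border a wall \<open>W\<close> when they have a piece of \<open>W\<close> of full dimension as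
  a common face, i.e. when their closures share a point of \<open>W\<close> lying on no wall other than \<open>W\<close>.
  Walls are compared as sets because \<open>wall s I J t = wall s (- I) (- J) (s - t)\<close>.\<close>

definition common_border ::
    "nat \<Rightarrow> ((real ^ 'm) \<times> (real ^ 'n) \<times> real) set \<Rightarrow> ((real ^ 'm) \<times> (real ^ 'n) \<times> real) set \<Rightarrow>
     ((real ^ 'm) \<times> (real ^ 'n) \<times> real) set \<Rightarrow> bool" where
  "common_border s W C1 C2 \<longleftrightarrow>
     (\<exists>p\<in>W. p \<in> closure C1 \<and> p \<in> closure C2 \<and> (\<forall>W'\<in>walls s. p \<in> W' \<longrightarrow> W' = W))"

definition wall_delta :: "'m set \<Rightarrow> 'n set \<Rightarrow> nat \<Rightarrow> int ^ 'm \<Rightarrow> int ^ 'n \<Rightarrow> int \<Rightarrow> int" where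
  "wall_delta I J t x y k = (\<Sum>i\<in>I. x $ i) - (\<Sum>j\<in>J. y $ j) - int t * k"


section \<open>The wall-crossing expression\<close>

text \<open>\<open>varsigma d\<close> is \<open>\<sigma>(dX) = e\<^bsup>dX/2\<^esup> - e\<^bsup>-dX/2\<^esup>\<close>.\<close>

definition varsigma :: "real \<Rightarrow> real fps" where
  "varsigma d = fps_exp (d / 2) - fps_exp (- d / 2)"

text \<open>For \<open>c, d \<noteq> 0\<close> the quotient \<open>\<sigma>(cX)/\<sigma>(dX)\<close> is a power series in \<open>X\<close>, into which the sum
  \<open>z\<^sub>K\<close> is substituted. For \<open>K = {}\<close> (where \<open>z\<^sub>K = 0\<close>) this gives \<open>\<sigma>(0)/\<sigma>(0)\<close> its limit value \<open>c/d\<close>.\<close>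

definition z_sum :: "nat set \<Rightarrow> real mfps" where
  "z_sum K = (\<Sum>p\<in>K. mvar p)"

definition varsigma_ratio :: "real \<Rightarrow> real \<Rightarrow> nat set \<Rightarrow> real mfps" where
  "varsigma_ratio c d K = msubst (varsigma c / varsigma d) (z_sum K)"

lemma mcoeff_z_sum_0: "mcoeff (z_sum K) 0 = 0"
proof -
  have "0 \<noteq> (Poly_Mapping.single p 1 :: nat \<Rightarrow>\<^sub>0 nat)" for p
    by (metis lookup_single_eq lookup_zero zero_neq_one)
  then have "mcoeff (mvar p :: real mfps) 0 = 0" for p by (simp add: mvar_def)
  then show ?thesis
    by (induction K rule: infinite_finite_induct)
       (simp_all add: z_sum_def zero_mfps.rep_eq plus_mfps.rep_eq)
qed

lemma varsigma_ratio_mult: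
  assumes "d \<noteq> 0"
  shows "varsigma_ratio c d K * msubst (varsigma d) (z_sum K) = msubst (varsigma c) (z_sum K)"
proof -
  have 1: "fps_nth (varsigma d) 1 = d" and 0: "fps_nth (varsigma e) 0 = 0" for e d
    by (simp_all add: varsigma_def)
  have nz: "varsigma d \<noteq> 0" using 1[of d] assms by (metis fps_zero_nth)
  have sub: "subdegree (varsigma d) = 1"
    by (rule subdegreeI) (use 1[of d] 0 assms in auto)
  have "varsigma c = 0 \<or> subdegree (varsigma c) \<ge> 1"
    using 0[of c] by (metis One_nat_def Suc_leI gr0I subdegree_eq_0_iff)
  then have "varsigma c / varsigma d * varsigma d = varsigma c"
    using nz sub by (cases "varsigma c = 0") (auto simp: fps_dvd_iff)
  then show ?thesis
    by (simp add: varsigma_ratio_def msubst_mult[OF mcoeff_z_sum_0, symmetric])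
qed

definition wc_summand ::
    "nat \<Rightarrow> 'm::{finite,linorder} set \<Rightarrow> 'n::{finite,linorder} set \<Rightarrow>
     int ^ 'm::{finite,linorder} \<Rightarrow> int ^ 'n::{finite,linorder} \<Rightarrow> int \<Rightarrow> int \<Rightarrow> nat set \<Rightarrow> real mfps" where
  "wc_summand s I J \<mu> \<nu> k \<delta> K =
     mconst ((real_of_int \<delta>)\<^sup>2) *
     (varsigma_ratio 1 \<delta> K * varsigma_ratio 1 \<delta> ({1..s} - K) * varsigma_ratio \<delta> 1 {1..s}) *
     H_series k (sub_tuple \<mu> I) (sub_tuple \<nu> J @ [\<delta>]) (sorted_list_of_set K) *
     H_series k (\<delta> # sub_tuple \<mu> (- I)) (sub_tuple \<nu> (- J)) (sorted_list_of_set ({1..s} - K))"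

end

theory Submission imports Defs "HOL-Library.Multiset" begin

text \<open>A vacuum expectation is regularised along a direction \<open>q\<close>: displacing the energies \<open>p\<close> by \<open>j q\<close> gives,
  coefficientwise, a polynomial in \<open>j\<close> for large \<open>j\<close>. Its value at \<open>0\<close> is, for \<open>q\<close> in a chamber, the chamber
  polynomial at \<open>p\<close>. The wall crossing is therefore the difference of two regularised expectations whose directions
  lie on the two sides of the wall, and commuting operators turns this difference into a sum of products of two
  regularised expectations, one for each side of the wall.

  It remains to replace the directions in these products by the point itself. Chambers are also cut by the loci
  \<open>x\<^sub>I = k t\<close>, which are not walls; across such a locus a coefficient can change only if the letters split into blocks
  of energy zero with sufficiently many \<open>z\<close>-letters in each. The existence of the chamber polynomial excludes such
  splittings: as all commutators have nonnegative coefficients, a splitting would make two expansions of one and the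
  same coefficient differ by a positive number.\<close>

text \<open>The coefficients of the exchange rule see only the point, while the vanishing of a word
  is decided by the direction and by the point only where the direction is zero. So both directions
  can be put next to the wall, where a proper part of a side and the rest of that side have opposite
  signs, while the point stays where it is, possibly far from the wall. The quotient of values of
  sigma(x) = e^{x/2} - e^{-x/2} comes from two-letter words: for a side and its complement the
  difference is sigma(\<delta> z)/sigma(z) in all variables, and each factor gives such a quotient
  in its own variables, which is divided out; \<delta>^2 undoes the division by \<delta> in the two
  factors. The product formula is an identity of series, but directions are replaced by the point
  only in the coefficient of the final monomial. A splitting into balanced blocks is refuted by one
  of two differences that the chamber polynomial makes zero: for blocks of even leftover degree, the
  value at a balanced point against the regularised value there; for two blocks of odd leftover
  degree, two directions on either side of the balancing hyperplane.\<close>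

interpretation wedge: module "wscale :: 'a::comm_ring_1 => 'a wedge => 'a wedge"
  by unfold_locales (auto intro!: poly_mapping_eqI simp: lookup_add algebra_simps)

section \<open>Linear operators on the wedge space and the canonical anticommutation
  relations\<close>

lemmas wedge_hom_add =
  module_pair.module_hom_add[OF module_pair.intro[OF wedge.module_axioms wedge.module_axioms]]

lemma lookup_linear_ext_superset:
  assumes "finite A" "keys v \<subseteq> A"
  shows "lookup (linear_ext f v) T = (\<Sum>S\<in>A. lookup v S * lookup (f S) T)"
  unfolding lookup_linear_ext
  by (rule sum.mono_neutral_left) (use assms in \<open>auto simp: in_keys_iff\<close>)

lemma linear_ext_linear: "module_hom wscale wscale (linear_ext f)"
proof (unfold_locales, goal_cases)
  case (1 u v)
  let ?A = "keys u \<union> keys v"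
  have "keys (u + v) \<subseteq> ?A" by (rule Poly_Mapping.keys_add)
  then show ?case
    by (intro poly_mapping_eqI)
       (simp add: lookup_add lookup_linear_ext_superset[where A = ?A] algebra_simps sum.distrib)
next
  case (2 c v)
  have "keys (wscale c v) \<subseteq> keys v" by (auto simp: in_keys_iff)
  then show ?case
    by (intro poly_mapping_eqI)
       (simp add: lookup_linear_ext_superset[where A = "keys v"] sum_distrib_left mult.assoc)
qed

lemma linear_ext_single: "linear_ext f (Poly_Mapping.single S 1) = f S"
  by (rule poly_mapping_eqI) (simp add: lookup_linear_ext_superset[where A = "{S}"])

lemma wedge_linear_eqI:
  fixes f g :: "'a::comm_ring_1 wedge => 'a wedge"
  assumes f: "module_hom wscale wscale f" and g: "module_hom wscale wscale g"
    and eq: "\<And>S. f (Poly_Mapping.single S 1) = g (Poly_Mapping.single S 1)"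
  shows "f v = g v"
proof -
  interpret f: module_hom wscale wscale f by fact
  interpret g: module_hom wscale wscale g by fact
  have v: "v = (\<Sum>S\<in>keys v. wscale (lookup v S) (Poly_Mapping.single S 1))"
  proof (rule poly_mapping_eqI)
    fix T
    have "lookup (\<Sum>S\<in>keys v. wscale (lookup v S) (Poly_Mapping.single S 1)) T =
        (\<Sum>S\<in>keys v. if S = T then lookup v S else 0)"
      unfolding lookup_sum by (rule sum.cong) (auto simp: lookup_single when_def)
    then show "lookup v T = lookup (\<Sum>S\<in>keys v. wscale (lookup v S) (Poly_Mapping.single S 1)) T"
      by (simp add: in_keys_iff)
  qed
  show ?thesis
    using arg_cong[OF v, of f] arg_cong[OF v, of g] by (simp add: f.sum f.scale g.sum g.scale eq)
qed

lemma psi_linear: "module_hom wscale wscale (psi i)"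
  unfolding psi_def by (rule linear_ext_linear)

lemma psi_dag_linear: "module_hom wscale wscale (psi_dag i)"
  unfolding psi_dag_def by (rule linear_ext_linear)

lemma wscale_single: "wscale c (Poly_Mapping.single S d) = Poly_Mapping.single S (c * d)"
  by (rule poly_mapping_eqI) (simp add: lookup_single when_def)

lemma psi_single:
  "psi i (Poly_Mapping.single S c) =
     (if i \<in> entries S then 0 else Poly_Mapping.single (maya_insert i S) (c * wedge_sign i S))"
proof -
  interpret p: module_hom wscale wscale "psi i :: 'a wedge => _" by (rule psi_linear)
  show ?thesis
    using p.scale[of c "Poly_Mapping.single S 1"]
    by (simp add: psi_def linear_ext_single wscale_single)
qed

lemma psi_dag_single:
  "psi_dag i (Poly_Mapping.single S c) =
     (if i \<in> entries S then Poly_Mapping.single (maya_remove i S) (c * wedge_sign i S) else 0)"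
proof -
  interpret p: module_hom wscale wscale "psi_dag i :: 'a wedge => _" by (rule psi_dag_linear)
  show ?thesis
    using p.scale[of c "Poly_Mapping.single S 1"]
    by (simp add: psi_dag_def linear_ext_single wscale_single)
qed

lemmas psi_0 = module_hom.zero[OF psi_linear]
lemmas psi_dag_0 = module_hom.zero[OF psi_dag_linear]

lemma finite_entries_above: "finite {j \<in> entries S. j > i}"
proof -
  have "{j \<in> entries S. j > i} \<subseteq> (entries S \<inter> {0..}) \<union> {i..0}" by auto
  moreover have "finite ((entries S \<inter> {0..}) \<union> {i..0})"
    using entries[of S] by (simp add: is_maya_def)
  ultimately show ?thesis by (rule finite_subset)
qed

lemma wedge_sign_insert:
  assumes "j \<notin> entries S"
  shows "wedge_sign i (maya_insert j S) = (if j > i then - wedge_sign i S else wedge_sign i S)"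
proof -
  have "{k \<in> insert j (entries S). k > i} =
      (if j > i then insert j {k \<in> entries S. k > i} else {k \<in> entries S. k > i})" by auto
  then show ?thesis
    using assms finite_entries_above[of S i] by (simp add: wedge_sign_def maya_insert.rep_eq)
qed

lemma wedge_sign_remove:
  assumes "j \<in> entries S"
  shows "wedge_sign i (maya_remove j S) = (if j > i then - wedge_sign i S else wedge_sign i S)"
proof -
  have "maya_insert j (maya_remove j S) = S"
    using assms by (intro entries_inject[THEN iffD1]) (auto simp: maya_insert.rep_eq maya_remove.rep_eq)
  moreover have "j \<notin> entries (maya_remove j S)" by (simp add: maya_remove.rep_eq)
  ultimately show ?thesis using wedge_sign_insert[of j "maya_remove j S" i, where 'a='a] by auto
qed

lemma maya_commute:
  "maya_insert i (maya_insert j S) = maya_insert j (maya_insert i S)"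
  "maya_remove i (maya_remove j S) = maya_remove j (maya_remove i S)"
  "i ~= j ==> maya_insert i (maya_remove j S) = maya_remove j (maya_insert i S)"
  "i \<in> entries S ==> maya_insert i (maya_remove i S) = S"
  "i \<notin> entries S ==> maya_remove i (maya_insert i S) = S"
  by (intro entries_inject[THEN iffD1]; auto simp: maya_insert.rep_eq maya_remove.rep_eq)+

lemma wedge_sign_square [simp]: "wedge_sign i S * wedge_sign i S = 1"
  by (simp add: wedge_sign_def power_add[symmetric] mult_2[symmetric] power_mult)

context
begin

private lemma hom_comp2:
  fixes f g :: "'a::comm_ring_1 wedge => 'a wedge"
  assumes "module_hom wscale wscale f" "module_hom wscale wscale g"
  shows "module_hom wscale wscale (%v. f (g v))"
  using module_hom_compose[OF assms(2,1)] by (simp add: o_def)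

private lemma wscale_hom:
  "module_hom wscale wscale (wscale c :: 'a::comm_ring_1 wedge => _)"
  by unfold_locales (simp_all add: wedge.scale_right_distrib mult.commute)

text \<open>By linearity only basis vectors matter. For different indices both orders lead to the
  same basis vector, and exactly one of the two signs sees the entry that the other operator has
  inserted or removed; for equal indices exactly one of the two terms survives.\<close>

lemma psi_psi_dag_anticomm:
  fixes v :: "'a::comm_ring_1 wedge"
  shows "psi i (psi_dag j v) + psi_dag j (psi i v) = (if i = j then v else 0)"
proof -
  interpret p: module_hom wscale wscale "psi i :: 'a wedge => _" by (rule psi_linear)
  interpret d: module_hom wscale wscale "psi_dag j :: 'a wedge => _" by (rule psi_dag_linear)
  have "psi i (psi_dag j v) + psi_dag j (psi i v) = wscale (if i = j then 1 else 0) v"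
  proof (rule wedge_linear_eqI[where f = "%v. psi i (psi_dag j v) + psi_dag j (psi i v)" and g = "wscale (if i = j then 1 else 0)"])
    show "module_hom wscale wscale (%v::'a wedge. psi i (psi_dag j v) + psi_dag j (psi i v))"
      by (rule wedge_hom_add[OF hom_comp2[OF psi_linear psi_dag_linear] hom_comp2[OF psi_dag_linear psi_linear]])
    show "module_hom wscale wscale (wscale (if i = j then 1 else 0) :: 'a wedge => _)"
      by (rule wscale_hom)
    fix S
    show "psi i (psi_dag j (Poly_Mapping.single S 1)) + psi_dag j (psi i (Poly_Mapping.single S 1)) =
      wscale (if i = j then 1 else 0) (Poly_Mapping.single S (1::'a))"
    proof (cases "i = j")
      case True
      show ?thesis
        by (cases "i \<in> entries S")
           (simp_all add: True psi_single psi_dag_single psi_0 psi_dag_0 wscale_single single_uminus maya_insert.rep_eq maya_remove.rep_eq maya_commute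
             wedge_sign_insert wedge_sign_remove)
    next
      case False
      then show ?thesis
        by (cases "i \<in> entries S"; cases "j \<in> entries S"; cases "i < j")
           (simp_all add: psi_single psi_dag_single psi_0 psi_dag_0 wscale_single single_uminus maya_insert.rep_eq maya_remove.rep_eq maya_commute
             wedge_sign_insert wedge_sign_remove mult.commute)
    qed
  qed
  then show ?thesis by simp
qed

lemma psi_psi_anticomm:
  fixes v :: "'a::comm_ring_1 wedge"
  shows "psi i (psi j v) = - psi j (psi i v)"
proof -
  interpret p: module_hom wscale wscale "psi i :: 'a wedge => _" by (rule psi_linear)
  interpret d: module_hom wscale wscale "psi j :: 'a wedge => _" by (rule psi_linear)
  have "psi i (psi j v) + psi j (psi i v) = wscale 0 v"
  proof (rule wedge_linear_eqI[where f = "%v. psi i (psi j v) + psi j (psi i v)" and g = "wscale (0)"])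
    show "module_hom wscale wscale (%v::'a wedge. psi i (psi j v) + psi j (psi i v))"
      by (rule wedge_hom_add[OF hom_comp2[OF psi_linear psi_linear] hom_comp2[OF psi_linear psi_linear]])
    show "module_hom wscale wscale (wscale 0 :: 'a wedge => _)"
      by (rule wscale_hom)
    fix S
    show "psi i (psi j (Poly_Mapping.single S 1)) + psi j (psi i (Poly_Mapping.single S 1)) =
      wscale 0 (Poly_Mapping.single S (1::'a))"
      by (cases "i \<in> entries S"; cases "j \<in> entries S"; rule linorder_cases[of i j])
           (simp_all add: psi_single psi_0 psi_dag_0 wscale_single single_uminus maya_insert.rep_eq maya_commute(1)[of i j]
             wedge_sign_insert mult.commute)
  qed
  then show ?thesis by (simp add: eq_neg_iff_add_eq_0)
qed

lemma psi_dag_psi_dag_anticomm: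
  fixes v :: "'a::comm_ring_1 wedge"
  shows "psi_dag i (psi_dag j v) = - psi_dag j (psi_dag i v)"
proof -
  interpret p: module_hom wscale wscale "psi_dag i :: 'a wedge => _" by (rule psi_dag_linear)
  interpret d: module_hom wscale wscale "psi_dag j :: 'a wedge => _" by (rule psi_dag_linear)
  have "psi_dag i (psi_dag j v) + psi_dag j (psi_dag i v) = wscale 0 v"
  proof (rule wedge_linear_eqI[where f = "%v. psi_dag i (psi_dag j v) + psi_dag j (psi_dag i v)" and g = "wscale (0)"])
    show "module_hom wscale wscale (%v::'a wedge. psi_dag i (psi_dag j v) + psi_dag j (psi_dag i v))"
      by (rule wedge_hom_add[OF hom_comp2[OF psi_dag_linear psi_dag_linear] hom_comp2[OF psi_dag_linear psi_dag_linear]])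
    show "module_hom wscale wscale (wscale 0 :: 'a wedge => _)"
      by (rule wscale_hom)
    fix S
    show "psi_dag i (psi_dag j (Poly_Mapping.single S 1)) + psi_dag j (psi_dag i (Poly_Mapping.single S 1)) =
      wscale 0 (Poly_Mapping.single S (1::'a))"
      by (cases "i \<in> entries S"; cases "j \<in> entries S"; rule linorder_cases[of i j])
           (simp_all add: psi_dag_single psi_0 psi_dag_0 wscale_single single_uminus maya_remove.rep_eq maya_commute(2)[of i j]
             wedge_sign_remove mult.commute)
  qed
  then show ?thesis by (simp add: eq_neg_iff_add_eq_0)
qed

end

text \<open>Without normal ordering the bilinears obey the relations of matrix units, with no
  central term. The central term of \<open>Eop_commutator\<close> comes only from the correction in
  \<open>E_unit_psi\<close>.\<close>

lemma psi_pair_commutator: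
  fixes v :: "'a::comm_ring_1 wedge"
  shows "psi i (psi_dag j (psi k (psi_dag l v))) - psi k (psi_dag l (psi i (psi_dag j v))) =
    (if j = k then psi i (psi_dag l v) else 0) - (if i = l then psi k (psi_dag j v) else 0)"
proof -
  interpret pi: module_hom wscale wscale "psi i :: 'a wedge => _" by (rule psi_linear)
  interpret pk: module_hom wscale wscale "psi k :: 'a wedge => _" by (rule psi_linear)
  have 1: "psi_dag j (psi k w) = (if j = k then w else 0) - psi k (psi_dag j w)" for w :: "'a wedge"
    using psi_psi_dag_anticomm[of k j w] by (auto simp: algebra_simps)
  have 2: "psi_dag l (psi i w) = (if i = l then w else 0) - psi i (psi_dag l w)" for w :: "'a wedge"
    using psi_psi_dag_anticomm[of i l w] by (auto simp: algebra_simps)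
  have a: "psi i (psi_dag j (psi k (psi_dag l v))) =
      (if j = k then psi i (psi_dag l v) else 0) - psi i (psi k (psi_dag j (psi_dag l v)))"
    by (subst 1) (simp add: pi.diff pi.zero)
  have b: "psi k (psi_dag l (psi i (psi_dag j v))) =
      (if i = l then psi k (psi_dag j v) else 0) - psi k (psi i (psi_dag l (psi_dag j v)))"
    by (subst 2) (simp add: pk.diff pk.zero)
  have c: "psi i (psi k (psi_dag j (psi_dag l v))) = psi k (psi i (psi_dag l (psi_dag j v)))"
    using psi_psi_anticomm[of i k "psi_dag j (psi_dag l v)"] psi_dag_psi_dag_anticomm[of j l v]
    by (simp add: pi.neg pk.neg)
  show ?thesis unfolding a b c by simp
qed

section \<open>Exponentials and quotients of sigma as formal series in several variables\<close>

abbreviation vfree :: "'a::comm_ring_1 mfps => bool" where "vfree u \<equiv> mcoeff u 0 = 0"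

lemma mcoeff_zero [simp]: "mcoeff 0 m = 0" by (simp add: zero_mfps.rep_eq)
lemma mcoeff_add [simp]: "mcoeff (f + g) m = mcoeff f m + mcoeff g m" by (simp add: plus_mfps.rep_eq)
lemma mcoeff_diff [simp]: "mcoeff (f - g) m = mcoeff f m - mcoeff g m" by (simp add: minus_mfps.rep_eq)
lemma mcoeff_uminus [simp]: "mcoeff (- f) m = - mcoeff f m" by (simp add: uminus_mfps.rep_eq)
lemma mcoeff_1: "mcoeff 1 m = (if m = 0 then 1 else 0)" by (simp add: one_mfps.rep_eq)
lemma mcoeff_mult: "mcoeff (f * g) m = (\<Sum>(a, b)\<in>splits m. mcoeff f a * mcoeff g b)"
  by (simp add: times_mfps.rep_eq)
lemma mcoeff_sum: "mcoeff (sum f A) m = (\<Sum>x\<in>A. mcoeff (f x) m)"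
  by (induction A rule: infinite_finite_induct) simp_all

lemma mcoeff_mconst: "mcoeff (mconst c) m = (if m = 0 then c else 0)"
  by (simp add: mconst_def)

lemma mcoeff_mconst_mult [simp]: "mcoeff (mconst c * f) m = c * mcoeff f m"
proof -
  have "mcoeff (mconst c * f) m = (\<Sum>p\<in>splits m. if p = (0, m) then c * mcoeff f m else 0)"
    unfolding mcoeff_mult by (rule sum.cong) (auto simp: mcoeff_mconst split: if_splits)
  then show ?thesis by (simp add: finite_splits)
qed

lemma mconst_0 [simp]: "mconst 0 = 0" and mconst_1 [simp]: "mconst 1 = 1"
  by (auto intro!: mfps_eqI simp: mcoeff_mconst mcoeff_1)
lemma mconst_add: "mconst (a + b) = mconst a + mconst b"
  by (rule mfps_eqI) (simp add: mcoeff_mconst)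
lemma mconst_minus: "mconst (- a) = - mconst a"
  by (rule mfps_eqI) (simp add: mcoeff_mconst)
lemma mconst_mult: "mconst (a * b) = mconst a * mconst b"
  by (rule mfps_eqI) (simp add: mcoeff_mconst)
lemma mconst_power: "mconst (a ^ n) = mconst a ^ n"
proof (induction n)
  case (Suc n)
  then show ?case by (simp only: power_Suc mconst_mult)
qed (simp only: power_0 mconst_1)

lemma splits_0: "splits 0 = {(0, 0)}"
proof -
  have "(a, b) \<in> splits 0 \<longleftrightarrow> (a, b) = (0, 0)" for a b :: "nat \<Rightarrow>\<^sub>0 nat"
  proof
    assume "(a, b) \<in> splits 0"
    then have "mdeg a + mdeg b = 0"
      using mdeg_add[of a b] mdeg_eq_0_iff[of "0 :: nat \<Rightarrow>\<^sub>0 nat"] by simp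
    then show "(a, b) = (0, 0)" by (simp add: mdeg_eq_0_iff)
  qed simp
  then show ?thesis by (metis (no_types, lifting) insertCI set_eqI singletonD surj_pair)
qed

lemma vfree_mult [simp]: "vfree u ==> vfree (f * u)"
  by (simp add: mcoeff_mult splits_0)

lemma msubst_add: "msubst (F + G) u = msubst F u + msubst G u"
  by (rule mfps_eqI) (simp add: msubst_def sum.distrib algebra_simps)
lemma msubst_minus: "msubst (- F) u = - msubst F u"
  by (rule mfps_eqI) (simp add: msubst_def sum_negf)
lemma msubst_diff: "msubst (F - G) u = msubst F u - msubst G u"
  using msubst_add[of F "- G" u] by (simp add: msubst_minus)
lemma msubst_sum: "msubst (sum F A) u = (\<Sum>x\<in>A. msubst (F x) u)"
proof (induction A rule: infinite_finite_induct)
  case empty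
  show ?case by (rule mfps_eqI) (simp add: msubst_def)
next
  case (infinite A)
  then show ?case by (auto intro!: mfps_eqI simp add: msubst_def)
qed (simp_all add: msubst_add)

definition mexp :: "real mfps => real mfps" where "mexp u = msubst (fps_exp 1) u"

lemma msubst_fps_exp: "msubst (fps_exp c) u = mexp (mconst c * u)"
  by (rule mfps_eqI)
     (simp add: msubst_def mexp_def power_mult_distrib mconst_power[symmetric])

text \<open>Since u^i v^j has no term of degree below i + j, both sides reduce to the same finite
  sum over the triangle where i + j is at most the degree of the monomial; there the binomial
  theorem applies.\<close>

lemma mexp_add:
  assumes u: "vfree u" and v: "vfree v"
  shows "mexp (u + v) = mexp u * mexp v"
proof (rule mfps_eqI)
  fix m
  let ?N = "mdeg m"
  let ?c = "%i j. 1 / (fact i * fact j) :: real"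
  have uv: "vfree (u + v)" using u v by simp
  have small: "mcoeff (u ^ i * v ^ j) m = 0" if "~ i + j <= ?N" for i j
  proof -
    have "mcoeff (u ^ i) a * mcoeff (v ^ j) b = 0" if ab: "a + b = m" for a b
      using mcoeff_power_eq_0[OF u, of a i] mcoeff_power_eq_0[OF v, of b j] \<open>~ i + j <= ?N\<close>
        mdeg_add[of a b] ab by (metis add_mono mult_eq_0_iff not_le_imp_less)
    then show ?thesis by (auto simp: mcoeff_mult intro!: sum.neutral)
  qed
  have "mcoeff (mexp u * mexp v) m =
      (\<Sum>(a, b)\<in>splits m. (\<Sum>i\<le>?N. fps_nth (fps_exp 1) i * mcoeff (u ^ i) a) * (\<Sum>j\<le>?N. fps_nth (fps_exp 1) j * mcoeff (v ^ j) b))"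
    unfolding mcoeff_mult mexp_def
    by (rule sum.cong) (auto simp: mcoeff_msubst[OF u, where N = ?N] mcoeff_msubst[OF v, where N = ?N] mdeg_add)
  also have "... = (\<Sum>p\<in>splits m. \<Sum>i\<le>?N. \<Sum>j\<le>?N. ?c i j * (mcoeff (u ^ i) (fst p) * mcoeff (v ^ j) (snd p)))"
    by (simp add: sum_product case_prod_unfold mult_ac)
  also have "... = (\<Sum>i\<le>?N. \<Sum>p\<in>splits m. \<Sum>j\<le>?N. ?c i j * (mcoeff (u ^ i) (fst p) * mcoeff (v ^ j) (snd p)))"
    by (rule sum.swap)
  also have "... = (\<Sum>i\<le>?N. \<Sum>j\<le>?N. \<Sum>p\<in>splits m. ?c i j * (mcoeff (u ^ i) (fst p) * mcoeff (v ^ j) (snd p)))"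
    by (intro sum.cong refl sum.swap)
  also have "... = (\<Sum>i\<le>?N. \<Sum>j\<le>?N. ?c i j * mcoeff (u ^ i * v ^ j) m)"
    by (simp add: mcoeff_mult case_prod_unfold sum_distrib_left)
  also have "... = (\<Sum>(i, j)\<in>{..?N} \<times> {..?N}. ?c i j * mcoeff (u ^ i * v ^ j) m)"
    by (simp add: sum.cartesian_product)
  also have "... = (\<Sum>(i, j)\<in>{(i, j). i + j <= ?N}. ?c i j * mcoeff (u ^ i * v ^ j) m)"
    by (rule sum.mono_neutral_right) (use small in \<open>fastforce+\<close>)
  also have "... = (\<Sum>(n, i)\<in>(SIGMA n:{..?N}. {..n}). ?c i (n - i) * mcoeff (u ^ i * v ^ (n - i)) m)"
    by (rule sum.reindex_bij_witness[where i = "%(n, i). (i, n - i)" and j = "%(i, j). (i + j, i)"]) auto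
  also have "... = (\<Sum>n\<le>?N. \<Sum>i\<le>n. ?c i (n - i) * mcoeff (u ^ i * v ^ (n - i)) m)"
    by (subst sum.Sigma) auto
  also have "... = (\<Sum>n\<le>?N. fps_nth (fps_exp 1) n * mcoeff ((u + v) ^ n) m)"
  proof (rule sum.cong[OF refl])
    fix n
    have "(u + v) ^ n = (\<Sum>i\<le>n. mconst (of_nat (n choose i)) * (u ^ i * v ^ (n - i)))"
    proof -
      have "of_nat c = mconst (of_nat c :: real)" for c
        by (induction c) (simp_all add: mconst_add)
      then show ?thesis by (simp add: binomial_ring mult.assoc)
    qed
    then show "(\<Sum>i\<le>n. ?c i (n - i) * mcoeff (u ^ i * v ^ (n - i)) m) =
        fps_nth (fps_exp 1) n * mcoeff ((u + v) ^ n) m"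
      by (simp add: mcoeff_sum sum_distrib_left binomial_fact)
  qed
  also have "... = mcoeff (mexp (u + v)) m"
    by (simp add: mexp_def msubst_def)
  finally show "mcoeff (mexp (u + v)) m = mcoeff (mexp u * mexp v) m" by simp
qed

definition vs :: "real mfps => real mfps" where "vs u = msubst (varsigma 1) u"

text \<open>This is sigma(a u)/sigma(u), with value \<open>a\<close> at u = 0: the scalar in the
  commutator of two operators of opposite energies. At u = 0 it gives the Heisenberg
  relation.\<close>

definition rat :: "int => real mfps => real mfps" where
  "rat a u = msubst (varsigma (of_int a) / varsigma 1) u"

lemma vs_mexp: "vs u = mexp (mconst (1/2) * u) - mexp (mconst (- 1/2) * u)"
  by (simp add: vs_def varsigma_def msubst_diff msubst_fps_exp)

lemma varsigma_1_nonzero: "varsigma 1 ~= 0"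
proof
  assume "varsigma 1 = 0"
  then have "fps_nth (varsigma 1) 1 = 0" by simp
  then show False by (simp add: varsigma_def)
qed

text \<open>Multiplied by sigma, the exponentials telescope. The exponents are \<open>a\<close>
  numbers with spacing 1, symmetric about 0; the evenness of the quotient and the positivity of its
  coefficients are later read off from this.\<close>

lemma varsigma_quotient:
  assumes "a >= 0"
  shows "varsigma (of_int a) / varsigma 1 =
    (\<Sum>l\<in>{-a..<0}. fps_exp (of_int l + 1/2 + of_int a / 2))"
proof -
  have "(\<Sum>l\<in>{-a..<0}. fps_exp (of_int l + 1/2 + of_int a / 2)) * varsigma 1 = varsigma (of_int a)"
  proof -
    have "(\<Sum>l\<in>{- int n..<0}. fps_exp (of_int l + 1/2 + c) * varsigma 1) =
        fps_exp c - fps_exp (c - of_nat n)" for n and c :: real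
    proof (induction n)
      case (Suc n)
      have "{- int (Suc n)..<0} = insert (- int (Suc n)) {- int n..<0}" by auto
      moreover have "fps_exp (of_int (- int (Suc n)) + 1/2 + c) * varsigma 1 =
          fps_exp (c - of_nat n) - fps_exp (c - of_nat (Suc n))"
      proof -
        have e: "fps_exp x * varsigma 1 = fps_exp (x + 1/2) - fps_exp (x - 1/2)" for x :: real
          unfolding varsigma_def using fps_exp_add_mult[of x "1/2"] fps_exp_add_mult[of x "- 1/2"]
          by (simp add: right_diff_distrib)
        show ?thesis unfolding e by (simp add: algebra_simps)
      qed
      ultimately show ?case using Suc by simp
    qed simp
    from this[where n = "nat a" and c = "of_int a / 2"] show ?thesis
      using assms by (simp add: sum_distrib_right varsigma_def)
  qed
  then show ?thesis
    using varsigma_1_nonzero by (metis nonzero_mult_div_cancel_right)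
qed

lemma rat_nonneg_sum:
  assumes "a >= 0"
  shows "rat a w = (\<Sum>l\<in>{-a..<0}. mexp (mconst (of_int l + 1/2 + of_int a / 2) * w))"
  unfolding rat_def varsigma_quotient[OF assms] by (simp add: msubst_sum msubst_fps_exp)

lemma varsigma_neg: "varsigma (- c) = - varsigma c" by (simp add: varsigma_def)

lemma rat_neg: "rat (- a) w = - rat a w"
proof -
  have "(- varsigma (of_int a)) / varsigma 1 = - (varsigma (of_int a) / varsigma 1)"
    by (metis fps_divide_uminus)
  then show ?thesis by (simp add: rat_def varsigma_neg msubst_minus)
qed

section \<open>The operators E_n(u) through finite cutoffs, and their commutator\<close>

definition ex :: "int => real mfps => int => real mfps" where
  "ex n u k = mexp (mconst (of_int k + 1/2 - of_int n / 2) * u)"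

lemma Eop_ex: "Eop n u v = Sum_any (%k. wscale (ex n u k) (E_unit (k - n) k v))"
  by (simp add: Eop_def ex_def msubst_fps_exp)

lemma E_unit_psi:
  "E_unit i j v = psi i (psi_dag j v) - (if i = j & j < 0 then v else 0)"
  using psi_psi_dag_anticomm[of i j v] by (auto simp: E_unit_def algebra_simps)

lemma eventually_interval_superset:
  assumes "finite (A :: int set)"
  shows "\<forall>\<^sub>F N in at_top. A \<subseteq> {-N..<N}"
proof -
  have "A \<subseteq> {-N..<N}" if "N >= (\<Sum>x\<in>A. \<bar>x\<bar>) + 1" for N
  proof
    fix x assume "x \<in> A"
    then have "\<bar>x\<bar> <= (\<Sum>x\<in>A. \<bar>x\<bar>)" using assms by (simp add: member_le_sum)
    then show "x \<in> {-N..<N}" using that by auto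
  qed
  then show ?thesis by (rule eventually_at_top_linorderI)
qed

text \<open>Without normal ordering, products are governed by \<open>psi_pair_commutator\<close>;
  the cutoff keeps the sum finite. On a given vector and for large \<open>N\<close> it differs from
  \<open>Eop\<close> only by the scalar \<open>Eshift\<close>, which has no limit as
  \<open>N\<close> grows.\<close>

definition Eraw :: "int => int => real mfps => real mfps wedge => real mfps wedge" where
  "Eraw N n u v = (\<Sum>k\<in>{-N..<N}. wscale (ex n u k) (psi (k - n) (psi_dag k v)))"

definition Eshift :: "int => int => real mfps => real mfps" where
  "Eshift N n u = (if n = 0 then \<Sum>k\<in>{-N..<0}. ex n u k else 0)"

lemma Eop_interval:
  "\<forall>\<^sub>F N in at_top. Eop n u v = (\<Sum>k\<in>{-N..<N}. wscale (ex n u k) (E_unit (k - n) k v))"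
  using eventually_interval_superset[OF finite_E_unit_nonzero[of n v]]
proof eventually_elim
  case (elim N)
  show ?case unfolding Eop_ex
  proof (rule Sum_any.expand_superset)
    show "{k. wscale (ex n u k) (E_unit (k - n) k v) ~= 0} \<subseteq> {-N..<N}"
      using elim by (auto simp: wedge.scale_zero_right)
  qed simp
qed

lemma Eop_Eraw:
  "\<forall>\<^sub>F N in at_top. Eop n u v = Eraw N n u v - wscale (Eshift N n u) v"
  using Eop_interval[of n u v] eventually_ge_at_top[of 0]
proof eventually_elim
  case (elim N)
  have "(\<Sum>k\<in>{-N..<N}. wscale (ex n u k) (if k - n = k & k < 0 then v else 0)) = wscale (Eshift N n u) v"
  proof (cases "n = 0")
    case True
    have "(\<Sum>k\<in>{-N..<N}. wscale (ex n u k) (if k - n = k & k < 0 then v else 0)) =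
        (\<Sum>k\<in>{-N..<0}. wscale (ex n u k) v)"
      by (rule sum.mono_neutral_cong_right) (use elim(2) True in auto)
    then show ?thesis by (simp add: Eshift_def True wedge.scale_sum_left)
  qed (simp add: Eshift_def)
  then show ?case
    by (simp add: elim(1) Eraw_def E_unit_psi wedge.scale_right_diff_distrib sum_subtractf)
qed

lemma Eraw_linear: "module_hom wscale wscale (Eraw N n u)"
proof -
  have 1: "module_hom wscale wscale (%v. wscale (ex n u k) (psi (k - n) (psi_dag k v)))" for k
  proof -
    have "module_hom wscale wscale (%v. psi (k - n) (psi_dag k v :: real mfps wedge))"
      using module_hom_compose[OF psi_dag_linear psi_linear] by (simp add: o_def)
    then show ?thesis
      by (rule module_pair.module_hom_scale[OF module_pair.intro[OF wedge.module_axioms wedge.module_axioms]])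
  qed
  show ?thesis unfolding Eraw_def
    by (rule module_pair.module_hom_sum[OF module_pair.intro[OF wedge.module_axioms wedge.module_axioms]])
       (auto simp: 1 wedge.module_axioms)
qed

text \<open>The operators differ from their cutoffs by scalars on the four vectors involved, and
  scalars drop out of a commutator.\<close>

lemma Eop_commutator_Eraw:
  "\<forall>\<^sub>F N in at_top. Eop a u (Eop b v x) - Eop b v (Eop a u x) =
     Eraw N a u (Eraw N b v x) - Eraw N b v (Eraw N a u x)"
  using Eop_Eraw[of a u x] Eop_Eraw[of b v x] Eop_Eraw[of a u "Eop b v x"] Eop_Eraw[of b v "Eop a u x"]
proof eventually_elim
  case (elim N)
  interpret A: module_hom wscale wscale "Eraw N a u" by (rule Eraw_linear)
  interpret B: module_hom wscale wscale "Eraw N b v" by (rule Eraw_linear)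
  show ?case
    unfolding elim(3,4) unfolding elim(1,2)
    by (simp add: A.diff B.diff A.scale B.scale wedge.scale_right_diff_distrib mult.commute)
qed

lemma vfree_mconst_mult [simp]: "vfree u ==> vfree (mconst c * u)" by simp

lemma ex_mult_shift:
  assumes "vfree u" "vfree v"
  shows "ex a u (l - b) * ex b v l =
    mexp (mconst (1/2) * (mconst (of_int a) * v - mconst (of_int b) * u)) * ex (a + b) (u + v) l"
proof -
  have "mconst (of_int (l - b) + 1/2 - of_int a / 2) * u + mconst (of_int l + 1/2 - of_int b / 2) * v =
      mconst (1/2) * (mconst (of_int a) * v - mconst (of_int b) * u) +
      mconst (of_int l + 1/2 - of_int (a + b) / 2) * (u + v)"
    by (rule mfps_eqI, simp only: mcoeff_mconst_mult mcoeff_add mcoeff_diff) (simp add: field_simps)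
  then show ?thesis
    using assms unfolding ex_def by (subst (1 2) mexp_add[symmetric]) auto
qed

text \<open>Both contractions leave the same bilinears. They differ in the exponential prefactor and
  in the range of \<open>l\<close> that the cutoff allows: the prefactors combine to sigma, and the
  ranges will produce the central term.\<close>

lemma Eraw_commutator:
  fixes a b :: int and u v :: "real mfps"
  assumes uv: "vfree u" "vfree v"
  defines "w \<equiv> mconst (of_int a) * v - mconst (of_int b) * u"
  shows "Eraw N a u (Eraw N b v x) - Eraw N b v (Eraw N a u x) =
    wscale (mexp (mconst (1/2) * w)) (\<Sum>l\<in>{-N..<N} \<inter> {l. l - b \<in> {-N..<N}}.
       wscale (ex (a + b) (u + v) l) (psi (l - (a + b)) (psi_dag l x))) -
    wscale (mexp (mconst (- 1/2) * w)) (\<Sum>l\<in>{-N..<N} \<inter> {l. l - a \<in> {-N..<N}}.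
       wscale (ex (a + b) (u + v) l) (psi (l - (a + b)) (psi_dag l x)))"
proof -
  let ?I = "{-N..<N}"
  define P where "P k n = psi (k - n) (psi_dag k x)" for k n :: int
  have hom: "module_hom wscale wscale (%y. psi i (psi_dag j y :: real mfps wedge))" for i j
    using module_hom_compose[OF psi_dag_linear psi_linear] by (simp add: o_def)
  have prod: "Eraw N a u (Eraw N b v x) = (\<Sum>k\<in>?I. \<Sum>l\<in>?I. wscale (ex a u k * ex b v l)
      (psi (k - a) (psi_dag k (psi (l - b) (psi_dag l x)))))" for a b u v
    unfolding Eraw_def
    by (simp add: module_hom.sum[OF hom] module_hom.scale[OF hom] wedge.scale_sum_right)
  have "Eraw N a u (Eraw N b v x) - Eraw N b v (Eraw N a u x) =
      (\<Sum>k\<in>?I. \<Sum>l\<in>?I. wscale (ex a u k * ex b v l)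
        (psi (k - a) (psi_dag k (psi (l - b) (psi_dag l x))) -
         psi (l - b) (psi_dag l (psi (k - a) (psi_dag k x)))))"
    unfolding prod[of a u b v] prod[of b v a u]
    by (subst (2) sum.swap) (simp add: sum_subtractf wedge.scale_right_diff_distrib mult.commute)
  also have "... = (\<Sum>k\<in>?I. \<Sum>l\<in>?I. wscale (ex a u k * ex b v l)
        ((if k = l - b then P l (a + b) else 0) - (if k - a = l then P k (a + b) else 0)))"
    by (intro sum.cong refl arg_cong[where f = "wscale _"])
       (auto simp: psi_pair_commutator P_def algebra_simps)
  also have "... = (\<Sum>k\<in>?I. \<Sum>l\<in>?I. if k = l - b then wscale (ex a u k * ex b v l) (P l (a + b)) else 0) -
      (\<Sum>k\<in>?I. \<Sum>l\<in>?I. if l = k - a then wscale (ex a u k * ex b v l) (P k (a + b)) else 0)"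
    unfolding sum_subtractf[symmetric]
    by (intro sum.cong refl) (auto simp: wedge.scale_right_diff_distrib)
  also have "(\<Sum>k\<in>?I. \<Sum>l\<in>?I. if k = l - b then wscale (ex a u k * ex b v l) (P l (a + b)) else 0) =
      (\<Sum>l\<in>?I. \<Sum>k\<in>?I. if k = l - b then wscale (ex a u k * ex b v l) (P l (a + b)) else 0)"
    by (rule sum.swap)
  also have "(\<Sum>l\<in>?I. \<Sum>k\<in>?I. if k = l - b then wscale (ex a u k * ex b v l) (P l (a + b)) else 0) =
      (\<Sum>l\<in>?I. if l - b \<in> ?I then wscale (ex a u (l - b) * ex b v l) (P l (a + b)) else 0)"
    by (simp add: sum.delta)
  also have "... = wscale (mexp (mconst (1/2) * w)) (\<Sum>l\<in>?I \<inter> {l. l - b \<in> ?I}. wscale (ex (a + b) (u + v) l) (P l (a + b)))"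
    unfolding wedge.scale_sum_right w_def
    by (subst sum.inter_restrict) (auto simp: ex_mult_shift[OF uv] intro!: sum.cong)
  also have "(\<Sum>k\<in>?I. \<Sum>l\<in>?I. if l = k - a then wscale (ex a u k * ex b v l) (P k (a + b)) else 0) =
      (\<Sum>k\<in>?I. if k - a \<in> ?I then wscale (ex a u k * ex b v (k - a)) (P k (a + b)) else 0)"
    by (simp add: sum.delta)
  also have "... = wscale (mexp (mconst (- 1/2) * w)) (\<Sum>l\<in>?I \<inter> {l. l - a \<in> ?I}. wscale (ex (a + b) (u + v) l) (P l (a + b)))"
  proof -
    have "mconst (1/2) * (mconst (of_int b) * u - mconst (of_int a) * v) = mconst (- 1/2) * w"
      by (rule mfps_eqI, simp only: w_def mcoeff_mconst_mult mcoeff_diff) (simp add: field_simps)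
    then have "ex a u k * ex b v (k - a) = mexp (mconst (- 1/2) * w) * ex (a + b) (u + v) k" for k
      using ex_mult_shift[OF uv(2,1), of b k a] by (simp add: add.commute mult.commute)
    then show ?thesis
      unfolding wedge.scale_sum_right by (subst sum.inter_restrict) (auto intro!: sum.cong)
  qed
  finally show ?thesis by (simp add: P_def)
qed

lemma Eop_partial_sum:
  assumes fin: "finite I" and sup: "{k. E_unit (k - n) k x ~= 0} \<subseteq> I"
  shows "(\<Sum>l\<in>I. wscale (ex n u l) (psi (l - n) (psi_dag l x))) =
    Eop n u x + (if n = 0 then wscale (\<Sum>l\<in>I \<inter> {..<0}. ex n u l) x else 0)"
proof -
  have E: "Eop n u x = (\<Sum>l\<in>I. wscale (ex n u l) (E_unit (l - n) l x))"
    unfolding Eop_ex by (rule Sum_any.expand_superset) (use assms in auto)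
  have "(\<Sum>l\<in>I. wscale (ex n u l) (psi (l - n) (psi_dag l x))) =
      (\<Sum>l\<in>I. wscale (ex n u l) (E_unit (l - n) l x) + wscale (ex n u l) (if n = 0 & l < 0 then x else 0))"
    by (intro sum.cong refl) (auto simp: E_unit_psi wedge.scale_right_diff_distrib)
  also have "... = Eop n u x + (\<Sum>l\<in>I. wscale (ex n u l) (if n = 0 & l < 0 then x else 0))"
    by (simp add: sum.distrib E)
  also have "(\<Sum>l\<in>I. wscale (ex n u l) (if n = 0 & l < 0 then x else 0)) =
      (if n = 0 then wscale (\<Sum>l\<in>I \<inter> {..<0}. ex n u l) x else 0)"
  proof (cases "n = 0")
    case True
    have "(\<Sum>l\<in>I. wscale (ex n u l) (if n = 0 & l < 0 then x else 0)) = (\<Sum>l\<in>I \<inter> {..<0}. wscale (ex n u l) x)"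
      by (rule sum.mono_neutral_cong_right) (use fin True in auto)
    then show ?thesis by (simp add: True wedge.scale_sum_left)
  qed simp
  finally show ?thesis .
qed

text \<open>A shift by \<open>a\<close> turns the second sum into the same summands over the
  half-line below \<open>- a\<close> instead of below 0. The ends at the cutoff cancel, and the
  summands in between form the quotient of \<open>varsigma_quotient\<close>, up to sign if
  \<open>a\<close> is negative.\<close>

lemma central_term:
  assumes "vfree w" "N > \<bar>a\<bar>"
  defines "h \<equiv> %l. mexp (mconst (of_int l + 1/2 + of_int a / 2) * w)"
  shows "(\<Sum>l\<in>({-N..<N} \<inter> {l. l + a \<in> {-N..<N}}) \<inter> {..<0}. h l) -
    (\<Sum>l\<in>({-N..<N} \<inter> {l. l - a \<in> {-N..<N}}) \<inter> {..<0}. h (l - a)) = rat a w"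
proof -
  let ?I = "{-N..<N} \<inter> {l. l + a \<in> {-N..<N}}"
  have shift: "(\<Sum>l\<in>({-N..<N} \<inter> {l. l - a \<in> {-N..<N}}) \<inter> {..<0}. h (l - a)) = (\<Sum>l\<in>?I \<inter> {..<-a}. h l)"
    by (rule sum.reindex_bij_witness[where i = "%l. l + a" and j = "%l. l - a"]) auto
  show ?thesis
  proof (cases "a >= 0")
    case True
    have e: "?I \<inter> {..<0} = (?I \<inter> {..<-a}) \<union> {-a..<0}" using True assms(2) by auto
    have "(\<Sum>l\<in>?I \<inter> {..<0}. h l) = (\<Sum>l\<in>?I \<inter> {..<-a}. h l) + (\<Sum>l\<in>{-a..<0}. h l)"
      by (subst e, rule sum.union_disjoint) auto
    then show ?thesis unfolding shift using True by (simp add: rat_nonneg_sum h_def)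
  next
    case False
    have e: "?I \<inter> {..<-a} = (?I \<inter> {..<0}) \<union> {0..<-a}" using False assms(2) by auto
    have "(\<Sum>l\<in>?I \<inter> {..<-a}. h l) = (\<Sum>l\<in>?I \<inter> {..<0}. h l) + (\<Sum>l\<in>{0..<-a}. h l)"
      by (subst e, rule sum.union_disjoint) auto
    moreover have "(\<Sum>l\<in>{0..<-a}. h l) = rat (- a) w"
    proof -
      have "rat (- a) w = (\<Sum>l\<in>{a..<0}. mexp (mconst (of_int l + 1/2 - of_int a / 2) * w))"
        using False by (simp add: rat_nonneg_sum)
      also have "... = (\<Sum>l\<in>{0..<-a}. h l)"
        unfolding h_def
        by (rule sum.reindex_bij_witness[where i = "%l. l + a" and j = "%l. l - a"])
           (auto intro!: arg_cong[where f = mexp] arg_cong[where f = "%c. mconst c * w"])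
      finally show ?thesis by simp
    qed
    ultimately show ?thesis unfolding shift by (simp add: rat_neg)
  qed
qed

text \<open>\<open>Eop 0\<close> lacks the scalar 1/sigma. In the usual form of the commutator this
  scalar would give sigma(a v - b u)/sigma(u + v) for a + b = 0; as a v - b u is then a (u + v), the
  quotient is the power series \<open>rat a (u + v)\<close>, and no division by a series without
  constant term is left.\<close>

theorem Eop_commutator:
  assumes uv: "vfree u" "vfree v"
  shows "Eop a u (Eop b v x) = Eop b v (Eop a u x) +
    wscale (vs (mconst (of_int a) * v - mconst (of_int b) * u)) (Eop (a + b) (u + v) x) +
    (if a + b = 0 then wscale (rat a (u + v)) x else 0)"
proof -
  let ?S = "{k. E_unit (k - (a + b)) k x ~= 0}"
  have fin: "finite (?S \<union> (%k. k - a) ` ?S \<union> (%k. k - b) ` ?S)"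
    using finite_E_unit_nonzero[of "a + b" x] by simp
  have "\<forall>\<^sub>F N in at_top. Eop a u (Eop b v x) - Eop b v (Eop a u x) =
      Eraw N a u (Eraw N b v x) - Eraw N b v (Eraw N a u x) \<and>
      (?S \<union> (%k. k - a) ` ?S \<union> (%k. k - b) ` ?S \<subseteq> {-N..<N}) & N > \<bar>a\<bar>"
    using Eop_commutator_Eraw[of a u b v x] eventually_interval_superset[OF fin] eventually_gt_at_top
    by (intro eventually_conj)
  then obtain N where N: "Eop a u (Eop b v x) - Eop b v (Eop a u x) =
      Eraw N a u (Eraw N b v x) - Eraw N b v (Eraw N a u x)"
    and sup: "?S \<union> (%k. k - a) ` ?S \<union> (%k. k - b) ` ?S \<subseteq> {-N..<N}" and Na: "N > \<bar>a\<bar>"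
    using eventually_happens'[OF trivial_limit_at_top_linorder] by blast
  define w where "w = mconst (of_int a) * v - mconst (of_int b) * u"
  define Y where "Y = Eop (a + b) (u + v) x"
  let ?c1 = "mexp (mconst (1/2) * w)" and ?c2 = "mexp (mconst (- 1/2) * w)"
  let ?Ib = "{-N..<N} \<inter> {l. l - b \<in> {-N..<N}}" and ?Ia = "{-N..<N} \<inter> {l. l - a \<in> {-N..<N}}"
  have "?S \<subseteq> ?Ib" "?S \<subseteq> ?Ia" using sup by auto
  then have parts:
    "(\<Sum>l\<in>?Ib. wscale (ex (a + b) (u + v) l) (psi (l - (a + b)) (psi_dag l x))) =
      Y + (if a + b = 0 then wscale (\<Sum>l\<in>?Ib \<inter> {..<0}. ex (a + b) (u + v) l) x else 0)"
    "(\<Sum>l\<in>?Ia. wscale (ex (a + b) (u + v) l) (psi (l - (a + b)) (psi_dag l x))) =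
      Y + (if a + b = 0 then wscale (\<Sum>l\<in>?Ia \<inter> {..<0}. ex (a + b) (u + v) l) x else 0)"
    unfolding Y_def by (intro Eop_partial_sum; simp)+
  have "Eop a u (Eop b v x) - Eop b v (Eop a u x) =
      wscale ?c1 (Y + (if a + b = 0 then wscale (\<Sum>l\<in>?Ib \<inter> {..<0}. ex (a + b) (u + v) l) x else 0)) -
      wscale ?c2 (Y + (if a + b = 0 then wscale (\<Sum>l\<in>?Ia \<inter> {..<0}. ex (a + b) (u + v) l) x else 0))"
    unfolding N Eraw_commutator[OF uv] w_def[symmetric] parts ..
  also have "... = wscale (?c1 - ?c2) Y + (if a + b = 0 then
      wscale (?c1 * (\<Sum>l\<in>?Ib \<inter> {..<0}. ex (a + b) (u + v) l) - ?c2 * (\<Sum>l\<in>?Ia \<inter> {..<0}. ex (a + b) (u + v) l)) x else 0)"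
    by (simp add: wedge.scale_left_diff_distrib wedge.scale_right_distrib)
  also have "?c1 - ?c2 = vs w" by (simp add: vs_mexp)
  also have "(if a + b = 0 then
      wscale (?c1 * (\<Sum>l\<in>?Ib \<inter> {..<0}. ex (a + b) (u + v) l) - ?c2 * (\<Sum>l\<in>?Ia \<inter> {..<0}. ex (a + b) (u + v) l)) x else 0) =
      (if a + b = 0 then wscale (rat a (u + v)) x else 0)"
  proof (cases "a + b = 0")
    case True
    then have b: "b = - a" by simp
    have f: "vfree (u + v)" "vfree w" using uv by (simp_all add: w_def)
    define h where "h = (%l::int. mexp (mconst (of_int l + 1/2 + of_int a / 2) * (u + v)))"
    have e1: "?c1 * ex (a + b) (u + v) l = h l" for l
    proof -
      have "mconst (1/2) * w + mconst (of_int l + 1/2 - of_int (a + b) / 2) * (u + v) =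
          mconst (of_int l + 1/2 + of_int a / 2) * (u + v)"
        by (rule mfps_eqI, simp only: w_def b mcoeff_mconst_mult mcoeff_add mcoeff_diff) (simp add: field_simps)
      then show ?thesis unfolding ex_def h_def using f by (subst mexp_add[symmetric]) auto
    qed
    have e2: "?c2 * ex (a + b) (u + v) l = h (l - a)" for l
    proof -
      have "mconst (- 1/2) * w + mconst (of_int l + 1/2 - of_int (a + b) / 2) * (u + v) =
          mconst (of_int (l - a) + 1/2 + of_int a / 2) * (u + v)"
        by (rule mfps_eqI, simp only: w_def b mcoeff_mconst_mult mcoeff_add mcoeff_diff) (simp add: field_simps)
      then show ?thesis unfolding ex_def h_def using f by (subst mexp_add[symmetric]) auto
    qed
    have "?c1 * (\<Sum>l\<in>?Ib \<inter> {..<0}. ex (a + b) (u + v) l) - ?c2 * (\<Sum>l\<in>?Ia \<inter> {..<0}. ex (a + b) (u + v) l) =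
        rat a (u + v)"
      unfolding sum_distrib_left e1 e2 h_def
      using central_term[OF f(1) Na] by (simp add: b)
    then show ?thesis by (simp only:)
  qed simp
  finally show ?thesis by (simp add: w_def Y_def algebra_simps)
qed

section \<open>Vacuum expectations of words\<close>

definition Gv :: "(int \<times> real mfps) list => real mfps" where
  "Gv w = vev (map (%(e, u). Eop e u) w)"

definition act :: "(int \<times> real mfps) list => real mfps wedge => real mfps wedge" where
  "act w x = foldr (%(e, u). Eop e u) w x"

abbreviation vac :: "real mfps wedge" where "vac \<equiv> Poly_Mapping.single vacuum_maya 1"

lemma Gv_act: "Gv w = lookup (act w vac) vacuum_maya"
proof -
  have "foldr (%A v. A v) (map (%(e, u). Eop e u) w) x = act w x" for x
    by (induction w) (auto simp: act_def)
  then show ?thesis by (simp add: Gv_def vev_def Let_def wedge_inner_def)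
qed

lemma Eop_linear: "module_hom wscale wscale (Eop n u)"
proof (unfold_locales, goal_cases)
  case (1 x y)
  have "\<forall>\<^sub>F N in (at_top :: int filter). Eop n u (x + y) = Eop n u x + Eop n u y"
    using Eop_Eraw[of n u x] Eop_Eraw[of n u y] Eop_Eraw[of n u "x + y"]
  proof eventually_elim
    case (elim N)
    show ?case unfolding elim
      by (simp add: module_hom.add[OF Eraw_linear] wedge.scale_right_distrib)
  qed
  then show ?case by simp
next
  case (2 c x)
  have "\<forall>\<^sub>F N in (at_top :: int filter). Eop n u (wscale c x) = wscale c (Eop n u x)"
    using Eop_Eraw[of n u x] Eop_Eraw[of n u "wscale c x"]
  proof eventually_elim
    case (elim N)
    show ?case unfolding elim
      by (simp add: module_hom.scale[OF Eraw_linear] wedge.scale_right_diff_distrib mult.commute)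
  qed
  then show ?case by simp
qed

lemma act_append: "act (w1 @ w2) x = act w1 (act w2 x)"
  by (simp add: act_def)

lemma act_linear: "module_hom wscale wscale (act w)"
proof (induction w)
  case Nil
  show ?case by unfold_locales (simp_all add: act_def)
next
  case (Cons a w)
  have "act (a # w) = Eop (fst a) (snd a) \<circ> act w"
    by (auto simp: act_def case_prod_unfold)
  then show ?case using module_hom_compose[OF Cons Eop_linear] by (simp only:)
qed

theorem Gv_swap:
  assumes "vfree u" "vfree v"
  shows "Gv (w1 @ (a, u) # (b, v) # w2) = Gv (w1 @ (b, v) # (a, u) # w2) +
     vs (mconst (of_int a) * v - mconst (of_int b) * u) * Gv (w1 @ (a + b, u + v) # w2) +
     (if a + b = 0 then rat a (u + v) * Gv (w1 @ w2) else 0)"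
proof -
  interpret A: module_hom wscale wscale "act w1" by (rule act_linear)
  have *: "act ((e, f) # w) x = Eop e f (act w x)" for e f w x by (simp add: act_def)
  show ?thesis
    unfolding Gv_act act_append *
    by (subst Eop_commutator[OF assms]) (simp add: A.add A.scale lookup_add A.zero)
qed

lemma E_unit_vac:
  assumes "n >= 0" shows "E_unit (k - n) k vac = 0"
proof (cases "k >= 0")
  case True
  then show ?thesis by (simp add: E_unit_def psi_dag_single vacuum_maya.rep_eq psi_0)
next
  case False
  then show ?thesis using assms by (simp add: E_unit_def psi_single vacuum_maya.rep_eq psi_dag_0)
qed

lemma Gv_last: "e >= 0 ==> Gv (w @ [(e, u)]) = 0"
proof -
  assume "e >= 0"
  then have "Eop e u vac = 0" by (simp add: Eop_def E_unit_vac)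
  then have "act [(e, u)] vac = 0" by (simp add: act_def)
  then show ?thesis by (simp add: Gv_act act_append module_hom.zero[OF act_linear])
qed

lemma lookup_psi_0: "i \<notin> entries T ==> lookup (psi i x) T = 0"
  unfolding psi_def lookup_linear_ext
  by (rule sum.neutral) (auto simp: lookup_single when_def maya_insert.rep_eq)

lemma lookup_psi_dag_0: "i \<in> entries T ==> lookup (psi_dag i x) T = 0"
  unfolding psi_dag_def lookup_linear_ext
  by (rule sum.neutral) (auto simp: lookup_single when_def maya_remove.rep_eq)

lemma Gv_first: "e <= 0 ==> Gv ((e, u) # w) = 0"
proof -
  assume e: "e <= 0"
  have "lookup (E_unit (k - e) k x) vacuum_maya = 0" for k and x :: "real mfps wedge"
    using e by (auto simp: E_unit_def vacuum_maya.rep_eq lookup_psi_0 lookup_psi_dag_0)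
  then have "lookup (Eop e u x) vacuum_maya = 0" for x
    using Eop_interval[of e u x]
    using eventually_happens'[OF trivial_limit_at_top_linorder] by (fastforce simp: lookup_sum)
  then show ?thesis by (simp add: Gv_act act_def)
qed

lemma Gv_Nil: "Gv [] = 1" by (simp add: Gv_act act_def)

section \<open>Eventually polynomial families\<close>

text \<open>The number \<open>c\<close> is the value at 0 of the polynomial that agrees with
  \<open>f\<close> for large arguments; \<open>f 0\<close> itself may differ from it.\<close>

definition evpoly :: "(nat => real) => real => bool" where
  "evpoly f c \<longleftrightarrow> (\<exists>P. (\<forall>\<^sub>F j in sequentially. f j = poly P (real j)) & poly P 0 = c)"

lemma evpolyI: "(\<And>j. f j = poly P (real j)) ==> poly P 0 = c ==> evpoly f c"
  unfolding evpoly_def by (intro exI[of _ P]) simp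

lemma evpoly_unique:
  assumes "evpoly f c" "evpoly f d" shows "c = d"
proof -
  obtain P Q where P: "\<forall>\<^sub>F j in sequentially. f j = poly P (real j)" "poly P 0 = c"
    and Q: "\<forall>\<^sub>F j in sequentially. f j = poly Q (real j)" "poly Q 0 = d"
    using assms unfolding evpoly_def by blast
  have "\<forall>\<^sub>F j in sequentially. poly (P - Q) (real j) = 0"
    using P(1) Q(1) by eventually_elim simp
  then obtain N where N: "\<And>j. j >= N ==> poly (P - Q) (real j) = 0"
    by (auto simp: eventually_sequentially)
  have "P - Q = 0"
  proof (rule ccontr)
    assume "P - Q ~= 0"
    then have "finite {x. poly (P - Q) x = 0}" by (rule poly_roots_finite)
    moreover have "real ` {N..} \<subseteq> {x. poly (P - Q) x = 0}" using N by auto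
    ultimately have "finite (real ` {N..})" using finite_subset by blast
    then have "finite {N..}" by (rule finite_imageD) (simp add: inj_on_def)
    then show False using infinite_Ici by blast
  qed
  then show ?thesis using P(2) Q(2) by simp
qed

lemma evpoly_const: "evpoly (%_. c) c" by (rule evpolyI[of _ "[:c:]"]) simp_all

lemma evpoly_add: "evpoly f c ==> evpoly g d ==> evpoly (%j. f j + g j) (c + d)"
proof -
  assume "evpoly f c" "evpoly g d"
  then obtain P Q where P: "\<forall>\<^sub>F j in sequentially. f j = poly P (real j)" "poly P 0 = c"
    and Q: "\<forall>\<^sub>F j in sequentially. g j = poly Q (real j)" "poly Q 0 = d"
    unfolding evpoly_def by blast
  have "\<forall>\<^sub>F j in sequentially. f j + g j = poly (P + Q) (real j)"
    using P(1) Q(1) by eventually_elim simp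
  then show ?thesis using P(2) Q(2) unfolding evpoly_def by (intro exI[of _ "P + Q"]) simp
qed

lemma evpoly_mult: "evpoly f c ==> evpoly g d ==> evpoly (%j. f j * g j) (c * d)"
proof -
  assume "evpoly f c" "evpoly g d"
  then obtain P Q where P: "\<forall>\<^sub>F j in sequentially. f j = poly P (real j)" "poly P 0 = c"
    and Q: "\<forall>\<^sub>F j in sequentially. g j = poly Q (real j)" "poly Q 0 = d"
    unfolding evpoly_def by blast
  have "\<forall>\<^sub>F j in sequentially. f j * g j = poly (P * Q) (real j)"
    using P(1) Q(1) by eventually_elim simp
  then show ?thesis using P(2) Q(2) unfolding evpoly_def by (intro exI[of _ "P * Q"]) simp
qed

lemma evpoly_power: "evpoly f c ==> evpoly (%j. f j ^ n) (c ^ n)"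
  by (induction n) (simp_all add: evpoly_const evpoly_mult)

lemma evpoly_sum: "(\<And>x. x \<in> A ==> evpoly (f x) (c x)) ==> evpoly (%j. \<Sum>x\<in>A. f x j) (\<Sum>x\<in>A. c x)"
  by (induction A rule: infinite_finite_induct) (simp_all add: evpoly_const evpoly_add)

lemma evpoly_cong: "evpoly f c ==> \<forall>\<^sub>F j in sequentially. f j = g j ==> evpoly g c"
proof -
  assume "evpoly f c" and e: "\<forall>\<^sub>F j in sequentially. f j = g j"
  then obtain P where P: "\<forall>\<^sub>F j in sequentially. f j = poly P (real j)" "poly P 0 = c"
    unfolding evpoly_def by blast
  have "\<forall>\<^sub>F j in sequentially. g j = poly P (real j)"
    using P(1) e by eventually_elim simp
  then show ?thesis using P(2) unfolding evpoly_def by blast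
qed

lemma evpoly_affine: "evpoly (%j. real_of_int (p + int j * q)) (of_int p)"
  by (rule evpolyI[of _ "[:of_int p, of_int q:]"]) simp_all

definition mpoly :: "(nat => real mfps) => real mfps => bool" where
  "mpoly F v \<longleftrightarrow> (\<forall>m. evpoly (%j. mcoeff (F j) m) (mcoeff v m))"

lemma mpolyI: "(\<And>m. evpoly (%j. mcoeff (F j) m) (mcoeff v m)) ==> mpoly F v"
  by (simp add: mpoly_def)

lemma mpoly_unique: "mpoly F v ==> mpoly F w ==> v = w"
  by (rule mfps_eqI) (auto simp: mpoly_def intro: evpoly_unique)

lemma mpoly_const: "mpoly (%_. v) v" by (simp add: mpoly_def evpoly_const)

lemma mpoly_add: "mpoly F v ==> mpoly G w ==> mpoly (%j. F j + G j) (v + w)"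
  by (simp add: mpoly_def evpoly_add)

lemma mpoly_mult: "mpoly F v ==> mpoly G w ==> mpoly (%j. F j * G j) (v * w)"
  unfolding mpoly_def mcoeff_mult case_prod_unfold by (intro allI evpoly_sum evpoly_mult) auto

lemma mpoly_diff: "mpoly F v ==> mpoly G w ==> mpoly (%j. F j - G j) (v - w)"
  using mpoly_add[of F v "%j. mconst (-1) * G j" "mconst (-1) * w"]
    mpoly_mult[OF mpoly_const[of "mconst (-1)"], of G w]
  by (simp add: mconst_minus)

lemma mpoly_power: "mpoly F v ==> mpoly (%j. F j ^ n) (v ^ n)"
  by (induction n) (simp_all add: mpoly_const mpoly_mult)

lemma mpoly_mconst: "evpoly f c ==> mpoly (%j. mconst (f j)) (mconst c)"
  by (simp add: mpoly_def mcoeff_mconst evpoly_const)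

lemma mpoly_cong: "mpoly F v ==> \<forall>\<^sub>F j in sequentially. F j = G j ==> mpoly G v"
  unfolding mpoly_def
proof (intro allI)
  fix m assume F: "\<forall>m. evpoly (%j. mcoeff (F j) m) (mcoeff v m)" and e: "\<forall>\<^sub>F j in sequentially. F j = G j"
  have "\<forall>\<^sub>F j in sequentially. mcoeff (F j) m = mcoeff (G j) m" using e by eventually_elim simp
  then show "evpoly (%j. mcoeff (G j) m) (mcoeff v m)" by (rule evpoly_cong[OF F[rule_format]])
qed

lemma mpoly_msubst: "mpoly U u ==> mpoly (%j. msubst F (U j)) (msubst F u)"
proof (rule mpolyI)
  fix m assume U: "mpoly U u"
  show "evpoly (%j. mcoeff (msubst F (U j)) m) (mcoeff (msubst F u) m)"
    unfolding msubst_def mcoeff_Abs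
    by (intro evpoly_sum evpoly_mult evpoly_const)
       (use mpoly_power[OF U] in \<open>simp add: mpoly_def\<close>)
qed

lemma varsigma_fps_X: "varsigma c = fps_X * fps_shift 1 (varsigma c)"
  by (rule fps_ext) (simp add: varsigma_def)

text \<open>Numerator and denominator are both divided by X; the denominator becomes invertible and
  does not involve \<open>c\<close>, so every coefficient of the quotient is polynomial in
  \<open>c\<close>.\<close>

lemma varsigma_quotient_coeff:
  "fps_nth (varsigma c / varsigma 1) n =
     (\<Sum>i\<le>n. fps_nth (varsigma c) (i + 1) * fps_nth (inverse (fps_shift 1 (varsigma 1))) (n - i))"
proof -
  let ?g = "fps_shift 1 (varsigma 1)" and ?f = "fps_shift 1 (varsigma c)"
  have "fps_nth ?g 0 ~= 0" by (simp add: varsigma_def)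
  then have g: "inverse ?g * ?g = 1" by (rule inverse_mult_eq_1)
  have "?f * inverse ?g * varsigma 1 = fps_X * ?f * (inverse ?g * ?g)"
    by (subst (3) varsigma_fps_X) (simp only: mult_ac)
  also have "... = varsigma c" unfolding g by (simp only: mult_1_right varsigma_fps_X[symmetric])
  finally have "varsigma c / varsigma 1 = ?f * inverse ?g"
    using varsigma_1_nonzero by (metis nonzero_mult_div_cancel_right)
  then show ?thesis by (simp add: fps_mult_nth atLeast0AtMost)
qed

lemma fps_nth_varsigma: "fps_nth (varsigma c) n = ((c/2) ^ n - (- c/2) ^ n) / fact n"
  by (simp add: varsigma_def diff_divide_distrib)

lemma mpoly_rat: "mpoly (%j. rat (p + int j * q) u) (rat p u)"
proof (rule mpolyI)
  fix m
  have v: "evpoly (%j. fps_nth (varsigma (of_int (p + int j * q))) n) (fps_nth (varsigma (of_int p)) n)" for n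
  proof -
    have a: "evpoly (%j. (1/2 * of_int (p + int j * q)) ^ n) ((1/2 * of_int p) ^ n)"
      by (intro evpoly_power evpoly_mult evpoly_const evpoly_affine)
    have b: "evpoly (%j. (- 1/2 * of_int (p + int j * q)) ^ n) ((- 1/2 * of_int p) ^ n)"
      by (intro evpoly_power evpoly_mult evpoly_const evpoly_affine)
    have "evpoly (%j. 1 / fact n * ((1/2 * of_int (p + int j * q)) ^ n + (-1) * (- 1/2 * of_int (p + int j * q)) ^ n))
        (1 / fact n * ((1/2 * of_int p) ^ n + (-1) * (- 1/2 * of_int p) ^ n))"
      by (intro evpoly_mult evpoly_const evpoly_add a b)
    moreover have "fps_nth (varsigma c) n = 1 / fact n * ((1/2 * c) ^ n + (-1) * (- 1/2 * c) ^ n)" for c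
      by (simp add: fps_nth_varsigma)
    ultimately show ?thesis by (simp only:)
  qed
  show "evpoly (%j. mcoeff (rat (p + int j * q) u) m) (mcoeff (rat p u) m)"
    unfolding rat_def msubst_def mcoeff_Abs varsigma_quotient_coeff
    by (intro evpoly_sum evpoly_mult evpoly_const v)
qed

section \<open>Sorting induction on words\<close>

fun inversions :: "('l => bool) => 'l list => nat" where
  "inversions pos [] = 0"
| "inversions pos (a # w) = (if pos a then length (filter (%b. ~ pos b) w) else 0) + inversions pos w"

lemma inversions_swap:
  "pos a ==> ~ pos b ==> inversions pos (w1 @ a # b # w2) = Suc (inversions pos (w1 @ b # a # w2))"
  by (induction w1) auto

lemma adjacent_inversion:
  assumes "pos a" "~ pos b"
  shows "\<exists>w1 c d w2. a # w @ [b] = w1 @ c # d # w2 & pos c & ~ pos d"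
  using assms(1)
proof (induction w arbitrary: a)
  case Nil
  then show ?case using assms(2) by (intro exI[of _ "[]"]) auto
next
  case (Cons c w)
  show ?case
  proof (cases "pos c")
    case True
    from Cons.IH[OF this] obtain w1 c' d w2 where "c # w @ [b] = w1 @ c' # d # w2" "pos c'" "~ pos d" by blast
    then show ?thesis by (intro exI[of _ "a # w1"]) auto
  next
    case False
    then show ?thesis using Cons.prems by (intro exI[of _ "[]"]) auto
  qed
qed

text \<open>Positive letters are sorted to the right: an exchange lowers the number of inversions at
  equal length, while merging or cancelling the two letters lowers the length. A nonempty word that
  admits no exchange begins with a letter that is not positive or ends with a positive one, and
  there expectations vanish.\<close>

lemma word_induct [case_names Nil first last swap]:
  assumes Nil: "P []"
    and first: "\<And>a w. ~ pos a ==> P (a # w)"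
    and last: "\<And>a w. pos a ==> P (w @ [a])"
    and swap: "\<And>w1 a b w2. pos a ==> ~ pos b ==> P (w1 @ b # a # w2) ==> P (w1 @ mg a b # w2) ==>
        P (w1 @ w2) ==> P (w1 @ a # b # w2)"
  shows "P w"
proof (induction "length w" arbitrary: w rule: less_induct)
  case less
  note IH = this
  show ?case using IH
  proof (induction "inversions pos w" arbitrary: w rule: less_induct)
    case less
    show ?case
    proof (cases w)
      case Nil
      then show ?thesis using assms(1) by simp
    next
      case (Cons a w')
      show ?thesis
      proof (cases "pos a")
        case True
        show ?thesis
        proof (cases "pos (last w)")
          case True
          moreover have "butlast w @ [last w] = w" using Cons by simp
          ultimately show ?thesis using assms(3)[of "last w" "butlast w"] by simp
        next
          case False
          with \<open>pos a\<close> Cons have "w' ~= []" by auto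
          then have "w = a # butlast w' @ [last w']" using Cons by simp
          moreover have "~ pos (last w')" using False \<open>w' ~= []\<close> Cons by simp
          ultimately obtain w1 c d w2 where w: "w = w1 @ c # d # w2" "pos c" "~ pos d"
            using adjacent_inversion[where pos = pos, OF \<open>pos a\<close>, of "last w'" "butlast w'"] by metis
          show ?thesis unfolding w(1)
          proof (rule swap[OF w(2,3)])
            show "P (w1 @ d # c # w2)"
              by (rule less.hyps) (use less.prems w inversions_swap[where pos = pos, OF w(2,3)] in auto)
          qed (rule less.prems, simp add: w)+
        qed
      next
        case False
        then show ?thesis using assms(2) Cons by simp
      qed
    qed
  qed
qed

section \<open>Regularised vacuum expectations\<close>

text \<open>A letter \<open>((q, p), u)\<close> has energy \<open>p + j q\<close> at time \<open>j\<close>. The expectation of a word is, coefficientwise,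
  polynomial in \<open>j\<close> for large \<open>j\<close>; its regularised value is the value of that polynomial at \<open>0\<close>. So the regularised
  expectation continues to the point \<open>p\<close> the polynomial valid far out in direction \<open>q\<close>.\<close>

type_synonym letter = "(int \<times> int) \<times> real mfps"

definition at_time :: "nat => letter => int \<times> real mfps" where
  "at_time j = (%((q, p), u). (p + int j * q, u))"

text \<open>The sign of \<open>p + j q\<close> for large \<open>j\<close>: it is decided by
  \<open>q\<close>, and by \<open>p\<close> if \<open>q\<close> is 0.\<close>

definition lpos :: "int \<times> int => bool" where
  "lpos = (%(q, p). q > 0 | q = 0 & p > 0)"

definition lneg :: "int \<times> int => bool" where
  "lneg = (%(q, p). q < 0 | q = 0 & p < 0)"

text \<open>The value is unique by \<open>mpoly_unique\<close> and exists by \<open>Rv_mpoly\<close>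
  when no argument has a constant term, so nothing depends on the choice.\<close>

definition Rv :: "letter list => real mfps" where
  "Rv w = (SOME v. mpoly (%j. Gv (map (at_time j) w)) v)"

lemma eventually_affine_neg:
  assumes "~ lpos (q, p)"
  shows "\<forall>\<^sub>F j in sequentially. p + int j * q <= 0"
proof (cases "q = 0")
  case True
  then show ?thesis using assms by (simp add: lpos_def not_less)
next
  case False
  then have q: "q < 0" using assms by (simp add: lpos_def)
  have "p + int j * q <= 0" if "j >= nat \<bar>p\<bar>" for j
  proof -
    have "int j * q <= int j * (-1)" using q by (intro mult_left_mono) auto
    then show ?thesis using that by linarith
  qed
  then show ?thesis by (auto simp: eventually_sequentially)
qed

lemma eventually_affine_pos:
  assumes "~ lneg (q, p)"
  shows "\<forall>\<^sub>F j in sequentially. p + int j * q >= 0"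
proof -
  have "~ lpos (-q, -p)" using assms by (auto simp: lpos_def lneg_def)
  from eventually_affine_neg[OF this] show ?thesis by eventually_elim simp
qed

definition lmerge :: "letter => letter => letter" where
  "lmerge a b = (fst a + fst b, snd a + snd b)"

abbreviation lvs :: "letter => letter => real mfps" where
  "lvs a b \<equiv> vs (mconst (of_int (snd (fst a))) * snd b - mconst (of_int (snd (fst b))) * snd a)"

lemma Gv_swap_time:
  assumes "vfree (snd a)" "vfree (snd b)"
  shows "\<forall>\<^sub>F j in sequentially.
     Gv (map (at_time j) (w1 @ b # a # w2)) +
     vs (mconst (of_int (snd (fst a) + int j * fst (fst a))) * snd b - mconst (of_int (snd (fst b) + int j * fst (fst b))) * snd a)
       * Gv (map (at_time j) (w1 @ lmerge a b # w2)) +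
     (if fst a + fst b = 0 then rat (snd (fst a) + int j * fst (fst a)) (snd a + snd b) else 0) * Gv (map (at_time j) (w1 @ w2)) =
     Gv (map (at_time j) (w1 @ a # b # w2))"
proof -
  obtain q p u q' p' v where ab: "a = ((q, p), u)" "b = ((q', p'), v)" by (metis surj_pair)
  \<comment> \<open>Two energies that are affine in \<open>j\<close> cancel for infinitely many
    \<open>j\<close> only if they cancel identically. So for large \<open>j\<close> the presence of
    the central term is decided by the pairs of direction and point alone.\<close>
  have ev: "\<forall>\<^sub>F j in sequentially. ((p + int j * q) + (p' + int j * q') = 0) = (q + q' = 0 & p + p' = 0)"
  proof (cases "q + q' = 0")
    case True
    then have q': "q' = - q" by simp
    show ?thesis by (simp add: q')
  next
    case False
    have "(p + int j * q) + (p' + int j * q') ~= 0" if j: "j >= Suc (nat \<bar>p + p'\<bar>)" for j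
    proof
      assume "(p + int j * q) + (p' + int j * q') = 0"
      then have "int j * (q + q') = - (p + p')" by (simp add: algebra_simps)
      then have "int j * \<bar>q + q'\<bar> = \<bar>p + p'\<bar>" by (metis abs_minus_cancel abs_mult abs_of_nat)
      moreover have "int j * \<bar>q + q'\<bar> >= int j * 1" using False by (intro mult_left_mono) auto
      ultimately show False using j by linarith
    qed
    then show ?thesis using False by (auto simp: eventually_sequentially)
  qed
  show ?thesis
    using ev
  proof eventually_elim
    case (elim j)
    have at: "at_time j a = (p + int j * q, u)" "at_time j b = (p' + int j * q', v)"
      "at_time j (lmerge a b) = ((p + int j * q) + (p' + int j * q'), u + v)"
      by (simp_all add: ab at_time_def lmerge_def algebra_simps)
    have z: "(fst a + fst b = 0) = (q + q' = 0 & p + p' = 0)"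
      by (simp add: ab zero_prod_def)
    have ps: "snd (fst a) = p" "fst (fst a) = q" "snd a = u" "snd (fst b) = p'" "fst (fst b) = q'" "snd b = v"
      by (simp_all add: ab)
    have vf: "vfree u" "vfree v" using assms by (simp_all add: ab)
    show ?case
      unfolding map_append list.map at ps z elim[symmetric]
      using Gv_swap[OF vf, of "map (at_time j) w1" "p + int j * q" "p' + int j * q'" "map (at_time j) w2"]
      by simp
  qed
qed

lemma mpoly_swap:
  assumes "vfree (snd a)" "vfree (snd b)"
    and "mpoly (%j. Gv (map (at_time j) (w1 @ b # a # w2))) x"
    and "mpoly (%j. Gv (map (at_time j) (w1 @ lmerge a b # w2))) y"
    and "mpoly (%j. Gv (map (at_time j) (w1 @ w2))) z"
  shows "mpoly (%j. Gv (map (at_time j) (w1 @ a # b # w2)))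
    (x + lvs a b * y + (if fst a + fst b = 0 then rat (snd (fst a)) (snd a + snd b) else 0) * z)"
proof (rule mpoly_cong[OF _ Gv_swap_time[OF assms(1,2)]])
  have 1: "mpoly (%j. mconst (of_int (p + int j * q)) * u - mconst (of_int (p' + int j * q')) * v)
      (mconst (of_int p) * u - mconst (of_int p') * v)" for p q p' q' u v
    by (intro mpoly_diff mpoly_mult mpoly_mconst evpoly_affine mpoly_const)
  have 2: "mpoly (%j. if fst a + fst b = 0 then rat (snd (fst a) + int j * fst (fst a)) (snd a + snd b) else 0)
     (if fst a + fst b = 0 then rat (snd (fst a)) (snd a + snd b) else 0)"
    by (cases "fst a + fst b = 0") (simp_all add: mpoly_rat mpoly_const)
  show "mpoly (%j. Gv (map (at_time j) (w1 @ b # a # w2)) +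
     vs (mconst (of_int (snd (fst a) + int j * fst (fst a))) * snd b - mconst (of_int (snd (fst b) + int j * fst (fst b))) * snd a)
       * Gv (map (at_time j) (w1 @ lmerge a b # w2)) +
     (if fst a + fst b = 0 then rat (snd (fst a) + int j * fst (fst a)) (snd a + snd b) else 0) * Gv (map (at_time j) (w1 @ w2)))
     (x + lvs a b * y + (if fst a + fst b = 0 then rat (snd (fst a)) (snd a + snd b) else 0) * z)"
    unfolding vs_def
    by (intro mpoly_add mpoly_mult assms(3-5) 2 mpoly_msubst 1)
qed

lemma mpoly_last:
  assumes "~ lneg (fst a)" shows "mpoly (%j. Gv (map (at_time j) (w @ [a]))) 0"
proof (rule mpoly_cong[OF mpoly_const])
  have "\<forall>\<^sub>F j in sequentially. snd (fst a) + int j * fst (fst a) >= 0"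
    using eventually_affine_pos[of "fst (fst a)" "snd (fst a)"] assms by simp
  then show "\<forall>\<^sub>F j in sequentially. 0 = Gv (map (at_time j) (w @ [a]))"
    by eventually_elim (simp add: at_time_def case_prod_unfold Gv_last)
qed

lemma mpoly_first:
  assumes "~ lpos (fst a)" shows "mpoly (%j. Gv (map (at_time j) (a # w))) 0"
proof (rule mpoly_cong[OF mpoly_const])
  have "\<forall>\<^sub>F j in sequentially. snd (fst a) + int j * fst (fst a) <= 0"
    using eventually_affine_neg[of "fst (fst a)" "snd (fst a)"] assms by simp
  then show "\<forall>\<^sub>F j in sequentially. 0 = Gv (map (at_time j) (a # w))"
    by eventually_elim (simp add: at_time_def case_prod_unfold Gv_first)
qed

abbreviation vfrees :: "letter list => bool" where "vfrees w \<equiv> \<forall>a\<in>set w. vfree (snd a)"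

lemma lpos_lneg: "lpos e ==> ~ lneg e" by (auto simp: lpos_def lneg_def split: prod.splits)

lemma Rv_mpoly: "vfrees w ==> mpoly (%j. Gv (map (at_time j) w)) (Rv w)"
proof -
  have "vfrees w --> (\<exists>v. mpoly (%j. Gv (map (at_time j) w)) v)"
  proof (induction w rule: word_induct[where pos = "%a. lpos (fst a)" and mg = lmerge])
    case Nil
    show ?case by (auto intro: mpoly_const)
  next
    case (first a w)
    then show ?case using mpoly_first by blast
  next
    case (last a w)
    then show ?case using mpoly_last lpos_lneg by blast
  next
    case (swap w1 a b w2)
    show ?case
    proof
      assume v: "vfrees (w1 @ a # b # w2)"
      then obtain x y z where
        "mpoly (%j. Gv (map (at_time j) (w1 @ b # a # w2))) x"
        "mpoly (%j. Gv (map (at_time j) (w1 @ lmerge a b # w2))) y"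
        "mpoly (%j. Gv (map (at_time j) (w1 @ w2))) z"
        using swap by (auto simp: lmerge_def)
      then show "\<exists>v. mpoly (%j. Gv (map (at_time j) (w1 @ a # b # w2))) v"
        using mpoly_swap[of a b w1 w2 x y z] v by auto
    qed
  qed
  then show "vfrees w ==> mpoly (%j. Gv (map (at_time j) w)) (Rv w)"
    unfolding Rv_def by (metis someI_ex)
qed

lemma Rv_eqI: "vfrees w ==> mpoly (%j. Gv (map (at_time j) w)) v ==> Rv w = v"
  using Rv_mpoly mpoly_unique by blast

text \<open>The coefficients are those at time 0 and involve only the point, whereas
  \<open>Rv_first\<close> and \<open>Rv_last\<close> are decided by the direction in the first
  place. Two directions over one point thus share the exchange rule up to central terms, and differ
  in the words on which they vanish.\<close>

theorem Rv_swap: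
  assumes "vfrees (w1 @ a # b # w2)"
  shows "Rv (w1 @ a # b # w2) = Rv (w1 @ b # a # w2) + lvs a b * Rv (w1 @ lmerge a b # w2) +
    (if fst a + fst b = 0 then rat (snd (fst a)) (snd a + snd b) else 0) * Rv (w1 @ w2)"
proof (rule Rv_eqI[OF assms])
  show "mpoly (%j. Gv (map (at_time j) (w1 @ a # b # w2))) (Rv (w1 @ b # a # w2) + lvs a b * Rv (w1 @ lmerge a b # w2) +
    (if fst a + fst b = 0 then rat (snd (fst a)) (snd a + snd b) else 0) * Rv (w1 @ w2))"
    by (rule mpoly_swap; (rule Rv_mpoly)?) (use assms in \<open>auto simp: lmerge_def\<close>)
qed

lemma Rv_last: "vfrees (w @ [a]) ==> ~ lneg (fst a) ==> Rv (w @ [a]) = 0"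
  using Rv_eqI mpoly_last by blast

lemma Rv_first: "vfrees (a # w) ==> ~ lpos (fst a) ==> Rv (a # w) = 0"
  using Rv_eqI mpoly_first by blast

lemma Rv_Nil: "Rv [] = 1"
  by (rule Rv_eqI) (auto simp: Gv_Nil mpoly_const)

lemma Rv_static: "vfrees w ==> \<forall>a\<in>set w. fst (fst a) = 0 ==> Rv w = Gv (map (%a. (snd (fst a), snd a)) w)"
proof (rule Rv_eqI)
  assume "\<forall>a\<in>set w. fst (fst a) = 0"
  then have "map (at_time j) w = map (%a. (snd (fst a), snd a)) w" for j
    by (auto simp: at_time_def case_prod_unfold)
  then have e: "(%j. Gv (map (at_time j) w)) = (%j. Gv (map (%a. (snd (fst a), snd a)) w))" by (simp only:)
  show "mpoly (%j. Gv (map (at_time j) w)) (Gv (map (%a. (snd (fst a), snd a)) w))"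
    unfolding e by (rule mpoly_const)
qed

section \<open>Monomials of series\<close>

definition mons :: "real mfps => ((nat \<Rightarrow>\<^sub>0 nat) => bool) => bool" where
  "mons f P \<longleftrightarrow> (\<forall>m. mcoeff f m ~= 0 --> P m)"

lemma mons_0 [simp]: "mons 0 P" by (simp add: mons_def)
lemma mons_add: "mons f P ==> mons g P ==> mons (f + g) P"
  unfolding mons_def mcoeff_add by (metis add.right_neutral)
lemma mons_diff: "mons f P ==> mons g P ==> mons (f - g) P"
  unfolding mons_def mcoeff_diff by (metis diff_self)
lemma mons_sum: "(\<And>x. x \<in> A ==> mons (f x) P) ==> mons (sum f A) P"
  by (induction A rule: infinite_finite_induct) (simp_all add: mons_add)
lemma mons_mono: "mons f P ==> (\<And>m. P m ==> Q m) ==> mons f Q"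
  by (auto simp: mons_def)
lemma mons_mult:
  assumes "mons f P" "mons g Q" "\<And>a b. P a ==> Q b ==> H (a + b)"
  shows "mons (f * g) H"
  unfolding mons_def
proof (intro allI impI)
  fix m assume "mcoeff (f * g) m ~= 0"
  then have "\<exists>x\<in>splits m. (case x of (a, b) => mcoeff f a * mcoeff g b) ~= 0"
    unfolding mcoeff_mult by (meson sum.neutral)
  then obtain a b where "a + b = m" "mcoeff f a * mcoeff g b ~= 0"
    by (auto simp: splits_def)
  then show "H m" using assms by (auto simp: mons_def)
qed

lemma mons_mconst_mult: "mons f P ==> mons (mconst c * f) P"
  by (simp add: mons_def)

definition homog :: "nat set => nat => (nat \<Rightarrow>\<^sub>0 nat) => bool" where
  "homog V d m \<longleftrightarrow> keys m \<subseteq> V & mdeg m = d"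

lemma homog_add: "homog V c a ==> homog V d b ==> homog V (c + d) (a + b)"
  using Poly_Mapping.keys_add[of a b] by (auto simp: homog_def mdeg_add)

lemma mons_power: "mons f (homog V 1) ==> mons (f ^ n) (homog V n)"
proof (induction n)
  case 0
  have "keys (0 :: nat \<Rightarrow>\<^sub>0 nat) = {}" by simp
  then show ?case by (auto simp: mons_def homog_def mcoeff_1 mdeg_def split: if_splits)
next
  case (Suc n)
  have "mons (f * f ^ n) (homog V (1 + n))"
    by (rule mons_mult[where P = "homog V 1" and Q = "homog V n"])
       (use Suc homog_add[of V "Suc 0" _ n] in auto)
  then show ?case by simp
qed

lemma mons_msubst:
  assumes "mons u (homog V 1)"
  shows "mons (msubst F u) (%m. keys m \<subseteq> V & fps_nth F (mdeg m) ~= 0)"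
  unfolding mons_def msubst_def mcoeff_Abs
proof (intro allI impI)
  fix m assume "(\<Sum>n\<le>mdeg m. fps_nth F n * mcoeff (u ^ n) m) ~= 0"
  then obtain n where "fps_nth F n * mcoeff (u ^ n) m ~= 0" by (meson sum.neutral)
  then have "fps_nth F n ~= 0" "mcoeff (u ^ n) m ~= 0" by auto
  then show "keys m \<subseteq> V & fps_nth F (mdeg m) ~= 0"
    using mons_power[OF assms, of n] by (auto simp: mons_def homog_def)
qed

lemma fps_nth_varsigma_even: "even n ==> fps_nth (varsigma c) n = 0"
  by (simp add: fps_nth_varsigma)

lemma fps_nth_quotient:
  assumes "a >= 0"
  shows "fps_nth (varsigma (of_int a) / varsigma 1) n =
    (\<Sum>l\<in>{-a..<0}. (of_int l + 1/2 + of_int a / 2) ^ n / fact n)"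
  unfolding varsigma_quotient[OF assms] by (simp add: fps_sum_nth)

text \<open>The reflection of the index about the centre of the range negates the base of each odd
  power, so the sum equals its own negative.\<close>

lemma fps_nth_quotient_odd_nonneg:
  assumes "a >= 0" "odd n"
  shows "fps_nth (varsigma (of_int a) / varsigma 1) n = 0"
proof -
  let ?f = "%l::int. (of_int l + 1/2 + of_int a / 2) ^ n / fact n :: real"
  have "(\<Sum>l\<in>{-a..<0}. ?f l) = (\<Sum>l\<in>{-a..<0}. - ?f l)"
  proof (rule sum.reindex_bij_witness[where i = "%l. - a - 1 - l" and j = "%l. - a - 1 - l"])
    fix l
    have "of_int (- a - 1 - l) + 1/2 + of_int a / 2 = - (of_int l + 1/2 + of_int a / 2 :: real)" by simp
    then have "(of_int (- a - 1 - l) + 1/2 + of_int a / 2) ^ n = - ((of_int l + 1/2 + of_int a / 2) ^ n :: real)"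
      using power_minus_odd[OF assms(2), of "of_int l + 1/2 + of_int a / 2 :: real"] by (simp only:)
    then show "- ?f (- a - 1 - l) = ?f l" by simp
  qed auto
  then show ?thesis using assms(1) by (simp add: fps_nth_quotient sum_negf)
qed

lemma fps_nth_quotient_odd:
  assumes "odd n"
  shows "fps_nth (varsigma (of_int a) / varsigma 1) n = 0"
proof (cases "a >= 0")
  case False
  have "varsigma (of_int a) / varsigma 1 = - (varsigma (of_int (- a)) / varsigma 1)"
    by (simp add: varsigma_neg fps_divide_uminus)
  then show ?thesis using fps_nth_quotient_odd_nonneg[of "- a" n] False assms by simp
qed (simp add: fps_nth_quotient_odd_nonneg assms)

lemma mons_vs: "mons u (homog V 1) ==> mons (vs u) (%m. keys m \<subseteq> V & odd (mdeg m))"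
  unfolding vs_def by (rule mons_mono[OF mons_msubst]) (auto intro: fps_nth_varsigma_even)

lemma mons_rat: "mons u (homog V 1) ==> mons (rat a u) (%m. keys m \<subseteq> V & even (mdeg m))"
  unfolding rat_def by (rule mons_mono[OF mons_msubst]) (auto intro: fps_nth_quotient_odd)

definition zvar :: "nat option => real mfps" where
  "zvar o' = (case o' of None => 0 | Some v => mvar v)"

lemma keys_single_one: "keys (Poly_Mapping.single v (1::nat)) = {v}" by simp

lemma single_nonzero: "Poly_Mapping.single v (Suc 0) ~= 0"
  using keys_single_one[of v] by (metis One_nat_def insert_not_empty keys_zero)

lemma vfree_zvar [simp]: "vfree (zvar o')"
  by (auto simp: zvar_def mvar_def single_nonzero split: option.splits)

lemma vfree_sum: "(\<And>i. i \<in> T ==> vfree (f i)) ==> vfree (sum f T)"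
  by (simp add: mcoeff_sum)

definition wt :: "('i => nat option) => (nat \<Rightarrow>\<^sub>0 nat) => 'i => nat" where
  "wt z m i = (case z i of None => 0 | Some v => lookup m v)"

lemma wt_add: "wt z (a + b) i = wt z a i + wt z b i"
  by (simp add: wt_def lookup_add split: option.splits)

section \<open>Words whose letters are sets of indices\<close>

text \<open>Merging adds energies and arguments. Hence every letter met while a word of single
  operators is expanded belongs to a set of the original letters, and this set determines its
  direction, its energy and its variables.\<close>

definition slet :: "('i => int) => ('i => int) => ('i => nat option) => 'i set => letter" where
  "slet q p z T = ((sum q T, sum p T), \<Sum>i\<in>T. zvar (z i))"

definition Rw :: "('i => int) => ('i => int) => ('i => nat option) => 'i set list => real mfps" where
  "Rw q p z w = Rv (map (slet q p z) w)"

fun dword :: "'i set list => bool" where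
  "dword [] = True"
| "dword (T # w) = (finite T & T ~= {} & T \<inter> \<Union>(set w) = {} & dword w)"

lemma dword_append: "dword (w1 @ w2) \<longleftrightarrow> dword w1 & dword w2 & \<Union>(set w1) \<inter> \<Union>(set w2) = {}"
  by (induction w1) auto

lemma dword_swap: "dword (w1 @ S # T # w2) ==> dword (w1 @ T # S # w2)"
  and dword_merge: "dword (w1 @ S # T # w2) ==> dword (w1 @ (S \<union> T) # w2)"
  and dword_drop: "dword (w1 @ S # T # w2) ==> dword (w1 @ w2)"
  by (auto simp: dword_append)

lemma dword_finite_Union: "dword w ==> finite (\<Union>(set w))" by (induction w) auto

lemma dword_sum: "dword w ==> sum f (\<Union>(set w)) = (\<Sum>T\<leftarrow>w. sum f T)" for f :: "'i => int"
  by (induction w) (auto simp: sum.union_disjoint dword_finite_Union)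

definition cvs :: "('i => int) => ('i => nat option) => 'i set => 'i set => real mfps" where
  "cvs p z S T = lvs (slet p p z S) (slet p p z T)"

definition crat :: "('i => int) => ('i => nat option) => 'i set => 'i set => real mfps" where
  "crat p z S T = rat (sum p S) (\<Sum>i\<in>S \<union> T. zvar (z i))"

definition null :: "('i => int) => ('i => int) => 'i set => bool" where
  "null q p T \<longleftrightarrow> sum q T = 0 & sum p T = 0"

abbreviation spos :: "('i => int) => ('i => int) => 'i set => bool" where
  "spos q p T \<equiv> lpos (sum q T, sum p T)"
abbreviation sneg :: "('i => int) => ('i => int) => 'i set => bool" where
  "sneg q p T \<equiv> lneg (sum q T, sum p T)"

lemma vfree_slet: "vfree (snd (slet q p z T))" by (simp add: slet_def vfree_sum)

lemma slet_merge:
  assumes "finite S" "finite T" "S \<inter> T = {}"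
  shows "lmerge (slet q p z S) (slet q p z T) = slet q p z (S \<union> T)"
  using assms by (simp add: lmerge_def slet_def sum.union_disjoint)

lemma Rv_slet_swap:
  assumes f: "finite S" "finite T" "S \<inter> T = {}" and v: "vfrees u1" "vfrees u2"
  shows "Rv (u1 @ slet q p z S # slet q p z T # u2) = Rv (u1 @ slet q p z T # slet q p z S # u2) +
    cvs p z S T * Rv (u1 @ slet q p z (S \<union> T) # u2) +
    (if null q p (S \<union> T) then crat p z S T else 0) * Rv (u1 @ u2)"
proof -
  have e1: "(fst (slet q p z S) + fst (slet q p z T) = 0) = null q p (S \<union> T)"
    using f by (simp add: slet_def null_def zero_prod_def sum.union_disjoint)
  have e2: "snd (slet q p z S) + snd (slet q p z T) = (\<Sum>i\<in>S \<union> T. zvar (z i))"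
    using f by (simp add: slet_def sum.union_disjoint)
  have e3: "vs (mconst (of_int (sum p S)) * snd (slet q p z T) - mconst (of_int (sum p T)) * snd (slet q p z S)) = cvs p z S T"
    by (simp add: cvs_def slet_def)
  have e4: "snd (fst (slet q p z T)) = sum p T" for T by (simp add: slet_def)
  have vf: "vfrees (u1 @ slet q p z S # slet q p z T # u2)"
    using v by (auto simp: vfree_slet)
  show ?thesis
    unfolding crat_def
    by (subst Rv_swap[OF vf]) (simp only: slet_merge[OF f] e1 e2 e3 e4)
qed

theorem Rw_swap:
  assumes "dword (w1 @ S # T # w2)"
  shows "Rw q p z (w1 @ S # T # w2) = Rw q p z (w1 @ T # S # w2) + cvs p z S T * Rw q p z (w1 @ (S \<union> T) # w2) +
    (if null q p (S \<union> T) then crat p z S T else 0) * Rw q p z (w1 @ w2)"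
proof -
  have f: "finite S" "finite T" "S \<inter> T = {}" using assms by (auto simp: dword_append)
  show ?thesis unfolding Rw_def map_append list.map
    by (rule Rv_slet_swap[OF f]) (auto simp: vfree_slet)
qed

lemma Rw_last: "~ sneg q p T ==> Rw q p z (w @ [T]) = 0"
  unfolding Rw_def map_append list.map by (rule Rv_last) (auto simp: vfree_slet, simp add: slet_def)

lemma Rw_first: "~ spos q p T ==> Rw q p z (T # w) = 0"
  unfolding Rw_def list.map by (rule Rv_first) (auto simp: vfree_slet, simp add: slet_def)

lemma Rw_Nil: "Rw q p z [] = 1" by (simp add: Rw_def Rv_Nil)

definition vars :: "('i => nat option) => 'i set => nat set" where
  "vars z T = {v. \<exists>i\<in>T. z i = Some v}"

lemma mons_zvar: "i \<in> T ==> mons (zvar (z i)) (homog (vars z T) 1)"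
  by (auto simp: zvar_def mons_def mvar_def homog_def vars_def mdeg_def split: option.splits if_splits)

lemma mons_zsum: "S \<subseteq> T ==> mons (\<Sum>i\<in>S. zvar (z i)) (homog (vars z T) 1)"
  by (rule mons_sum, rule mons_zvar) auto

lemma mons_cvs: "mons (cvs p z S T) (%m. keys m \<subseteq> vars z (S \<union> T) & odd (mdeg m))"
  unfolding cvs_def slet_def fst_conv snd_conv
  by (intro mons_vs mons_diff mons_mconst_mult mons_zsum) auto

lemma mons_crat: "mons (crat p z S T) (%m. keys m \<subseteq> vars z (S \<union> T) & even (mdeg m))"
  unfolding crat_def by (intro mons_rat mons_zsum) auto

section \<open>Propagation along adjacent transpositions\<close>

text \<open>An exchange changes \<open>D\<close> by a multiple of its value on a shorter word and by
  a term supported in \<open>ok\<close>. By induction on the length it is enough to find, for each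
  word, one letter and one end of the word such that the claim holds once the letter stands there.
  The coefficient \<open>cvs\<close> contributes monomials of odd degree in the variables of the two
  letters, and \<open>ok_merge\<close> has to absorb them.\<close>

lemma swap_closed:
  assumes good_swap: "\<And>w1 S T w2. good (w1 @ S # T # w2) ==> good (w1 @ T # S # w2)"
    and good_merge: "\<And>w1 S T w2. good (w1 @ S # T # w2) ==> good (w1 @ (S \<union> T) # w2)"
    and ok_swap: "\<And>w1 S T w2 m. good (w1 @ S # T # w2) ==> ok (w1 @ T # S # w2) m ==> ok (w1 @ S # T # w2) m"
    and ok_merge: "\<And>w1 S T w2 m m'. good (w1 @ S # T # w2) ==> ok (w1 @ (S \<union> T) # w2) m ==>
        keys m' \<subseteq> vars z (S \<union> T) ==> odd (mdeg m') ==> ok (w1 @ S # T # w2) (m' + m)"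
    and D_swap: "\<And>w1 S T w2. good (w1 @ S # T # w2) ==>
        (\<And>w. length w < length (w1 @ S # T # w2) ==> good w ==> mons (D w) (ok w)) ==>
        mons (D (w1 @ S # T # w2) - D (w1 @ T # S # w2) - cvs p z S T * D (w1 @ (S \<union> T) # w2)) (ok (w1 @ S # T # w2))"
    and base: "\<And>w. good w ==> mons (D w) (ok w) \<or>
        (\<exists>w1 T w2. w = w1 @ T # w2 \<and>
          (mons (D (w1 @ w2 @ [T])) (ok (w1 @ w2 @ [T])) | mons (D (T # w1 @ w2)) (ok (T # w1 @ w2))))"
    and "good w"
  shows "mons (D w) (ok w)"
  using \<open>good w\<close>
proof (induction "length w" arbitrary: w rule: less_induct)
  case less
  have step: "mons (D (w1 @ S # T # w2)) (ok (w1 @ S # T # w2))"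
    if g: "good (w1 @ S # T # w2)" and len: "length (w1 @ S # T # w2) = length w"
      and m: "mons (D (w1 @ T # S # w2)) (ok (w1 @ T # S # w2))" for w1 S T w2
  proof -
    have "mons (D (w1 @ (S \<union> T) # w2)) (ok (w1 @ (S \<union> T) # w2))"
      by (rule less.hyps) (use len good_merge[OF g] in auto)
    from mons_mult[OF mons_cvs this] have 1: "mons (cvs p z S T * D (w1 @ (S \<union> T) # w2)) (ok (w1 @ S # T # w2))"
      using ok_merge[OF g] by blast
    have 2: "mons (D (w1 @ T # S # w2)) (ok (w1 @ S # T # w2))"
      using mons_mono[OF m] ok_swap[OF g] by blast
    have "mons (D (w1 @ S # T # w2) - D (w1 @ T # S # w2) - cvs p z S T * D (w1 @ (S \<union> T) # w2)) (ok (w1 @ S # T # w2))"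
      by (rule D_swap[OF g]) (use less.hyps len in auto)
    from mons_add[OF mons_add[OF this 2] 1] show ?thesis by simp
  qed
  have to_last: "mons (D (w1 @ T # w2)) (ok (w1 @ T # w2))"
    if "good (w1 @ T # w2)" "length (w1 @ T # w2) = length w" "mons (D (w1 @ w2 @ [T])) (ok (w1 @ w2 @ [T]))" for w1 T w2
    using that
  proof (induction w2 arbitrary: w1)
    case (Cons S w2)
    have "mons (D ((w1 @ [S]) @ T # w2)) (ok ((w1 @ [S]) @ T # w2))"
      by (rule Cons.IH) (use Cons.prems good_swap[of w1 T S w2] in auto)
    then show ?case using step[of w1 T S w2] Cons.prems by simp
  qed simp
  have to_first: "mons (D (w1 @ T # w2)) (ok (w1 @ T # w2))"
    if "good (w1 @ T # w2)" "length (w1 @ T # w2) = length w" "mons (D (T # w1 @ w2)) (ok (T # w1 @ w2))" for w1 T w2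
    using that
  proof (induction w1 arbitrary: w2 rule: rev_induct)
    case (snoc S w1)
    have "mons (D (w1 @ T # (S # w2))) (ok (w1 @ T # (S # w2)))"
      by (rule snoc.IH) (use snoc.prems good_swap[of w1 S T w2] in auto)
    then show ?case using step[of w1 S T w2] snoc.prems by simp
  qed simp
  from base[OF less.prems] show ?case
    using to_last to_first less.prems by auto
qed

definition total0 :: "('i => int) => 'i set list => bool" where
  "total0 f w \<longleftrightarrow> sum f (\<Union>(set w)) = 0"

lemma total0_swap: "total0 f (w1 @ S # T # w2) ==> total0 f (w1 @ T # S # w2)"
  by (simp add: total0_def Un_ac)
lemma total0_merge: "total0 f (w1 @ S # T # w2) ==> total0 f (w1 @ (S \<union> T) # w2)"
  by (simp add: total0_def Un_ac)

lemma sum_list_lneg: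
  assumes "w ~= []" "\<And>T. T \<in> set w ==> lneg (f T, g T)"
  shows "lneg (\<Sum>T\<leftarrow>w. f T, \<Sum>T\<leftarrow>w. g T)"
  using assms
proof (induction w rule: list_nonempty_induct)
  case (cons T w)
  then have "lneg (f T, g T)" "lneg (\<Sum>T\<leftarrow>w. f T, \<Sum>T\<leftarrow>w. g T)" by auto
  then show ?case by (auto simp: lneg_def)
qed simp

lemma exists_nonneg_letter:
  assumes "dword w" "w ~= []" "total0 q w" "total0 p w"
  shows "\<exists>T\<in>set w. ~ sneg q p T"
proof (rule ccontr)
  assume "~ ?thesis"
  then have "lneg (\<Sum>T\<leftarrow>w. sum q T, \<Sum>T\<leftarrow>w. sum p T)"
    using sum_list_lneg[of w "sum q" "sum p"] assms(2) by blast
  then show False using assms by (simp add: total0_def dword_sum[symmetric] lneg_def)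
qed

lemma total0_drop:
  assumes "dword (w1 @ S # T # w2)" "total0 f (w1 @ S # T # w2)" "sum f (S \<union> T) = 0"
  shows "total0 f (w1 @ w2)"
proof -
  have d: "dword (w1 @ w2)" "dword (w1 @ (S \<union> T) # w2)" using assms(1) dword_drop dword_merge by blast+
  have "total0 f (w1 @ (S \<union> T) # w2)" using assms(2) by (rule total0_merge)
  then show ?thesis using assms(3) unfolding total0_def dword_sum[OF d(1)] dword_sum[OF d(2)] by simp
qed

text \<open>A merger removes one letter and contributes an odd degree, a central term removes two
  letters and contributes an even degree, and the empty word gives 1.\<close>

theorem Rw_parity:
  assumes "dword w" "total0 q w" "total0 p w"
  shows "mons (Rw q p z w) (%m. even (mdeg m) = even (length w))"
proof (rule swap_closed[where good = "%w. dword w & total0 q w & total0 p w" and p = p and z = z])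
  fix w1 S T w2 assume g: "dword (w1 @ S # T # w2) & total0 q (w1 @ S # T # w2) & total0 p (w1 @ S # T # w2)"
    and IH: "\<And>w. length w < length (w1 @ S # T # w2) ==> dword w & total0 q w & total0 p w ==>
       mons (Rw q p z w) (%m. even (mdeg m) = even (length w))"
  have "mons ((if null q p (S \<union> T) then crat p z S T else 0) * Rw q p z (w1 @ w2))
     (%m. even (mdeg m) = even (length (w1 @ S # T # w2)))"
  proof (cases "null q p (S \<union> T)")
    case True
    then have "mons (Rw q p z (w1 @ w2)) (%m. even (mdeg m) = even (length (w1 @ w2)))"
      using g by (intro IH) (auto simp: null_def intro: total0_drop dword_drop)
    from mons_mult[OF mons_crat[of p z S T] this] show ?thesis using True by (simp add: mdeg_add)
  qed simp
  then show "mons (Rw q p z (w1 @ S # T # w2) - Rw q p z (w1 @ T # S # w2) - cvs p z S T * Rw q p z (w1 @ (S \<union> T) # w2))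
     (%m. even (mdeg m) = even (length (w1 @ S # T # w2)))"
    using g by (simp only: Rw_swap) simp
next
  fix w :: "'a set list" assume g: "dword w & total0 q w & total0 p w"
  show "mons (Rw q p z w) (%m. even (mdeg m) = even (length w)) \<or>
        (\<exists>w1 T w2. w = w1 @ T # w2 \<and>
          (mons (Rw q p z (w1 @ w2 @ [T])) (%m. even (mdeg m) = even (length (w1 @ w2 @ [T]))) \<or>
           mons (Rw q p z (T # w1 @ w2)) (%m. even (mdeg m) = even (length (T # w1 @ w2)))))"
  proof (cases "w = []")
    case True
    then show ?thesis by (auto simp: Rw_Nil mons_def mcoeff_1 mdeg_def split: if_splits)
  next
    case False
    then obtain T where "T \<in> set w" "~ sneg q p T" using exists_nonneg_letter g by blast
    then show ?thesis by (metis Rw_last append_assoc mons_0 split_list)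
  qed
qed (use assms in \<open>auto intro: dword_swap dword_merge total0_swap total0_merge simp: mdeg_add\<close>)

section \<open>Degree bounds\<close>

text \<open>A labelling \<open>\<beta>\<close> splits a word into blocks. A block with \<open>n\<close> letters needs at least \<open>n - 2\<close>
  commutators to be contracted, each of which contributes a positive degree in the variables of the block.\<close>

definition lab_ok :: "('i => int) => ('i => nat option) => 'i set list => ('i => nat) => (nat \<Rightarrow>\<^sub>0 nat) => bool" where
  "lab_ok r z w \<beta> m \<longleftrightarrow> (\<forall>T\<in>set w. \<forall>i\<in>T. \<forall>j\<in>T. \<beta> i = \<beta> j) \<and>
     (\<forall>n. sum r {i \<in> \<Union>(set w). \<beta> i = n} = 0) \<and>
     (\<forall>n. length (filter (%T. \<exists>i\<in>T. \<beta> i = n) w) <= (\<Sum>i\<in>{i \<in> \<Union>(set w). \<beta> i = n}. wt z m i) + 2)"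

lemma lab_okI:
  assumes "\<And>T i j. T \<in> set w ==> i \<in> T ==> j \<in> T ==> \<beta> i = \<beta> j"
    and "\<And>n. sum r {i \<in> \<Union>(set w). \<beta> i = n} = 0"
    and "\<And>n. length (filter (%T. \<exists>i\<in>T. \<beta> i = n) w) <= (\<Sum>i\<in>{i \<in> \<Union>(set w). \<beta> i = n}. wt z m i) + 2"
  shows "lab_ok r z w \<beta> m"
  unfolding lab_ok_def using assms by (intro conjI ballI allI) assumption+

lemma lab_okD:
  assumes "lab_ok r z w \<beta> m"
  shows "T \<in> set w ==> i \<in> T ==> j \<in> T ==> \<beta> i = \<beta> j"
    and "sum r {i \<in> \<Union>(set w). \<beta> i = n} = 0"
    and "length (filter (%T. \<exists>i\<in>T. \<beta> i = n) w) <= (\<Sum>i\<in>{i \<in> \<Union>(set w). \<beta> i = n}. wt z m i) + 2"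
proof -
  note d = assms[unfolded lab_ok_def]
  show "T \<in> set w ==> i \<in> T ==> j \<in> T ==> \<beta> i = \<beta> j" using d[THEN conjunct1] by blast
  show "sum r {i \<in> \<Union>(set w). \<beta> i = n} = 0" by (rule d[THEN conjunct2, THEN conjunct1, rule_format])
  show "length (filter (%T. \<exists>i\<in>T. \<beta> i = n) w) <= (\<Sum>i\<in>{i \<in> \<Union>(set w). \<beta> i = n}. wt z m i) + 2"
    by (rule d[THEN conjunct2, THEN conjunct2, rule_format])
qed

lemma lab_ok_perm: "mset w = mset w' ==> lab_ok r z w \<beta> m = lab_ok r z w' \<beta> m"
proof -
  assume e: "mset w = mset w'"
  have "length (filter P w) = length (filter P w')" for P
    using e by (metis mset_filter size_mset)
  then show ?thesis using mset_eq_setD[OF e] by (simp add: lab_ok_def)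
qed

lemma sum_wt_pos:
  assumes "finite A" "keys m \<subseteq> vars z T" "odd (mdeg m)" "T \<subseteq> A"
  shows "(\<Sum>i\<in>A. wt z m i) >= 1"
proof -
  have "mdeg m ~= 0" using assms(3) by (metis even_zero)
  then obtain v where v: "v \<in> keys m" by (auto simp: mdeg_def)
  then obtain i where i: "i \<in> T" "z i = Some v" using assms(2) by (auto simp: vars_def)
  have "1 <= wt z m i" using v i by (simp add: wt_def in_keys_iff)
  also have "... <= (\<Sum>i\<in>A. wt z m i)" by (rule member_le_sum) (use i assms in auto)
  finally show ?thesis .
qed

text \<open>The coefficient of a merger has odd, hence positive, degree in the variables of the
  merged letter. This pays for the one letter by which the count of its block grows.\<close>

lemma lab_ok_merge:
  assumes d: "dword (w1 @ S # T # w2)" and l: "lab_ok r z (w1 @ (S \<union> T) # w2) \<beta> m"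
    and m': "keys m' \<subseteq> vars z (S \<union> T)" "odd (mdeg m')"
  shows "lab_ok r z (w1 @ S # T # w2) \<beta> (m' + m)"
proof -
  have U: "\<Union>(set (w1 @ S # T # w2)) = \<Union>(set (w1 @ (S \<union> T) # w2))" by auto
  have fin: "finite (\<Union>(set (w1 @ (S \<union> T) # w2)))" using dword_finite_Union[OF d] unfolding U .
  have "length (filter (%T. \<exists>i\<in>T. \<beta> i = n) (w1 @ S # T # w2)) \<le>
      (\<Sum>i\<in>{i \<in> \<Union>(set (w1 @ S # T # w2)). \<beta> i = n}. wt z (m' + m) i) + 2" for n
  proof -
    let ?A = "{i \<in> \<Union>(set (w1 @ (S \<union> T) # w2)). \<beta> i = n}"
    let ?P = "%T. \<exists>i\<in>T. \<beta> i = n"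
    have 1: "length (filter ?P (w1 @ (S \<union> T) # w2)) <= (\<Sum>i\<in>?A. wt z m i) + 2"
      by (rule lab_okD(3)[OF l])
    have 2: "(\<Sum>i\<in>?A. wt z (m' + m) i) = (\<Sum>i\<in>?A. wt z m' i) + (\<Sum>i\<in>?A. wt z m i)"
      by (simp add: wt_add sum.distrib)
    show ?thesis
    proof (cases "?P (S \<union> T)")
      case True
      then obtain k where k: "k \<in> S \<union> T" "\<beta> k = n" by blast
      have "\<beta> i = n" if "i \<in> S \<union> T" for i
        using lab_okD(1)[OF l, of "S \<union> T" i k] that k by simp
      then have "S \<union> T \<subseteq> ?A" by auto
      moreover have "finite ?A" by (rule finite_subset[OF _ fin]) auto
      ultimately have "(\<Sum>i\<in>?A. wt z m' i) >= 1" using sum_wt_pos[OF _ m'] by blast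
      moreover have "length (filter ?P (w1 @ S # T # w2)) <= length (filter ?P (w1 @ (S \<union> T) # w2)) + 1"
        using True by simp
      ultimately show ?thesis using 1 2 unfolding U by linarith
    next
      case False
      then have "~ ?P S" "~ ?P T" by blast+
      then have "length (filter ?P (w1 @ S # T # w2)) = length (filter ?P (w1 @ (S \<union> T) # w2))"
        using False by simp
      then show ?thesis using 1 2 unfolding U by linarith
    qed
  qed
  note count = this
  show ?thesis
  proof (rule lab_okI)
    fix V i j assume "V \<in> set (w1 @ S # T # w2)" "i \<in> V" "j \<in> V"
    then show "\<beta> i = \<beta> j" using lab_okD(1)[OF l, of "S \<union> T" i j] lab_okD(1)[OF l, of V i j] by auto
  next
    show "sum r {i \<in> \<Union>(set (w1 @ S # T # w2)). \<beta> i = n} = 0" for n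
      unfolding U by (rule lab_okD(2)[OF l])
  qed (rule count)
qed

text \<open>Letters that cancel against each other become a block of their own with label 0, and all
  other labels move up by one. The 2 in the bound of \<open>lab_ok\<close> stands for the two
  letters of a central term.\<close>

lemma lab_ok_block:
  assumes d: "dword (v @ w)" and l: "lab_ok r z w \<beta> m" and r: "sum r (\<Union>(set v)) = 0"
    and len: "length v <= 2"
  shows "lab_ok r z (v @ w) (%i. if i \<in> \<Union>(set v) then 0 else Suc (\<beta> i)) (m' + m)"
proof -
  let ?b = "%i. if i \<in> \<Union>(set v) then 0 else Suc (\<beta> i)"
  have dis: "\<Union>(set v) \<inter> \<Union>(set w) = {}" using d by (simp add: dword_append)
  have vset: "{i \<in> \<Union>(set (v @ w)). ?b i = 0} = \<Union>(set v)" by auto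
  have wset: "{i \<in> \<Union>(set (v @ w)). ?b i = Suc n} = {i \<in> \<Union>(set w). \<beta> i = n}" for n using dis by auto
  have "sum r {i \<in> \<Union>(set (v @ w)). ?b i = n} = 0" for n
    using r lab_okD(2)[OF l] wset vset by (cases n) (simp_all only:)
  moreover have "length (filter (%T. \<exists>i\<in>T. ?b i = n) (v @ w)) \<le>
      (\<Sum>i\<in>{i \<in> \<Union>(set (v @ w)). ?b i = n}. wt z (m' + m) i) + 2" for n
  proof (cases n)
    case 0
    have "filter (%T. \<exists>i\<in>T. ?b i = 0) w = []" using dis by (auto simp: filter_empty_conv)
    then have "length (filter (%T. \<exists>i\<in>T. ?b i = n) (v @ w)) <= length v" using 0 by simp
    then show ?thesis using len by linarith
  next
    case (Suc k)
    have "filter (%T. \<exists>i\<in>T. ?b i = n) v = []" using Suc by (auto simp: filter_empty_conv)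
    moreover have "filter (%T. \<exists>i\<in>T. ?b i = n) w = filter (%T. \<exists>i\<in>T. \<beta> i = k) w"
      using dis Suc by (intro filter_cong) auto
    moreover have "length (filter (%T. \<exists>i\<in>T. \<beta> i = k) w) <= (\<Sum>i\<in>{i \<in> \<Union>(set w). \<beta> i = k}. wt z m i) + 2"
      by (rule lab_okD(3)[OF l])
    ultimately show ?thesis unfolding Suc wset by (simp add: wt_add sum.distrib)
  qed
  moreover have "?b i = ?b j" if "T \<in> set (v @ w)" "i \<in> T" "j \<in> T" for T i j
    using lab_okD(1)[OF l, of T i j] dis that by auto
  ultimately show ?thesis by (intro lab_okI)
qed

lemma lab_ok_Nil: "lab_ok r z [] \<beta> m" by (simp add: lab_ok_def)

lemma lab_ok_null_letters:
  assumes "dword w" "\<forall>T\<in>set w. sum r T = 0"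
  shows "\<exists>\<beta>. lab_ok r z w \<beta> m"
  using assms
proof (induction w)
  case (Cons T w)
  then obtain \<beta> where "lab_ok r z w \<beta> m" by auto
  from lab_ok_block[of "[T]", OF _ this, of "0"] Cons.prems show ?case by auto
qed (auto simp: lab_ok_Nil)

text \<open>The labelling has to separate two indices. This singles out the contributions in which
  two directions can differ, see \<open>Rw_compare\<close>.\<close>

definition ok1 :: "('i => int) => ('i => nat option) => 'i set list => (nat \<Rightarrow>\<^sub>0 nat) => bool" where
  "ok1 r z w m \<longleftrightarrow> (\<exists>\<beta>. lab_ok r z w \<beta> m & (\<exists>i\<in>\<Union>(set w). \<exists>j\<in>\<Union>(set w). \<beta> i ~= \<beta> j))"

lemma ok1_perm: "mset w = mset w' ==> ok1 r z w m = ok1 r z w' m"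
  using mset_eq_setD[of w w'] lab_ok_perm[of w w' r z _ m] by (simp add: ok1_def)

lemma ok1_block:
  assumes d: "dword (v @ w)" and l: "lab_ok r z w \<beta> m" and r: "sum r (\<Union>(set v)) = 0"
    and len: "length v <= 2" and ne: "v ~= []" "w ~= []"
  shows "ok1 r z (v @ w) (m' + m)"
proof -
  obtain S v' T w' where vw: "v = S # v'" "w = T # w'" using ne by (metis list.exhaust)
  then obtain i j where "i \<in> S" "j \<in> T" using d by (auto simp: dword_append)
  moreover have "j \<notin> \<Union>(set v)" using d \<open>j \<in> T\<close> vw by (auto simp: dword_append)
  ultimately show ?thesis
    using lab_ok_block[OF d l r len, of m'] vw unfolding ok1_def by (intro exI conjI bexI[of _ i] bexI[of _ j]) auto
qed

text \<open>\<open>compat X z r q p\<close>: sending the energy of a letter to its sign at \<open>r\<close> is consistent with the vanishing rules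
  for the regularised expectation in direction \<open>q\<close> at \<open>p\<close>.\<close>

definition compat :: "'i set => ('i => nat option) => ('i => int) => ('i => int) => ('i => int) => bool" where
  "compat X z r q p \<longleftrightarrow>
     (\<forall>T\<subseteq>X. (sum r T > 0 --> ~ sneg q p T) & (sum r T < 0 --> ~ spos q p T)) \<and>
     (\<forall>w1 S T w2. dword (w1 @ S # T # w2) & \<Union>(set (w1 @ S # T # w2)) \<subseteq> X \<and>
        total0 r (w1 @ S # T # w2) & total0 q (w1 @ w2) & total0 p (w1 @ w2) & null q p (S \<union> T) & sum r (S \<union> T) ~= 0 -->
        crat p z S T * Rw q p z (w1 @ w2) = 0)"

definition good :: "'i set => ('i => int) => ('i => int) => ('i => int) => 'i set list => bool" where
  "good X r q p w \<longleftrightarrow> dword w & \<Union>(set w) \<subseteq> X & total0 r w & total0 q w & total0 p w"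

lemma good_swap: "good X r q p (w1 @ S # T # w2) ==> good X r q p (w1 @ T # S # w2)"
  unfolding good_def by (auto intro: total0_swap dest: dword_swap)

lemma good_merge: "good X r q p (w1 @ S # T # w2) ==> good X r q p (w1 @ (S \<union> T) # w2)"
  unfolding good_def by (auto intro: total0_merge dest: dword_merge)

lemma good_drop:
  "good X r q p (w1 @ S # T # w2) ==> null q p (S \<union> T) ==> sum r (S \<union> T) = 0 ==> good X r q p (w1 @ w2)"
  unfolding good_def null_def by (auto intro: total0_drop dest: dword_drop)

lemma mset_pair: "mset ([S, T] @ w1 @ w2) = mset (w1 @ S # T # w2)" by simp

text \<open>A block records the letters that end up in one central term. Some letter is not negative
  and can be moved to the right end, where the expectation vanishes; what remains are mergers and
  central terms, and a central term that does not balance \<open>r\<close> contributes nothing by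
  \<open>compat\<close>.\<close>

theorem Rw_degree:
  assumes c: "compat X z r q p" and g: "good X r q p w"
  shows "mons (Rw q p z w) (%m. \<exists>\<beta>. lab_ok r z w \<beta> m)"
proof (rule swap_closed[where good = "good X r q p" and p = p and z = z])
  show "good X r q p w" by fact
next
  fix w1 S T w2 m assume "\<exists>\<beta>. lab_ok r z (w1 @ T # S # w2) \<beta> m"
  then show "\<exists>\<beta>. lab_ok r z (w1 @ S # T # w2) \<beta> m"
    using lab_ok_perm[of "w1 @ T # S # w2" "w1 @ S # T # w2"] by auto
next
  fix w1 S T w2 m m' assume "good X r q p (w1 @ S # T # w2)" "\<exists>\<beta>. lab_ok r z (w1 @ (S \<union> T) # w2) \<beta> m"
    "keys m' \<subseteq> vars z (S \<union> T)" "odd (mdeg m')"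
  then show "\<exists>\<beta>. lab_ok r z (w1 @ S # T # w2) \<beta> (m' + m)"
    using lab_ok_merge by (metis good_def)
next
  fix w1 S T w2
  assume g: "good X r q p (w1 @ S # T # w2)"
    and IH: "\<And>w. length w < length (w1 @ S # T # w2) ==> good X r q p w ==> mons (Rw q p z w) (%m. \<exists>\<beta>. lab_ok r z w \<beta> m)"
  have d: "dword (w1 @ S # T # w2)" using g by (simp add: good_def)
  have "mons ((if null q p (S \<union> T) then crat p z S T else 0) * Rw q p z (w1 @ w2))
      (%m. \<exists>\<beta>. lab_ok r z (w1 @ S # T # w2) \<beta> m)"
  proof (cases "null q p (S \<union> T) & sum r (S \<union> T) = 0")
    case True
    then have "good X r q p (w1 @ w2)" using good_drop[OF g] by blast
    then have "mons (Rw q p z (w1 @ w2)) (%m. \<exists>\<beta>. lab_ok r z (w1 @ w2) \<beta> m)" by (rule IH[rotated]) simp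
    moreover have "dword ([S, T] @ w1 @ w2)" using d by (auto simp: dword_append)
    note block = lab_ok_block[OF this, of r z]
    have "\<exists>\<beta>. lab_ok r z ([S, T] @ w1 @ w2) \<beta> (a + b)" if h: "\<exists>\<beta>. lab_ok r z (w1 @ w2) \<beta> b" for a b
    proof -
      obtain \<beta> where "lab_ok r z (w1 @ w2) \<beta> b" using h by blast
      from block[OF this] True show ?thesis by auto
    qed
    ultimately have "mons (crat p z S T * Rw q p z (w1 @ w2)) (%m. \<exists>\<beta>. lab_ok r z ([S, T] @ w1 @ w2) \<beta> m)"
      by (intro mons_mult[OF mons_crat, where Q = "%m. \<exists>\<beta>. lab_ok r z (w1 @ w2) \<beta> m"]) blast+
    then show ?thesis using True unfolding lab_ok_perm[OF mset_pair] by simp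
  next
    case False
    then have "(if null q p (S \<union> T) then crat p z S T else 0) * Rw q p z (w1 @ w2) = 0"
      using c g d total0_drop[OF d] unfolding compat_def good_def null_def by auto
    then show ?thesis by simp
  qed
  then show "mons (Rw q p z (w1 @ S # T # w2) - Rw q p z (w1 @ T # S # w2) - cvs p z S T * Rw q p z (w1 @ (S \<union> T) # w2))
      (%m. \<exists>\<beta>. lab_ok r z (w1 @ S # T # w2) \<beta> m)"
    by (simp only: Rw_swap[OF d]) simp
next
  fix w assume g: "good X r q p w"
  show "mons (Rw q p z w) (%m. \<exists>\<beta>. lab_ok r z w \<beta> m) \<or>
      (\<exists>w1 T w2. w = w1 @ T # w2 \<and>
         (mons (Rw q p z (w1 @ w2 @ [T])) (%m. \<exists>\<beta>. lab_ok r z (w1 @ w2 @ [T]) \<beta> m) \<or>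
          mons (Rw q p z (T # w1 @ w2)) (%m. \<exists>\<beta>. lab_ok r z (T # w1 @ w2) \<beta> m)))"
  proof (cases "w = []")
    case True
    then show ?thesis by (simp add: mons_def lab_ok_Nil)
  next
    case False
    have "dword w" "total0 q w" "total0 p w" using g by (simp_all add: good_def)
    from exists_nonneg_letter[OF this(1) False this(2,3)]
    obtain T where T: "T \<in> set w" "~ sneg q p T" by blast
    obtain w1 w2 where w: "w = w1 @ T # w2" using split_list[OF T(1)] by blast
    have "Rw q p z (w1 @ w2 @ [T]) = 0" using Rw_last[OF T(2), of z "w1 @ w2"] by simp
    then show ?thesis using w by (intro disjI2 exI conjI disjI1) auto
  qed
qed (auto intro: good_swap good_merge)

text \<open>A letter with nonzero sum of \<open>r\<close> is annihilated at the same end for both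
  directions, so moving it there reduces the difference to mergers and central terms. A central term
  splits off a block from the rest of the word and is therefore supported in \<open>ok1\<close>,
  unless it exhausts the word; then it is the same for both directions.\<close>

theorem Rw_compare:
  assumes c: "compat X z r q p" "compat X z r q' p" and g: "good X r q p w" "total0 q' w"
  shows "mons (Rw q p z w - Rw q' p z w) (ok1 r z w)"
proof (rule swap_closed[where good = "%w. good X r q p w & total0 q' w" and p = p and z = z
      and D = "%w. Rw q p z w - Rw q' p z w" and ok = "ok1 r z"])
  show "good X r q p w & total0 q' w" using g by simp
next
  fix w1 S T w2 m assume "ok1 r z (w1 @ T # S # w2) m"
  then show "ok1 r z (w1 @ S # T # w2) m"
    using ok1_perm[of "w1 @ T # S # w2" "w1 @ S # T # w2" r z m] by simp
next
  fix w1 S T w2 m m' assume "good X r q p (w1 @ S # T # w2) & total0 q' (w1 @ S # T # w2)"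
    "ok1 r z (w1 @ (S \<union> T) # w2) m" "keys m' \<subseteq> vars z (S \<union> T)" "odd (mdeg m')"
  then show "ok1 r z (w1 @ S # T # w2) (m' + m)"
  proof -
    assume g: "good X r q p (w1 @ S # T # w2) & total0 q' (w1 @ S # T # w2)"
      and k: "ok1 r z (w1 @ (S \<union> T) # w2) m" "keys m' \<subseteq> vars z (S \<union> T)" "odd (mdeg m')"
    obtain \<beta> where b: "lab_ok r z (w1 @ (S \<union> T) # w2) \<beta> m"
      "\<exists>i\<in>\<Union>(set (w1 @ (S \<union> T) # w2)). \<exists>j\<in>\<Union>(set (w1 @ (S \<union> T) # w2)). \<beta> i ~= \<beta> j"
      using k(1) unfolding ok1_def by blast
    have U: "\<Union>(set (w1 @ S # T # w2)) = \<Union>(set (w1 @ (S \<union> T) # w2))" by auto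
    have "dword (w1 @ S # T # w2)" using g by (simp add: good_def)
    from lab_ok_merge[OF this b(1) k(2,3)] b(2) show ?thesis unfolding ok1_def U by blast
  qed
next
  fix w1 S T w2
  assume "good X r q p (w1 @ S # T # w2) & total0 q' (w1 @ S # T # w2)"
  then have g: "good X r q p (w1 @ S # T # w2)" and g': "total0 q' (w1 @ S # T # w2)" by auto
  have d: "dword (w1 @ S # T # w2)" using g by (simp add: good_def)
  have gq': "good X r q' p (w1 @ S # T # w2)" using g g' by (simp add: good_def)
  have "mons ((if null q p (S \<union> T) then crat p z S T else 0) * Rw q p z (w1 @ w2))
      (ok1 r z (w1 @ S # T # w2))"
    if c: "compat X z r q p" and g: "good X r q p (w1 @ S # T # w2)" and ne: "w1 @ w2 ~= []" for q
  proof (cases "null q p (S \<union> T) & sum r (S \<union> T) = 0")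
    case True
    then have "good X r q p (w1 @ w2)" using good_drop[OF g] by blast
    then have "mons (Rw q p z (w1 @ w2)) (%m. \<exists>\<beta>. lab_ok r z (w1 @ w2) \<beta> m)" by (rule Rw_degree[OF c])
    moreover have "dword ([S, T] @ w1 @ w2)" using d by (auto simp: dword_append)
    note block = ok1_block[OF this, of r z]
    have "ok1 r z ([S, T] @ w1 @ w2) (a + b)" if h: "\<exists>\<beta>. lab_ok r z (w1 @ w2) \<beta> b" for a b
    proof -
      obtain \<beta> where "lab_ok r z (w1 @ w2) \<beta> b" using h by blast
      from block[OF this] True ne show ?thesis by auto
    qed
    ultimately have "mons (crat p z S T * Rw q p z (w1 @ w2)) (ok1 r z ([S, T] @ w1 @ w2))"
      by (intro mons_mult[OF mons_crat, where Q = "%m. \<exists>\<beta>. lab_ok r z (w1 @ w2) \<beta> m"]) blast+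
    moreover have "ok1 r z ([S, T] @ w1 @ w2) m = ok1 r z (w1 @ S # T # w2) m" for m
      by (rule ok1_perm[OF mset_pair])
    ultimately show ?thesis using True by (simp add: mons_def)
  next
    case False
    then have "(if null q p (S \<union> T) then crat p z S T else 0) * Rw q p z (w1 @ w2) = 0"
      using c g d total0_drop[OF d] unfolding compat_def good_def null_def by auto
    then show ?thesis by simp
  qed
  note central = this
  have "mons ((if null q p (S \<union> T) then crat p z S T else 0) * Rw q p z (w1 @ w2) -
      (if null q' p (S \<union> T) then crat p z S T else 0) * Rw q' p z (w1 @ w2)) (ok1 r z (w1 @ S # T # w2))"
  \<comment> \<open>If the two letters are the whole word, the vanishing totals make them null for
    both directions, and the central terms cancel in the difference.\<close>
  proof (cases "w1 @ w2 = []")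
    case True
    then have "null q p (S \<union> T)" "null q' p (S \<union> T)" using g g' by (auto simp: good_def total0_def null_def)
    then show ?thesis using True by (simp add: Rw_Nil)
  next
    case False
    show ?thesis by (intro mons_diff central c g gq' False)
  qed
  then show "mons (Rw q p z (w1 @ S # T # w2) - Rw q' p z (w1 @ S # T # w2) -
      (Rw q p z (w1 @ T # S # w2) - Rw q' p z (w1 @ T # S # w2)) -
      cvs p z S T * (Rw q p z (w1 @ (S \<union> T) # w2) - Rw q' p z (w1 @ (S \<union> T) # w2))) (ok1 r z (w1 @ S # T # w2))"
    by (simp only: Rw_swap[OF d]) (simp add: algebra_simps)
next
  fix w assume "good X r q p w & total0 q' w"
  then have g: "good X r q p w" and g': "total0 q' w" by auto
  show "mons (Rw q p z w - Rw q' p z w) (ok1 r z w) \<or>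
      (\<exists>w1 T w2. w = w1 @ T # w2 \<and>
         (mons (Rw q p z (w1 @ w2 @ [T]) - Rw q' p z (w1 @ w2 @ [T])) (ok1 r z (w1 @ w2 @ [T])) \<or>
          mons (Rw q p z (T # w1 @ w2) - Rw q' p z (T # w1 @ w2)) (ok1 r z (T # w1 @ w2))))"
  proof (cases "\<exists>T\<in>set w. sum r T ~= 0")
    case True
    then obtain T w1 w2 where w: "w = w1 @ T # w2" and T: "sum r T ~= 0" using split_list by metis
    have X: "T \<subseteq> X" using g w by (auto simp: good_def)
    show ?thesis
    proof (cases "sum r T > 0")
      case True
      then have "~ sneg q p T" "~ sneg q' p T" using c X by (auto simp: compat_def)
      then have "Rw q p z (w1 @ w2 @ [T]) = 0" "Rw q' p z (w1 @ w2 @ [T]) = 0"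
        using Rw_last[of q T p z "w1 @ w2"] Rw_last[of q' T p z "w1 @ w2"] by simp_all
      then show ?thesis using w by (intro disjI2 exI[of _ w1] exI[of _ T] exI[of _ w2] conjI disjI1) auto
    next
      case False
      then have "~ spos q p T" "~ spos q' p T" using c X T by (auto simp: compat_def)
      then have "Rw q p z (T # w1 @ w2) = 0" "Rw q' p z (T # w1 @ w2) = 0"
        by (auto intro: Rw_first)
      then show ?thesis using w by (intro disjI2 exI[of _ w1] exI[of _ T] exI[of _ w2] conjI disjI2) auto
    qed
  next
    case False
    have d: "dword w" using g by (simp add: good_def)
    consider "w = []" | T where "w = [T]" | T S w' where "w = T # S # w'" by (metis list.exhaust)
    then show ?thesis
    proof cases
      case 1
      then show ?thesis by (simp add: Rw_Nil)
    next
      case 2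
      then have "~ sneg q p T" "~ sneg q' p T" using g g' by (auto simp: good_def total0_def lneg_def)
      then have "Rw q p z w = 0" "Rw q' p z w = 0" using Rw_last[of q T p z "[]"] Rw_last[of q' T p z "[]"] 2 by simp_all
      then show ?thesis by simp
    next
      case 3
      \<comment> \<open>When every letter is balanced for \<open>r\<close>, each can be a block by
        itself, and with at least two letters every monomial is admissible.\<close>
      have "ok1 r z w m" for m
      proof -
        obtain \<beta> where "lab_ok r z (S # w') \<beta> m"
          using lab_ok_null_letters[of "S # w'" r z m] d False 3 by auto
        from ok1_block[of "[T]", OF _ this, of 0] d False 3 show ?thesis by auto
      qed
      then show ?thesis by (simp add: mons_def)
    qed
  qed
qed (auto intro: good_swap good_merge total0_swap total0_merge)

section \<open>Crossing a wall\<close>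

lemma Rv_pair:
  assumes v: "vfree u" "vfree v" and e: "lpos e"
  shows "Rv [(e, u), (- e, v)] = rat (snd e) (u + v)" "Rv [(- e, v), (e, u)] = 0"
proof -
  obtain a b where ab: "e = (a, b)" by fastforce
  have n: "~ lpos (- e)" and p: "~ lneg (e - e)"
    using e by (auto simp: ab lpos_def lneg_def zero_prod_def)
  show 2: "Rv [(- e, v), (e, u)] = 0" by (rule Rv_first) (use v n in auto)
  have 3: "Rv [(e - e, u + v)] = 0"
    using Rv_last[of "[]" "(e - e, u + v)"] v p by simp
  show "Rv [(e, u), (- e, v)] = rat (snd e) (u + v)"
    using Rv_swap[of "[]" "(e, u)" "(- e, v)" "[]"] v 2 3 by (simp add: lmerge_def Rv_Nil)
qed

text \<open>In the application \<open>F\<close> has one side \<open>S\<close> for each choice of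
  z-letters. \<open>near\<close> and \<open>near_co\<close> express that \<open>q1\<close> is close
  to the wall: the energy of a side is so small that a proper part and the rest of the side have
  opposite signs. \<open>anti\<close>, \<open>meet\<close> and \<open>join\<close> keep two
  different sides from being nested, and any two from being disjoint or covering \<open>X\<close>.
  \<open>pref\<close> rescales the product of two two-letter expectations to the one for
  \<open>X\<close>; it is the origin of the quotient of sigmas in the final formula.\<close>

locale wall_crossing =
  fixes X :: "'i set" and z :: "'i => nat option" and q1 q2 p :: "'i => int"
    and F :: "'i set set" and pref :: "'i set => real mfps"
  assumes finX: "finite X" and X_ne: "X ~= {}"
    and tot: "sum q1 X = 0" "sum q2 X = 0" "sum p X = 0"
    and nonflip: "\<And>T. T \<subseteq> X ==> T ~= {} ==> T ~= X ==> T \<notin> F ==> X - T \<notin> F ==>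
        spos q1 p T & spos q2 p T | sneg q1 p T & sneg q2 p T"
    and flip: "\<And>S. S \<in> F ==> S \<subseteq> X & S ~= {} & S ~= X & spos q1 p S & sneg q2 p S"
    and near: "\<And>S T. S \<in> F ==> T \<subset> S ==> T ~= {} ==>
        spos q1 p T & sneg q1 p (S - T) | sneg q1 p T & spos q1 p (S - T)"
    and near_co: "\<And>S T. S \<in> F ==> T \<subset> X - S ==> T ~= {} ==>
        spos q1 p T & sneg q1 p (X - S - T) | sneg q1 p T & spos q1 p (X - S - T)"
    and anti: "\<And>S S'. S \<in> F ==> S' \<in> F ==> S \<subseteq> S' ==> S = S'"
    and meet: "\<And>S S'. S \<in> F ==> S' \<in> F ==> S \<inter> S' ~= {}"
    and join: "\<And>S S'. S \<in> F ==> S' \<in> F ==> S \<union> S' ~= X"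
    and pref: "\<And>S. S \<in> F ==> pref S * rat (sum p S) (\<Sum>i\<in>S. zvar (z i)) * rat (sum p S) (\<Sum>i\<in>X - S. zvar (z i)) =
        rat (sum p S) (\<Sum>i\<in>X. zvar (z i))"
begin

abbreviation "L \<equiv> slet q1 p z"

text \<open>The letter that balances the side \<open>S\<close>. It carries no variable and becomes
  the entry \<delta> appended to the first factor; \<open>starp\<close> plays the same part for the
  complement.\<close>

definition starm :: "'i set => letter" where "starm S = (- (sum q1 S, sum p S), 0)"
definition starp :: "'i set => letter" where "starp S = ((sum q1 S, sum p S), 0)"

definition left :: "'i set => 'i set list => real mfps" where
  "left S w = Rv (map L (filter (%T. T \<subseteq> S) w) @ [starm S])"
definition right :: "'i set => 'i set list => real mfps" where
  "right S w = Rv (starp S # map L (filter (%T. T \<subseteq> X - S) w))"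
definition refines :: "'i set list => 'i set => bool" where
  "refines w S \<longleftrightarrow> (\<forall>T\<in>set w. T \<subseteq> S | T \<subseteq> X - S)"
definition crossing :: "'i set => 'i set list => real mfps" where
  "crossing S w = (if refines w S then pref S * left S w * right S w else 0)"

lemma finF: "finite F"
  by (rule finite_subset[of _ "Pow X"]) (use flip finX in auto)

lemma fin: "T \<subseteq> X ==> finite T" using finX finite_subset by blast

lemma vf: "vfrees (map L w @ [starm S])" "vfrees (starp S # map L w)"
  by (auto simp: vfree_slet starm_def starp_def)

lemma sum_minus: "T \<subseteq> S ==> S \<subseteq> X ==> sum f (S - T) = sum f S - sum f T" for f :: "'i => int"
  by (rule sum_diff[OF fin])

lemma not_null:
  assumes "S \<in> F" "T ~= {}" "T \<subseteq> S | T \<subseteq> X - S"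
  shows "~ null q1 p T"
proof -
  have "spos q1 p T | sneg q1 p T"
  proof -
    consider "T = S" | "T = X - S" | "T \<subset> S" | "T \<subset> X - S" using assms(3) by blast
    then show ?thesis
    proof cases
      case 2
      have "sum q1 T = - sum q1 S" "sum p T = - sum p S"
        unfolding 2 using sum_minus[of S X] flip[OF assms(1)] tot by auto
      then show ?thesis using flip[OF assms(1)] by (auto simp: lpos_def lneg_def)
    qed (use flip near near_co assms in blast)+
  qed
  then show ?thesis by (auto simp: null_def lpos_def lneg_def)
qed

text \<open>Two letters on the same side affect only one factor, and their union is never null
  there. For letters on different sides the order is irrelevant to both factors, and their union
  fits into neither side. So the product obeys the exchange rule without central term.\<close>

lemma crossing_swap:
  assumes d: "dword (w1 @ S # T # w2)" and S: "K \<in> F"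
  shows "crossing K (w1 @ S # T # w2) = crossing K (w1 @ T # S # w2) + cvs p z S T * crossing K (w1 @ (S \<union> T) # w2)"
proof (cases "refines (w1 @ S # T # w2) K")
  case False
  then have "~ refines (w1 @ T # S # w2) K" "~ refines (w1 @ (S \<union> T) # w2) K" by (auto simp: refines_def)
  then show ?thesis using False by (simp add: crossing_def)
next
  case True
  have f: "finite S" "finite T" "S \<inter> T = {}" "S ~= {}" "T ~= {}" using d by (auto simp: dword_append)
  have r: "refines (w1 @ T # S # w2) K" using True by (auto simp: refines_def)
  have ST: "S \<subseteq> K | S \<subseteq> X - K" "T \<subseteq> K | T \<subseteq> X - K" using True by (auto simp: refines_def)
  have v: "vfrees (map L w)" "vfrees [starm K]" "vfrees [starp K]" for w
    by (auto simp: vfree_slet starm_def starp_def)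
  consider "S \<subseteq> K" "T \<subseteq> K" | "S \<subseteq> X - K" "T \<subseteq> X - K" | "(S \<subseteq> K & T \<subseteq> X - K) | (S \<subseteq> X - K & T \<subseteq> K)"
    using ST by blast
  then show ?thesis
  proof cases
    case 1
    have n: "~ S \<subseteq> X - K" "~ T \<subseteq> X - K" "~ S \<union> T \<subseteq> X - K" using 1 f by blast+
    have rm: "refines (w1 @ (S \<union> T) # w2) K" using True 1 by (auto simp: refines_def)
    have sub: "S \<union> T \<subseteq> K" using 1 by blast
    have nn: "~ null q1 p (S \<union> T)" using not_null[OF S, of "S \<union> T"] f sub by blast
    have "left K (w1 @ S # T # w2) = left K (w1 @ T # S # w2) + cvs p z S T * left K (w1 @ (S \<union> T) # w2)"
    proof -
      have "vfrees (map L (filter (%T. T \<subseteq> K) w1))" "vfrees (map L (filter (%T. T \<subseteq> K) w2) @ [starm K])"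
        using v by auto
      from Rv_slet_swap[OF f(1-3) this, of q1 p z]
      show ?thesis unfolding left_def by (simp only: nn if_False filter_append filter.simps 1 sub if_True map_append list.map append_assoc append_Cons mult_zero_left add_0_right)
    qed
    moreover have "right K (w1 @ S # T # w2) = right K (w1 @ w2)" "right K (w1 @ T # S # w2) = right K (w1 @ w2)"
      "right K (w1 @ (S \<union> T) # w2) = right K (w1 @ w2)"
      using n by (simp_all add: right_def)
    ultimately show ?thesis using True r rm by (simp add: crossing_def algebra_simps)
  next
    case 2
    have n: "~ S \<subseteq> K" "~ T \<subseteq> K" "~ S \<union> T \<subseteq> K" using 2 f by blast+
    have rm: "refines (w1 @ (S \<union> T) # w2) K" using True 2 by (auto simp: refines_def)
    have sub: "S \<union> T \<subseteq> X - K" using 2 by blast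
    have nn: "~ null q1 p (S \<union> T)" using not_null[OF S, of "S \<union> T"] f sub by blast
    have "right K (w1 @ S # T # w2) = right K (w1 @ T # S # w2) + cvs p z S T * right K (w1 @ (S \<union> T) # w2)"
    proof -
      have "vfrees (starp K # map L (filter (%T. T \<subseteq> X - K) w1))" "vfrees (map L (filter (%T. T \<subseteq> X - K) w2))"
        using v by auto
      from Rv_slet_swap[OF f(1-3) this, of q1 p z]
      show ?thesis unfolding right_def by (simp only: nn if_False filter_append filter.simps 2 sub if_True map_append list.map append_assoc append_Cons mult_zero_left add_0_right)
    qed
    moreover have "left K (w1 @ S # T # w2) = left K (w1 @ w2)" "left K (w1 @ T # S # w2) = left K (w1 @ w2)"
      "left K (w1 @ (S \<union> T) # w2) = left K (w1 @ w2)"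
      using n by (simp_all add: left_def)
    ultimately show ?thesis using True r rm by (simp add: crossing_def algebra_simps)
  next
    case 3
    then have n: "~ (S \<union> T \<subseteq> K | S \<union> T \<subseteq> X - K)" using f by blast
    then have "~ refines (w1 @ (S \<union> T) # w2) K" by (auto simp: refines_def)
    moreover have "left K (w1 @ S # T # w2) = left K (w1 @ T # S # w2)"
      "right K (w1 @ S # T # w2) = right K (w1 @ T # S # w2)"
      using 3 n by (auto simp: left_def right_def)
    ultimately show ?thesis using True r by (simp add: crossing_def)
  qed
qed

text \<open>The letter \<open>T\<close> has to pass the closing letter. Merged with it,
  \<open>T\<close> has the energy opposite to that of \<open>S - T\<close>, which is positive by
  \<open>near\<close>; so both resulting words end in a letter that is not negative.\<close>

lemma left_last_zero:
  assumes S: "S \<in> F" and T: "T \<subset> S" "T ~= {}" "spos q1 p T"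
  shows "left S (w @ [T]) = 0"
proof -
  have SX: "S \<subseteq> X" using flip S by blast
  have "sneg q1 p (S - T)" using near[OF S T(1,2)] T(3) lpos_lneg by blast
  moreover have "T \<subseteq> S" using T by blast
  ultimately have "lneg (sum q1 S - sum q1 T, sum p S - sum p T)"
    using sum_minus[OF _ SX, of T q1] sum_minus[OF _ SX, of T p] by (simp only:)
  then have m: "~ lneg ((sum q1 T, sum p T) + - (sum q1 S, sum p S))"
    and nz: "(sum q1 T, sum p T) + - (sum q1 S, sum p S) ~= 0"
    by (auto simp: lneg_def zero_prod_def)
  let ?u = "map L (filter (%T. T \<subseteq> S) w)"
  have "Rv (?u @ [starm S] @ [L T]) = 0"
  proof -
    have "vfrees ((?u @ [starm S]) @ [L T])" by (auto simp: vfree_slet starm_def)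
    moreover have "~ lneg (fst (L T))" using T(3) lpos_lneg by (simp add: slet_def)
    ultimately show ?thesis using Rv_last by fastforce
  qed
  moreover have "Rv (?u @ [lmerge (L T) (starm S)]) = 0"
    by (rule Rv_last) (use m vf in \<open>auto simp: lmerge_def slet_def starm_def vfree_slet vfree_sum\<close>)
  moreover have "fst (L T) + fst (starm S) ~= 0" using nz by (simp add: slet_def starm_def)
  ultimately show ?thesis
    using Rv_swap[of ?u "L T" "starm S" "[]"] T(1) by (auto simp: left_def vfree_slet starm_def)
qed

lemma right_first_zero:
  assumes S: "S \<in> F" and T: "T \<subset> X - S" "T ~= {}" "sneg q1 p T"
  shows "right S (T # w) = 0"
proof -
  have SX: "S \<subseteq> X" using flip S by blast
  have "spos q1 p (X - S - T)" using near_co[OF S T(1,2)] T(3) lpos_lneg by blast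
  moreover have "sum f (X - S - T) = sum f X - sum f S - sum f T" for f :: "'i => int"
  proof -
    have "T \<subseteq> X - S" using T by blast
    then have "sum f (X - S - T) = sum f (X - S) - sum f T" by (rule sum_minus) auto
    also have "sum f (X - S) = sum f X - sum f S" by (rule sum_minus[OF SX]) auto
    finally show ?thesis .
  qed
  ultimately have e: "lpos (- ((sum q1 S, sum p S) + (sum q1 T, sum p T)))"
    using tot by (simp add: algebra_simps)
  then have m: "~ lpos ((sum q1 S, sum p S) + (sum q1 T, sum p T))" and nz: "(sum q1 S, sum p S) + (sum q1 T, sum p T) ~= 0"
    by (auto simp: lpos_def zero_prod_def)
  let ?u = "map L (filter (%T. T \<subseteq> X - S) w)"
  have np: "~ spos q1 p T" using T(3) lpos_lneg by blast
  have "Rv (L T # starp S # ?u) = 0"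
    by (rule Rv_first) (use np vf in \<open>auto simp: slet_def vfree_slet starp_def vfree_sum\<close>)
  moreover have "Rv (lmerge (starp S) (L T) # ?u) = 0"
    by (rule Rv_first) (use m vf in \<open>auto simp: lmerge_def slet_def starp_def vfree_slet vfree_sum\<close>)
  moreover have "fst (starp S) + fst (L T) ~= 0" using nz by (simp add: slet_def starp_def)
  ultimately show ?thesis
    using Rv_swap[of "[]" "starp S" "L T" ?u] T(1) by (auto simp: right_def vfree_slet starp_def)
qed

lemma right_last_zero: "T \<subseteq> X - S ==> spos q1 p T ==> right S (w @ [T]) = 0"
  using Rv_last[of "starp S # map L (filter (%T. T \<subseteq> X - S) w)" "L T"] vf lpos_lneg
  by (auto simp: right_def slet_def vfree_slet starp_def vfree_sum)

lemma left_first_zero: "T \<subseteq> S ==> sneg q1 p T ==> left S (T # w) = 0"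
  using Rv_first[of "L T" "map L (filter (%T. T \<subseteq> S) w) @ [starm S]"] vf lpos_lneg
  by (auto simp: left_def slet_def vfree_slet starm_def vfree_sum)

text \<open>These are the words on which the recursion ends, and they fix the normalisation
  \<open>pref\<close>. In either order of the two letters only one of the two directions contributes
  to the difference.\<close>

lemma pair:
  assumes S: "S \<in> F"
  shows "Rw q1 p z [S, X - S] - Rw q2 p z [S, X - S] = rat (sum p S) (\<Sum>i\<in>X. zvar (z i))"
    and "Rw q1 p z [X - S, S] - Rw q2 p z [X - S, S] = rat (sum p S) (\<Sum>i\<in>X. zvar (z i))"
    and "pref S * left S [S, X - S] * right S [S, X - S] = rat (sum p S) (\<Sum>i\<in>X. zvar (z i))"
    and "pref S * left S [X - S, S] * right S [X - S, S] = rat (sum p S) (\<Sum>i\<in>X. zvar (z i))"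
proof -
  have SX: "S \<subseteq> X" "S ~= {}" "X - S ~= {}" using flip[OF S] by auto
  have u: "(\<Sum>i\<in>S. zvar (z i)) + (\<Sum>i\<in>X - S. zvar (z i)) = (\<Sum>i\<in>X. zvar (z i))"
    by (metis SX(1) add.commute finX sum.subset_diff)
  have s: "sum q1 (X - S) = - sum q1 S" "sum q2 (X - S) = - sum q2 S" "sum p (X - S) = - sum p S"
    using sum_minus[of S X] SX tot by auto
  have p1: "lpos (sum q1 S, sum p S)" and n2: "lneg (sum q2 S, sum p S)" using flip[OF S] by auto
  then have p2: "lpos (- (sum q2 S, sum p S))" by (auto simp: lneg_def lpos_def)
  note P1 = Rv_pair[OF _ _ p1, of "\<Sum>i\<in>S. zvar (z i)" "\<Sum>i\<in>X - S. zvar (z i)"]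
  note P2 = Rv_pair[OF _ _ p2, of "\<Sum>i\<in>X - S. zvar (z i)" "\<Sum>i\<in>S. zvar (z i)"]
  have v: "vfree (\<Sum>i\<in>T. zvar (z i))" for T by (simp add: vfree_sum)
  show "Rw q1 p z [S, X - S] - Rw q2 p z [S, X - S] = rat (sum p S) (\<Sum>i\<in>X. zvar (z i))"
    using P1(1)[OF v v] P2(2)[OF v v] u s by (simp add: Rw_def slet_def)
  show "Rw q1 p z [X - S, S] - Rw q2 p z [X - S, S] = rat (sum p S) (\<Sum>i\<in>X. zvar (z i))"
    using P1(2)[OF v v] P2(1)[OF v v] u s by (simp add: Rw_def slet_def rat_neg add.commute)
  have n: "~ X - S \<subseteq> S" "~ S \<subseteq> X - S" using SX by blast+
  have l: "Rv [L S, starm S] = rat (sum p S) (\<Sum>i\<in>S. zvar (z i))"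
    using Rv_pair(1)[OF v[of S] _ p1, of 0] by (simp add: slet_def starm_def)
  have r: "Rv [starp S, L (X - S)] = rat (sum p S) (\<Sum>i\<in>X - S. zvar (z i))"
    using Rv_pair(1)[OF _ v[of "X - S"] p1, of 0] s by (simp add: slet_def starp_def)
  show "pref S * left S [S, X - S] * right S [S, X - S] = rat (sum p S) (\<Sum>i\<in>X. zvar (z i))"
    "pref S * left S [X - S, S] * right S [X - S, S] = rat (sum p S) (\<Sum>i\<in>X. zvar (z i))"
    using n pref[OF S] by (simp_all add: left_def right_def l r)
qed

text \<open>Both sides obey the same exchange rule. A letter that is neither in \<open>F\<close> nor
  complementary to a member of \<open>F\<close>, and is not all of \<open>X\<close>, has a common
  sign for both directions; moved to the corresponding end, it makes all terms vanish. If there is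
  no such letter, the conditions on \<open>F\<close> leave a single letter \<open>X\<close> or the
  two words treated in \<open>pair\<close>.\<close>

theorem crossing_formula:
  assumes "dword w" "\<Union>(set w) = X"
  shows "Rw q1 p z w - Rw q2 p z w = (\<Sum>S\<in>F. crossing S w)"
proof -
  \<comment> \<open>For an admissible set without any monomial, \<open>swap_closed\<close> says that
    the difference is zero.\<close>
  let ?D = "%w. Rw q1 p z w - Rw q2 p z w - (\<Sum>S\<in>F. crossing S w)"
  have "mons (?D w) (%_. False)"
  proof (rule swap_closed[where good = "%w. dword w & \<Union>(set w) = X" and p = p and z = z and D = ?D and ok = "%_ _. False"])
    show "dword w & \<Union>(set w) = X" using assms by simp
  next
    fix w1 S T w2 assume g: "dword (w1 @ S # T # w2) & \<Union>(set (w1 @ S # T # w2)) = X"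
    then have d: "dword (w1 @ S # T # w2)" by simp
    have ST: "S \<union> T \<subseteq> X" "S \<union> T ~= {}" using g by (auto simp: dword_append)
    \<comment> \<open>A union of two letters can be null only if it is all of \<open>X\<close>; the
      rest of the word is then empty and both directions give the same central term.\<close>
    have central: "(if null q1 p (S \<union> T) then crat p z S T else 0) * Rw q1 p z (w1 @ w2) =
        (if null q2 p (S \<union> T) then crat p z S T else 0) * Rw q2 p z (w1 @ w2)"
    proof (cases "S \<union> T = X")
      case True
      have "w1 @ w2 = []"
      proof (rule ccontr)
        assume "w1 @ w2 ~= []"
        then obtain V where "V \<in> set (w1 @ w2)" by (metis list.set_intros(1) neq_Nil_conv)
        moreover from this have "V ~= {}" "V \<inter> (S \<union> T) = {}"
          using d by (auto simp: dword_append dest: split_list)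
        ultimately show False using g True by auto
      qed
      then show ?thesis unfolding True using tot by (simp add: null_def Rw_Nil)
    next
      case False
      have "~ null q1 p (S \<union> T)" "~ null q2 p (S \<union> T)"
      proof -
        have "(spos q1 p T | sneg q1 p T) & (spos q2 p T | sneg q2 p T)" if T: "T \<subseteq> X" "T ~= {}" "T ~= X" for T
        proof (cases "T \<in> F | X - T \<in> F")
          case True
          then show ?thesis
          proof
            assume "T \<in> F" then show ?thesis using flip by blast
          next
            assume "X - T \<in> F"
            moreover have "sum f (X - T) = sum f X - sum f T" for f :: "'i => int" using sum_minus[of T X] T by auto
            ultimately show ?thesis using flip[of "X - T"] tot by (auto simp: lpos_def lneg_def)
          qed
        qed (use nonflip that in blast)
        from this[OF ST False] show "~ null q1 p (S \<union> T)" "~ null q2 p (S \<union> T)"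
          by (auto simp: null_def lpos_def lneg_def)
      qed
      then show ?thesis by simp
    qed
    have "(\<Sum>K\<in>F. crossing K (w1 @ S # T # w2)) =
        (\<Sum>K\<in>F. crossing K (w1 @ T # S # w2)) + cvs p z S T * (\<Sum>K\<in>F. crossing K (w1 @ (S \<union> T) # w2))"
      by (simp add: crossing_swap[OF d] sum.distrib sum_distrib_left)
    then have "?D (w1 @ S # T # w2) - ?D (w1 @ T # S # w2) - cvs p z S T * ?D (w1 @ (S \<union> T) # w2) = 0"
      using central by (simp only: Rw_swap[OF d]) (simp add: algebra_simps)
    then show "mons (?D (w1 @ S # T # w2) - ?D (w1 @ T # S # w2) - cvs p z S T * ?D (w1 @ (S \<union> T) # w2)) (%_. False)"
      by simp
  next
    fix w assume g: "dword w & \<Union>(set w) = X"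
    have zero: "mons f (%_. False)" if "f = 0" for f using that by simp
    have sub: "T \<subseteq> X" "T ~= {}" if "T \<in> set w" for T
      using g that by (auto simp: dword_append dest!: split_list)
    show "mons (?D w) (%_. False) \<or>
      (\<exists>w1 T w2. w = w1 @ T # w2 \<and>
         (mons (?D (w1 @ w2 @ [T])) (%_. False) | mons (?D (T # w1 @ w2)) (%_. False)))"
    proof (cases "\<exists>T\<in>set w. T ~= X & T \<notin> F & X - T \<notin> F")
      case True
      then obtain T w1 w2 where w: "w = w1 @ T # w2" and T: "T ~= X" "T \<notin> F" "X - T \<notin> F" by (metis split_list)
      have TX: "T \<subseteq> X" "T ~= {}" using sub w by auto
      have ref: "T \<subset> S | T \<subset> X - S" if "refines v S" "T \<in> set v" "S \<in> F" for v S
      proof -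
        have "T ~= X - S" using T(3) flip[OF that(3)] by (metis double_diff subset_refl that(3))
        then show ?thesis using that T by (auto simp: refines_def)
      qed
      from nonflip[OF TX T] show ?thesis
      proof
        assume s: "spos q1 p T & spos q2 p T"
        have "crossing S (w1 @ w2 @ [T]) = 0" if "S \<in> F" for S
        proof (cases "refines (w1 @ w2 @ [T]) S")
          case True
          from ref[OF True _ that] have "T \<subset> S | T \<subset> X - S" by simp
          then have "left S ((w1 @ w2) @ [T]) = 0 | right S ((w1 @ w2) @ [T]) = 0"
            using left_last_zero[OF that _ TX(2)] right_last_zero[of T S "w1 @ w2"] s by blast
          then show ?thesis by (auto simp: crossing_def)
        qed (simp add: crossing_def)
        moreover have "Rw q1 p z (w1 @ w2 @ [T]) = 0" "Rw q2 p z (w1 @ w2 @ [T]) = 0"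
          using Rw_last[of q1 T p z "w1 @ w2"] Rw_last[of q2 T p z "w1 @ w2"] s lpos_lneg by auto
        ultimately have "?D (w1 @ w2 @ [T]) = 0" by simp
        then show ?thesis using w by (intro disjI2 exI[of _ w1] exI[of _ T] exI[of _ w2] conjI disjI1 zero) auto
      next
        assume s: "sneg q1 p T & sneg q2 p T"
        have "crossing S (T # w1 @ w2) = 0" if "S \<in> F" for S
        proof (cases "refines (T # w1 @ w2) S")
          case True
          from ref[OF True _ that] have "T \<subset> S | T \<subset> X - S" by simp
          then have "left S (T # w1 @ w2) = 0 | right S (T # w1 @ w2) = 0"
            using right_first_zero[OF that _ TX(2)] left_first_zero[of T S "w1 @ w2"] s by blast
          then show ?thesis by (auto simp: crossing_def)
        qed (simp add: crossing_def)
        moreover have "Rw q1 p z (T # w1 @ w2) = 0" "Rw q2 p z (T # w1 @ w2) = 0"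
          using s lpos_lneg by (auto intro: Rw_first)
        ultimately have "?D (T # w1 @ w2) = 0" by simp
        then show ?thesis using w by (intro disjI2 exI[of _ w1] exI[of _ T] exI[of _ w2] conjI disjI2 zero) auto
      qed
    next
      case False
      consider "w = []" | T where "w = [T]" | T S w' where "w = T # S # w'" by (metis list.exhaust)
      then have "?D w = 0"
      proof cases
        case 1 then show ?thesis using g X_ne by simp
      next
        case 2
        then have "T = X" using g by simp
        have "~ sneg q1 p X" "~ sneg q2 p X" using tot by (auto simp: lneg_def)
        then have "Rw q1 p z w = 0" "Rw q2 p z w = 0"
          using Rw_last[of q1 X p z "[]"] Rw_last[of q2 X p z "[]"] 2 \<open>T = X\<close> by simp_all
        moreover have "crossing S w = 0" if "S \<in> F" for S
          using flip[OF that] 2 \<open>T = X\<close> by (auto simp: crossing_def refines_def)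
        ultimately show ?thesis by simp
      next
        case 3
        have dis: "T \<inter> S = {}" "T \<subseteq> X" "S \<subseteq> X" "T ~= {}" "S ~= {}" using g 3 by auto
        then have nX: "T ~= X" "S ~= X" by blast+
        then have F: "T \<in> F | X - T \<in> F" "S \<in> F | X - S \<in> F" using False 3 by auto
        obtain K where K: "K \<in> F" "T = K & S = X - K | T = X - K & S = K"
        proof -
          consider "T \<in> F" "S \<in> F" | "T \<in> F" "X - S \<in> F" | "X - T \<in> F" "S \<in> F" | "X - T \<in> F" "X - S \<in> F"
            using F by blast
          then show ?thesis
          proof cases
            case 1 then show ?thesis using meet dis by blast
          next
            case 2
            then have "T = X - S" using anti[OF 2] dis by blast
            then show ?thesis using that[of T] 2 dis by blast
          next
            case 3
            then have "S = X - T" using anti[OF 3(2,1)] dis by blast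
            then show ?thesis using that[of S] 3 dis by blast
          next
            case 4
            have "(X - T) \<union> (X - S) = X" using dis by blast
            then show ?thesis using join[OF 4] by blast
          qed
        qed
        have "w' = []"
        proof (rule ccontr)
          assume "w' ~= []"
          then obtain V v where "w' = V # v" by (metis list.exhaust)
          then show False using g 3 K(2) flip[OF K(1)] by auto
        qed
        then have w: "w = [K, X - K] | w = [X - K, K]" using 3 K(2) by auto
        have "crossing S w = 0" if "S \<in> F" "S ~= K" for S
        proof -
          have "~ K \<subseteq> S" "~ K \<subseteq> X - S" using anti[OF K(1) that(1)] meet[OF K(1) that(1)] that by blast+
          then have "~ refines w S" using w by (auto simp: refines_def)
          then show ?thesis by (simp add: crossing_def)
        qed
        then have "(\<Sum>S\<in>F. crossing S w) = crossing K w"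
          using finF K(1) by (subst sum.remove[OF finF K(1)]) (simp add: sum.neutral)
        also have "... = pref K * left K w * right K w" using w by (auto simp: crossing_def refines_def)
        finally show ?thesis using w pair[OF K(1)] by auto
      qed
      then show ?thesis by simp
    qed
  qed (auto dest: dword_swap dword_merge)
  then have "?D w = 0" by (intro mfps_eqI) (simp add: mons_def)
  then show ?thesis by simp
qed

end

section \<open>Positivity\<close>

definition nonneg :: "real mfps => bool" where "nonneg f \<longleftrightarrow> (\<forall>m. mcoeff f m >= 0)"

lemma nonneg_0 [simp]: "nonneg 0" by (simp add: nonneg_def)
lemma nonneg_1: "nonneg 1" by (simp add: nonneg_def mcoeff_1)
lemma nonneg_add: "nonneg f ==> nonneg g ==> nonneg (f + g)" by (simp add: nonneg_def)
lemma nonneg_mult: "nonneg f ==> nonneg g ==> nonneg (f * g)"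
  by (auto simp: nonneg_def mcoeff_mult intro!: sum_nonneg)
lemma nonneg_power: "nonneg f ==> nonneg (f ^ n)"
  by (induction n) (simp_all add: nonneg_1 nonneg_mult)
lemma nonneg_sum: "(\<And>x. x \<in> A ==> nonneg (f x)) ==> nonneg (sum f A)"
  by (induction A rule: infinite_finite_induct) (simp_all add: nonneg_add)
lemma nonneg_mconst_mult: "c >= 0 ==> nonneg f ==> nonneg (mconst c * f)"
  by (simp add: nonneg_def)
lemma nonneg_zvar: "nonneg (zvar o')"
  by (simp add: nonneg_def zvar_def mvar_def split: option.splits)

lemma nonneg_msubst: "(\<And>n. fps_nth F n >= 0) ==> nonneg u ==> nonneg (msubst F u)"
  using nonneg_power[of u] by (auto simp: nonneg_def msubst_def intro!: sum_nonneg)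

lemma fps_nth_varsigma_1_nonneg: "fps_nth (varsigma 1) n >= 0"
  by (cases "even n") (simp_all add: fps_nth_varsigma)

lemma fps_nth_quotient_nonneg:
  assumes "a >= 0" shows "fps_nth (varsigma (of_int a) / varsigma 1) n >= 0"
proof (cases "even n")
  case True
  then show ?thesis unfolding fps_nth_quotient[OF assms]
    by (intro sum_nonneg divide_nonneg_nonneg) (auto simp: zero_le_even_power)
qed (simp add: fps_nth_quotient_odd)

text \<open>The outermost summand is nonzero for \<open>a\<close> at least 2. For
  \<open>a = 1\<close> the quotient is 1 and its higher coefficients vanish; this is why vectors
  with even energies are used further on.\<close>

lemma fps_nth_quotient_pos:
  assumes "a >= 2" "even n" shows "fps_nth (varsigma (of_int a) / varsigma 1) n > 0"
proof -
  have a: "a >= 0" using assms by simp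
  have "0 < (of_int (- a) + 1/2 + of_int a / 2 :: real) ^ n / fact n"
  proof -
    have "(of_int (- a) + 1/2 + of_int a / 2 :: real) ~= 0" using assms(1) by simp
    then show ?thesis using assms(2) by (simp add: zero_less_power_eq)
  qed
  also have "... <= fps_nth (varsigma (of_int a) / varsigma 1) n"
    unfolding fps_nth_quotient[OF a]
    by (rule member_le_sum[of "- a" "{-a..<0}" "%l. (of_int l + 1/2 + of_int a / 2) ^ n / fact n"])
       (use assms in \<open>auto simp: zero_le_even_power\<close>)
  finally show ?thesis .
qed

lemma nonneg_vs: "nonneg u ==> nonneg (vs u)"
  unfolding vs_def by (intro nonneg_msubst fps_nth_varsigma_1_nonneg)
lemma nonneg_rat: "a >= 0 ==> nonneg u ==> nonneg (rat a u)"
  unfolding rat_def by (intro nonneg_msubst fps_nth_quotient_nonneg)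

lemma nonneg_zsum: "nonneg (\<Sum>i\<in>T. zvar (z i))" by (intro nonneg_sum nonneg_zvar)

lemma nonneg_crat: "sum p S >= 0 ==> nonneg (crat p z S T)"
  unfolding crat_def by (intro nonneg_rat nonneg_zsum)

lemma nonneg_cvs_aux:
  "nonneg (mconst (of_int (sum p S)) * (\<Sum>i\<in>T. zvar (z i)) - mconst (of_int (sum p T)) * (\<Sum>i\<in>S. zvar (z i))) ==>
   nonneg (cvs p z S T)"
  unfolding cvs_def slet_def fst_conv snd_conv by (rule nonneg_vs)

definition bare :: "('i => nat option) => 'i set => bool" where "bare z T \<longleftrightarrow> (\<forall>i\<in>T. z i = None)"

lemma bare_zsum: "bare z T ==> (\<Sum>i\<in>T. zvar (z i)) = 0"
  by (intro sum.neutral) (simp add: bare_def zvar_def)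

lemma nonneg_cvs:
  assumes "sum p S >= 0 & sum p T <= 0 | bare z S & sum p S >= 0 | bare z T & sum p T <= 0"
  shows "nonneg (cvs p z S T)"
proof (rule nonneg_cvs_aux)
  have *: "nonneg (mconst (of_int a) * U - mconst (of_int b) * V)"
    if "a >= 0 & b <= 0 | V = 0 & a >= 0 | U = 0 & b <= 0" "nonneg U" "nonneg V" for a b :: int and U V
  proof -
    have "mconst (of_int a) * U - mconst (of_int b) * V = mconst (of_int a) * U + mconst (- of_int b) * V"
      by (simp add: mconst_minus)
    moreover have "nonneg (mconst (of_int a) * U)" using that by (cases "U = 0") (auto intro: nonneg_mconst_mult)
    moreover have "nonneg (mconst (- of_int b) * V)" using that by (cases "V = 0") (auto intro: nonneg_mconst_mult)
    ultimately show ?thesis by (simp only: nonneg_add)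
  qed
  show "nonneg (mconst (of_int (sum p S)) * (\<Sum>i\<in>T. zvar (z i)) - mconst (of_int (sum p T)) * (\<Sum>i\<in>S. zvar (z i)))"
    by (rule *) (use assms in \<open>auto simp: bare_zsum nonneg_zsum\<close>)
qed

abbreviation e1 :: "nat => (nat \<Rightarrow>\<^sub>0 nat)" where "e1 v \<equiv> Poly_Mapping.single v 1"

lemma mdeg_e1: "mdeg (Poly_Mapping.single v (Suc 0)) = 1" by (simp add: mdeg_def)

lemma mcoeff_msubst_e1:
  assumes "vfree u" shows "mcoeff (msubst F u) (e1 v) = fps_nth F 1 * mcoeff u (e1 v)"
proof -
  have "e1 v ~= 0" using single_nonzero by simp
  then show ?thesis unfolding msubst_def mcoeff_Abs by (simp add: mcoeff_1 mdeg_e1)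
qed

lemma mcoeff_zsum_e1:
  assumes "finite T" shows "mcoeff (\<Sum>i\<in>T. zvar (z i)) (e1 v) = of_nat (card {i \<in> T. z i = Some v})"
proof -
  have inj: "e1 a = e1 b \<longleftrightarrow> a = b" for a b
    by (metis keys_single_one singleton_inject)
  have "mcoeff (zvar (z i)) (e1 v) = (if z i = Some v then 1 else 0)" for i
    using inj by (auto simp: zvar_def mvar_def split: option.splits)
  then have "mcoeff (\<Sum>i\<in>T. zvar (z i)) (e1 v) = (\<Sum>i\<in>T. if z i = Some v then 1 else 0)"
    by (simp add: mcoeff_sum)
  also have "... = of_nat (card {i \<in> T. z i = Some v})"
    using assms by (simp add: sum.If_cases Int_def)
  finally show ?thesis .
qed

text \<open>The coefficient of one variable is the energy of \<open>S\<close> times its multiplicity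
  in \<open>T\<close>, minus the energy of \<open>T\<close> times its multiplicity in
  \<open>S\<close>. Under the sign conditions neither contribution is negative and one is
  positive.\<close>

lemma mcoeff_cvs_e1_pos:
  assumes f: "finite S" "finite T"
    and s: "sum p S > 0 & v \<in> vars z T & (sum p T <= 0 | bare z S) | sum p T < 0 & v \<in> vars z S & (sum p S >= 0 | bare z T)"
  shows "mcoeff (cvs p z S T) (e1 v) > 0"
proof -
  let ?c = "%T. real (card {i \<in> T. z i = Some v})"
  have vf: "vfree (mconst (of_int (sum p S)) * (\<Sum>i\<in>T. zvar (z i)) - mconst (of_int (sum p T)) * (\<Sum>i\<in>S. zvar (z i)))"
    by (simp add: vfree_sum)
  have c: "mcoeff (cvs p z S T) (e1 v) = of_int (sum p S) * ?c T - of_int (sum p T) * ?c S"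
    unfolding cvs_def slet_def fst_conv snd_conv vs_def mcoeff_msubst_e1[OF vf]
    by (simp only: mcoeff_diff mcoeff_mconst_mult mcoeff_zsum_e1 f) (simp add: fps_nth_varsigma)
  have b: "bare z T ==> ?c T = 0" for T by (auto simp: bare_def card_eq_0_iff)
  have v: "v \<in> vars z T ==> finite T ==> ?c T > 0" for T by (auto simp: vars_def card_gt_0_iff)
  have *: "of_int a * x - of_int b * y > (0::real)"
    if "a > 0 & x > 0 & (b <= 0 | y = 0) | b < 0 & y > 0 & (a >= 0 | x = 0)" "x >= 0" "y >= 0" for a b :: int and x y
  proof -
    have p1: "of_int a * x > 0" if "a > 0" "x > 0" using that by simp
    have p2: "of_int b * y < 0" if "b < 0" "y > 0" using that by (simp add: mult_neg_pos)
    have p3: "of_int b * y <= 0" if "b <= 0" using that \<open>y >= 0\<close> by (simp add: mult_nonpos_nonneg)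
    have p4: "of_int a * x >= 0" if "a >= 0" using that \<open>x >= 0\<close> by simp
    from that(1) show ?thesis
    proof
      assume "a > 0 & x > 0 & (b <= 0 | y = 0)"
      then have "of_int a * x > 0" "of_int b * y <= 0" using p1 p3 by auto
      then show ?thesis by linarith
    next
      assume "b < 0 & y > 0 & (a >= 0 | x = 0)"
      then have "of_int b * y < 0" "of_int a * x >= 0" using p2 p4 by auto
      then show ?thesis by linarith
    qed
  qed
  show ?thesis unfolding c
    by (rule *) (use s f v[of T] v[of S] b[of T] b[of S] in auto)
qed

lemma mcoeff_mult_pos:
  assumes "nonneg f" "nonneg g" "mcoeff f a > 0" "mcoeff g b > 0"
  shows "mcoeff (f * g) (a + b) > 0"
proof -
  have "0 < mcoeff f a * mcoeff g b" using assms by simp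
  also have "... = (%(a, b). mcoeff f a * mcoeff g b) (a, b)" by simp
  also have "... <= mcoeff (f * g) (a + b)"
    unfolding mcoeff_mult
    by (rule member_le_sum) (use assms finite_splits in \<open>auto simp: nonneg_def\<close>)
  finally show ?thesis .
qed

lemma mcoeff_zsum_power_pos:
  assumes "finite T" "keys m \<subseteq> vars z T" "mdeg m = n"
  shows "mcoeff ((\<Sum>i\<in>T. zvar (z i)) ^ n) m > 0"
  using assms(2,3)
proof (induction n arbitrary: m)
  case 0
  then show ?case by (simp add: mdeg_eq_0_iff mcoeff_1)
next
  case (Suc n)
  have "keys m ~= {}" using Suc.prems(2) by (auto simp: mdeg_def)
  then obtain v where v: "v \<in> keys m" by blast
  define m' where "m' = m - e1 v"
  have le: "lookup m v >= 1" using v by (simp add: in_keys_iff)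
  have m: "m = e1 v + m'"
    unfolding m'_def using le by (intro poly_mapping_eqI) (auto simp: lookup_add lookup_minus lookup_single when_def)
  have "keys m' \<subseteq> keys m" unfolding m by (auto simp: in_keys_iff lookup_add)
  moreover have "mdeg m' = n" using Suc.prems(2) unfolding m by (simp add: mdeg_add mdeg_e1)
  ultimately have "mcoeff ((\<Sum>i\<in>T. zvar (z i)) ^ n) m' > 0" using Suc by blast
  moreover have "mcoeff (\<Sum>i\<in>T. zvar (z i)) (e1 v) > 0"
    unfolding mcoeff_zsum_e1[OF assms(1)] using v Suc.prems assms(1) by (auto simp: vars_def card_gt_0_iff)
  ultimately show ?case unfolding m power_Suc
    by (intro mcoeff_mult_pos nonneg_power nonneg_zsum)
qed

lemma mcoeff_rat_pos:
  assumes "a >= 2" "finite T" "keys m \<subseteq> vars z T" "even (mdeg m)"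
  shows "mcoeff (rat a (\<Sum>i\<in>T. zvar (z i))) m > 0"
proof -
  let ?f = "%n. fps_nth (varsigma (of_int a) / varsigma 1) n * mcoeff ((\<Sum>i\<in>T. zvar (z i)) ^ n) m"
  have "0 < ?f (mdeg m)"
    using fps_nth_quotient_pos[OF assms(1,4)] mcoeff_zsum_power_pos[OF assms(2,3) refl] by simp
  also have "... <= (\<Sum>n\<le>mdeg m. ?f n)"
    by (rule member_le_sum)
       (use assms(1) nonneg_power[OF nonneg_zsum] in \<open>auto simp: nonneg_def intro!: mult_nonneg_nonneg fps_nth_quotient_nonneg\<close>)
  finally show ?thesis by (simp add: rat_def msubst_def)
qed

definition mle :: "real mfps => real mfps => bool" where "mle f g \<longleftrightarrow> (\<forall>m. mcoeff f m <= mcoeff g m)"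

text \<open>A functional on the words that exhaust \<open>X\<close> all of whose coefficients are bounded below by those
  obtained from the commutation rules after dropping central terms.\<close>

locale posfun =
  fixes X :: "'i set" and z :: "'i => nat option" and p :: "'i => int" and \<Phi> :: "'i set list => real mfps"
  assumes nn: "\<And>w. dword w ==> \<Union>(set w) = X ==> nonneg (\<Phi> w)"
    and exch: "\<And>w1 S T w2. dword (w1 @ S # T # w2) ==> \<Union>(set (w1 @ S # T # w2)) = X ==>
      sum p S >= 0 | sum p T <= 0 ==>
      mle (\<Phi> (w1 @ T # S # w2) + cvs p z S T * \<Phi> (w1 @ (S \<union> T) # w2)) (\<Phi> (w1 @ S # T # w2))"
begin

definition dom :: "'i set list => bool" where "dom w \<longleftrightarrow> dword w & \<Union>(set w) = X"

lemma dom_swap: "dom (w1 @ S # T # w2) \<longleftrightarrow> dom (w1 @ T # S # w2)"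
  unfolding dom_def by (auto dest: dword_swap)
lemma dom_merge: "dom (w1 @ S # T # w2) ==> dom (w1 @ (S \<union> T) # w2)"
  unfolding dom_def by (auto dest: dword_merge)

definition pos :: "'i set list => (nat \<Rightarrow>\<^sub>0 nat) => bool" where "pos w m \<longleftrightarrow> mcoeff (\<Phi> w) m > 0"

lemma pos_swap:
  assumes "dom (w1 @ S # T # w2)" "bare z S & sum p S >= 0 | bare z T & sum p T <= 0" "pos (w1 @ T # S # w2) m"
  shows "pos (w1 @ S # T # w2) m"
proof -
  have "nonneg (cvs p z S T * \<Phi> (w1 @ (S \<union> T) # w2))"
    using assms dom_merge[OF assms(1)] by (intro nonneg_mult nonneg_cvs nn) (auto simp: dom_def)
  then show ?thesis using exch[of w1 S T w2] assms unfolding mle_def dom_def pos_def nonneg_def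
    by (smt (verit, best) mcoeff_add)
qed

lemma pos_merge:
  assumes d: "dom (w1 @ S # T # w2)" and m: "pos (w1 @ (S \<union> T) # w2) m"
    and s: "sum p S > 0 & v \<in> vars z T & (sum p T <= 0 | bare z S) | sum p T < 0 & v \<in> vars z S & (sum p S >= 0 | bare z T)"
  shows "pos (w1 @ S # T # w2) (m + e1 v)"
proof -
  have f: "finite S" "finite T" using d by (auto simp: dom_def dword_append)
  have 1: "nonneg (\<Phi> (w1 @ T # S # w2))" "nonneg (\<Phi> (w1 @ (S \<union> T) # w2))"
    using d dom_swap dom_merge by (auto simp: dom_def intro!: nn dest: dword_swap dword_merge)
  have 2: "nonneg (cvs p z S T)" by (rule nonneg_cvs) (use s in auto)
  have "mcoeff (cvs p z S T * \<Phi> (w1 @ (S \<union> T) # w2)) (e1 v + m) > 0"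
    using mcoeff_mult_pos[OF 2 1(2) mcoeff_cvs_e1_pos[OF f s]] m by (simp add: pos_def)
  moreover have "mle (\<Phi> (w1 @ T # S # w2) + cvs p z S T * \<Phi> (w1 @ (S \<union> T) # w2)) (\<Phi> (w1 @ S # T # w2))"
    by (rule exch) (use d s in \<open>auto simp: dom_def\<close>)
  ultimately show ?thesis using 1(1) unfolding mle_def pos_def nonneg_def
    by (smt (verit, best) mcoeff_add add.commute)
qed

lemma pos_move_right:
  assumes "dom (w1 @ S # v @ w2)" "bare z S" "sum p S >= 0" "pos (w1 @ v @ S # w2) m"
  shows "pos (w1 @ S # v @ w2) m"
  using assms(1,4)
proof (induction v arbitrary: w1)
  case (Cons T v)
  have "dom ((w1 @ [T]) @ S # v @ w2)" using Cons.prems(1) dom_swap[of w1 S T] by simp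
  then have "pos ((w1 @ [T]) @ S # v @ w2) m" by (rule Cons.IH) (use Cons.prems in simp)
  then show ?case using pos_swap[of w1 S T "v @ w2"] Cons.prems(1) assms(2,3) by simp
qed simp

lemma pos_move_left:
  assumes "dom (w1 @ v @ T # w2)" "bare z T" "sum p T <= 0" "pos (w1 @ T # v @ w2) m"
  shows "pos (w1 @ v @ T # w2) m"
  using assms(1,4)
proof (induction v arbitrary: w2 rule: rev_induct)
  case (snoc S v)
  have "dom (w1 @ v @ T # S # w2)" using snoc.prems(1) dom_swap[of "w1 @ v" S T w2] by simp
  then have "pos (w1 @ v @ T # S # w2) m" by (rule snoc.IH) (use snoc.prems in simp)
  then show ?case using pos_swap[of "w1 @ v" S T w2] snoc.prems(1) assms(2,3) by simp
qed simp

lemma dom_move: "dom (w1 @ S # v @ w2) \<longleftrightarrow> dom (w1 @ v @ S # w2)"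
proof (induction v arbitrary: w1)
  case (Cons T v)
  then show ?case using dom_swap[of w1 S T "v @ w2"] Cons[of "w1 @ [T]"] by simp
qed simp

lemma pos_absorb_right:
  assumes d: "dom (w1 @ S # v @ T # w2)" and b: "bare z S" "sum p S > 0" and m: "pos (w1 @ v @ (S \<union> T) # w2) m"
    and x: "x \<in> vars z T"
  shows "pos (w1 @ S # v @ T # w2) (m + e1 x)"
proof -
  have d': "dom ((w1 @ v) @ S # T # w2)" using d dom_move[of w1 S v "T # w2"] by simp
  have "pos ((w1 @ v) @ S # T # w2) (m + e1 x)"
    by (rule pos_merge[OF d']) (use m b x in auto)
  then show ?thesis using pos_move_right[OF d b(1)] b(2) by simp
qed

lemma pos_absorb_left:
  assumes d: "dom (w1 @ S # v @ T # w2)" and b: "bare z T" "sum p T < 0" and m: "pos (w1 @ (S \<union> T) # v @ w2) m"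
    and x: "x \<in> vars z S"
  shows "pos (w1 @ S # v @ T # w2) (m + e1 x)"
proof -
  have d': "dom (w1 @ S # T # v @ w2)" using d dom_move[of "w1 @ [S]" T v w2] by simp
  have "pos (w1 @ S # T # v @ w2) (m + e1 x)"
    by (rule pos_merge[OF d']) (use m b x in auto)
  then show ?thesis using pos_move_left[of "w1 @ [S]" v T w2] d b by simp
qed

end

section \<open>Contracting a path\<close>

text \<open>The first list is the path, the second a rearrangement of its letters. Every merger
  joins neighbours of both lists; in the rearrangement the letter with positive sum stands on the
  left, which gives the merger a coefficient series without negative coefficients.\<close>

inductive path_ord :: "('i => int) => 'i set list => 'i set list => bool" for r where
  single: "path_ord r [T] [T]"
| merge: "path_ord r (a @ (T \<union> T') # b) (c @ (T \<union> T') # d) ==> sum r T > 0 ==> sum r T' < 0 ==>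
    mset (a @ (T \<union> T') # b) = mset (c @ (T \<union> T') # d) ==> V = T & V' = T' | V = T' & V' = T ==>
    path_ord r (a @ V # V' # b) (c @ T # T' # d)"

lemma path_ord_mset: "path_ord r L w ==> mset w = mset L"
  by (induction rule: path_ord.induct) auto

lemma adjacent_opposite:
  fixes f :: "'l => int"
  assumes "\<And>x. x \<in> set L ==> f x ~= 0" "\<exists>x\<in>set L. f x > 0" "\<exists>x\<in>set L. f x < 0"
  shows "\<exists>a x y b. L = a @ x # y # b & (f x > 0 & f y < 0 | f x < 0 & f y > 0)"
  using assms
proof (induction L)
  case (Cons x L)
  then obtain y L' where L: "L = y # L'" by (cases L) auto
  show ?case
  proof (cases "f x > 0 & f y < 0 | f x < 0 & f y > 0")
    case True
    then show ?thesis unfolding L by (intro exI[of _ "[]"]) auto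
  next
    case False
    have "f x ~= 0" "f y ~= 0" using Cons.prems(1) L by auto
    then have "f x > 0 & f y > 0 | f x < 0 & f y < 0" using False by linarith
    then have "\<exists>x\<in>set L. f x > 0" "\<exists>x\<in>set L. f x < 0" using Cons.prems(2,3) L by auto
    then obtain a u v b where "L = a @ u # v # b" "f u > 0 & f v < 0 | f u < 0 & f v > 0"
      using Cons.IH Cons.prems(1) by auto
    then show ?thesis by (intro exI[of _ "x # a"]) auto
  qed
qed simp

text \<open>No proper union of letters is balanced, so no letter that arises on the way has sum
  zero, except the last. As the total is zero, some two neighbours have opposite signs and can be
  merged.\<close>

lemma path_ord_exists:
  assumes "dword L" "L ~= []" "sum r (\<Union>(set L)) = 0"
    and "\<And>T. T \<subset> \<Union>(set L) ==> T ~= {} ==> (\<exists>A\<subseteq>set L. T = \<Union>A) ==> sum r T ~= 0"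
  shows "\<exists>w. path_ord r L w"
  using assms
proof (induction "length L" arbitrary: L rule: less_induct)
  case less
  show ?case
  proof (cases "length L = 1")
    case True
    then obtain T where "L = [T]" by (auto simp: length_Suc_conv)
    then show ?thesis using path_ord.single by blast
  next
    case False
    then have len: "length L >= 2" using less.prems(2) by (cases L) (auto simp: Suc_le_eq)
    have nz: "sum r T ~= 0" if T: "T \<in> set L" for T
    proof (rule less.prems(4))
      obtain a b where L: "L = a @ T # b" using split_list[OF T] by blast
      have "a @ b ~= []" using len L by auto
      then obtain V where V: "V \<in> set (a @ b)" by (metis list.set_intros(1) neq_Nil_conv)
      obtain c d where cd: "a @ b = c @ V # d" using split_list[OF V] by blast
      have "dword (a @ b)" "V \<inter> T = {}" using less.prems(1) V unfolding L by (auto simp: dword_append)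
      then have "V ~= {}" unfolding cd by (auto simp: dword_append)
      then show "T \<subset> \<Union>(set L)" using V L \<open>V \<inter> T = {}\<close> by auto
      show "T ~= {}" using less.prems(1) L by (auto simp: dword_append)
      show "\<exists>A\<subseteq>set L. T = \<Union>A" using T by (intro exI[of _ "{T}"]) auto
    qed
    have sum0: "(\<Sum>T\<leftarrow>L. sum r T) = 0" using dword_sum[OF less.prems(1), of r] less.prems(3) by simp
    have ex_pos: "\<exists>T\<in>set L. sum r T > 0" if s: "(\<Sum>T\<leftarrow>L. sum r T) = 0"
      and nzz: "\<And>T. T \<in> set L ==> sum r T ~= 0" for r :: "'a => int"
    proof (rule ccontr)
      assume "~ ?thesis"
      then have n: "\<And>T. T \<in> set L ==> sum r T < 0" using nzz by (meson linorder_neqE_linordered_idom)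
      have "(\<Sum>T\<leftarrow>L'. sum r T) < 0" if "L' ~= []" "set L' \<subseteq> set L" for L'
        using that by (induction L' rule: list_nonempty_induct) (auto simp: n add_neg_neg)
      from this[OF less.prems(2) subset_refl] show False using s by simp
    qed
    have "\<exists>T\<in>set L. sum r T > 0" by (rule ex_pos[OF sum0 nz])
    moreover have "\<exists>T\<in>set L. sum r T < 0"
    proof -
      have "(\<Sum>T\<leftarrow>L. sum (%i. - r i) T) = 0" using sum0 by (simp add: sum_negf uminus_sum_list_map[symmetric, unfolded o_def])
      then have "\<exists>T\<in>set L. sum (%i. - r i) T > 0" by (rule ex_pos) (use nz in \<open>simp add: sum_negf\<close>)
      then show ?thesis by (simp add: sum_negf)
    qed
    ultimately obtain a T T' b where L: "L = a @ T # T' # b"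
      and s: "sum r T > 0 & sum r T' < 0 | sum r T < 0 & sum r T' > 0"
      using adjacent_opposite[of L "sum r"] nz by blast
    let ?L = "a @ (T \<union> T') # b"
    have U: "\<Union>(set ?L) = \<Union>(set L)" unfolding L by auto
    have "\<exists>w. path_ord r ?L w"
    proof (rule less.hyps)
      show "length ?L < length L" by (simp add: L)
      show "dword ?L" using less.prems(1) dword_merge unfolding L by blast
      show "?L ~= []" by simp
      show "sum r (\<Union>(set ?L)) = 0" unfolding U by (rule less.prems(3))
      fix V assume "V \<subset> \<Union>(set ?L)" "V ~= {}" "\<exists>A\<subseteq>set ?L. V = \<Union>A"
      moreover from this obtain A where A: "A \<subseteq> set ?L" "V = \<Union>A" by blast
      then have "\<exists>B\<subseteq>set L. V = \<Union>B"
      proof (cases "T \<union> T' \<in> A")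
        case True
        then show ?thesis using A unfolding L by (intro exI[of _ "(A - {T \<union> T'}) \<union> {T, T'}"]) auto
      next
        case False
        then show ?thesis using A unfolding L by (intro exI[of _ A]) auto
      qed
      ultimately show "sum r V ~= 0" using less.prems(4) U by simp
    qed
    then obtain w where w: "path_ord r ?L w" by blast
    have ms: "mset w = mset ?L" by (rule path_ord_mset[OF w])
    then have "T \<union> T' \<in> set w" using mset_eq_setD[OF ms] by simp
    then obtain c d where wd: "w = c @ (T \<union> T') # d" using split_list by metis
    from s show ?thesis
    proof
      assume "sum r T > 0 & sum r T' < 0"
      then show ?thesis using path_ord.merge[of r a T T' b c d T T'] w ms unfolding wd L by auto
    next
      assume "sum r T < 0 & sum r T' > 0"
      then show ?thesis using path_ord.merge[of r a T' T b c d T T'] w ms unfolding wd L Un_commute[of T T'] by auto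
    qed
  qed
qed

text \<open>Every inner vertex owns one variable. Merging two neighbours uses up one of the
  variables they own, so a path has been contracted to two letters exactly when all are used up;
  this is why the path of two letters is excluded.\<close>

lemma path_vars_step:
  assumes L: "a @ T # T' # b = T0 # Ls @ [Tl]" and v: "list_all2 (%T v. v \<in> vars z T) Ls ws"
    and ne: "~ (a = [] & b = [])"
  obtains T0' Ls' Tl' ws' v where "a @ (T \<union> T') # b = T0' # Ls' @ [Tl']"
    "list_all2 (%T v. v \<in> vars z T) Ls' ws'" "v \<in> vars z T | v \<in> vars z T'"
    "sum_list (map e1 ws) = sum_list (map e1 ws') + e1 v"
proof (cases b rule: rev_cases)
  case Nil
  with ne obtain a' where a: "a = T0 # a'" using L by (cases a) auto
  then have Ls: "Ls = a' @ [T]" "Tl = T'" using L Nil by auto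
  then obtain va vT where ws: "ws = va @ [vT]" "list_all2 (%T v. v \<in> vars z T) a' va" "vT \<in> vars z T"
    using v by (auto simp: list_all2_append1 list_all2_Cons1)
  show ?thesis
    by (rule that[of T0 a' "T \<union> T'" va vT]) (use a Nil ws in \<open>auto simp: ac_simps\<close>)
next
  case (snoc b' Tl')
  show ?thesis
  proof (cases a)
    case Nil
    then have Ls: "Ls = T' # b'" "Tl' = Tl" "T0 = T" using L snoc by auto
    then obtain v' vb where ws: "ws = v' # vb" "v' \<in> vars z T'" "list_all2 (%T v. v \<in> vars z T) b' vb"
      using v by (auto simp: list_all2_Cons1)
    show ?thesis
      by (rule that[of "T \<union> T'" b' Tl vb v']) (use Nil snoc Ls ws in \<open>auto simp: ac_simps\<close>)
  next
    case (Cons T0' a')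
    then have Ls: "Ls = a' @ T # T' # b'" "Tl' = Tl" "T0' = T0" using L snoc by auto
    then obtain va vT vT' vb where ws: "ws = va @ vT # vT' # vb" "list_all2 (%T v. v \<in> vars z T) a' va"
      "vT \<in> vars z T" "vT' \<in> vars z T'" "list_all2 (%T v. v \<in> vars z T) b' vb"
      using v by (auto simp: list_all2_append1 list_all2_Cons1)
    show ?thesis
      by (rule that[of T0 "a' @ (T \<union> T') # b'" Tl "va @ vT # vb" vT'])
         (use Cons snoc Ls ws in \<open>auto simp: ac_simps vars_def intro!: list_all2_appendI\<close>)
  qed
qed

lemma singleton_mset_split: "mset [x] = mset (c @ y # d) ==> c = [] & d = []"
  by (metis append_is_Nil_conv length_append_singleton length_Cons length_append list.size(3) mset_eq_length
      add_is_0 add_Suc_right length_0_conv nat.inject)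

context posfun
begin

text \<open>Read backwards, the construction of the path contracts the word to one positive and one
  negative letter, which \<open>base\<close> takes care of; each merger on the way multiplies by one
  variable.\<close>

theorem path_pos:
  assumes "path_ord r L w" "L = T0 # Ls @ [Tl]" "list_all2 (%T v. v \<in> vars z T) Ls ws"
    and "dom (pre @ w @ post)"
    and sgn: "\<And>T. T \<subseteq> X ==> (sum r T > 0 --> sum p T > 0) & (sum r T < 0 --> sum p T < 0)"
    and base: "\<And>A B. A \<union> B = \<Union>(set L) ==> sum r A > 0 ==> sum r B < 0 ==>
        dom (pre @ [A, B] @ post) ==> pos (pre @ [A, B] @ post) m"
  shows "pos (pre @ w @ post) (m + sum_list (map e1 ws))"
  using assms(1-4) base
proof (induction arbitrary: T0 Ls Tl ws rule: path_ord.induct)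
  case (single T)
  then show ?case by simp
next
  case (merge a T T' b c d V V')
  have d: "dom ((pre @ c) @ T # T' # (d @ post))" using merge.prems by simp
  then have X: "T \<subseteq> X" "T' \<subseteq> X" by (auto simp: dom_def)
  have s: "sum p T > 0" "sum p T' < 0" using sgn X merge.hyps by auto
  have VV: "V \<union> V' = T \<union> T'" using merge.hyps(5) by auto
  show ?case
  proof (cases "a = [] & b = []")
    case True
    then have "c = [] & d = []" using merge.hyps(4) singleton_mset_split by fastforce
    then show ?thesis using True merge.prems merge.hyps VV by auto
  next
    case False
    obtain T0' Ls' Tl' ws' v where st: "a @ (V \<union> V') # b = T0' # Ls' @ [Tl']"
      "list_all2 (%T v. v \<in> vars z T) Ls' ws'" "v \<in> vars z V | v \<in> vars z V'"
      "sum_list (map e1 ws) = sum_list (map e1 ws') + e1 v"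
      using path_vars_step[OF merge.prems(1,2) False] by metis
    have "pos (pre @ (c @ (T \<union> T') # d) @ post) (m + sum_list (map e1 ws'))"
    proof (rule merge.IH[OF st(1)[unfolded VV] st(2)])
      show "dom (pre @ (c @ (T \<union> T') # d) @ post)" using dom_merge[OF d] by simp
      fix A B assume "A \<union> B = \<Union>(set (a @ (T \<union> T') # b))" "sum r A > 0" "sum r B < 0" "dom (pre @ [A, B] @ post)"
      then show "pos (pre @ [A, B] @ post) m" using VV by (intro merge.prems(4)) auto
    qed
    then have "pos ((pre @ c) @ T # T' # (d @ post)) (m + sum_list (map e1 ws') + e1 v)"
      by (intro pos_merge[OF d]) (use s st(3) merge.hyps(5) in auto)
    then show ?thesis unfolding st(4) by (simp add: add.assoc)
  qed
qed

end

definition path_word :: "('i => nat option) => ('i => int) => 'i set list => nat list => bool" where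
  "path_word z r w ws \<longleftrightarrow> (\<exists>L T0 Ls Tl. path_ord r L w & L = T0 # Ls @ [Tl] & list_all2 (%T v. v \<in> vars z T) Ls ws)"

lemma (in posfun) path_word_pos:
  assumes "path_word z r w ws" "dom (pre @ w @ post)"
    and "\<And>T. T \<subseteq> X ==> (sum r T > 0 --> sum p T > 0) & (sum r T < 0 --> sum p T < 0)"
    and base: "\<And>A B. A \<union> B = \<Union>(set w) ==> sum r A > 0 ==> sum r B < 0 ==>
        dom (pre @ [A, B] @ post) ==> pos (pre @ [A, B] @ post) m"
  shows "pos (pre @ w @ post) (m + sum_list (map e1 ws))"
proof -
  obtain L T0 Ls Tl where L: "path_ord r L w" "L = T0 # Ls @ [Tl]" "list_all2 (%T v. v \<in> vars z T) Ls ws"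
    using assms(1) unfolding path_word_def by blast
  have "\<Union>(set L) = \<Union>(set w)" using mset_eq_setD[OF path_ord_mset[OF L(1)]] by simp
  then show ?thesis using base by (intro path_pos[OF L assms(2,3)]) auto
qed

definition rem :: "'i set => 'i set list => 'i set list" where
  "rem A V = filter (%T. T ~= {}) (map (%T. T - A) V)"

lemma rem_rem: "rem A (rem B V) = rem (B \<union> A) V"
  by (induction V) (auto simp: rem_def Diff_eq Int_assoc)

lemma rem_disjoint: "dword V ==> \<Union>(set V) \<inter> A = {} ==> rem A V = V"
  by (induction V) (auto simp: rem_def Diff_triv)

lemma rem_split:
  assumes "dword (v1 @ T # v2)" "x \<in> T"
  shows "rem {x} (v1 @ T # v2) = v1 @ (if T = {x} then [] else [T - {x}]) @ v2"
proof -
  have "rem {x} v1 = v1" "rem {x} v2 = v2"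
    by (rule rem_disjoint; use assms in \<open>auto simp: dword_append\<close>)+
  moreover have "rem {x} (v1 @ T # v2) = rem {x} v1 @ rem {x} [T] @ rem {x} v2" by (simp add: rem_def)
  moreover have "rem {x} [T] = (if T = {x} then [] else [T - {x}])" using assms(2) by (auto simp: rem_def)
  ultimately show ?thesis by simp
qed

lemma vars_Diff: "z x = None ==> vars z (T - {x}) = vars z T"
  by (auto simp: vars_def)

context posfun
begin

text \<open>The letter \<open>x\<close> sits next to a variable, and \<open>h x\<close> is such a
  variable: this is the price of taking \<open>x\<close> out of its letter by undoing a
  merger.\<close>

definition attached :: "'i set list => ('i => (nat \<Rightarrow>\<^sub>0 nat)) => 'i => bool" where
  "attached V h x \<longleftrightarrow> z x = None & (\<exists>T\<in>set V. x \<in> T & (\<exists>v\<in>vars z T. h x = e1 v))"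

lemma attached_rem:
  assumes "attached V h x" "y ~= x" "z y = None"
  shows "attached (rem {y} V) h x"
proof -
  obtain T v where T: "T \<in> set V" "x \<in> T" "v \<in> vars z T" "h x = e1 v" "z x = None"
    using assms(1) by (auto simp: attached_def)
  then have "T - {y} \<in> set (rem {y} V)" "x \<in> T - {y}" using assms(2) by (auto simp: rem_def)
  moreover have "v \<in> vars z (T - {y})" using T vars_Diff[of z y T] assms(3) by simp
  ultimately show ?thesis unfolding attached_def
    using T(4,5) by (intro conjI bexI[of _ "T - {y}"] bexI[of _ v]) auto
qed

lemma mem_rem_singleton: "{x} \<in> set V ==> y ~= x ==> {x} \<in> set (rem {y} V)"
  unfolding rem_def set_filter set_map by (intro CollectI conjI image_eqI[of _ _ "{x}"]) auto

lemma attached_or_rem: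
  assumes "attached V h x | {x} \<in> set V & h x = 0 & z x = None" "y ~= x" "z y = None"
  shows "attached (rem {y} V) h x | {x} \<in> set (rem {y} V) & h x = 0 & z x = None"
  using assms(1) attached_rem[OF _ assms(2,3)] mem_rem_singleton[OF _ assms(2)] by blast

lemma dom_cong:
  assumes "dom (pre @ V @ post)" "dword V'" "\<Union>(set V') = \<Union>(set V)"
  shows "dom (pre @ V' @ post)"
proof -
  have "dword (pre @ V' @ post)"
    using assms unfolding dom_def dword_append set_append Union_Un_distrib by simp
  moreover have "\<Union>(set (pre @ V' @ post)) = X"
    using assms unfolding dom_def set_append Union_Un_distrib by simp
  ultimately show ?thesis by (simp add: dom_def)
qed

lemma assemble_x_step:
  assumes m: "pos (pre @ V) m" and d: "dom (pre @ V)" and x: "p x > 0"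
    and a: "attached V h x | {x} \<in> set V & h x = 0 & z x = None"
  shows "pos (pre @ {x} # rem {x} V) (m + h x) & dom (pre @ {x} # rem {x} V)"
proof -
  obtain T where T: "T \<in> set V" "x \<in> T" "T = {x} & h x = 0 | (\<exists>v\<in>vars z T. h x = e1 v)" and zx: "z x = None"
    using a by (auto simp: attached_def)
  obtain v1 v2 where V: "V = v1 @ T # v2" using split_list[OF T(1)] by blast
  have dV: "dword (v1 @ T # v2)" using d by (auto simp: V dom_def dword_append)
  have b: "bare z {x}" using zx by (simp add: bare_def)
  show ?thesis
  proof (cases "T = {x}")
    case True
    then have "vars z T = {}" using zx by (simp add: vars_def)
    then have h: "h x = 0" using T(3) by auto
    have r: "rem {x} V = v1 @ v2" unfolding V rem_split[OF dV T(2)] using True by simp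
    have "dom (pre @ {x} # v1 @ v2)" using d dom_move[of pre "{x}" v1 v2] True V by simp
    then show ?thesis using pos_move_right[of pre "{x}" v1 v2 m] b x m True V h r by simp
  next
    case False
    then obtain v where v: "v \<in> vars z T" "h x = e1 v" using T(3) by auto
    have r: "rem {x} V = v1 @ (T - {x}) # v2" unfolding V rem_split[OF dV T(2)] using False by simp
    have "dword (v1 @ {x} # (T - {x}) # v2)" using dV T(2) False by (auto simp: dword_append)
    moreover have "\<Union>(set (v1 @ {x} # (T - {x}) # v2)) = \<Union>(set V)" using T(2) unfolding V by auto
    ultimately have "dom (pre @ (v1 @ {x} # (T - {x}) # v2) @ [])"
      by (rule dom_cong[of pre V "[]", rotated]) (use d in simp)
    then have "dom ((pre @ v1) @ {x} # (T - {x}) # v2)" by simp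
    then have d': "dom (pre @ {x} # v1 @ (T - {x}) # v2)" using dom_move[of pre "{x}" v1 "(T - {x}) # v2"] by simp
    have "pos (pre @ {x} # v1 @ (T - {x}) # v2) (m + e1 v)"
    proof (rule pos_absorb_right[OF d' b])
      have "{x} \<union> (T - {x}) = T" using T(2) by blast
      then show "pos (pre @ v1 @ ({x} \<union> (T - {x})) # v2) m" using m V by simp
    qed (use x v vars_Diff[of z x T] zx in auto)
    then show ?thesis using r v d' by simp
  qed
qed

lemma assemble_x:
  assumes "pos (pre @ V) m" "dom (pre @ V)" "distinct xs" "\<And>x. x \<in> set xs ==> p x > 0"
    and "\<And>x. x \<in> set xs ==> attached V h x | {x} \<in> set V & h x = 0 & z x = None"
  shows "pos (pre @ map (%x. {x}) xs @ rem (set xs) V) (m + sum_list (map h xs)) \<and>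
    dom (pre @ map (%x. {x}) xs @ rem (set xs) V)"
  using assms
proof (induction xs arbitrary: pre V m)
  case Nil
  have "dword V" using Nil by (simp add: dom_def dword_append)
  then have "rem {} V = V" by (intro rem_disjoint) auto
  then show ?case using Nil by simp
next
  case (Cons x xs)
  have step: "pos (pre @ {x} # rem {x} V) (m + h x) & dom (pre @ {x} # rem {x} V)"
    by (rule assemble_x_step) (use Cons.prems in auto)
  have zx: "z x = None" using Cons.prems(5)[of x] by (auto simp: attached_def)
  have "pos ((pre @ [{x}]) @ map (%x. {x}) xs @ rem (set xs) (rem {x} V)) (m + h x + sum_list (map h xs)) \<and>
    dom ((pre @ [{x}]) @ map (%x. {x}) xs @ rem (set xs) (rem {x} V))"
  proof (rule Cons.IH)
    fix y assume y: "y \<in> set xs"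
    then have "y ~= x" using Cons.prems(3) by auto
    then show "attached (rem {x} V) h y | {y} \<in> set (rem {x} V) & h y = 0 & z y = None"
      using attached_or_rem[OF Cons.prems(5)[of y], of x] y zx by simp
  qed (use step Cons.prems in auto)
  then show ?case by (simp add: rem_rem add.assoc)
qed

lemma assemble_y_step:
  assumes m: "pos (V @ post) m" and d: "dom (V @ post)" and x: "p x < 0" and a: "attached V h x"
  shows "pos (rem {x} V @ {x} # post) (m + h x) & dom (rem {x} V @ {x} # post)"
proof -
  obtain T v where T: "T \<in> set V" "x \<in> T" and v: "v \<in> vars z T" "h x = e1 v" and zx: "z x = None"
    using a by (auto simp: attached_def)
  obtain v1 v2 where V: "V = v1 @ T # v2" using split_list[OF T(1)] by blast
  have dV: "dword (v1 @ T # v2)" using d by (auto simp: V dom_def dword_append)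
  have b: "bare z {x}" using zx by (simp add: bare_def)
  have F: "T ~= {x}" using v zx by (auto simp: vars_def)
  have r: "rem {x} V = v1 @ (T - {x}) # v2" unfolding V rem_split[OF dV T(2)] using F by simp
  have "dword (v1 @ (T - {x}) # {x} # v2)" using dV T(2) F by (auto simp: dword_append)
  moreover have "\<Union>(set (v1 @ (T - {x}) # {x} # v2)) = \<Union>(set V)" using T(2) unfolding V by auto
  ultimately have "dom ([] @ (v1 @ (T - {x}) # {x} # v2) @ post)"
    by (rule dom_cong[of "[]" V post, rotated]) (use d in simp)
  then have "dom (v1 @ (T - {x}) # {x} # v2 @ post)" by simp
  then have d': "dom (v1 @ (T - {x}) # v2 @ {x} # post)" using dom_move[of "v1 @ [T - {x}]" "{x}" v2 post] by simp
  have "pos (v1 @ (T - {x}) # v2 @ {x} # post) (m + e1 v)"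
  proof (rule pos_absorb_left[OF d' b])
    have "(T - {x}) \<union> {x} = T" using T(2) by blast
    then show "pos (v1 @ ((T - {x}) \<union> {x}) # v2 @ post) m" using m V by simp
  qed (use x v vars_Diff[of z x T] zx in auto)
  then show ?thesis using r v d' by simp
qed

lemma assemble_y:
  assumes "pos (V @ post) m" "dom (V @ post)" "distinct ys" "\<And>y. y \<in> set ys ==> p y < 0"
    and "\<And>y. y \<in> set ys ==> attached V h y"
  shows "pos (rem (set ys) V @ map (%y. {y}) ys @ post) (m + sum_list (map h ys)) \<and>
    dom (rem (set ys) V @ map (%y. {y}) ys @ post)"
  using assms
proof (induction ys arbitrary: post V m rule: rev_induct)
  case Nil
  have "dword V" using Nil by (simp add: dom_def dword_append)
  then have "rem {} V = V" by (intro rem_disjoint) auto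
  then show ?case using Nil by simp
next
  case (snoc y ys)
  have step: "pos (rem {y} V @ {y} # post) (m + h y) & dom (rem {y} V @ {y} # post)"
    by (rule assemble_y_step) (use snoc.prems in auto)
  have zy: "z y = None" using snoc.prems(5)[of y] by (auto simp: attached_def)
  have "pos (rem (set ys) (rem {y} V) @ map (%x. {x}) ys @ {y} # post) (m + h y + sum_list (map h ys)) \<and>
    dom (rem (set ys) (rem {y} V) @ map (%x. {x}) ys @ {y} # post)"
  proof (rule snoc.IH)
    fix x assume x: "x \<in> set ys"
    then have "y ~= x" using snoc.prems(3) by auto
    then show "attached (rem {y} V) h x" using snoc.prems(5)[of x] x attached_rem[of V h x y] zy by auto
  qed (use step snoc.prems in auto)
  then show ?case by (simp add: rem_rem ac_simps)
qed

text \<open>The word of singletons is bounded below by the word in which the letters of \<open>ys\<close> and all but the isolated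
  letters of \<open>xs\<close> have been merged into the remaining letters.\<close>

theorem assemble:
  assumes "pos V m" "dom V" "distinct xs" "distinct ys" "set xs \<inter> set ys = {}"
    and "\<And>x. x \<in> set xs ==> p x > 0" "\<And>y. y \<in> set ys ==> p y < 0"
    and "\<And>x. x \<in> set xs ==> attached V h x | {x} \<in> set V & h x = 0 & z x = None"
    and "\<And>y. y \<in> set ys ==> attached V h y"
  shows "pos (map (%x. {x}) xs @ rem (set xs \<union> set ys) V @ map (%y. {y}) ys) (m + sum_list (map h xs) + sum_list (map h ys))"
proof -
  have y: "pos (rem (set ys) V @ map (%y. {y}) ys @ []) (m + sum_list (map h ys)) \<and>
    dom (rem (set ys) V @ map (%y. {y}) ys @ [])"
    by (rule assemble_y) (use assms in auto)
  let ?V = "rem (set ys) V @ map (%y. {y}) ys"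
  have "pos ([] @ map (%x. {x}) xs @ rem (set xs) ?V) (m + sum_list (map h ys) + sum_list (map h xs)) \<and>
    dom ([] @ map (%x. {x}) xs @ rem (set xs) ?V)"
  proof (rule assemble_x)
    fix x assume x: "x \<in> set xs"
    have "attached (rem (set ys') V) h x | {x} \<in> set (rem (set ys') V) & h x = 0 & z x = None" if "set ys' \<subseteq> set ys" for ys'
      using that
    proof (induction ys')
      case Nil
      have "rem {} V = V" by (rule rem_disjoint) (use assms(2) in \<open>auto simp: dom_def\<close>)
      then show ?case using assms(8)[OF x] by simp
    next
      case (Cons y ys')
      have "y ~= x" "z y = None" using Cons.prems x assms(5) assms(9)[of y] by (auto simp: attached_def)
      moreover have "rem (set (y # ys')) V = rem {y} (rem (set ys') V)" by (simp add: rem_rem)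
      moreover have "attached (rem (set ys') V) h x | {x} \<in> set (rem (set ys') V) & h x = 0 & z x = None"
        using Cons by simp
      ultimately show ?case using attached_or_rem by metis
    qed
    from this[of ys] show "attached ?V h x | {x} \<in> set ?V & h x = 0 & z x = None"
      by (auto simp: attached_def)
  qed (use y assms in auto)
  moreover have "rem (set xs) ?V = rem (set xs \<union> set ys) V @ map (%y. {y}) ys"
  proof -
    have "rem (set xs) (map (%y. {y}) ys) = map (%y. {y}) ys"
      using assms(5) by (induction ys) (auto simp: rem_def)
    moreover have "rem (set xs) ?V = rem (set xs) (rem (set ys) V) @ rem (set xs) (map (%y. {y}) ys)" by (simp add: rem_def)
    ultimately show ?thesis by (simp add: rem_rem Un_commute)
  qed
  ultimately show ?thesis by (simp add: ac_simps)
qed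

end

section \<open>Three functionals with positive coefficients\<close>

abbreviation zero_dir :: "'i => int" where "zero_dir \<equiv> %_. 0"

lemma spos_zero_dir [simp]: "lpos (0, a) \<longleftrightarrow> a > 0" "lneg (0, a) \<longleftrightarrow> a < 0"
  by (auto simp: lpos_def lneg_def)

text \<open>In the sorting, a positive letter on the left meets one on the right that is not
  positive; both the coefficient of the merger and that of the central term are then
  nonnegative.\<close>

theorem nonneg_static: "dword w ==> nonneg (Rw zero_dir p z w)"
proof (induction w rule: word_induct[where pos = "%T. sum p T > 0" and mg = "(\<union>)"])
  case Nil
  then show ?case by (simp add: Rw_Nil nonneg_1)
next
  case (first T w)
  then show ?case using Rw_first[of zero_dir T p z w] by simp
next
  case (last T w)
  then show ?case using Rw_last[of zero_dir T p z w] by simp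
next
  case (swap w1 S T w2)
  have "nonneg (cvs p z S T * Rw zero_dir p z (w1 @ (S \<union> T) # w2))"
    using swap dword_merge by (intro nonneg_mult nonneg_cvs) auto
  moreover have "nonneg ((if null zero_dir p (S \<union> T) then crat p z S T else 0) * Rw zero_dir p z (w1 @ w2))"
    using swap dword_drop by (intro nonneg_mult) (auto intro: nonneg_crat)
  moreover have "nonneg (Rw zero_dir p z (w1 @ T # S # w2))" using swap dword_swap by blast
  ultimately show ?case unfolding Rw_swap[OF swap(6)] by (intro nonneg_add)
qed

lemma dword_sum_Un: "dword (w1 @ S # T # w2) ==> sum f (S \<union> T) = sum f S + sum f T"
  by (intro sum.union_disjoint) (auto simp: dword_append)

lemma central_nonneg:
  assumes d: "dword (w1 @ S # T # w2)" and s: "sum p S >= 0 | sum p T <= 0"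
  shows "nonneg ((if null zero_dir p (S \<union> T) then crat p z S T else 0) * Rw zero_dir p z (w1 @ w2))"
proof (cases "null zero_dir p (S \<union> T)")
  case True
  have "sum p (S \<union> T) = sum p S + sum p T" using d by (intro sum.union_disjoint) (auto simp: dword_append)
  moreover have "sum p (S \<union> T) = 0" using True by (simp add: null_def)
  ultimately have "sum p S >= 0" using s by linarith
  then show ?thesis using nonneg_static dword_drop[OF d] by (intro nonneg_mult) (auto intro: nonneg_crat)
qed simp

lemma posfun_static: "posfun X z p (Rw zero_dir p z)"
proof
  fix w1 S T w2 assume d: "dword (w1 @ S # T # w2)" and s: "sum p S >= 0 | sum p T <= 0"
  show "mle (Rw zero_dir p z (w1 @ T # S # w2) + cvs p z S T * Rw zero_dir p z (w1 @ (S \<union> T) # w2)) (Rw zero_dir p z (w1 @ S # T # w2))"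
    unfolding Rw_swap[OF d] using central_nonneg[OF d s] by (simp add: mle_def nonneg_def)
qed (rule nonneg_static)

text \<open>What the expectation at the point has in addition to the regularised one: central terms
  of proper parts of energy zero, which the direction no longer regards as zero. If the point and
  the direction belong to a chamber with a polynomial, its coefficient at the final monomial must
  vanish.\<close>

definition excess :: "('i => int) => ('i => int) => ('i => nat option) => 'i set list => real mfps" where
  "excess q p z w = Rw zero_dir p z w - Rw q p z w"

text \<open>In the application \<open>q\<close> is a generic vector plus a large multiple of
  \<open>p\<close>. It decides every part of energy zero and leaves the other signs
  unchanged.\<close>

definition generic :: "'i set => ('i => int) => ('i => int) => bool" where
  "generic X q p \<longleftrightarrow> sum q X = 0 & sum p X = 0 \<and>
     (\<forall>T\<subseteq>X. T ~= {} --> T ~= X --> spos q p T & sum p T >= 0 | sneg q p T & sum p T <= 0)"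

lemma excess_swap:
  assumes g: "generic X q p" and d: "dword (w1 @ S # T # w2)" and X: "\<Union>(set (w1 @ S # T # w2)) = X"
  shows "excess q p z (w1 @ S # T # w2) = excess q p z (w1 @ T # S # w2) + cvs p z S T * excess q p z (w1 @ (S \<union> T) # w2) +
    (if S \<union> T = X then 0 else (if null zero_dir p (S \<union> T) then crat p z S T else 0) * Rw zero_dir p z (w1 @ w2))"
proof (cases "S \<union> T = X")
  case True
  have "w1 @ w2 = []"
  proof (rule ccontr)
    assume "w1 @ w2 ~= []"
    then obtain V where "V \<in> set (w1 @ w2)" by (metis list.set_intros(1) neq_Nil_conv)
    moreover from this have "V ~= {}" "V \<inter> (S \<union> T) = {}"
      using d by (auto simp: dword_append dest: split_list)
    ultimately show False using X True by auto
  qed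
  then show ?thesis using True g
    unfolding excess_def Rw_swap[OF d] by (simp add: generic_def null_def Rw_Nil algebra_simps)
next
  case False
  have "S \<union> T \<subseteq> X" "S \<union> T ~= {}" using X d by (auto simp: dword_append)
  then have "spos q p (S \<union> T) | sneg q p (S \<union> T)" using g False unfolding generic_def by blast
  then have "~ null q p (S \<union> T)" by (auto simp: null_def lpos_def lneg_def)
  then show ?thesis using False
    unfolding excess_def Rw_swap[OF d] by (simp add: algebra_simps)
qed

theorem nonneg_excess:
  assumes g: "generic X q p" shows "dword w ==> \<Union>(set w) = X ==> nonneg (excess q p z w)"
proof (induction w rule: word_induct[where pos = "spos q p" and mg = "(\<union>)"])
  case Nil
  then show ?case by (simp add: Rw_Nil excess_def)
next
  case (first T w)
  have "sum p T <= 0"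
  proof (cases "T = X")
    case False
    then show ?thesis using first g unfolding generic_def by auto
  qed (use g in \<open>simp add: generic_def\<close>)
  then show ?case using Rw_first[of zero_dir T p z w] Rw_first[of q T p z w] first by (simp add: excess_def)
next
  case (last T w)
  have "~ sneg q p T" using last(1) lpos_lneg by blast
  moreover have "sum p T >= 0"
  proof (cases "T = X")
    case False
    have "T ~= {}" "T \<subseteq> X" using last by (auto simp: dword_append)
    then show ?thesis using False last(1) g lpos_lneg unfolding generic_def by blast
  qed (use g in \<open>simp add: generic_def\<close>)
  ultimately show ?case using Rw_last[of zero_dir T p z w] Rw_last[of q T p z w] by (simp add: excess_def)
next
  case (swap w1 S T w2)
  have ST: "S \<subseteq> X" "T \<subseteq> X" "S ~= {}" "T ~= {}" "S ~= X" "T ~= X" using swap(6,7) by (auto simp: dword_append)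
  then have s: "sum p S >= 0" "sum p T <= 0" using swap(1,2) g lpos_lneg unfolding generic_def by blast+
  have "nonneg (excess q p z (w1 @ (S \<union> T) # w2))"
    by (rule swap(4)[OF dword_merge[OF swap(6)]]) (use swap(7) in auto)
  then have "nonneg (cvs p z S T * excess q p z (w1 @ (S \<union> T) # w2))"
    using s by (intro nonneg_mult nonneg_cvs) auto
  moreover have "nonneg (excess q p z (w1 @ T # S # w2))" using swap(3,6,7) dword_swap by auto
  moreover have "nonneg (if S \<union> T = X then 0 else (if null zero_dir p (S \<union> T) then crat p z S T else 0) * Rw zero_dir p z (w1 @ w2))"
    using central_nonneg[OF swap(6)] s by simp
  ultimately show ?case unfolding excess_swap[OF g swap(6,7)] by (intro nonneg_add)
qed

lemma posfun_excess:
  assumes g: "generic X q p" shows "posfun X z p (excess q p z)"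
proof
  fix w1 S T w2 assume d: "dword (w1 @ S # T # w2)" and X: "\<Union>(set (w1 @ S # T # w2)) = X" and s: "sum p S >= 0 | sum p T <= 0"
  show "mle (excess q p z (w1 @ T # S # w2) + cvs p z S T * excess q p z (w1 @ (S \<union> T) # w2)) (excess q p z (w1 @ S # T # w2))"
    unfolding excess_swap[OF g d X] using central_nonneg[OF d s] by (simp add: mle_def nonneg_def)
qed (rule nonneg_excess[OF g])

text \<open>The union of \<open>A\<close> and \<open>B\<close> has energy zero but is a proper part,
  hence decided by \<open>q\<close>. Its central term occurs at the point and is missing in
  direction \<open>q\<close>, and all other contributions are nonnegative.\<close>

lemma excess_central:
  assumes g: "generic X q p" and d: "dword (A # B # post)" and X: "\<Union>(set (A # B # post)) = X"
    and ne: "post ~= []" and s: "sum p A > 0" "sum p (A \<union> B) = 0"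
  shows "mle (crat p z A B * Rw zero_dir p z post) (excess q p z (A # B # post))"
proof -
  obtain V post' where "post = V # post'" using ne by (metis list.exhaust)
  then have "A \<union> B ~= X" using d X by auto
  moreover have "null zero_dir p (A \<union> B)" using s by (simp add: null_def)
  moreover have "sum p B <= 0" using s dword_sum_Un[of "[]" A B post p] d by simp
  then have "nonneg (cvs p z A B * excess q p z ((A \<union> B) # post))"
    using s d X nonneg_excess[OF g, of "(A \<union> B) # post"] by (intro nonneg_mult nonneg_cvs) auto
  moreover have "nonneg (excess q p z (B # A # post))"
    using d X nonneg_excess[OF g, of "B # A # post"] by auto
  ultimately show ?thesis
    using excess_swap[OF g, of "[]" A B post z] d X by (auto simp: mle_def nonneg_def)
qed

lemma static_central:
  assumes d: "dword (A # B # post)" and s: "sum p A > 0" "sum p (A \<union> B) = 0"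
  shows "mle (crat p z A B * Rw zero_dir p z post) (Rw zero_dir p z (A # B # post))"
proof -
  have d0: "dword ([] @ A # B # post)" using d by simp
  have "null zero_dir p (A \<union> B)" using s by (simp add: null_def)
  moreover have "sum p B <= 0" using s dword_sum_Un[of "[]" A B post p] d by simp
  then have "nonneg (cvs p z A B * Rw zero_dir p z ((A \<union> B) # post))"
    using s nonneg_static[OF dword_merge[OF d0, unfolded append_Nil]]
    by (intro nonneg_mult nonneg_cvs) auto
  moreover have "nonneg (Rw zero_dir p z (B # A # post))"
    using nonneg_static[OF dword_swap[OF d0, unfolded append_Nil]] .
  ultimately show ?thesis
    using Rw_swap[of "[]" A B post zero_dir p z] d by (auto simp: mle_def nonneg_def)
qed

context wall_crossing
begin

text \<open>If both directions lie in one chamber, the chamber polynomial forces the coefficient of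
  the jump at the final monomial to be zero; the positivity proved here is the counterpart of that
  for \<open>excess\<close>.\<close>

definition jump :: "'i set list => real mfps" where "jump w = Rw q1 p z w - Rw q2 p z w"

lemma jump_swap:
  assumes d: "dword (w1 @ S # T # w2)" and X: "\<Union>(set (w1 @ S # T # w2)) = X"
  shows "jump (w1 @ S # T # w2) = jump (w1 @ T # S # w2) + cvs p z S T * jump (w1 @ (S \<union> T) # w2)"
proof -
  have d': "dword (w1 @ T # S # w2)" "dword (w1 @ (S \<union> T) # w2)" using d dword_swap dword_merge by blast+
  have X': "\<Union>(set (w1 @ T # S # w2)) = X" "\<Union>(set (w1 @ (S \<union> T) # w2)) = X" using X by auto
  show ?thesis
    unfolding jump_def crossing_formula[OF d X] crossing_formula[OF d'(1) X'(1)] crossing_formula[OF d'(2) X'(2)]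
    by (simp add: crossing_swap[OF d] sum.distrib sum_distrib_left)
qed

lemma jump_unrefined:
  assumes "dword w" "\<Union>(set w) = X" "\<And>S. S \<in> F ==> ~ refines w S"
  shows "jump w = 0"
  unfolding jump_def crossing_formula[OF assms(1,2)] using assms(3) by (simp add: crossing_def)

lemma flip_partner:
  assumes "T0 \<in> F | X - T0 \<in> F" "T \<in> F | X - T \<in> F" "T \<inter> T0 = {}" "T \<subseteq> X" "T0 \<subseteq> X"
  shows "T = X - T0"
proof -
  consider "T \<in> F" "T0 \<in> F" | "T \<in> F" "X - T0 \<in> F" | "X - T \<in> F" "T0 \<in> F" | "X - T \<in> F" "X - T0 \<in> F"
    using assms by blast
  then show ?thesis
  proof cases
    case 1 then show ?thesis using meet assms by blast
  next
    case 2 then show ?thesis using anti[OF 2] assms by blast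
  next
    case 3
    then have "T0 = X - T" using anti[OF 3(2,1)] assms by blast
    then show ?thesis using assms by blast
  next
    case 4
    have "(X - T) \<union> (X - T0) = X" using assms by blast
    then show ?thesis using join[OF 4] by blast
  qed
qed

text \<open>A letter that strictly contains a member of \<open>F\<close> or the complement of one
  lies within neither side of any member of \<open>F\<close>, so no member refines the word.
  Consequently such a member passes every other letter without changing the jump.\<close>

lemma jump_merge_flip:
  assumes d: "dword (w1 @ T0 # T # w2)" and X: "\<Union>(set (w1 @ T0 # T # w2)) = X" and f: "T0 \<in> F | X - T0 \<in> F"
  shows "jump (w1 @ (T0 \<union> T) # w2) = 0"
proof (cases "w1 = [] & w2 = []")
  case True
  have "~ sneg q1 p X" "~ sneg q2 p X" using tot by (auto simp: lneg_def)
  then show ?thesis using True X Rw_last[of q1 X p z "[]"] Rw_last[of q2 X p z "[]"] by (simp add: jump_def)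
next
  case False
  have sub: "T0 \<subseteq> X" "T \<subseteq> X" "T ~= {}" "T0 \<inter> T = {}" using d X by (auto simp: dword_append)
  show ?thesis
  proof (rule jump_unrefined)
    fix S assume S: "S \<in> F"
    have SX: "S \<subseteq> X" using flip S by blast
    show "~ refines (w1 @ (T0 \<union> T) # w2) S"
    proof
      assume "refines (w1 @ (T0 \<union> T) # w2) S"
      then have "T0 \<union> T \<subseteq> S | T0 \<union> T \<subseteq> X - S" by (simp add: refines_def)
      then show False
      proof
        assume s: "T0 \<union> T \<subseteq> S"
        show False using f
        proof
          assume "T0 \<in> F" then show False using anti[OF _ S, of T0] s sub by blast
        next
          assume "X - T0 \<in> F" then show False using join[OF S, of "X - T0"] s SX sub by blast
        qed
      next
        assume s: "T0 \<union> T \<subseteq> X - S"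
        show False using f
        proof
          assume "T0 \<in> F" then show False using meet[OF _ S, of T0] s by blast
        next
          assume F0: "X - T0 \<in> F"
          have "S \<subseteq> X - T0" using s SX by blast
          then have "S = X - T0" by (rule anti[OF S F0])
          then show False using s sub by blast
        qed
      qed
    qed
  qed (use d X dword_merge in auto)
qed

lemma jump_pair:
  assumes "T0 \<in> F | X - T0 \<in> F" "T0 \<subseteq> X"
  shows "jump [T0, X - T0] = rat (if T0 \<in> F then sum p T0 else sum p (X - T0)) (\<Sum>i\<in>X. zvar (z i))"
  using assms pair[of T0] pair[of "X - T0"] by (auto simp: jump_def double_diff)

lemma jump_to_front:
  assumes "dword (w1 @ T0 # w2)" "\<Union>(set (w1 @ T0 # w2)) = X" "T0 \<in> F | X - T0 \<in> F"
  shows "jump (w1 @ T0 # w2) = jump (T0 # w1 @ w2)"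
  using assms
proof (induction w1 arbitrary: w2 rule: rev_induct)
  case (snoc T w1)
  have d: "dword (w1 @ T # T0 # w2)" and X: "\<Union>(set (w1 @ T # T0 # w2)) = X" using snoc.prems by auto
  have d': "dword (w1 @ T0 # T # w2)" and X': "\<Union>(set (w1 @ T0 # T # w2)) = X" using dword_swap[OF d] X by auto
  have "jump (w1 @ T # T0 # w2) = jump (w1 @ T0 # T # w2)"
    using jump_swap[OF d X] jump_merge_flip[OF d' X' snoc.prems(3)] by (simp add: Un_commute)
  also have "... = jump (T0 # w1 @ T # w2)" using snoc.IH[OF d' X' snoc.prems(3)] by simp
  finally show ?case by simp
qed simp

text \<open>A letter from \<open>F\<close>, or the complement of one, has opposite signs for the two
  directions and cannot take part in the sorting. It is put at the front, where it is inert, and the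
  remaining letters are sorted by their sign along \<open>q1\<close>.\<close>

theorem nonneg_jump:
  assumes sgn: "\<And>T. T \<subseteq> X ==> (spos q1 p T --> sum p T >= 0) & (sneg q1 p T --> sum p T <= 0)"
  shows "dword w ==> \<Union>(set w) = X ==> nonneg (jump w)"
proof (induction "length w" arbitrary: w rule: less_induct)
  case less
  have pm: "spos q1 p T | sneg q1 p T" if "T \<subseteq> X" "T ~= {}" "T ~= X" "T \<notin> F" "X - T \<notin> F" for T
    using nonflip[OF that] by blast
  have edge: "jump (T # w) = 0" if "T \<subseteq> X" "T ~= {}" "T ~= X" "T \<notin> F" "X - T \<notin> F" "~ spos q1 p T" for T w
    using nonflip[OF that(1-5)] that(6) Rw_first[of q1 T p z w] Rw_first[of q2 T p z w] lpos_lneg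
    by (auto simp: jump_def)
  have edge': "jump (w @ [T]) = 0" if "T \<subseteq> X" "T ~= {}" "T ~= X" "T \<notin> F" "X - T \<notin> F" "spos q1 p T" for T w
    using nonflip[OF that(1-5)] that(6) Rw_last[of q1 T p z w] Rw_last[of q2 T p z w] lpos_lneg
    by (auto simp: jump_def)
  show ?case
  proof (cases "\<exists>T0\<in>set w. T0 \<in> F | X - T0 \<in> F")
    case True
    then obtain T0 w1 w2 where w: "w = w1 @ T0 # w2" and f: "T0 \<in> F | X - T0 \<in> F" by (metis split_list)
    have T0: "T0 \<subseteq> X" using less.prems w by auto
    have "nonneg (jump (T0 # v))" if "dword (T0 # v)" "\<Union>(set (T0 # v)) = X" "length (T0 # v) <= length w" for v
      using that
    proof (induction v rule: word_induct[where pos = "spos q1 p" and mg = "(\<union>)"])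
      case Nil
      then have "T0 = X" by simp
      then show ?case using f flip by auto
    next
      case (first T v)
      have T: "T \<subseteq> X" "T ~= {}" "T \<inter> T0 = {}" "T ~= X" using first f flip by auto
      show ?case
      proof (cases "T \<in> F | X - T \<in> F")
        case True
        then have TT: "T = X - T0" using flip_partner[OF f True] T T0 by blast
        have "v = []"
        proof (rule ccontr)
          assume "v ~= []"
          then obtain V v' where "v = V # v'" by (metis list.exhaust)
          then show False using first(2,3) TT by auto
        qed
        moreover have "sum p (if T0 \<in> F then T0 else X - T0) >= 0" using sgn f flip T0 by auto
        ultimately show ?thesis using jump_pair[OF f T0] TT by (auto intro!: nonneg_rat nonneg_zsum split: if_splits)
      next
        case False
        have d: "dword ([] @ T0 # T # v)" "\<Union>(set ([] @ T0 # T # v)) = X" using first by auto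
        have "jump (T0 # T # v) = jump (T # T0 # v)"
          using jump_swap[OF d] jump_merge_flip[OF d f] by simp
        also have "... = 0" using edge[of T "T0 # v"] T False first(1) by blast
        finally show ?thesis by simp
      qed
    next
      case (last T v)
      have T: "T \<subseteq> X" "T ~= {}" "T \<inter> T0 = {}" "T ~= X" using last f flip by (auto simp: dword_append)
      show ?case
      proof (cases "T \<in> F | X - T \<in> F")
        case True
        then have TT: "T = X - T0" using flip_partner[OF f True] T T0 by blast
        have "v = []"
        proof (rule ccontr)
          assume "v ~= []"
          then obtain V v' where "v = V # v'" by (metis list.exhaust)
          then show False using last(2,3) TT by (auto simp: dword_append)
        qed
        moreover have "sum p (if T0 \<in> F then T0 else X - T0) >= 0" using sgn f flip T0 by auto
        ultimately show ?thesis using jump_pair[OF f T0] TT by (auto intro!: nonneg_rat nonneg_zsum split: if_splits)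
      next
        case False
        then show ?thesis using edge'[of T "T0 # v"] T last(1) by simp
      qed
    next
      case (swap v1 S T v2)
      have ST: "S \<subseteq> X" "T \<subseteq> X" "S ~= {}" "T ~= {}" "S ~= X" "T ~= X" "S \<inter> T = {}" "T \<inter> T0 = {}"
        using swap(6,7) by (auto simp: dword_append)
      have s: "sum p S >= 0" using sgn swap(1) ST by blast
      have "sneg q1 p T"
      proof (cases "T \<in> F | X - T \<in> F")
        case True
        then have "T = X - T0" using flip_partner[OF f True] ST T0 by blast
        then have False using swap(6,7) ST by (auto simp: dword_append)
        then show ?thesis ..
      qed (use pm ST swap(2) in blast)
      then have t: "sum p T <= 0" using sgn ST by blast
      have d: "dword ((T0 # v1) @ S # T # v2)" "\<Union>(set ((T0 # v1) @ S # T # v2)) = X" using swap by auto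
      have "nonneg (jump ((T0 # v1) @ (S \<union> T) # v2))"
        by (rule less.hyps) (use d dword_merge[OF d(1)] swap(8) in auto)
      moreover have "nonneg (jump ((T0 # v1) @ T # S # v2))"
        using swap(3) dword_swap[OF d(1)] d swap(8) by auto
      ultimately show ?case
        using jump_swap[OF d] s t by (auto intro!: nonneg_add nonneg_mult nonneg_cvs)
    qed
    moreover have "dword (T0 # w1 @ w2)" using less.prems w by (auto simp: dword_append)
    ultimately have "nonneg (jump (T0 # w1 @ w2))" using less.prems w by auto
    then show ?thesis using jump_to_front[of w1 T0 w2] less.prems f w by simp
  next
    case False
    have "nonneg (jump v)" if "dword v" "\<Union>(set v) = X" "length v <= length w" "\<forall>T\<in>set v. T \<notin> F & X - T \<notin> F" for v
      using that
    proof (induction v rule: word_induct[where pos = "spos q1 p" and mg = "(\<union>)"])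
      case Nil
      then show ?case using X_ne by simp
    next
      case (first T v)
      show ?case
      proof (cases "T = X")
        case True
        have "~ spos q2 p X" using tot by (auto simp: lpos_def)
        then show ?thesis using True first(1) Rw_first[of q1 T p z v] Rw_first[of q2 T p z v] by (simp add: jump_def)
      next
        case False
        then show ?thesis using edge[of T v] first by auto
      qed
    next
      case (last T v)
      show ?case
      proof (cases "T = X")
        case True
        then show ?thesis using last(1) tot by (auto simp: lpos_def)
      next
        case False
        then show ?thesis using edge'[of T v] last by (auto simp: dword_append)
      qed
    next
      case (swap v1 S T v2)
      have ST: "S \<subseteq> X" "T \<subseteq> X" "S ~= {}" "T ~= {}" "S ~= X" "T ~= X" using swap(6,7) by (auto simp: dword_append)
      have s: "sum p S >= 0" using sgn swap(1) ST by blast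
      have "sneg q1 p T" using pm[of T] ST swap(2,9) by auto
      then have t: "sum p T <= 0" using sgn ST by blast
      have "nonneg (jump (v1 @ (S \<union> T) # v2))"
        by (rule less.hyps) (use swap(6-8) dword_merge[OF swap(6)] in auto)
      moreover have "nonneg (jump (v1 @ T # S # v2))"
        using swap(3) dword_swap[OF swap(6)] swap(7-9) by auto
      ultimately show ?case
        using jump_swap[OF swap(6,7)] s t by (auto intro!: nonneg_add nonneg_mult nonneg_cvs)
    qed
    then show ?thesis using less.prems False by blast
  qed
qed

lemma posfun_jump:
  assumes sgn: "\<And>T. T \<subseteq> X ==> (spos q1 p T --> sum p T >= 0) & (sneg q1 p T --> sum p T <= 0)"
  shows "posfun X z p jump"
proof
  fix w1 S T w2 assume "dword (w1 @ S # T # w2)" "\<Union>(set (w1 @ S # T # w2)) = X"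
  from jump_swap[OF this] show "mle (jump (w1 @ T # S # w2) + cvs p z S T * jump (w1 @ (S \<union> T) # w2)) (jump (w1 @ S # T # w2))"
    by (simp add: mle_def)
qed (rule nonneg_jump[OF sgn])

end

section \<open>Generic lattice vectors\<close>

text \<open>Given \<open>u\<close> and \<open>v\<close>, a functional that is nonzero on one of them
  vanishes on v + n u for at most one \<open>n\<close>. So finitely many functionals can be avoided
  one after the other.\<close>

lemma generic_combination:
  fixes G :: "(('i => int) => int) set"
  assumes fin: "finite G" and ne: "u0 \<in> U"
    and cl: "\<And>u v n. u \<in> U ==> v \<in> U ==> (%i. u i + int n * v i) \<in> U"
    and lin: "\<And>g u v n. g \<in> G ==> g (%i. u i + int n * v i) = g u + int n * g v"
    and ex: "\<And>g. g \<in> G ==> \<exists>u\<in>U. g u ~= 0"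
  shows "\<exists>u\<in>U. \<forall>g\<in>G. g u ~= 0"
  using fin lin ex
proof (induction G rule: finite_induct)
  case empty
  then show ?case using ne by blast
next
  case (insert g G)
  then obtain u where u: "u \<in> U" "\<forall>g\<in>G. g u ~= 0" by auto
  obtain v where v: "v \<in> U" "g v ~= 0" using insert.prems(2) by auto
  have one: "finite {n. h v + int n * h u = 0}" if "h v ~= 0 | h u ~= 0" for h :: "('i => int) => int"
  proof (cases "h u = 0")
    case False
    have "n = m" if "h v + int n * h u = 0" "h v + int m * h u = 0" for n m
    proof -
      have "int n * h u = int m * h u" using that by linarith
      then show ?thesis using False by simp
    qed
    then have "\<exists>m. {n. h v + int n * h u = 0} \<subseteq> {m}" by blast
    then show ?thesis using finite_subset by blast
  qed (use that in simp)
  have "finite (\<Union>h\<in>insert g G. {n. h v + int n * h u = 0})"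
    using insert.hyps(1) u v by (intro finite_UN_I) (auto intro!: one)
  then obtain n where n: "n \<notin> (\<Union>h\<in>insert g G. {n. h v + int n * h u = 0})"
    using ex_new_if_finite infinite_UNIV_nat by blast
  have "\<forall>h\<in>insert g G. h (%i. v i + int n * u i) ~= 0"
    using n insert.prems(1) by auto
  then show ?case using cl[OF v(1) u(1)] by blast
qed

text \<open>Names for the operators of a word: those of the parts of \<mu> and \<nu>, those with a
  variable, and the additional one of energy plus or minus \<delta> in the two factors.\<close>

datatype ('m, 'n) idx = Xi 'm | Yj 'n | Zp nat | Star

fun zi :: "('m, 'n) idx => nat option" where
  "zi (Zp v) = Some v" | "zi _ = None"

definition XY :: "('m, 'n) idx set" where "XY = range Xi \<union> range Yj"

text \<open>Vectors of operator energies, hence with \<open>- k\<close> as the common value on all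
  z-letters. \<open>Star\<close> is set to 0 here and receives its energy only in
  \<open>ext\<close>; the last condition is the balance of the whole word.\<close>

definition lat :: "nat => (('m, 'n) idx => int) => bool" where
  "lat s u \<longleftrightarrow> (\<forall>v. u (Zp v) = u (Zp 0)) & u Star = 0 & sum u XY + int s * u (Zp 0) = 0"

text \<open>The energy of the letters \<open>A\<close> together with any \<open>t\<close> z-letters;
  as these all have the same energy, only their number matters.\<close>

definition val :: "(('m, 'n) idx => int) => ('m, 'n) idx set => nat => int" where
  "val u A t = sum u A + int t * u (Zp 0)"

lemma finite_XY [simp]: "finite (XY :: ('m::finite, 'n::finite) idx set)" by (simp add: XY_def)

lemma XY_zi: "i \<in> XY ==> zi i = None" by (auto simp: XY_def)
lemma Zp_notin_XY [simp]: "Zp v \<notin> XY" by (auto simp: XY_def)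
lemma Star_notin_XY [simp]: "Star \<notin> XY" by (auto simp: XY_def)

lemma lat_Zp: "lat s u ==> u (Zp v) = u (Zp 0)" by (simp add: lat_def)

lemma sum_val:
  assumes "lat s u" "finite A" "finite K" "A \<subseteq> XY"
  shows "sum u (A \<union> Zp ` K) = val u A (card K)"
proof -
  have "sum u (A \<union> Zp ` K) = sum u A + sum u (Zp ` K)"
    by (rule sum.union_disjoint) (use assms in auto)
  also have "sum u (Zp ` K) = (\<Sum>v\<in>K. u (Zp v))"
    by (subst sum.reindex) (auto simp: inj_on_def)
  also have "... = (\<Sum>v\<in>K. u (Zp 0))" by (rule sum.cong[OF refl lat_Zp[OF assms(1)]])
  finally show ?thesis by (simp add: val_def)
qed

lemma lat_comb: "lat s u ==> lat s v ==> lat s (%i. u i + int n * v i)"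
proof -
  assume a: "lat s u" "lat s v"
  have "sum (%i. u i + int n * v i) XY + int s * (u (Zp 0) + int n * v (Zp 0)) =
      (sum u XY + int s * u (Zp 0)) + int n * (sum v XY + int s * v (Zp 0))"
    by (simp add: sum.distrib sum_distrib_left algebra_simps)
  also have "... = 0" using a by (simp add: lat_def)
  finally have "sum (%i. u i + int n * v i) XY + int s * (u (Zp 0) + int n * v (Zp 0)) = 0" .
  moreover have "u (Zp v') + int n * v (Zp v') = u (Zp 0) + int n * v (Zp 0)" for v'
    using lat_Zp[OF a(1), of v'] lat_Zp[OF a(2), of v'] by simp
  moreover have "u Star + int n * v Star = 0" using a by (simp add: lat_def)
  ultimately show ?thesis unfolding lat_def by blast
qed

lemma val_comb: "val (%i. u i + int n * v i) A t = val u A t + int n * val v A t"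
  by (simp add: val_def sum.distrib sum_distrib_left algebra_simps)

text \<open>Blocks are indexed by a finite set \<open>Lb\<close>: block \<open>n\<close> consists of the letters \<open>A n\<close> and of \<open>t n\<close> of the \<open>z\<close>-letters.\<close>

definition flat :: "nat => nat set => (nat => ('m, 'n) idx set) => (nat => nat) => (('m, 'n) idx => int) set" where
  "flat s Lb A t = {u. lat s u & (\<forall>n\<in>Lb. val u (A n) (t n) = 0)}"

definition blocks :: "nat => nat set => (nat => ('m, 'n) idx set) => (nat => nat) => bool" where
  "blocks s Lb A t \<longleftrightarrow> finite Lb & (\<forall>n\<in>Lb. \<exists>i. Xi i \<in> A n) & (\<forall>n\<in>Lb. \<forall>n'\<in>Lb. n ~= n' --> A n \<inter> A n' = {}) \<and>
     (\<Union>n\<in>Lb. A n) = XY & (\<Sum>n\<in>Lb. t n) = s"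

lemma blocks_sum:
  fixes f :: "('m::finite, 'n::finite) idx => int"
  assumes "blocks s Lb A t" shows "sum f XY = (\<Sum>n\<in>Lb. sum f (A n))"
proof -
  have "\<forall>n\<in>Lb. finite (A n)" using assms unfolding blocks_def by (metis UN_upper finite_XY finite_subset)
  then have "sum f (\<Union>n\<in>Lb. A n) = (\<Sum>n\<in>Lb. sum f (A n))"
    using assms by (intro sum.UNION_disjoint) (auto simp: blocks_def)
  then show ?thesis using assms by (simp add: blocks_def)
qed

text \<open>The only functionals of this form that vanish on all balanced vectors are sums of whole
  blocks with the right number of z-letters. In every other case an explicit balanced vector is
  given.\<close>

lemma flat_witness:
  fixes A :: "nat => ('m::finite, 'n::finite) idx set"
  assumes b: "blocks s Lb A t" and B: "B \<subseteq> XY"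
    and ne: "~ ((\<forall>n\<in>Lb. A n \<subseteq> B | A n \<inter> B = {}) & k = (\<Sum>n\<in>{n\<in>Lb. A n \<subseteq> B}. t n))"
  shows "\<exists>u\<in>flat s Lb A t. val u B k ~= 0"
proof (cases "\<forall>n\<in>Lb. A n \<subseteq> B | A n \<inter> B = {}")
  case False
  then obtain n a c where n: "n \<in> Lb" "a \<in> A n" "a \<in> B" "c \<in> A n" "c \<notin> B" by blast
  \<comment> \<open>Two letters of one block, of which \<open>B\<close> contains exactly one,
    receive the energies 1 and -1, so every block stays balanced.\<close>
  define u :: "('m, 'n) idx => int" where "u = (%i. (if i = a then 1 else 0) - (if i = c then 1 else 0))"
  have XY: "a \<in> XY" "c \<in> XY" using n b unfolding blocks_def by blast+
  have z: "u (Zp v) = 0" "u Star = 0" for v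
    using XY by (auto simp: u_def)
  have s: "sum u C = (if a \<in> C then 1 else 0) - (if c \<in> C then 1 else 0)" if "finite C" for C
    using that by (simp add: u_def sum_subtractf)
  have fin: "finite (A n')" if "n' \<in> Lb" for n' using b that unfolding blocks_def by (metis UN_upper finite_XY finite_subset)
  have "a \<in> A n' \<longleftrightarrow> c \<in> A n'" if n': "n' \<in> Lb" for n'
  proof (cases "n' = n")
    case False
    then have "A n' \<inter> A n = {}" using n' n(1) b by (simp add: blocks_def)
    then show ?thesis using n by blast
  qed (use n in simp)
  then have "u \<in> flat s Lb A t" using s[of XY] XY s fin by (auto simp: flat_def lat_def val_def z)
  moreover have "val u B k ~= 0" using s[of B] n B finite_subset[OF B] by (simp add: val_def z)
  ultimately show ?thesis by blast
next
  case True
  then have k: "k ~= (\<Sum>n\<in>{n\<in>Lb. A n \<subseteq> B}. t n)" using ne by blast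
  have "\<forall>n\<in>Lb. \<exists>i. i \<in> A n" using b unfolding blocks_def by blast
  from bchoice[OF this] obtain a where a: "\<And>n. n \<in> Lb ==> a n \<in> A n" by blast
  \<comment> \<open>All z-letters receive energy -1 and one representative of each block
    \<open>n\<close> receives \<open>t n\<close>. The value on \<open>B\<close> then compares
    \<open>k\<close> with the number of z-letters of the blocks contained in
    \<open>B\<close>.\<close>
  define u :: "('m, 'n) idx => int" where
    "u = (%i. (\<Sum>n\<in>Lb. if i = a n then int (t n) else 0) - (case i of Zp v => 1 | _ => 0))"
  have fL: "finite Lb" using b by (simp add: blocks_def)
  have aXY: "a n \<in> XY" if "n \<in> Lb" for n using a[OF that] that b unfolding blocks_def by blast
  have z: "u (Zp v) = -1" "u Star = 0" for v
  proof -
    have "Zp v ~= a n & Star ~= a n" if "n \<in> Lb" for n using aXY[OF that] by (auto simp: XY_def)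
    then show "u (Zp v) = -1" "u Star = 0" by (auto simp: u_def intro!: sum.neutral)
  qed
  have s: "sum u C = (\<Sum>n\<in>{n\<in>Lb. a n \<in> C}. int (t n))" if "C \<subseteq> XY" for C
  proof -
    have fC: "finite C" using that finite_XY finite_subset by blast
    have "sum u C = (\<Sum>i\<in>C. \<Sum>n\<in>Lb. if i = a n then int (t n) else 0)"
      by (rule sum.cong) (use that in \<open>auto simp: u_def XY_def\<close>)
    also have "... = (\<Sum>n\<in>Lb. \<Sum>i\<in>C. if i = a n then int (t n) else 0)" by (rule sum.swap)
    also have "... = (\<Sum>n\<in>Lb. if a n \<in> C then int (t n) else 0)" using fC by (intro sum.cong refl) simp
    also have "... = (\<Sum>n\<in>{n\<in>Lb. a n \<in> C}. int (t n))" using fL by (simp add: sum.inter_filter)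
    finally show ?thesis .
  qed
  have An: "sum u (A n) = int (t n)" if n: "n \<in> Lb" for n
  proof -
    have "{n'\<in>Lb. a n' \<in> A n} = {n}" using a n b unfolding blocks_def by blast
    moreover have "A n \<subseteq> XY" using n b unfolding blocks_def by blast
    ultimately show ?thesis by (simp add: s)
  qed
  have "sum u XY = int s"
    using blocks_sum[OF b, of u] An b by (simp add: blocks_def flip: of_nat_sum)
  then have "u \<in> flat s Lb A t" by (simp add: flat_def lat_def val_def z An)
  moreover have "{n\<in>Lb. a n \<in> B} = {n\<in>Lb. A n \<subseteq> B}" using True a by blast
  then have "val u B k ~= 0" using k s[OF B] by (simp add: val_def z flip: of_nat_sum)
  ultimately show ?thesis by blast
qed

definition aligned :: "nat set => (nat => ('m, 'n) idx set) => (nat => nat) => ('m, 'n) idx set => nat => bool" where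
  "aligned Lb A t B k \<longleftrightarrow> (\<forall>n\<in>Lb. A n \<subseteq> B | A n \<inter> B = {}) & k = (\<Sum>n\<in>{n\<in>Lb. A n \<subseteq> B}. t n)"

lemma flat_generic:
  fixes A :: "nat => ('m::finite, 'n::finite) idx set"
  assumes b: "blocks s Lb A t"
  shows "\<exists>u\<in>flat s Lb A t. \<forall>B k. B \<subseteq> XY --> k <= s --> ~ aligned Lb A t B k --> val u B k ~= 0"
proof -
  let ?G = "(%(B, k). %u. val u B k) ` {(B, k). B \<subseteq> XY & k <= s & ~ aligned Lb A t B k}"
  have "finite ?G"
    by (rule finite_imageI, rule finite_subset[of _ "Pow XY \<times> {..s}"]) auto
  then have "\<exists>u\<in>flat s Lb A t. \<forall>g\<in>?G. g u ~= 0"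
  proof (rule generic_combination)
    show "(%_. 0) \<in> flat s Lb A t" by (simp add: flat_def lat_def val_def)
    show "(%i. u i + int n * v i) \<in> flat s Lb A t" if "u \<in> flat s Lb A t" "v \<in> flat s Lb A t" for u v n
      using that by (auto simp: flat_def val_comb intro: lat_comb)
    show "g (%i. u i + int n * v i) = g u + int n * g v" if "g \<in> ?G" for g u v n
      using that by (auto simp: val_comb)
    show "\<exists>u\<in>flat s Lb A t. g u ~= 0" if "g \<in> ?G" for g
      using that flat_witness[OF b] unfolding aligned_def by auto
  qed
  then obtain u where u: "u \<in> flat s Lb A t" "\<forall>g\<in>?G. g u ~= 0" by (elim bexE) simp
  have "val u B k ~= 0" if "B \<subseteq> XY" "k <= s" "~ aligned Lb A t B k" for B k
  proof -
    have "(B, k) \<in> {(B, k). B \<subseteq> XY & k <= s & ~ aligned Lb A t B k}" using that by simp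
    then have "(%(B, k). %u. val u B k) (B, k) \<in> ?G" by (rule imageI)
    then show ?thesis using u(2) by (simp only: prod.case Ball_def) blast
  qed
  then show ?thesis using u(1) by blast
qed

section \<open>The word of a chain of vertices\<close>

lemma path_ord_map:
  assumes "path_ord en L w" "\<And>i. i \<in> \<Union>(set L) ==> finite (f i) & sum r (f i) = en i"
    "\<And>i j. i \<in> \<Union>(set L) ==> j \<in> \<Union>(set L) ==> i ~= j ==> f i \<inter> f j = {}" "\<And>T. T \<in> set L ==> finite T"
  shows "path_ord r (map (%T. \<Union>(f ` T)) L) (map (%T. \<Union>(f ` T)) w)"
  using assms
proof (induction rule: path_ord.induct)
  case (single T)
  then show ?case by (simp add: path_ord.single)
next
  case (merge a T T' b c d V V')
  let ?g = "%T. \<Union>(f ` T)"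
  have s: "sum r (?g U) = sum en U" if "U \<in> {T, T'}" for U
  proof -
    have "sum r (?g U) = (\<Sum>i\<in>U. sum r (f i))"
    proof (rule sum.UNION_disjoint)
      have U: "U = V | U = V'" using that merge.hyps(5) by auto
      then show "finite U" using merge.prems(3)[of U] by auto
      show "\<forall>i\<in>U. finite (f i)" using merge.prems(1) U by auto
      show "\<forall>i\<in>U. \<forall>j\<in>U. i ~= j --> f i \<inter> f j = {}"
      proof (intro ballI impI)
        fix i j assume "i \<in> U" "j \<in> U" "i ~= j"
        then show "f i \<inter> f j = {}" using U by (intro merge.prems(2)) auto
      qed
    qed
    also have "... = sum en U"
    proof (rule sum.cong)
      fix i assume "i \<in> U"
      then have "i \<in> \<Union>(set (a @ V # V' # b))" using that merge.hyps(5) by auto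
      then show "sum r (f i) = en i" using merge.prems(1) by blast
    qed simp
    finally show ?thesis .
  qed
  have m: "?g (T \<union> T') = ?g T \<union> ?g T'" by auto
  have "path_ord r (map ?g (a @ (T \<union> T') # b)) (map ?g (c @ (T \<union> T') # d))"
  proof (rule merge.IH)
    have U: "\<Union>(set (a @ (T \<union> T') # b)) = \<Union>(set (a @ V # V' # b))" using merge.hyps(5) by auto
    show "finite (f i) & sum r (f i) = en i" if "i \<in> \<Union>(set (a @ (T \<union> T') # b))" for i
      using that unfolding U by (rule merge.prems(1))
    show "f i \<inter> f j = {}" if "i \<in> \<Union>(set (a @ (T \<union> T') # b))" "j \<in> \<Union>(set (a @ (T \<union> T') # b))" "i ~= j" for i j
      using that unfolding U by (rule merge.prems(2))
    show "finite U" if "U \<in> set (a @ (T \<union> T') # b)" for U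
      using that merge.prems(3)[of V] merge.prems(3)[of V'] merge.prems(3)[of U] merge.hyps(5) by auto
  qed
  moreover have "mset (map ?g (a @ (T \<union> T') # b)) = mset (map ?g (c @ (T \<union> T') # d))"
    unfolding mset_map using merge.hyps(4) by simp
  ultimately show ?case
    using path_ord.merge[of r "map ?g a" "?g T" "?g T'" "map ?g b" "map ?g c" "map ?g d" "?g V" "?g V'"] s merge.hyps(2,3,5)
    by (auto simp: m)
qed

lemma distribute:
  assumes "finite C" "card C <= (\<Sum>j\<in>{1..t}. cap j)"
  shows "\<exists>g. (\<forall>x\<in>C. g x \<in> {1..t::nat}) & (\<forall>j\<in>{1..t}. card {x\<in>C. g x = j} <= (cap j :: nat))"
  using assms
proof (induction C rule: finite_induct)
  case empty
  then show ?case by auto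
next
  case (insert x C)
  then obtain g where g: "\<forall>x\<in>C. g x \<in> {1..t}" "\<forall>j\<in>{1..t}. card {x\<in>C. g x = j} <= cap j" by auto
  have "\<exists>j\<in>{1..t}. card {x\<in>C. g x = j} < cap j"
  proof (rule ccontr)
    assume "~ ?thesis"
    then have "\<forall>j\<in>{1..t}. cap j <= card {x\<in>C. g x = j}" by (meson not_less)
    then have "(\<Sum>j\<in>{1..t}. cap j) <= (\<Sum>j\<in>{1..t}. card {x\<in>C. g x = j})" by (intro sum_mono) auto
    also have "... = card (\<Union>j\<in>{1..t}. {x\<in>C. g x = j})"
      using insert.hyps(1) by (intro card_UN_disjoint[symmetric]) auto
    also have "... <= card C" by (rule card_mono) (use insert.hyps in auto)
    finally show False using insert by simp
  qed
  then obtain j where j: "j \<in> {1..t}" "card {x\<in>C. g x = j} < cap j" by blast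
  have "card {y\<in>insert x C. (g(x := j)) y = i} <= cap i" if i: "i \<in> {1..t}" for i
  proof -
    have e: "{y\<in>insert x C. (g(x := j)) y = i} = (if i = j then insert x {y\<in>C. g y = i} else {y\<in>C. g y = i})"
      using insert.hyps(2) by auto
    show ?thesis unfolding e using j g(2) i insert.hyps by auto
  qed
  then show ?case using g(1) j by (intro exI[of _ "g(x := j)"]) auto
qed

lemma dword_map:
  assumes "distinct ns" "\<And>i. i \<in> set ns ==> finite (f i) & f i ~= {}"
    "\<And>i j. i \<in> set ns ==> j \<in> set ns ==> i ~= j ==> f i \<inter> f j = {}"
  shows "dword (map f ns)"
  using assms
proof (induction ns)
  case (Cons a ns)
  have "f a \<inter> f j = {}" if "j \<in> set ns" for j
    using Cons.prems(1) that by (intro Cons.prems(3)) auto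
  moreover have "dword (map f ns)" by (rule Cons.IH) (use Cons.prems in auto)
  ultimately show ?case using Cons.prems(2)[of a] by auto
qed simp

lemma exists_relabelling: "distinct ns ==> length ns = length ms ==> \<exists>\<sigma>. map \<sigma> ns = ms"
proof (induction ns arbitrary: ms)
  case (Cons n ns)
  then obtain m ms' where ms: "ms = m # ms'" by (cases ms) auto
  then obtain \<sigma> where "map \<sigma> ns = ms'" using Cons by auto
  then have "map (\<sigma>(n := m)) (n # ns) = ms" using ms Cons.prems(1) by (auto intro: map_cong)
  then show ?case by blast
qed simp

lemma lookup_sum_e1: "lookup (sum_list (map e1 ws)) v = length (filter (%x. x = v) ws)"
  by (induction ws) (auto simp: lookup_add lookup_single)

lemma mdeg_0 [simp]: "mdeg 0 = 0" by (simp add: mdeg_def)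

lemma mdeg_sum: "mdeg (\<Sum>i\<in>A. h i) = (\<Sum>i\<in>A. mdeg (h i))"
  by (induction A rule: infinite_finite_induct) (simp_all add: mdeg_add)

lemma mdeg_sum_e1: "mdeg (sum_list (map e1 ws)) = length ws"
  by (induction ws) (simp_all add: mdeg_add mdeg_e1)

text \<open>The letters of a block are distributed over its \<open>z\<close>-letters; the resulting letters form a path that starts at
  \<open>\<alpha>\<close>. The \<open>z\<close>-letters are numbered only after the path has been turned into a word, in the order of that word.\<close>

lemma block_word:
  fixes A :: "('m::finite, 'n::finite) idx set" and r :: "('m, 'n) idx => int"
  assumes lat: "\<And>v. r (Zp v) = r (Zp 0)" and A: "A \<subseteq> XY" "\<alpha> \<in> A" and t: "t >= 1"
    and tot: "val r A t = 0"
    and gen: "\<And>B k. B \<subseteq> A ==> k <= t ==> val r B k = 0 ==> B = {} & k = 0 | B = A & k = t"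
    and card: "card A <= (t - 1) * (R - 1) + c + 1" and R: "R >= 1"
  obtains w ws h v0 where "path_word zi r w ws" "v0 \<in> {o'+1..o'+t}"
    "dword w" "\<Union>(set w) = A \<union> Zp ` {o'+1..o'+t}" "{\<alpha>} \<in> set w" "rem A w = map (%v. {Zp v}) [o'+1..<o'+t+1]"
    "\<And>i. i \<in> A ==> i ~= \<alpha> ==> \<exists>T\<in>set w. i \<in> T & (\<exists>v\<in>vars zi T. h i = e1 v)" "h \<alpha> = 0"
    "\<And>v. lookup (sum_list (map e1 ws) + (\<Sum>i\<in>A. h i)) v <= (if v \<in> {o'+1..o'+t} then if v = v0 then c else R else 0)"
    "mdeg (sum_list (map e1 ws) + (\<Sum>i\<in>A. h i)) + 2 = t + card A"
proof -
  note upt_Suc [simp del]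
  have finA: "finite A" using A finite_XY finite_subset by blast
  \<comment> \<open>The inner vertices 1 to t - 1 of the path each spend one unit of their variable
    on a merger, which leaves \<open>R - 1\<close> units for the letters they carry. The end vertex
    \<open>t\<close> spends none and has the budget \<open>c\<close>.\<close>
  define cap where "cap j = (if j = t then c else R - 1)" for j
  have "(\<Sum>j\<in>{1..t}. cap j) = (\<Sum>j\<in>{1..t} - {t}. R - 1) + c"
  proof -
    have "(\<Sum>j\<in>{1..t}. cap j) = cap t + (\<Sum>j\<in>{1..t} - {t}. cap j)"
      using t by (subst sum.remove[of _ t]) auto
    also have "(\<Sum>j\<in>{1..t} - {t}. cap j) = (\<Sum>j\<in>{1..t} - {t}. R - 1)"
      by (rule sum.cong) (auto simp: cap_def)
    finally show ?thesis by (simp add: cap_def)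
  qed
  also have "(\<Sum>j\<in>{1..t} - {t}. R - 1) = (t - 1) * (R - 1)" using t by (simp add: card_Diff_singleton)
  finally have "card (A - {\<alpha>}) <= (\<Sum>j\<in>{1..t}. cap j)" using card A finA by (simp add: card_Diff_singleton)
  from distribute[OF _ this] finA obtain g where
    g: "\<And>x. x \<in> A - {\<alpha>} ==> g x \<in> {1..t}" "\<And>j. j \<in> {1..t} ==> card {x\<in>A - {\<alpha>}. g x = j} <= cap j"
    by blast
  define cont where "cont j = {x\<in>A - {\<alpha>}. g x = j}" for j
  have cont: "finite (cont j)" "cont j \<subseteq> A" "\<alpha> \<notin> cont j" "j ~= j' ==> cont j \<inter> cont j' = {}" for j j'
    using finA by (auto simp: cont_def)
  have zA: "Zp v \<notin> A" for v using A by auto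
  \<comment> \<open>Energies of the vertices: vertex 0 is the letter \<alpha> alone, every other
    vertex is a z-letter with the letters distributed to it.\<close>
  define en where "en i = (if i = 0 then r \<alpha> else r (Zp 0) + sum r (cont i))" for i
  define bl where "bl T = (if 0 \<in> T then {\<alpha>} else {}) \<union> (\<Union>i\<in>T - {0}. cont i)" for T
  have sum_en: "sum en T = val r (bl T) (card (T - {0}))" if "finite T" for T
  proof -
    have "sum en T = sum en (T \<inter> {0}) + sum en (T - {0})"
      using that by (metis sum.Int_Diff)
    also have "sum en (T - {0}) = (\<Sum>i\<in>T - {0}. r (Zp 0) + sum r (cont i))"
      by (rule sum.cong) (auto simp: en_def)
    also have "... = int (card (T - {0})) * r (Zp 0) + (\<Sum>i\<in>T - {0}. sum r (cont i))"
      by (simp add: sum.distrib)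
    also have "(\<Sum>i\<in>T - {0}. sum r (cont i)) = sum r (\<Union>i\<in>T - {0}. cont i)"
      using that cont by (intro sum.UNION_disjoint[symmetric]) auto
    also have "sum en (T \<inter> {0}) = sum r (if 0 \<in> T then {\<alpha>} else {})"
      by (cases "0 \<in> T") (auto simp: en_def)
    also have "sum r (if 0 \<in> T then {\<alpha>} else {}) + (int (card (T - {0})) * r (Zp 0) + sum r (\<Union>i\<in>T - {0}. cont i)) =
        val r (bl T) (card (T - {0}))"
    proof -
      have "sum r (bl T) = sum r (if 0 \<in> T then {\<alpha>} else {}) + sum r (\<Union>i\<in>T - {0}. cont i)"
        unfolding bl_def by (rule sum.union_disjoint) (use that cont in auto)
      then show ?thesis by (simp add: val_def)
    qed
    finally show ?thesis .
  qed
  have bl_all: "bl {0..t} = A"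
  proof -
    have "(\<Union>i\<in>{0..t} - {0}. cont i) = A - {\<alpha>}" using g(1) by (force simp: cont_def)
    then show ?thesis using A by (auto simp: bl_def)
  qed
  let ?L = "map (%i. {i}) [0..<Suc t]"
  have uL: "\<Union>(set ?L) = {0..t}" by auto
  have card_all: "card ({0..t} - {0}) = t" by simp
  have "\<exists>w. path_ord en ?L w"
  proof (rule path_ord_exists)
    show "dword ?L" by (rule dword_map) auto
    show "sum en (\<Union>(set ?L)) = 0" unfolding uL using sum_en[of "{0..t}"] bl_all tot by simp
    fix T assume "T \<subset> \<Union>(set ?L)" and ne: "T ~= {}"
    then have T: "T \<subset> {0..t}" unfolding uL by simp
    then have fT: "finite T" using finite_subset by blast
    have sub: "T - {0} \<subseteq> {0..t} - {0}" using T by auto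
    have k: "card (T - {0}) <= t" using card_mono[OF _ sub] card_all by simp
    have blA: "bl T \<subseteq> A" using cont A by (auto simp: bl_def)
    show "sum en T ~= 0"
    proof
      assume "sum en T = 0"
      from gen[OF blA k this[unfolded sum_en[OF fT]]]
      show False
      proof (elim disjE conjE)
        assume "bl T = {}" "card (T - {0}) = 0"
        then have "T \<subseteq> {0}" "0 \<notin> T" using fT by (auto simp: bl_def split: if_splits)
        then show False using ne by blast
      next
        assume a: "bl T = A" "card (T - {0}) = t"
        then have "T - {0} = {0..t} - {0}" using card_subset_eq[OF _ sub] card_all by simp
        moreover have "0 \<in> T" using a(1) A cont by (auto simp: bl_def split: if_splits)
        ultimately show False using T by auto
      qed
    qed
  qed simp
  then obtain w0 where w0: "path_ord en ?L w0" by blast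
  have m0: "mset w0 = mset ?L" by (rule path_ord_mset[OF w0])
  define ids where "ids = map the_elem w0"
  have "mset ids = mset [0..<Suc t]"
    unfolding ids_def mset_map m0 by (simp add: image_mset.compositionality o_def)
  then have ids: "distinct ids" "set ids = {0..t}"
  proof -
    assume m: "mset ids = mset [0..<Suc t]"
    show "distinct ids" using mset_eq_imp_distinct_iff[OF m] distinct_upt by blast
    show "set ids = {0..t}" unfolding mset_eq_setD[OF m] by auto
  qed
  have w0_ids: "w0 = map (%i. {i}) ids"
  proof -
    have "\<exists>i. T = {i}" if "T \<in> set w0" for T using that unfolding mset_eq_setD[OF m0] by auto
    then have "map ((%i. {i}) \<circ> the_elem) w0 = map id w0" by (intro map_cong refl) fastforce
    then show ?thesis by (simp add: ids_def)
  qed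
  define ns where "ns = filter (%i. i ~= 0) ids"
  have ns: "distinct ns" "set ns = {1..t}" using ids by (auto simp: ns_def)
  have "length ns = length [o'+1..<o'+t+1]" using distinct_card[OF ns(1)] ns(2) by (simp del: upt_Suc)
  from exists_relabelling[OF ns(1) this] obtain \<sigma> where \<sigma>: "map \<sigma> ns = [o'+1..<o'+t+1]" by blast
  have \<sigma>i: "inj_on \<sigma> {1..t}" using \<sigma> distinct_map[of \<sigma> ns] ns by simp
  have "\<sigma> ` {1..t} = set (map \<sigma> ns)" using ns by simp
  then have \<sigma>s: "\<sigma> ` {1..t} = {o'+1..o'+t}" unfolding \<sigma> by auto
  define f where "f i = (if i = 0 then {\<alpha>} else insert (Zp (\<sigma> i)) (cont i))" for i :: nat
  have f: "finite (f i) & f i ~= {}" for i by (simp add: f_def cont)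
  have fr: "sum r (f i) = en i" for i
  proof -
    have "Zp (\<sigma> i) \<notin> cont i" using cont(2)[of i] zA by blast
    then show ?thesis using cont(1) lat[of "\<sigma> i"] by (simp add: f_def en_def)
  qed
  have fd: "f i \<inter> f j = {}" if "i \<in> {0..t}" "j \<in> {0..t}" "i ~= j" for i j
  proof -
    have "\<sigma> i ~= \<sigma> j" if "i ~= 0" "j ~= 0"
      using that \<open>i \<in> _\<close> \<open>j \<in> _\<close> \<open>i ~= j\<close> inj_onD[OF \<sigma>i, of i j] by auto
    then show ?thesis using cont(2)[of i] cont(2)[of j] cont(3)[of i] cont(3)[of j] cont(4)[OF that(3)] that zA A
      by (auto simp: f_def)
  qed
  have fu: "\<Union>(f ` {0..t}) = A \<union> Zp ` {o'+1..o'+t}"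
  proof -
    have "{0..t} = insert 0 {1..t}" by auto
    then have "\<Union>(f ` {0..t}) = f 0 \<union> \<Union>(f ` {1..t})" by simp
    also have "\<Union>(f ` {1..t}) = (\<Union>i\<in>{1..t}. insert (Zp (\<sigma> i)) (cont i))"
      by (rule SUP_cong) (simp_all add: f_def)
    also have "f 0 = {\<alpha>}" by (simp add: f_def)
    also have "{\<alpha>} \<union> (\<Union>i\<in>{1..t}. insert (Zp (\<sigma> i)) (cont i)) = ({\<alpha>} \<union> (\<Union>i\<in>{1..t}. cont i)) \<union> Zp ` (\<sigma> ` {1..t})" by auto
    also have "{\<alpha>} \<union> (\<Union>i\<in>{1..t}. cont i) = A" using bl_all by (auto simp: bl_def)
    finally show ?thesis unfolding \<sigma>s .
  qed
  have po: "path_ord r (map (%T. \<Union>(f ` T)) ?L) (map (%T. \<Union>(f ` T)) w0)"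
    by (rule path_ord_map[OF w0]) (use uL f fr fd in auto)
  have mf: "map (%T. \<Union>(f ` T)) (map (%i. {i}) l) = map f l" for l by simp
  define ws where "ws = map \<sigma> [1..<t]"
  define h where "h i = (if i \<in> A - {\<alpha>} then e1 (\<sigma> (g i)) else 0)" for i
  have vf: "\<sigma> i \<in> vars zi (f i)" if "i ~= 0" for i using that by (auto simp: f_def vars_def)
  have L_eq: "map f [0..<Suc t] = f 0 # map f [1..<t] @ [f t]"
    using t by (simp add: upt_conv_Cons upt_Suc)
  have lk: "lookup (sum_list (map e1 ws) + (\<Sum>i\<in>A. h i)) v =
      length (filter (%x. x = v) ws) + card {i\<in>A - {\<alpha>}. \<sigma> (g i) = v}" for v
  proof -
    have "lookup (\<Sum>i\<in>A. h i) v = (\<Sum>i\<in>A. lookup (h i) v)" by (simp add: lookup_sum)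
    also have "... = (\<Sum>i\<in>A. if i ~= \<alpha> & \<sigma> (g i) = v then 1 else 0)"
      by (rule sum.cong) (auto simp: h_def lookup_single when_def)
    also have "... = card (A \<inter> {i. i ~= \<alpha> & \<sigma> (g i) = v})"
      using finA by (simp add: sum.If_cases)
    also have "A \<inter> {i. i ~= \<alpha> & \<sigma> (g i) = v} = {i\<in>A - {\<alpha>}. \<sigma> (g i) = v}" by auto
    finally show ?thesis unfolding lookup_add lookup_sum_e1 by simp
  qed
  show thesis
  proof (rule that[of "map f ids" ws "\<sigma> t" h])
    have "list_all2 (%T v. v \<in> vars zi T) (map f [1..<t]) ws"
      unfolding ws_def list_all2_map1 list_all2_map2 by (rule list.rel_refl_strong) (use vf in auto)
    then show "path_word zi r (map f ids) ws" unfolding path_word_def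
      by (intro exI conjI) (rule po[unfolded w0_ids mf], rule L_eq)
    show "\<sigma> t \<in> {o'+1..o'+t}" unfolding \<sigma>s[symmetric] using t by simp
    show "dword (map f ids)" by (rule dword_map[OF ids(1)]) (use f fd ids in auto)
    show "\<Union>(set (map f ids)) = A \<union> Zp ` {o'+1..o'+t}" using fu ids by simp
    show "{\<alpha>} \<in> set (map f ids)" using ids by (auto simp: f_def intro!: image_eqI[of _ _ 0])
    show "rem A (map f ids) = map (%v. {Zp v}) [o'+1..<o'+t+1]"
    proof -
      have fA: "f i - A = (if i = 0 then {} else {Zp (\<sigma> i)})" for i using cont(2)[of i] zA A by (auto simp: f_def)
      have "rem A (map f l) = map (%v. {Zp v}) (map \<sigma> (filter (%i. i ~= 0) l))" for l :: "nat list"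
        by (induction l) (simp_all add: rem_def fA)
      then show ?thesis unfolding ns_def[symmetric] \<sigma>[symmetric] by (metis ns_def)
    qed
    show "\<exists>T\<in>set (map f ids). i \<in> T & (\<exists>v\<in>vars zi T. h i = e1 v)" if "i \<in> A" "i ~= \<alpha>" for i
    proof (rule bexI[of _ "f (g i)"])
      have "g i \<in> {1..t}" using g that by simp
      then show "f (g i) \<in> set (map f ids)" using ids by auto
      have "i \<in> f (g i)" using that \<open>g i \<in> _\<close> by (auto simp: f_def cont_def)
      then show "i \<in> f (g i) & (\<exists>v\<in>vars zi (f (g i)). h i = e1 v)"
        using vf[of "g i"] \<open>g i \<in> _\<close> that by (auto simp: h_def)
    qed
    show "h \<alpha> = 0" by (simp add: h_def)
    show "lookup (sum_list (map e1 ws) + (\<Sum>i\<in>A. h i)) v \<le>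
        (if v \<in> {o'+1..o'+t} then if v = \<sigma> t then c else R else 0)" for v
    proof (cases "v \<in> {o'+1..o'+t}")
      case True
      then obtain j where j: "j \<in> {1..t}" "v = \<sigma> j" unfolding \<sigma>s[symmetric] by blast
      have "{i\<in>A - {\<alpha>}. \<sigma> (g i) = v} = {i\<in>A - {\<alpha>}. g i = j}"
        using g(1) j inj_on_eq_iff[OF \<sigma>i] by auto
      then have c: "card {i\<in>A - {\<alpha>}. \<sigma> (g i) = v} <= cap j" using g(2)[OF j(1)] by simp
      have dw: "distinct ws" unfolding ws_def distinct_map by (auto intro!: inj_on_subset[OF \<sigma>i])
      have "filter (%x. x = v) ws = (if v \<in> set ws then [v] else [])" 
        using dw by (induction ws) auto
      moreover have "v \<in> set ws \<longleftrightarrow> j ~= t"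
      proof -
        have "v \<in> set ws \<longleftrightarrow> (\<exists>i\<in>{1..<t}. \<sigma> j = \<sigma> i)" by (auto simp: ws_def j)
        also have "... \<longleftrightarrow> j ~= t" using j inj_on_eq_iff[OF \<sigma>i, of j] by force
        finally show ?thesis .
      qed
      moreover have "v = \<sigma> t \<longleftrightarrow> j = t" using j inj_on_eq_iff[OF \<sigma>i, of j t] by auto
      ultimately show ?thesis using c True R unfolding lk by (auto simp: cap_def)
    next
      case False
      then have "v \<notin> \<sigma> ` {1..t}" unfolding \<sigma>s .
      then have "filter (%x. x = v) ws = []" "{i\<in>A - {\<alpha>}. \<sigma> (g i) = v} = {}"
        using g(1) by (auto simp: ws_def filter_empty_conv)
      then show ?thesis unfolding lk using False by (simp only: list.size card.empty if_False)
    qed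
    have "(\<Sum>i\<in>A. mdeg (h i)) = (\<Sum>i\<in>A - {\<alpha>}. mdeg (h i)) + mdeg (h \<alpha>)"
      using A finA by (subst sum.remove[of _ \<alpha>]) auto
    also have "(\<Sum>i\<in>A - {\<alpha>}. mdeg (h i)) = (\<Sum>i\<in>A - {\<alpha>}. 1)"
      by (rule sum.cong) (auto simp: h_def mdeg_e1)
    finally have "(\<Sum>i\<in>A. mdeg (h i)) = card A - 1" using A finA by (simp add: h_def card_Diff_singleton)
    moreover have "card A >= 1" using A finA by (simp add: Suc_le_eq card_gt_0_iff) blast
    ultimately show "mdeg (sum_list (map e1 ws) + (\<Sum>i\<in>A. h i)) + 2 = t + card A"
      using t unfolding mdeg_add mdeg_sum mdeg_sum_e1 by (simp add: ws_def)
  qed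
qed

text \<open>The share of the final monomial that belongs to the \<open>t\<close> z-letters following
  number \<open>o'\<close>.\<close>

definition zmon :: "nat => nat => nat => nat \<Rightarrow>\<^sub>0 nat" where
  "zmon d o' t = (\<Sum>v\<in>{o'+1..o'+t}. Poly_Mapping.single v (Suc d))"

lemma lookup_zmon: "lookup (zmon d o' t) v = (if v \<in> {o'+1..o'+t} then Suc d else 0)"
proof -
  have "lookup (zmon d o' t) v = (\<Sum>x\<in>{o'+1..o'+t}. if x = v then Suc d else 0)"
    unfolding zmon_def lookup_sum by (rule sum.cong) (simp_all add: lookup_single when_def)
  then show ?thesis by simp
qed

lemma mdeg_single: "mdeg (Poly_Mapping.single v (c::nat)) = c" by (simp add: mdeg_def)

lemma mdeg_zmon: "mdeg (zmon d o' t) = Suc d * t" by (simp add: zmon_def mdeg_sum mdeg_single)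

lemma zmon_add: "zmon d o' t + zmon d (o' + t) t' = zmon d o' (t + t')"
  by (rule poly_mapping_eqI) (auto simp: lookup_add lookup_zmon)

lemma zmon_zmonomial: "zmon d 0 s = zmonomial s d" by (simp add: zmon_def zmonomial_def)

lemma poly_mapping_complement:
  fixes M Z :: "nat \<Rightarrow>\<^sub>0 nat"
  assumes "\<And>v. lookup M v <= lookup Z v" obtains m where "m + M = Z"
proof
  show "(Z - M) + M = Z"
    by (rule poly_mapping_eqI) (use assms in \<open>simp add: lookup_add lookup_minus\<close>)
qed

definition att :: "('m, 'n) idx set list => (('m, 'n) idx => nat \<Rightarrow>\<^sub>0 nat) => ('m, 'n) idx => bool" where
  "att V h i \<longleftrightarrow> (\<exists>T\<in>set V. i \<in> T & (\<exists>v\<in>vars zi T. h i = e1 v)) | {i} \<in> set V & h i = 0 & i \<in> range Xi"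

text \<open>A positive coefficient of the word \<open>V\<close> at \<open>m\<close> turns into one
  at the full monomial of the block when the letters of \<open>B\<close> are taken out, each at its
  price \<open>h i\<close>. What is left of \<open>V\<close> are the z-letters in increasing order,
  as in \<open>word0\<close>.\<close>

definition arranged :: "nat => nat => ('m::finite, 'n::finite) idx set => nat => ('m, 'n) idx set list =>
    (('m, 'n) idx => nat \<Rightarrow>\<^sub>0 nat) => (nat \<Rightarrow>\<^sub>0 nat) => bool" where
  "arranged d o' B t V h m \<longleftrightarrow> dword V & \<Union>(set V) = B \<union> Zp ` {o'+1..o'+t} & (\<forall>i\<in>B. att V h i) \<and>
     rem B V = map (%v. {Zp v}) [o'+1..<o'+t+1] & m + (\<Sum>i\<in>B. h i) = zmon d o' t"

lemma rem_irrelevant: "(\<And>T. T \<in> set V ==> T \<inter> C = {}) ==> rem (B \<union> C) V = rem B V"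
proof -
  assume a: "\<And>T. T \<in> set V ==> T \<inter> C = {}"
  have "map (%T. T - (B \<union> C)) V = map (%T. T - B) V" by (rule map_cong) (use a in auto)
  then show ?thesis by (simp only: rem_def)
qed

lemma rem_append: "rem B (V @ V') = rem B V @ rem B V'" by (simp add: rem_def)

lemma att_mono: "att V h i ==> set V \<subseteq> set V' ==> h i = h' i ==> att V' h' i"
  unfolding att_def by (metis subsetD)

lemma arranged_append:
  assumes a: "arranged d o' B t V h m" "arranged d (o' + t) B' t' V' h' m'" and B: "B \<inter> B' = {}" "B \<subseteq> XY" "B' \<subseteq> XY"
  shows "arranged d o' (B \<union> B') (t + t') (V @ V') (%i. if i \<in> B then h i else h' i) (m + m')"
proof -
  have u: "\<Union>(set V) = B \<union> Zp ` {o'+1..o'+t}" "\<Union>(set V') = B' \<union> Zp ` {o'+t+1..o'+t+t'}"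
    using a by (simp_all add: arranged_def)
  have z: "Zp v \<notin> B" "Zp v \<notin> B'" for v using B by auto
  have r: "rem (B \<union> B') (V @ V') = rem B V @ rem B' V'"
  proof -
    have "T \<inter> B' = {}" if "T \<in> set V" for T
    proof -
      have "T \<subseteq> B \<union> Zp ` {o'+1..o'+t}" using that u(1) by blast
      then show ?thesis using z B by blast
    qed
    moreover have "T \<inter> B = {}" if "T \<in> set V'" for T
    proof -
      have "T \<subseteq> B' \<union> Zp ` {o'+t+1..o'+t+t'}" using that u(2) by blast
      then show ?thesis using z B by blast
    qed
    ultimately show ?thesis
      using rem_irrelevant[of V B' B] rem_irrelevant[of V' B B'] by (simp add: rem_append Un_commute)
  qed
  have dis: "(B \<union> Zp ` {o'+1..o'+t}) \<inter> (B' \<union> Zp ` {o'+t+1..o'+t+t'}) = {}" using z B by auto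
  have I: "Zp ` {o'+1..o'+(t+t')} = Zp ` {o'+1..o'+t} \<union> Zp ` {o'+t+1..o'+t+t'}"
    by (subst image_Un[symmetric], rule arg_cong[where f = "(`) Zp"]) auto
  have s: "(\<Sum>i\<in>B \<union> B'. if i \<in> B then h i else h' i) = (\<Sum>i\<in>B. h i) + (\<Sum>i\<in>B'. h' i)"
  proof -
    have f: "finite B" "finite B'" using B finite_XY finite_subset by blast+
    have "(\<Sum>i\<in>B'. if i \<in> B then h i else h' i) = (\<Sum>i\<in>B'. h' i)" by (rule sum.cong) (use B in auto)
    then show ?thesis by (simp add: sum.union_disjoint[OF f B(1)])
  qed
  have e: "m + (\<Sum>i\<in>B. h i) = zmon d o' t" "m' + (\<Sum>i\<in>B'. h' i) = zmon d (o' + t) t'"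
    using a by (simp_all add: arranged_def)
  have "m + m' + (\<Sum>i\<in>B \<union> B'. if i \<in> B then h i else h' i) = (m + (\<Sum>i\<in>B. h i)) + (m' + (\<Sum>i\<in>B'. h' i))"
    unfolding s by (simp add: ac_simps)
  also have "... = zmon d o' (t + t')" unfolding e by (rule zmon_add)
  finally have sm: "m + m' + (\<Sum>i\<in>B \<union> B'. if i \<in> B then h i else h' i) = zmon d o' (t + t')" .
  have at: "att (V @ V') (%i. if i \<in> B then h i else h' i) i" if "i \<in> B \<union> B'" for i
  proof (cases "i \<in> B")
    case True
    then show ?thesis using a(1) att_mono[of V h i "V @ V'" "%i. if i \<in> B then h i else h' i"] by (simp add: arranged_def)
  next
    case False
    then show ?thesis using a(2) that att_mono[of V' h' i "V @ V'" "%i. if i \<in> B then h i else h' i"] by (simp add: arranged_def)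
  qed
  have l: "map (%v. {Zp v}) [o'+1..<o'+t+1] @ map (%v. {Zp v}) [o'+t+1..<o'+t+t'+1] =
      map (%v. {Zp v} :: ('m, 'n) idx set) [o'+1..<o'+(t+t')+1]"
    using upt_add_eq_append[of "o'+1" "o'+t+1" t'] by (simp flip: map_append add: ac_simps del: upt_Suc)
  show ?thesis
    unfolding arranged_def r l[symmetric] I
    using a at sm dis u by (auto simp: arranged_def dword_append simp del: upt_Suc)
qed

lemma Zp_image_disjoint: "B \<subseteq> XY ==> B \<inter> Zp ` K = {}" by auto

definition letters :: "nat => ('m, 'n) idx set" where "letters s = XY \<union> Zp ` {1..s}"
definition zc :: "('m, 'n) idx set => nat" where "zc T = card {v. Zp v \<in> T}"

lemma finite_letters [simp]: "finite (letters s :: ('m::finite, 'n::finite) idx set)" by (simp add: letters_def)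

lemma sum_letter:
  fixes T :: "('m::finite, 'n::finite) idx set"
  assumes "lat s u" "T \<subseteq> letters s"
  shows "sum u T = val u (T \<inter> XY) (zc T)" "zc T <= s" "finite {v. Zp v \<in> T}"
proof -
  have K: "{v. Zp v \<in> T} \<subseteq> {1..s}" using assms(2) by (auto simp: letters_def)
  then show f: "finite {v. Zp v \<in> T}" using finite_subset by blast
  have T: "T = (T \<inter> XY) \<union> Zp ` {v. Zp v \<in> T}" using assms(2) by (auto simp: letters_def)
  have "sum u ((T \<inter> XY) \<union> Zp ` {v. Zp v \<in> T}) = val u (T \<inter> XY) (zc T)"
    unfolding zc_def by (rule sum_val[OF assms(1) _ f]) auto
  then show "sum u T = val u (T \<inter> XY) (zc T)" using T by simp
  show "zc T <= s" unfolding zc_def using card_mono[OF _ K] by simp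
qed

lemma zc_letters: "zc (letters s) = s"
proof -
  have "{v. Zp v \<in> (letters s :: ('a, 'b) idx set)} = {1..s}" by (auto simp: letters_def)
  then show ?thesis by (simp add: zc_def)
qed

lemma letters_XY: "letters s \<inter> XY = XY" by (auto simp: letters_def)

lemma sum_letters: "lat s u ==> sum u (letters s) = 0" for u :: "('m::finite, 'n::finite) idx => int"
  using sum_letter(1)[of s u "letters s"] by (simp add: zc_letters letters_XY) (simp add: val_def lat_def)

definition word0 :: "nat => ('m, 'n) idx list => ('m, 'n) idx list => ('m, 'n) idx set list" where
  "word0 s xs ys = map (%i. {i}) xs @ map (%v. {Zp v}) [1..<Suc s] @ map (%i. {i}) ys"

lemma arranged_word0:
  fixes p :: "('m::finite, 'n::finite) idx => int"
  assumes "posfun (letters s) zi p \<Phi>" and a: "arranged d 0 XY s V h m" and m: "mcoeff (\<Phi> V) m > 0"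
    and xy: "distinct xs" "distinct ys" "set xs = range Xi" "set ys = range Yj"
    and sgn: "\<And>i. p (Xi i) > 0" "\<And>j. p (Yj j) < 0"
  shows "mcoeff (\<Phi> (word0 s xs ys)) (zmonomial s d) > 0"
proof -
  interpret posfun "letters s" zi p \<Phi> by fact
  have s: "set xs \<union> set ys = XY" "set xs \<inter> set ys = {}" using xy by (auto simp: XY_def)
  have at: "att V h i" if "i \<in> XY" for i using a that by (simp add: arranged_def)
  have zi: "zi i = None" if "i \<in> XY" for i using that by (rule XY_zi)
  have A: "attached V h i | {i} \<in> set V & h i = 0 & zi i = None & i \<in> range Xi" if "i \<in> XY" for i
    using at[OF that] zi[OF that] unfolding att_def attached_def by blast
  have "pos (map (%x. {x}) xs @ rem (set xs \<union> set ys) V @ map (%y. {y}) ys) (m + sum_list (map h xs) + sum_list (map h ys))"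
  proof (rule assemble)
    show "pos V m" using m by (simp add: pos_def)
    show "dom V" unfolding dom_def using a by (simp add: arranged_def letters_def)
    show "attached V h x | {x} \<in> set V & h x = 0 & zi x = None" if "x \<in> set xs" for x
      using A[of x] s that by blast
    show "attached V h y" if "y \<in> set ys" for y
    proof -
      have "y \<notin> range Xi" "y \<in> XY" using that xy(4) by (auto simp: XY_def)
      then show ?thesis using A by blast
    qed
    show "p x > 0" if "x \<in> set xs" for x using that xy sgn by auto
    show "p y < 0" if "y \<in> set ys" for y using that xy sgn by auto
  qed (use xy s in auto)
  moreover have "rem XY V = map (%v. {Zp v}) [1..<Suc s]" using a by (simp add: arranged_def del: upt_Suc)
  moreover have "m + sum_list (map h xs) + sum_list (map h ys) = zmonomial s d"
  proof -
    have "(\<Sum>i\<in>set xs \<union> set ys. h i) = sum h (set xs) + sum h (set ys)"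
      by (rule sum.union_disjoint) (use s in auto)
    then have "sum_list (map h xs) + sum_list (map h ys) = (\<Sum>i\<in>set xs \<union> set ys. h i)"
      unfolding sum_list_distinct_conv_sum_set[OF xy(1)] sum_list_distinct_conv_sum_set[OF xy(2)] by (rule sym)
    moreover have "m + (\<Sum>i\<in>XY. h i) = zmon d 0 s" using a by (simp add: arranged_def)
    ultimately show ?thesis unfolding s(1) zmon_zmonomial add.assoc by simp
  qed
  ultimately show ?thesis by (simp add: word0_def pos_def s)
qed

lemma vars_block: "A \<subseteq> XY ==> vars zi (A \<union> Zp ` K) = K"
proof -
  assume "A \<subseteq> XY"
  then have z: "zi i = None" if "i \<in> A" for i using XY_zi that by blast
  show ?thesis
  proof (intro set_eqI iffI)
    fix v assume "v \<in> vars zi (A \<union> Zp ` K)"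
    then obtain i where i: "i \<in> A \<union> Zp ` K" "zi i = Some v" by (auto simp: vars_def)
    then have "i \<in> Zp ` K" using z[of i] by auto
    then show "v \<in> K" using i by auto
  next
    fix v assume "v \<in> K"
    then show "v \<in> vars zi (A \<union> Zp ` K)" unfolding vars_def by (intro CollectI bexI[of _ "Zp v"]) auto
  qed
qed

text \<open>A block that is contracted down to two letters, or to one if \<open>b\<close>, up to the monomial \<open>m0\<close>.\<close>

lemma arranged_block:
  fixes A :: "('m::finite, 'n::finite) idx set" and r :: "('m, 'n) idx => int"
  assumes lat: "\<And>v. r (Zp v) = r (Zp 0)" and A: "A \<subseteq> XY" "Xi i0 \<in> A" and t: "t >= 1"
    and tot: "val r A t = 0"
    and gen: "\<And>B k. B \<subseteq> A ==> k <= t ==> val r B k = 0 ==> B = {} & k = 0 | B = A & k = t"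
    and card: "card A <= d * t + (if b then 1 else 2)"
  obtains w ws h m0 v0 where "path_word zi r w ws" "v0 \<in> {o'+1..o'+t}"
    "arranged d o' A t w h (m0 + (if b then e1 v0 else 0) + sum_list (map e1 ws))" "keys m0 \<subseteq> {o'+1..o'+t}"
    "mdeg m0 + card A = d * t + (if b then 1 else 2)"
proof -
  have R1: "Suc d >= 1" by simp
  \<comment> \<open>For a contraction to one letter, one unit of the variable \<open>v0\<close> is
    reserved for the last merger.\<close>
  define c where "c = (if b then d else Suc d)"
  have card': "card A <= (t - 1) * (Suc d - 1) + c + 1"
    using card t by (cases t; cases b) (simp_all add: c_def algebra_simps)
  obtain w ws h v0 where bw: "path_word zi r w ws" "v0 \<in> {o'+1..o'+t}"
    "dword w" "\<Union>(set w) = A \<union> Zp ` {o'+1..o'+t}" "{Xi i0} \<in> set w" "rem A w = map (%v. {Zp v}) [o'+1..<o'+t+1]"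
    "\<And>i. i \<in> A ==> i ~= Xi i0 ==> \<exists>T\<in>set w. i \<in> T & (\<exists>v\<in>vars zi T. h i = e1 v)" "h (Xi i0) = 0"
    "\<And>v. lookup (sum_list (map e1 ws) + (\<Sum>i\<in>A. h i)) v <= (if v \<in> {o'+1..o'+t} then if v = v0 then c else Suc d else 0)"
    "mdeg (sum_list (map e1 ws) + (\<Sum>i\<in>A. h i)) + 2 = t + card A"
    apply (rule block_word[where r = r and \<alpha> = "Xi i0" and R = "Suc d" and c = c and o' = o'])
             apply (rule lat)
            apply (rule A(1))
           apply (rule A(2))
          apply (rule t)
         apply (rule tot)
        apply (rule gen, assumption+)
       apply (rule card')
      apply (rule R1)
     apply (rule that, assumption+)
    done
  define x :: "nat \<Rightarrow>\<^sub>0 nat" where "x = (if b then e1 v0 else 0)"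
  obtain m0 where m0: "m0 + (x + (sum_list (map e1 ws) + (\<Sum>i\<in>A. h i))) = zmon d o' t"
  proof (rule poly_mapping_complement[of "x + (sum_list (map e1 ws) + (\<Sum>i\<in>A. h i))" "zmon d o' t"])
    fix v
    have "lookup (x + (sum_list (map e1 ws) + (\<Sum>i\<in>A. h i))) v =
        (if b & v = v0 then 1 else 0) + lookup (sum_list (map e1 ws) + (\<Sum>i\<in>A. h i)) v"
      unfolding lookup_add[of x] by (simp add: x_def lookup_single when_def)
    then show "lookup (x + (sum_list (map e1 ws) + (\<Sum>i\<in>A. h i))) v <= lookup (zmon d o' t) v"
      using bw(9)[of v] bw(2) unfolding lookup_zmon c_def by (auto split: if_splits)
  qed
  have "att w h i" if "i \<in> A" for i using bw(5,8) bw(7)[OF that] by (cases "i = Xi i0") (auto simp: att_def)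
  then have ar: "arranged d o' A t w h (m0 + x + sum_list (map e1 ws))"
    unfolding arranged_def using bw m0 by (simp add: add.assoc)
  have k: "keys m0 \<subseteq> {o'+1..o'+t}"
  proof
    fix v assume "v \<in> keys m0"
    then have "lookup m0 v > 0" by (simp add: in_keys_iff)
    moreover have "lookup m0 v <= lookup (zmon d o' t) v" unfolding m0[symmetric] by (simp add: lookup_add)
    ultimately show "v \<in> {o'+1..o'+t}" unfolding lookup_zmon by (auto split: if_splits)
  qed
  have "mdeg m0 + (mdeg x + mdeg (sum_list (map e1 ws) + (\<Sum>i\<in>A. h i))) = Suc d * t"
    using arg_cong[OF m0, of mdeg] unfolding mdeg_add mdeg_zmon by simp
  moreover have "mdeg x = (if b then 1 else 0)" using mdeg_single[of v0 1] by (simp add: x_def)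
  ultimately have dg: "mdeg m0 + card A = d * t + (if b then 1 else 2)" using bw(10) by (simp split: if_splits)
  show thesis by (rule that[OF bw(1,2) ar[unfolded x_def] k dg])
qed

lemma two_le_even_pos: "even (a::int) ==> a > 0 ==> a >= 2" by presburger

text \<open>The block is contracted to two letters of opposite energy. That energy is even and
  positive, hence at least 2, and the central term contains every monomial of even degree in the
  variables of the block, in particular the surplus \<open>m0\<close>.\<close>

lemma pos_block_append:
  fixes p :: "('m::finite, 'n::finite) idx => int"
  assumes "posfun X zi p \<Phi>"
    and po: "path_word zi p w ws"
    and ar: "arranged d o' A t w h (m0 + sum_list (map e1 ws))" "A \<subseteq> XY" and m0: "keys m0 \<subseteq> {o'+1..o'+t}" "even (mdeg m0)"
    and d: "dword (w @ post)" "\<Union>(set (w @ post)) = X" and ev: "\<And>T. even (sum p T)" "val p A t = 0" "lat s p"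
    and post: "nonneg (\<Psi> post)" "mcoeff (\<Psi> post) m' > 0"
    and central: "\<And>S T. dword (S # T # post) ==> \<Union>(set (S # T # post)) = X ==> sum p S > 0 ==> sum p (S \<union> T) = 0 ==>
      mle (crat p zi S T * \<Psi> post) (\<Phi> (S # T # post))"
  shows "mcoeff (\<Phi> (w @ post)) (m0 + sum_list (map e1 ws) + m') > 0"
proof -
  interpret posfun X zi p \<Phi> by fact
  have uw: "\<Union>(set w) = A \<union> Zp ` {o'+1..o'+t}" using ar by (simp add: arranged_def)
  have sA: "sum p (A \<union> Zp ` {o'+1..o'+t}) = 0"
    using sum_val[OF ev(3), of A "{o'+1..o'+t}"] ar(2) ev(2) finite_subset[OF ar(2)] by simp
  have "pos ([] @ w @ post) (m0 + m' + sum_list (map e1 ws))"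
  proof (rule path_word_pos[OF po])
    show "dom ([] @ w @ post)" using d by (simp add: dom_def)
    fix S T assume ST: "S \<union> T = \<Union>(set w)" "sum p S > 0" and dm: "dom ([] @ [S, T] @ post)"
    have s0: "sum p (S \<union> T) = 0" using ST(1) uw sA by simp
    have v: "keys m0 \<subseteq> vars zi (S \<union> T)" unfolding ST(1) uw vars_block[OF ar(2)] by (rule m0)
    have f: "finite (S \<union> T)" using dm by (simp add: dom_def)
    have "mcoeff (crat p zi S T) m0 > 0"
      unfolding crat_def by (rule mcoeff_rat_pos[OF two_le_even_pos[OF ev(1) ST(2)] f v m0(2)])
    then have "mcoeff (crat p zi S T * \<Psi> post) (m0 + m') > 0"
      using ST(2) by (intro mcoeff_mult_pos nonneg_crat post) auto
    moreover have "mle (crat p zi S T * \<Psi> post) (\<Phi> (S # T # post))"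
      using dm ST(2) s0 by (intro central) (auto simp: dom_def)
    ultimately show "pos ([] @ [S, T] @ post) (m0 + m')" by (fastforce simp: pos_def mle_def intro: less_le_trans)
  qed simp
  then show ?thesis by (simp add: pos_def ac_simps)
qed

section \<open>Chambers of lattice vectors\<close>

definition mixed :: "('m, 'n) idx set => bool" where
  "mixed B \<longleftrightarrow> B \<subseteq> XY & (\<exists>i. Xi i \<in> B) & (\<exists>i. Xi i \<notin> B) & (\<exists>j. Yj j \<in> B) & (\<exists>j. Yj j \<notin> B)"

definition regular :: "nat => (('m, 'n) idx => int) => bool" where
  "regular s e0 \<longleftrightarrow> (\<forall>B k. mixed B --> k <= s --> val e0 B k ~= 0)"

text \<open>Only mixed sets are compared, as only these define walls. A chamber may therefore
  contain vectors that balance other sets, for instance some letters of \<mu> against z-letters;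
  these are the loci that make \<open>transport\<close> necessary.\<close>

definition cham :: "nat => (('m, 'n) idx => int) => (('m, 'n) idx => int) set" where
  "cham s e0 = {e. lat s e & (\<forall>i. e (Xi i) > 0) & (\<forall>j. e (Yj j) < 0) & e (Zp 0) <= 0 \<and>
     (\<forall>B k. mixed B --> k <= s --> sgn (val e B k) = sgn (val e0 B k))}"

lemma sgn_dominant:
  fixes a b M N :: int assumes "a ~= 0" "\<bar>b\<bar> <= M" "N > M" shows "sgn (b + N * a) = sgn a"
proof (cases "a > 0")
  case True
  then have "N * 1 <= N * a" using assms by (intro mult_left_mono) linarith+
  then have "b + N * a > 0" using assms by linarith
  then show ?thesis using True by (simp add: sgn_if)
next
  case False
  then have "N * a <= N * (-1)" using assms by (intro mult_left_mono) linarith+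
  then have "b + N * a < 0" using assms by linarith
  then show ?thesis using False assms(1) by (simp add: sgn_if)
qed

text \<open>The bound \<open>Suc s\<close> instead of \<open>s\<close> includes the energy of a
  single z-letter, \<open>val q {} 1\<close>, also when \<open>s\<close> is 0.\<close>

lemma dominant:
  fixes u q :: "('m::finite, 'n::finite) idx => int"
  shows "\<exists>N0. \<forall>N\<ge>N0. \<forall>B k. B \<subseteq> XY --> k <= Suc s --> val q B k ~= 0 -->
    sgn (val (%i. u i + int N * q i) B k) = sgn (val q B k)"
proof -
  define M where "M = (\<Sum>i\<in>XY. \<bar>u i\<bar>) + int (Suc s) * \<bar>u (Zp 0)\<bar>"
  have M: "\<bar>val u B k\<bar> <= M" if "B \<subseteq> XY" "k <= Suc s" for B k
  proof -
    have "\<bar>sum u B\<bar> <= (\<Sum>i\<in>B. \<bar>u i\<bar>)" by (rule sum_abs)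
    also have "... <= (\<Sum>i\<in>XY. \<bar>u i\<bar>)" by (rule sum_mono2) (use that in auto)
    finally have 1: "\<bar>sum u B\<bar> <= (\<Sum>i\<in>XY. \<bar>u i\<bar>)" .
    have "\<bar>int k * u (Zp 0)\<bar> = int k * \<bar>u (Zp 0)\<bar>" by (simp add: abs_mult)
    also have "... <= int (Suc s) * \<bar>u (Zp 0)\<bar>" by (rule mult_right_mono) (use that in auto)
    finally show ?thesis using 1 unfolding val_def M_def by linarith
  qed
  have "sgn (val (%i. u i + int N * q i) B k) = sgn (val q B k)"
    if "N >= Suc (nat M)" "B \<subseteq> XY" "k <= Suc s" "val q B k ~= 0" for N B k
    unfolding val_comb using that by (intro sgn_dominant[OF _ M]) linarith+
  then show ?thesis by blast
qed

lemma cham_coord: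
  assumes "e \<in> cham s e0"
  shows "lat s e" "e (Xi i) > 0" "e (Yj j) < 0" "e (Zp 0) <= 0"
    "mixed B ==> k <= s ==> sgn (val e B k) = sgn (val e0 B k)"
  using assms by (auto simp: cham_def)

lemma val_simps: "val u {i} 0 = u i" "val u {} (Suc 0) = u (Zp 0)" "val u {} 0 = 0" by (simp_all add: val_def)

lemma cham_same_sgn:
  fixes e :: "('m::finite, 'n::finite) idx => int"
  assumes q: "q \<in> cham s e0" "regular s e0" "q (Zp 0) < 0" and e: "lat s e"
    and sg: "\<And>B k. B \<subseteq> XY ==> k <= Suc s ==> val q B k ~= 0 ==> sgn (val e B k) = sgn (val q B k)"
  shows "e \<in> cham s e0" "e (Zp 0) < 0"
proof -
  have pos: "e (Xi i) > 0" for i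
    using sg[of "{Xi i}" 0] cham_coord(2)[OF q(1), of i] by (auto simp: val_simps XY_def sgn_if split: if_splits)
  have neg: "e (Yj j) < 0" for j
    using sg[of "{Yj j}" 0] cham_coord(3)[OF q(1), of j] by (auto simp: val_simps XY_def sgn_if split: if_splits)
  show k: "e (Zp 0) < 0"
    using sg[of "{}" "Suc 0"] q(3) by (auto simp: val_simps sgn_if split: if_splits)
  have "sgn (val e B k) = sgn (val e0 B k)" if "mixed B" "k <= s" for B k
  proof -
    have s: "sgn (val q B k) = sgn (val e0 B k)" using cham_coord(5)[OF q(1) that] .
    have "val e0 B k ~= 0" using q(2) that by (simp add: regular_def)
    then have "val q B k ~= 0" using s by (metis sgn_eq_0_iff)
    then show ?thesis using sg[of B k] that s by (simp add: mixed_def)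
  qed
  then show "e \<in> cham s e0" using pos neg k e by (auto simp: cham_def)
qed

text \<open>If the z-letters have negative energy, all conditions of the chamber are strict at
  \<open>q\<close> and survive the addition of any vector to a large multiple of
  \<open>q\<close>.\<close>

lemma cham_open:
  fixes u :: "('m::finite, 'n::finite) idx => int"
  assumes q: "q \<in> cham s e0" "regular s e0" "q (Zp 0) < 0" and u: "lat s u"
  shows "\<exists>N0. \<forall>N\<ge>N0. (%i. u i + int N * q i) \<in> cham s e0 & (u (Zp 0) + int N * q (Zp 0) < 0)"
proof -
  obtain N0 where N0: "\<And>N B k. N >= N0 ==> B \<subseteq> XY ==> k <= Suc s ==> val q B k ~= 0 ==>
      sgn (val (%i. u i + int N * q i) B k) = sgn (val q B k)" using dominant[of s q u] by blast
  have "(%i. u i + int N * q i) \<in> cham s e0 & (u (Zp 0) + int N * q (Zp 0) < 0)" if "N >= N0" for N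
    using cham_same_sgn[OF q lat_comb[OF u cham_coord(1)[OF q(1)], of N]] N0[OF that] by blast
  then show ?thesis by blast
qed

lemma lat_scale: "lat s e ==> lat s (%i. a * e i)"
proof -
  assume e: "lat s e"
  have "(\<Sum>i\<in>XY. a * e i) + int s * (a * e (Zp 0)) = a * (sum e XY + int s * e (Zp 0))"
    by (simp add: sum_distrib_left algebra_simps)
  moreover have "a * e (Zp v) = a * e (Zp 0)" for v using lat_Zp[OF e, of v] by simp
  ultimately show ?thesis using e unfolding lat_def by simp
qed

lemma val_scale: "val (%i. a * e i) B k = a * val e B k"
  by (simp add: val_def sum_distrib_left algebra_simps)

lemma cham_scale: "e \<in> cham s e0 ==> a > 0 ==> (%i. a * e i) \<in> cham s e0" for a :: int
  unfolding cham_def by (auto simp: lat_scale val_scale mult_pos_neg mult_le_0_iff sgn_mult)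

lemma dword_word0:
  assumes "distinct xs" "distinct ys" "set xs = range Xi" "set ys = range Yj"
  shows "dword (word0 s xs ys)" "\<Union>(set (word0 s xs ys)) = letters s"
proof -
  have e: "word0 s xs ys = map (%i. {i}) (xs @ map Zp [1..<Suc s] @ ys)" by (simp add: word0_def del: upt_Suc)
  have "distinct (xs @ map Zp [1..<Suc s] @ ys)"
    using assms by (auto simp: distinct_map inj_on_def simp del: upt_Suc)
  then show "dword (word0 s xs ys)" unfolding e by (intro dword_map) auto
  show "\<Union>(set (word0 s xs ys)) = letters s" unfolding e using assms by (auto simp: letters_def XY_def simp del: upt_Suc)
qed

lemma Rw_line: "mpoly (%j. Rw zero_dir (%i. e i + int j * q i) z w) (Rw q e z w)"
proof -
  have "Rw zero_dir (%i. e i + int j * q i) z w = Gv (map (at_time j) (map (slet q e z) w))" for j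
    unfolding Rw_def by (subst Rv_static)
      (auto simp: vfree_sum slet_def at_time_def sum.distrib sum_distrib_left intro!: arg_cong[where f = Gv])
  then show ?thesis using Rv_mpoly[of "map (slet q e z) w"] by (simp add: Rw_def vfree_slet)
qed

lemma aligned_block:
  assumes b: "blocks s Lb A t" and n: "n \<in> Lb" and B: "B \<subseteq> A n" and a: "aligned Lb A t B k"
  shows "B = {} & k = 0 | B = A n & k = t n"
proof -
  have "~ A n' \<subseteq> B" if "n' \<in> Lb" "n' ~= n" for n'
  proof
    assume "A n' \<subseteq> B"
    moreover have "A n' \<inter> A n = {}" using b that n by (simp add: blocks_def)
    moreover have "A n' ~= {}" using b that by (auto simp: blocks_def)
    ultimately show False using B by blast
  qed
  then have e: "{n'\<in>Lb. A n' \<subseteq> B} = (if A n \<subseteq> B then {n} else {})" using n by auto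
  have k: "k = (\<Sum>n\<in>{n\<in>Lb. A n \<subseteq> B}. t n)" and c: "A n \<subseteq> B | A n \<inter> B = {}" using a n by (auto simp: aligned_def)
  show ?thesis
  proof (cases "A n \<subseteq> B")
    case False
    then have "B = {}" using c B by blast
    moreover have "k = 0" using k False unfolding e by simp
    ultimately show ?thesis by simp
  qed (use k e B in auto)
qed

lemma trivial_block: "blocks s {0} (%_. XY :: ('m::finite, 'n::finite) idx set) (%_. s)"
  by (auto simp: blocks_def XY_def)

lemma lat_uminus: "lat s u ==> lat s (%i. - u i)"
  using lat_scale[of s u "-1"] by simp

lemma exists_positive_val:
  assumes "A \<subseteq> XY" "A ~= {}" "A ~= XY"
  obtains u where "lat s u" "val u (A :: ('m::finite, 'n::finite) idx set) t > 0"
proof -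
  have "~ aligned {0} (%_. XY) (%_. s) A t" using assms by (auto simp: aligned_def)
  then obtain w where w: "w \<in> flat s {0} (%_. XY :: ('m, 'n) idx set) (%_. s)" "val w A t ~= 0"
    using flat_witness[OF trivial_block assms(1)] unfolding aligned_def by blast
  then have l: "lat s w" by (simp add: flat_def)
  show thesis
  proof (cases "val w A t > 0")
    case True
    then show ?thesis using that l by blast
  next
    case False
    then have "val (%i. - w i) A t > 0" using w(2) val_scale[of "-1" w] by simp
    then show ?thesis using that lat_uminus[OF l] by blast
  qed
qed

locale chamber_polynomial =
  fixes s d :: nat and xs ys :: "('m::finite, 'n::finite) idx list" and e0 :: "('m, 'n) idx => int"
    and Q :: "(('m, 'n) idx => int) => real"
  assumes xy: "distinct xs" "distinct ys" "set xs = range Xi" "set ys = range Yj"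
    and d: "d >= 1" and n2: "CARD('n) >= 2"
    and reg: "regular s e0"
    and line: "\<And>e q. lat s e ==> lat s q ==> evpoly (%j. Q (%i. e i + int j * q i)) (Q e)"
    and static: "\<And>e. e \<in> cham s e0 ==> mcoeff (Rw zero_dir e zi (word0 s xs ys)) (zmonomial s d) = Q e"
begin

abbreviation "W \<equiv> word0 s xs ys"
abbreviation "Z \<equiv> zmonomial s d"

lemmas dW = dword_word0[OF xy]

text \<open>Far out in the direction \<open>q\<close> the line from \<open>e\<close> runs inside the
  chamber, where the coefficient agrees with \<open>Q\<close>. The vector \<open>e\<close> may lie
  in any other chamber.\<close>

lemma directional:
  assumes q: "q \<in> cham s e0" "q (Zp 0) < 0" and e: "lat s e"
  shows "mcoeff (Rw q e zi W) Z = Q e"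
proof -
  obtain N0 where N0: "\<And>N. N >= N0 ==> (%i. e i + int N * q i) \<in> cham s e0"
    using cham_open[OF q(1) reg q(2) e] by blast
  have "evpoly (%j. mcoeff (Rw zero_dir (%i. e i + int j * q i) zi W) Z) (mcoeff (Rw q e zi W) Z)"
    using Rw_line[of e q zi W] by (simp add: mpoly_def)
  moreover have "evpoly (%j. mcoeff (Rw zero_dir (%i. e i + int j * q i) zi W) Z) (Q e)"
    by (rule evpoly_cong[OF line[OF e cham_coord(1)[OF q(1)]]])
      (use N0 static in \<open>auto intro!: eventually_sequentiallyI[of N0]\<close>)
  ultimately show ?thesis by (rule evpoly_unique)
qed

text \<open>A balanced splitting that the degree bound would allow: a block has
  \<open>card (A n) + t n\<close> letters, and its variables supply the degree
  \<open>Suc d * t n\<close>.\<close>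

definition labelled :: "(('m, 'n) idx => int) => nat set => (nat => ('m, 'n) idx set) => (nat => nat) => bool" where
  "labelled r Lb A t \<longleftrightarrow> blocks s Lb A t & card Lb >= 2 \<and>
     (\<forall>n\<in>Lb. val r (A n) (t n) = 0 & t n >= 1 & card (A n) <= d * t n + 2)"

text \<open>A generic vector that balances the blocks removes all accidental balances, and a large
  multiple of \<open>r\<close> keeps the sum in the chamber. Doubling makes all energies even, so
  that the positive ones are at least 2.\<close>

lemma generic_flat:
  assumes r: "r \<in> cham s e0" "r (Zp 0) < 0" and l: "labelled r Lb A t"
  obtains p where "p \<in> cham s e0" "p (Zp 0) < 0" "\<And>n. n \<in> Lb ==> val p (A n) (t n) = 0"
    "\<And>B k. B \<subseteq> XY ==> k <= s ==> ~ aligned Lb A t B k ==> val p B k ~= 0" "\<And>T. even (sum p T)"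
proof -
  have b: "blocks s Lb A t" using l by (simp add: labelled_def)
  obtain u where u: "u \<in> flat s Lb A t" "\<And>B k. B \<subseteq> XY ==> k <= s ==> ~ aligned Lb A t B k ==> val u B k ~= 0"
    using flat_generic[OF b] by blast
  obtain N1 where N1: "\<And>N. N >= N1 ==> (%i. u i + int N * r i) \<in> cham s e0 & (u (Zp 0) + int N * r (Zp 0) < 0)"
  proof -
    have "lat s u" using u(1) by (simp add: flat_def)
    from cham_open[OF r(1) reg r(2) this] show ?thesis using that by blast
  qed
  obtain N2 where N2: "\<And>N B k. N >= N2 ==> B \<subseteq> XY ==> k <= Suc s ==> val r B k ~= 0 ==>
      sgn (val (%i. u i + int N * r i) B k) = sgn (val r B k)" using dominant[of s r u] by blast
  define N where "N = max N1 N2"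
  define v where "v = (%i. u i + int N * r i)"
  have v: "v \<in> cham s e0" "v (Zp 0) < 0" using N1[of N] by (simp_all add: N_def v_def)
  show thesis
  proof (rule that[of "%i. 2 * v i"])
    show "(%i. 2 * v i) \<in> cham s e0" using cham_scale[OF v(1), of 2] by simp
    show "2 * v (Zp 0) < 0" using v by simp
    show "val (%i. 2 * v i) (A n) (t n) = 0" if "n \<in> Lb" for n
      using u(1) l that unfolding val_scale v_def val_comb by (simp add: flat_def labelled_def)
    show "even (\<Sum>i\<in>T. 2 * v i)" for T by (simp flip: sum_distrib_left)
    show "val (%i. 2 * v i) B k ~= 0" if B: "B \<subseteq> XY" "k <= s" "~ aligned Lb A t B k" for B k
    proof (cases "val r B k = 0")
      case True
      then show ?thesis using u(2)[OF B] unfolding val_scale v_def val_comb by simp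
    next
      case False
      then have "sgn (val v B k) = sgn (val r B k)" using N2[of N B k] B by (simp add: N_def v_def)
      then show ?thesis using False unfolding val_scale by (auto simp: sgn_if split: if_splits)
    qed
  qed
qed

text \<open>The blocks are contracted one after the other to central terms. The leftover degree
  \<open>d * t n + 2 - card (A n)\<close> of each block has to be even, because central terms
  contain only even degrees.\<close>

lemma static_chain:
  assumes b: "blocks s Lb A t" and p: "lat s p" "\<And>T. even (sum p T)"
    and n: "\<forall>n\<in>Lb. val p (A n) (t n) = 0 & t n >= 1 & card (A n) <= d * t n + 2 & even (d * t n + card (A n))"
    and g: "\<forall>B k. B \<subseteq> XY --> k <= s --> ~ aligned Lb A t B k --> val p B k ~= 0"
  shows block: "n \<in> Lb ==> \<exists>w ws h m0. path_word zi p w ws \<and>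
      arranged d o' (A n) (t n) w h (m0 + sum_list (map e1 ws)) & keys m0 \<subseteq> {o'+1..o'+t n} & even (mdeg m0)"
    and "distinct ns ==> set ns \<subseteq> Lb ==> \<exists>V h m. arranged d o' (\<Union>n\<in>set ns. A n) (\<Sum>n\<in>set ns. t n) V h m \<and>
      mcoeff (Rw zero_dir p zi V) m > 0"
proof -
  note n = n[rule_format] and g = g[rule_format]
  have AXY: "A n \<subseteq> XY" if "n \<in> Lb" for n using b that by (auto simp: blocks_def)
  have ts: "t n <= s" if "n \<in> Lb" for n
  proof -
    have "t n <= (\<Sum>n\<in>Lb. t n)" by (rule member_le_sum) (use b that in \<open>auto simp: blocks_def\<close>)
    then show ?thesis using b by (simp add: blocks_def)
  qed
  show block: "\<exists>w ws h m0. path_word zi p w ws \<and>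
      arranged d o' (A n) (t n) w h (m0 + sum_list (map e1 ws)) & keys m0 \<subseteq> {o'+1..o'+t n} & even (mdeg m0)" if nn: "n \<in> Lb" for n o'
  proof -
    obtain i0 where i0: "Xi i0 \<in> A n" using b nn by (auto simp: blocks_def)
    have gen: "B = {} & k = 0 | B = A n & k = t n" if "B \<subseteq> A n" "k <= t n" "val p B k = 0" for B k
      using g[of B k] that AXY[OF nn] ts[OF nn] aligned_block[OF b nn] by (meson le_trans order_trans)
    obtain w ws h m0 where "path_word zi p w ws"
      "arranged d o' (A n) (t n) w h (m0 + sum_list (map e1 ws))" "keys m0 \<subseteq> {o'+1..o'+t n}" "mdeg m0 + card (A n) = d * t n + 2"
      apply (rule arranged_block[where b = False, unfolded if_False add_0_right, where r = p and A = "A n" and ?i0.0 = i0 and t = "t n" and d = d and o' = o'])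
             apply (rule lat_Zp[OF p(1)])
            apply (rule AXY[OF nn])
           apply (rule i0)
          using n[OF nn] apply blast
         using n[OF nn] apply blast
        apply (rule gen, assumption+)
       using n[OF nn] apply blast
      apply (rule that, assumption+)
      done
    moreover from this(4) n[OF nn] have "even (mdeg m0)" by presburger
    ultimately show ?thesis by blast
  qed
  show "\<exists>V h m. arranged d o' (\<Union>n\<in>set ns. A n) (\<Sum>n\<in>set ns. t n) V h m & mcoeff (Rw zero_dir p zi V) m > 0"
    if "distinct ns" "set ns \<subseteq> Lb" for ns
    using that
  proof (induction ns arbitrary: o')
    case Nil
    have "arranged d o' {} 0 [] (%_. 0) 0" by (simp add: arranged_def rem_def zmon_def)
    moreover have "mcoeff (Rw zero_dir p zi []) 0 > 0" by (simp add: Rw_Nil mcoeff_1)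
    ultimately show ?case by auto
  next
    case (Cons n ns)
    let ?B = "\<Union>n\<in>set ns. A n" and ?t = "\<Sum>n\<in>set ns. t n"
    have nn: "n \<in> Lb" "n \<notin> set ns" "set ns \<subseteq> Lb" using Cons.prems by auto
    obtain V' h' m' where V': "arranged d (o' + t n) ?B ?t V' h' m'" "mcoeff (Rw zero_dir p zi V') m' > 0"
      using Cons by fastforce
    obtain w ws h m0 where w: "path_word zi p w ws"
      "arranged d o' (A n) (t n) w h (m0 + sum_list (map e1 ws))" "keys m0 \<subseteq> {o'+1..o'+t n}" "even (mdeg m0)"
      using block[OF nn(1), of o'] by blast
    have "A n \<inter> A n' = {}" if "n' \<in> set ns" for n'
    proof -
      have "n' \<in> Lb" "n ~= n'" using that nn by blast+
      then show ?thesis using b nn(1) by (simp add: blocks_def)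
    qed
    then have dis: "A n \<inter> ?B = {}" by blast
    have BXY: "?B \<subseteq> XY" using AXY nn by blast
    note aa = arranged_append[OF w(2) V'(1) dis AXY[OF nn(1)] BXY]
    have "mcoeff (Rw zero_dir p zi (w @ V')) (m0 + sum_list (map e1 ws) + m') > 0"
    proof (rule pos_block_append[OF posfun_static w(1,2) AXY[OF nn(1)] w(3,4)])
      show "dword (w @ V')" using aa by (simp add: arranged_def)
      show "nonneg (Rw zero_dir p zi V')" using V'(1) by (intro nonneg_static) (simp add: arranged_def)
      show "mle (crat p zi S T * Rw zero_dir p zi V') (Rw zero_dir p zi (S # T # V'))"
        if "dword (S # T # V')" "0 < sum p S" "sum p (S \<union> T) = 0" for S T
        by (rule static_central[OF that])
    qed (use V'(2) p n[OF nn(1)] in auto)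
    then show ?case using aa nn by (intro exI conjI) simp_all
  qed
qed

text \<open>At a point that balances all blocks, the excess contains the central term of the first
  block times the expectation of the others, so its coefficient at the final monomial is positive.
  But the static and the directional coefficient are both given by \<open>Q\<close>.\<close>

lemma even_blocks_impossible:
  assumes r: "r \<in> cham s e0" "r (Zp 0) < 0" and l: "labelled r Lb A t"
    and ev: "\<And>n. n \<in> Lb ==> even (d * t n + card (A n))"
  shows False
proof -
  have b: "blocks s Lb A t" using l by (simp add: labelled_def)
  obtain p where p: "p \<in> cham s e0" "p (Zp 0) < 0" "\<And>n. n \<in> Lb ==> val p (A n) (t n) = 0"
    "\<And>B k. B \<subseteq> XY ==> k <= s ==> ~ aligned Lb A t B k ==> val p B k ~= 0" "\<And>T. even (sum p T)"
    using generic_flat[OF r l] by blast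
  note lp = cham_coord(1)[OF p(1)]
  obtain u where u: "u \<in> flat s {0} (%_. XY :: ('m, 'n) idx set) (%_. s)"
    "\<And>B k. B \<subseteq> XY ==> k <= s ==> ~ aligned {0} (%_. XY) (%_. s) B k ==> val u B k ~= 0"
    using flat_generic[OF trivial_block] by blast
  have lu: "lat s u" using u(1) by (simp add: flat_def)
  obtain N where N: "\<And>B k. B \<subseteq> XY ==> k <= Suc s ==> val p B k ~= 0 ==>
      sgn (val (%i. u i + int N * p i) B k) = sgn (val p B k)" using dominant[of s p u] by blast
  \<comment> \<open>The generic vector decides all parts that \<open>p\<close> balances, and the
    multiple of \<open>p\<close> fixes the signs of all others.\<close>
  define q where "q = (%i. u i + int N * p i)"
  have lq: "lat s q" unfolding q_def by (rule lat_comb[OF lu lp])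
  have q: "q \<in> cham s e0" "q (Zp 0) < 0" using cham_same_sgn[OF p(1) reg p(2) lq] N by (auto simp: q_def)
  have gen: "generic (letters s) q p"
    unfolding generic_def
  proof (intro conjI allI impI)
    show "sum q (letters s) = 0" "sum p (letters s) = 0" using sum_letters lq lp by blast+
    fix T :: "('m, 'n) idx set" assume T: "T \<subseteq> letters s" "T ~= {}" "T ~= letters s"
    let ?v = "%u. val u (T \<inter> XY) (zc T)"
    have sm: "sum p T = ?v p" "sum q T = ?v q" "zc T <= s" using sum_letter lp lq T(1) by blast+
    show "spos q p T & 0 <= sum p T | sneg q p T & sum p T <= 0"
    proof (cases "?v p = 0")
      case True
      have "~ aligned {0} (%_. XY) (%_. s) (T \<inter> XY) (zc T)"
      proof
        assume "aligned {0} (%_. XY) (%_. s) (T \<inter> XY) (zc T)"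
        then consider "T \<inter> XY = {}" "zc T = 0" | "XY \<subseteq> T" "zc T = s"
          by (auto simp: aligned_def split: if_splits)
        then show False
        proof cases
          case 1
          then have "{v. Zp v \<in> T} = {}" using sum_letter(3)[OF lp T(1)] by (simp add: zc_def)
          then show False using 1(1) T(1,2) by (auto simp: letters_def)
        next
          case 2
          have K: "{v. Zp v \<in> T} \<subseteq> {1..s}" using T(1) by (auto simp: letters_def)
          have "{v. Zp v \<in> T} = {1..s}" by (rule card_subset_eq[OF _ K]) (use 2 in \<open>auto simp: zc_def\<close>)
          then have "letters s \<subseteq> T" using 2(1) by (auto simp: letters_def)
          then show False using T by blast
        qed
      qed
      then have "?v u ~= 0" using u(2)[of "T \<inter> XY" "zc T"] sm(3) by simp
      then have "?v q ~= 0" using True by (simp add: q_def val_comb)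
      then show ?thesis using True sm by (auto simp: lpos_def lneg_def)
    next
      case False
      then have "sgn (?v q) = sgn (?v p)" unfolding q_def using N sm(3) by simp
      then show ?thesis using False sm by (auto simp: lpos_def lneg_def sgn_if split: if_splits)
    qed
  qed
  have n: "val p (A n) (t n) = 0 & t n >= 1 & card (A n) <= d * t n + 2 & even (d * t n + card (A n))" if "n \<in> Lb" for n
    using l ev p(3) that by (simp add: labelled_def)
  have n': "\<forall>n\<in>Lb. val p (A n) (t n) = 0 & t n >= 1 & card (A n) <= d * t n + 2 & even (d * t n + card (A n))"
    using n by blast
  have g': "\<forall>B k. B \<subseteq> XY --> k <= s --> ~ aligned Lb A t B k --> val p B k ~= 0" using p(4) by blast
  note ch = static_chain[OF b lp p(5) n' g']
  have fL: "finite Lb" using b by (simp add: blocks_def)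
  obtain ns where ns: "distinct ns" "set ns = Lb" using finite_distinct_list[OF fL] by blast
  have len: "length ns >= 2" using distinct_card[OF ns(1)] ns(2) l by (simp add: labelled_def)
  then obtain n1 ns' where ns': "ns = n1 # ns'" by (cases ns) auto
  have nn: "n1 \<in> Lb" "set ns' \<subseteq> Lb" "n1 \<notin> set ns'" "distinct ns'" using ns ns' by auto
  let ?B = "\<Union>n\<in>set ns'. A n" and ?t = "\<Sum>n\<in>set ns'. t n"
  have A1: "A n1 \<subseteq> XY" "?B \<subseteq> XY" using b nn unfolding blocks_def by blast+
  have "A n1 \<inter> A n = {}" if "n \<in> set ns'" for n
  proof -
    have "n \<in> Lb" "n1 ~= n" using that nn by blast+
    then show ?thesis using b nn(1) by (simp add: blocks_def)
  qed
  then have dis: "A n1 \<inter> ?B = {}" by blast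
  obtain V' h' m' where V': "arranged d (0 + t n1) ?B ?t V' h' m'" "mcoeff (Rw zero_dir p zi V') m' > 0"
    using ch(2)[OF nn(4,2)] by blast
  obtain w ws h m0 where w: "path_word zi p w ws"
      "arranged d 0 (A n1) (t n1) w h (m0 + sum_list (map e1 ws))" "keys m0 \<subseteq> {0+1..0+t n1}" "even (mdeg m0)"
    using ch(1)[OF nn(1), of 0] by blast
  note aa = arranged_append[OF w(2) V'(1) dis A1]
  have U: "A n1 \<union> ?B = XY" and sT: "t n1 + ?t = s" using b ns ns' nn by (auto simp: blocks_def)
  obtain n2' where "n2' \<in> set ns'" using len ns' by (cases ns') auto
  moreover from this obtain i where "Xi i \<in> A n2'" using b nn(2) unfolding blocks_def by blast
  ultimately have "?B ~= {}" by blast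
  then have V'_ne: "V' ~= []" using V'(1) by (auto simp: arranged_def)
  note aa' = aa[unfolded U sT]
  have "mcoeff (excess q p zi (w @ V')) (m0 + sum_list (map e1 ws) + m') > 0"
  proof (rule pos_block_append[OF posfun_excess[OF gen] w(1,2) A1(1) w(3,4)])
    show "dword (w @ V')" "\<Union>(set (w @ V')) = letters s" using aa' by (simp_all add: arranged_def letters_def)
    show "nonneg (Rw zero_dir p zi V')" using V'(1) by (intro nonneg_static) (simp add: arranged_def)
    show "mle (crat p zi S T * Rw zero_dir p zi V') (excess q p zi (S # T # V'))"
      if "dword (S # T # V')" "\<Union>(set (S # T # V')) = letters s" "0 < sum p S" "sum p (S \<union> T) = 0" for S T
      by (rule excess_central[OF gen that(1,2) V'_ne that(3,4)])
  qed (use V'(2) p(5) lp n[OF nn(1)] in auto)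
  then have "mcoeff (excess q p zi W) Z > 0"
    by (rule arranged_word0[OF posfun_excess[OF gen] aa' _ xy]) (use cham_coord(2,3)[OF p(1)] in auto)
  moreover have "mcoeff (excess q p zi W) Z = 0"
    using static[OF p(1)] directional[OF q lp] by (simp add: excess_def)
  ultimately show False by simp
qed

end

section \<open>The two sides of a wall and directions close to it\<close>

definition irat :: "int => real mfps => real mfps" where
  "irat a u = msubst (varsigma 1 / varsigma (of_int a)) u"

lemma varsigma_quotient_inverse:
  assumes "a ~= 0" shows "varsigma 1 / varsigma a * (varsigma a / varsigma 1) = 1"
proof -
  have s: "fps_nth (varsigma c) 0 = 0" "fps_nth (varsigma c) 1 = c" for c by (simp_all add: varsigma_def)
  have nz: "varsigma c ~= 0" if "c ~= 0" for c using s(2)[of c] that by (metis fps_zero_nth)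
  have sub: "subdegree (varsigma c) = 1" if "c ~= 0" for c
    by (rule subdegreeI) (use s[of c] that in auto)
  let ?a = "varsigma a" and ?b = "varsigma 1"
  have d: "?b / ?a * ?a = ?b" "?a / ?b * ?b = ?a"
    using nz[of 1] nz[of a] sub[of 1] sub[of a] assms by (auto simp: fps_dvd_iff)
  have "(?b / ?a) * (?a / ?b) * ?a = ?a" using d by (metis mult.assoc mult.commute)
  then have "((?b / ?a) * (?a / ?b) - 1) * ?a = 0" by (simp only: left_diff_distrib mult_1_left diff_self)
  then have "(?b / ?a) * (?a / ?b) - 1 = 0" using nz[of a] assms unfolding mult_eq_0_iff by simp
  then show ?thesis by simp
qed

lemma irat_rat: "a ~= 0 ==> vfree u ==> irat a u * rat a u = 1"
  using varsigma_quotient_inverse[of "of_int a"] unfolding irat_def rat_def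
  by (simp add: msubst_mult[symmetric]) (intro mfps_eqI, simp add: msubst_def mcoeff_1 if_distrib[where f = "%x. x * _"] mdeg_eq_0_iff cong: if_cong)

abbreviation zS :: "('m, 'n) idx set => real mfps" where "zS T \<equiv> \<Sum>i\<in>T. zvar (zi i)"

text \<open>There is one member for each choice of \<open>t\<close> z-letters, that is, for each set
  \<open>K\<close> in the formula.\<close>

definition sides :: "nat => ('m, 'n) idx set => nat => ('m, 'n) idx set set" where
  "sides s A t = {T. T \<subseteq> letters s & T \<inter> XY = A & zc T = t}"

definition prefactor :: "nat => (('m, 'n) idx => int) => ('m, 'n) idx set => real mfps" where
  "prefactor s p S = irat (sum p S) (zS S) * irat (sum p S) (zS (letters s - S)) * rat (sum p S) (zS (letters s :: ('m, 'n) idx set))"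

text \<open>The pairs whose value on every vector of \<open>lat s\<close> is zero or plus or minus
  that of the pair \<open>A\<close>, \<open>t\<close>. They cannot be separated from the
  wall.\<close>

definition on_wall :: "nat => ('m, 'n) idx set => nat => ('m, 'n) idx set => nat => bool" where
  "on_wall s A t B k \<longleftrightarrow> B = {} & k = 0 | B = A & k = t | B = XY - A & k = s - t | B = XY & k = s"

lemma val_complement:
  assumes "lat s u" "A \<subseteq> XY" "t <= s"
  shows "val u (XY - A) (s - t) = - val u (A :: ('m::finite, 'n::finite) idx set) t"
proof -
  have "sum u (XY - A) = sum u XY - sum u A" by (rule sum_diff) (use assms in auto)
  moreover have "int (s - t) = int s - int t" using assms by (simp add: of_nat_diff)
  moreover have "sum u XY + int s * u (Zp 0) = 0" using assms by (simp add: lat_def)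
  ultimately show ?thesis unfolding val_def by (simp add: algebra_simps)
qed

lemma zc_empty: "T \<subseteq> letters s ==> T \<inter> XY = {} ==> zc T = 0 ==> T = {}" for T :: "('m::finite, 'n::finite) idx set"
proof -
  assume a: "T \<subseteq> letters s" "T \<inter> XY = {}" "zc T = 0"
  have "{v. Zp v \<in> T} \<subseteq> {1..s}" using a(1) by (auto simp: letters_def)
  then have "finite {v. Zp v \<in> T}" using finite_subset by blast
  then have "{v. Zp v \<in> T} = {}" using a(3) by (simp add: zc_def)
  then show "T = {}" using a by (auto simp: letters_def)
qed

lemma zc_subset_eq: "T \<subseteq> S ==> S \<subseteq> letters s ==> T \<inter> XY = S \<inter> XY ==> zc T = zc S ==> T = S"
  for T :: "('m::finite, 'n::finite) idx set"
proof -
  assume a: "T \<subseteq> S" "S \<subseteq> letters s" "T \<inter> XY = S \<inter> XY" "zc T = zc S"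
  have "{v. Zp v \<in> S} \<subseteq> {1..s}" using a(2) by (auto simp: letters_def)
  then have f: "finite {v. Zp v \<in> S}" using finite_subset by blast
  have "{v. Zp v \<in> T} = {v. Zp v \<in> S}"
    by (rule card_subset_eq[OF f]) (use a in \<open>auto simp: zc_def\<close>)
  then have "S \<subseteq> T" using a(2,3) by (auto simp: letters_def)
  then show "T = S" using a(1) by blast
qed

lemma zc_Diff: "T \<subseteq> S ==> S \<subseteq> letters s ==> zc (S - T) = zc S - zc T" for T :: "('m::finite, 'n::finite) idx set"
proof -
  assume a: "T \<subseteq> S" "S \<subseteq> letters s"
  have "{v. Zp v \<in> T} \<subseteq> {1..s}" using a by (auto simp: letters_def)
  then have f: "finite {v. Zp v \<in> T}" using finite_subset by blast
  have "{v. Zp v \<in> S - T} = {v. Zp v \<in> S} - {v. Zp v \<in> T}" by auto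
  moreover have "{v. Zp v \<in> T} \<subseteq> {v. Zp v \<in> S}" using a(1) by auto
  ultimately show ?thesis unfolding zc_def by (simp only: card_Diff_subset[OF f])
qed

lemma sides_compl:
  fixes S :: "('m::finite, 'n::finite) idx set"
  assumes "S \<in> sides s A t" shows "letters s - S \<in> sides s (XY - A) (s - t)"
proof -
  have S: "S \<subseteq> letters s" "S \<inter> XY = A" "zc S = t" using assms by (auto simp: sides_def)
  have "(letters s - S) \<inter> XY = XY - A" using S by (auto simp: letters_def)
  then show ?thesis using zc_Diff[of S "letters s" s] S(1,3) by (simp add: sides_def zc_letters)
qed

text \<open>\<open>q0\<close> lies on the hyperplane of the wall and on no other one,
  \<open>q1\<close> and \<open>q2\<close> are its neighbours on the two sides. The point
  \<open>p\<close> only has to lie off the hyperplane and need not be near it.\<close>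

locale two_blocks =
  fixes s :: nat and A :: "('m::finite, 'n::finite) idx set" and t :: nat and q0 q1 q2 p :: "('m, 'n) idx => int"
  assumes A: "A \<subseteq> XY" "A ~= {}" "A ~= XY" "t <= s" and l: "lat s q0" "lat s q1" "lat s q2" "lat s p"
    and z: "val q0 A t = 0"
    and g: "\<And>B k. B \<subseteq> XY ==> k <= s ==> ~ on_wall s A t B k ==>
      val q0 B k ~= 0 & sgn (val q1 B k) = sgn (val q0 B k) & sgn (val q2 B k) = sgn (val q0 B k)"
    and cr: "val q1 A t > 0" "val q2 A t < 0" "val p A t ~= 0"
begin

lemma sgn_letter:
  assumes "T \<subseteq> letters s" "~ on_wall s A t (T \<inter> XY) (zc T)"
  shows "sum q0 T ~= 0 & sgn (sum q1 T) = sgn (sum q0 T) & sgn (sum q2 T) = sgn (sum q0 T)"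
  using g[of "T \<inter> XY" "zc T"] sum_letter[OF l(1) assms(1)] sum_letter(1)[OF l(2) assms(1)] sum_letter(1)[OF l(3) assms(1)] assms
  by simp

text \<open>On the hyperplane a side has energy zero, so a proper part and the rest have opposite
  energies, which are nonzero since \<open>q0\<close> is generic; \<open>q1\<close> has the same
  signs.\<close>

lemma near:
  assumes S: "S \<in> sides s B k" "B = A & k = t | B = XY - A & k = s - t" and T: "T \<subset> S" "T ~= {}"
  shows "spos q1 p T & sneg q1 p (S - T) | sneg q1 p T & spos q1 p (S - T)"
proof -
  have SX: "S \<subseteq> letters s" "S \<inter> XY = B" "zc S = k" using S(1) by (auto simp: sides_def)
  have not_on: "~ on_wall s A t (T \<inter> XY) (zc T)" if T: "T \<subset> S" "T ~= {}" for T
  proof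
    assume o: "on_wall s A t (T \<inter> XY) (zc T)"
    have TX: "T \<subseteq> letters s" "T \<inter> XY \<subseteq> B" using T SX by auto
    have B: "B ~= {}" "B ~= XY" "B \<subseteq> XY" using S(2) A by auto
    have "T \<inter> XY = {} & zc T = 0 | T \<inter> XY = B & zc T = k"
    proof -
      have "~ XY - B \<subseteq> B" using B by blast
      moreover have "~ XY \<subseteq> B" using B by blast
      moreover have "XY - (XY - A) = A" using A by blast
      ultimately show ?thesis using o S(2) TX(2) A(4) unfolding on_wall_def by (elim disjE conjE) simp_all
    qed
    then show False
    proof (elim disjE conjE)
      assume "T \<inter> XY = {}" "zc T = 0" then show False using zc_empty[OF TX(1)] T by blast
    next
      assume "T \<inter> XY = B" "zc T = k" then show False using zc_subset_eq[of T S s] T SX by auto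
    qed
  qed
  have s0: "sum q0 S = 0"
  proof -
    have "val q0 (XY - A) (s - t) = - val q0 A t" by (rule val_complement) (use l A in auto)
    then show ?thesis using sum_letter(1)[OF l(1) SX(1)] SX S(2) z by auto
  qed
  have d: "sum q0 (S - T) = - sum q0 T"
    using sum_diff[of S T q0] finite_subset[OF SX(1)] T s0 by auto
  have T': "S - T \<subset> S" "S - T ~= {}" "S - T \<subseteq> letters s" "T \<subseteq> letters s" using T SX by auto
  show ?thesis using sgn_letter[OF T'(4) not_on[OF T]] sgn_letter[OF T'(3) not_on[OF T'(1,2)]] d
    by (auto simp: lpos_def lneg_def sgn_if split: if_splits)
qed

lemma wall_crossing: "wall_crossing (letters s) zi q1 q2 p (sides s A t) (prefactor s p)"
proof
  show "finite (letters s :: ('m, 'n) idx set)" by simp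
  show "letters s ~= ({} :: ('m, 'n) idx set)" using A by (auto simp: letters_def)
  show "sum q1 (letters s) = 0" "sum q2 (letters s) = 0" "sum p (letters s) = 0" using l sum_letters by blast+
next
  fix T :: "('m, 'n) idx set" assume T: "T \<subseteq> letters s" "T ~= {}" "T ~= letters s" "T \<notin> sides s A t" "letters s - T \<notin> sides s A t"
  have "~ on_wall s A t (T \<inter> XY) (zc T)"
  proof
    assume "on_wall s A t (T \<inter> XY) (zc T)"
    then show False unfolding on_wall_def
    proof (elim disjE conjE)
      assume "T \<inter> XY = {}" "zc T = 0" then show False using zc_empty T by blast
    next
      assume "T \<inter> XY = A" "zc T = t" then show False using T by (simp add: sides_def)
    next
      assume a: "T \<inter> XY = XY - A" "zc T = s - t"
      then have "T \<in> sides s (XY - A) (s - t)" using T by (simp add: sides_def)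
      from sides_compl[OF this] show False using T A by (simp add: double_diff)
    next
      assume a: "T \<inter> XY = XY" "zc T = s" 
      then show False using zc_subset_eq[of T "letters s" s] T by (auto simp: letters_XY zc_letters)
    qed
  qed
  from sgn_letter[OF T(1) this] show "spos q1 p T & spos q2 p T | sneg q1 p T & sneg q2 p T"
    by (auto simp: lpos_def lneg_def sgn_if split: if_splits)
next
  fix S assume S: "S \<in> sides s A t"
  then have SX: "S \<subseteq> letters s" "S \<inter> XY = A" "zc S = t" by (auto simp: sides_def)
  have v: "sum q1 S = val q1 A t" "sum q2 S = val q2 A t" "sum p S = val p A t"
    using sum_letter(1) l SX by metis+
  have "S ~= letters s"
  proof
    assume "S = letters s"
    then show False using SX(2) A(3) by (simp add: letters_XY)
  qed
  moreover have "S ~= {}" using SX A by blast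
  ultimately show "S \<subseteq> letters s & S ~= {} & S ~= letters s & spos q1 p S & sneg q2 p S"
    using SX(1) v cr by (simp add: lpos_def lneg_def)
  have vf: "vfree (zS T)" for T :: "('m, 'n) idx set" by (simp add: vfree_sum)
  have "sum p S ~= 0" using v cr by simp
  note ir = irat_rat[OF this vf[of S]] irat_rat[OF this vf[of "letters s - S"]]
  have "prefactor s p S * rat (sum p S) (zS S) * rat (sum p S) (zS (letters s - S)) =
      (irat (sum p S) (zS S) * rat (sum p S) (zS S)) * (irat (sum p S) (zS (letters s - S)) * rat (sum p S) (zS (letters s - S))) *
      rat (sum p S) (zS (letters s :: ('m, 'n) idx set))" by (simp only: prefactor_def ac_simps)
  then show "prefactor s p S * rat (sum p S) (zS S) * rat (sum p S) (zS (letters s - S)) = rat (sum p S) (zS (letters s :: ('m, 'n) idx set))"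
    by (simp only: ir mult_1_left)
next
  fix S T assume "S \<in> sides s A t" "T \<subset> S" "T ~= {}"
  from near[OF this(1) _ this(2,3)] show "spos q1 p T & sneg q1 p (S - T) | sneg q1 p T & spos q1 p (S - T)" by simp
next
  fix S T assume "S \<in> sides s A t" "T \<subset> letters s - S" "T ~= {}"
  from near[OF sides_compl[OF this(1)] _ this(2,3)]
  show "spos q1 p T & sneg q1 p (letters s - S - T) | sneg q1 p T & spos q1 p (letters s - S - T)" by simp
next
  fix S S' :: "('m, 'n) idx set" assume S: "S \<in> sides s A t" "S' \<in> sides s A t"
  show "S \<subseteq> S' ==> S = S'" using zc_subset_eq[of S S' s] S by (auto simp: sides_def)
  show "S \<inter> S' ~= {}" using S A by (auto simp: sides_def)
  show "S \<union> S' ~= letters s"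
  proof
    assume "S \<union> S' = letters s"
    then have "(S \<inter> XY) \<union> (S' \<inter> XY) = XY" by (auto simp: letters_def)
    then show False using S A by (simp add: sides_def)
  qed
qed

end

lemma aligned_pair:
  fixes A :: "nat => ('m::finite, 'n::finite) idx set"
  assumes b: "blocks s {a, b} A t" and ab: "a ~= b" and B: "B \<subseteq> XY" and al: "aligned {a, b} A t B k"
  shows "on_wall s (A a) (t a) B k"
proof -
  have AA: "A a \<union> A b = XY" "A b = XY - A a" "t a + t b = s" "t b = s - t a" using b ab by (auto simp: blocks_def)
  have c: "A a \<subseteq> B | A a \<inter> B = {}" "A b \<subseteq> B | A b \<inter> B = {}" "k = (\<Sum>n\<in>{n\<in>{a, b}. A n \<subseteq> B}. t n)"
    using al by (auto simp: aligned_def)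
  have e: "{n\<in>{a, b}. A n \<subseteq> B} = (if A a \<subseteq> B then {a} else {}) \<union> (if A b \<subseteq> B then {b} else {})" by auto
  note k = c(3)[unfolded e]
  show ?thesis
  proof (cases "A a \<subseteq> B"; cases "A b \<subseteq> B")
    assume h: "A a \<subseteq> B" "A b \<subseteq> B"
    then have "k = s" using k AA(3) ab by simp
    moreover have "B = XY" using h AA(1) B by blast
    ultimately show ?thesis by (simp add: on_wall_def)
  next
    assume h: "A a \<subseteq> B" "~ A b \<subseteq> B"
    then have "k = t a" using k by simp
    moreover have "B = A a" using h c(2) AA(1) B by blast
    ultimately show ?thesis by (simp add: on_wall_def)
  next
    assume h: "~ A a \<subseteq> B" "A b \<subseteq> B"
    then have "k = t b" using k by simp
    moreover have "B = A b" using h c(1) AA(1) B by blast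
    ultimately show ?thesis using AA(2,4) by (simp add: on_wall_def)
  next
    assume h: "~ A a \<subseteq> B" "~ A b \<subseteq> B"
    then have "k = 0" using k by simp
    moreover have "B = {}" using h c(1,2) AA(1) B by blast
    ultimately show ?thesis by (simp add: on_wall_def)
  qed
qed

context chamber_polynomial
begin

text \<open>Two directions on either side of the hyperplane that balances both blocks lie in the
  same chamber, so the coefficient of the jump is zero. On the other hand each block can be
  contracted to a single letter: the additional merger changes the parity of the leftover degree to
  even, and the remaining two-letter word gives a positive coefficient.\<close>

lemma two_odd_blocks_impossible:
  assumes r: "r \<in> cham s e0" "r (Zp 0) < 0" and l: "labelled r {a, b} A t" and ab: "a ~= b"
    and od: "odd (d * t a + card (A a))" "odd (d * t b + card (A b))"
  shows False
proof -
  let ?Lb = "{a, b}"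
  have b: "blocks s ?Lb A t" using l by (simp add: labelled_def)
  have AA: "A a \<union> A b = XY" "A a \<inter> A b = {}" "t a + t b = s" "A a ~= {}" "A b ~= {}"
    using b ab by (auto simp: blocks_def)
  have Ab: "A b = XY - A a" "t b = s - t a" using AA by auto
  have Aa: "A a \<subseteq> XY" "A b \<subseteq> XY" "A a ~= XY" "t a <= s" using AA by auto
  note al = aligned_pair[OF b ab]
  obtain q0 where q0: "q0 \<in> cham s e0" "q0 (Zp 0) < 0" "\<And>n. n \<in> ?Lb ==> val q0 (A n) (t n) = 0"
    "\<And>B k. B \<subseteq> XY ==> k <= s ==> ~ aligned ?Lb A t B k ==> val q0 B k ~= 0" "\<And>T. even (sum q0 T)"
    using generic_flat[OF r l] by blast
  note l0 = cham_coord(1)[OF q0(1)]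
  obtain u1 where u1: "lat s u1" "val u1 (A a) (t a) > 0" using exists_positive_val[OF Aa(1) AA(4) Aa(3)] by blast
  define u2 where "u2 = (%i. - u1 i)"
  have u2: "lat s u2" "val u2 (A a) (t a) < 0" using u1 lat_uminus val_scale[of "-1" u1] by (simp_all add: u2_def)
  obtain N1 where N1: "\<And>N B k. N >= N1 ==> B \<subseteq> XY ==> k <= Suc s ==> val q0 B k ~= 0 ==>
      sgn (val (%i. u1 i + int N * q0 i) B k) = sgn (val q0 B k)" using dominant[of s q0 u1] by blast
  obtain N2 where N2: "\<And>N B k. N >= N2 ==> B \<subseteq> XY ==> k <= Suc s ==> val q0 B k ~= 0 ==>
      sgn (val (%i. u2 i + int N * q0 i) B k) = sgn (val q0 B k)" using dominant[of s q0 u2] by blast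
  define N where "N = max N1 N2"
  define q1 where "q1 = (%i. u1 i + int N * q0 i)"
  define q2 where "q2 = (%i. u2 i + int N * q0 i)"
  \<comment> \<open>The signs of \<open>p\<close> are those of \<open>q1\<close>, as the positivity
    of the jump demands, and its energies are even.\<close>
  define p where "p = (%i. 2 * q1 i)"
  have l12: "lat s q1" "lat s q2" unfolding q1_def q2_def by (rule lat_comb[OF u1(1) l0] lat_comb[OF u2(1) l0])+
  have lp: "lat s p" unfolding p_def by (rule lat_scale[OF l12(1)])
  have s1: "sgn (val q1 B k) = sgn (val q0 B k)" if "B \<subseteq> XY" "k <= Suc s" "val q0 B k ~= 0" for B k
    unfolding q1_def by (rule N1) (use that in \<open>auto simp: N_def\<close>)
  have s2: "sgn (val q2 B k) = sgn (val q0 B k)" if "B \<subseteq> XY" "k <= Suc s" "val q0 B k ~= 0" for B k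
    unfolding q2_def by (rule N2) (use that in \<open>auto simp: N_def\<close>)
  have q1: "q1 \<in> cham s e0" "q1 (Zp 0) < 0" using cham_same_sgn[OF q0(1) reg q0(2) l12(1)] s1 by blast+
  have q2: "q2 \<in> cham s e0" "q2 (Zp 0) < 0" using cham_same_sgn[OF q0(1) reg q0(2) l12(2)] s2 by blast+
  have z0: "val q0 (A a) (t a) = 0" "val q0 (A b) (t b) = 0" using q0(3) by auto
  have v1: "val q1 (A a) (t a) > 0" "val q2 (A a) (t a) < 0"
    using u1 u2 z0 by (simp_all add: q1_def q2_def val_comb)
  have v2: "val p (A a) (t a) ~= 0" unfolding p_def val_scale using v1 by simp
  interpret tb: two_blocks s "A a" "t a" q0 q1 q2 p
  proof
    show "A a \<subseteq> XY" "A a ~= {}" "A a ~= XY" "t a <= s" by fact+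
    show "lat s q0" "lat s q1" "lat s q2" "lat s p" by fact+
    show "val q0 (A a) (t a) = 0" "val q1 (A a) (t a) > 0" "val q2 (A a) (t a) < 0" "val p (A a) (t a) ~= 0" by fact+
    fix B k assume B: "B \<subseteq> XY" "k <= s" "~ on_wall s (A a) (t a) B k"
    then have "val q0 B k ~= 0" using q0(4)[OF B(1,2)] al[OF B(1)] by blast
    then show "val q0 B k ~= 0 & sgn (val q1 B k) = sgn (val q0 B k) & sgn (val q2 B k) = sgn (val q0 B k)"
      using s1[OF B(1)] s2[OF B(1)] B(2) by simp
  qed
  interpret wc: wall_crossing "letters s" zi q1 q2 p "sides s (A a) (t a)" "prefactor s p" by (rule tb.wall_crossing)
  have sg: "(spos q1 p T --> sum p T >= 0) & (sneg q1 p T --> sum p T <= 0)" for T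
  proof -
    have "sum p T = 2 * sum q1 T" by (simp add: p_def sum_distrib_left)
    then show ?thesis by (auto simp: lpos_def lneg_def)
  qed
  have PJ: "posfun (letters s) zi p wc.jump" by (rule wc.posfun_jump) (rule sg)
  interpret pj: posfun "letters s" zi p wc.jump by (rule PJ)
  have sgn0: "(sum q0 T > 0 --> sum p T > 0) & (sum q0 T < 0 --> sum p T < 0)" if T: "T \<subseteq> letters s" for T
  proof -
    have e: "sum p T = 2 * sum q1 T" by (simp add: p_def sum_distrib_left)
    have s: "sum q0 T = val q0 (T \<inter> XY) (zc T)" "sum q1 T = val q1 (T \<inter> XY) (zc T)" "zc T <= s"
      using sum_letter l0 l12 T by blast+
    show ?thesis using s1[of "T \<inter> XY" "zc T"] s unfolding e by (auto simp: sgn_if split: if_splits)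
  qed
  have ln: "val r (A n) (t n) = 0 & t n >= 1 & card (A n) <= d * t n + 2" if n: "n \<in> ?Lb" for n
  proof -
    have "\<forall>n\<in>?Lb. val r (A n) (t n) = 0 & t n >= 1 & card (A n) <= d * t n + 2"
      using l unfolding labelled_def by (elim conjE)
    from bspec[OF this n] show ?thesis .
  qed
  have blk: "\<exists>w ws h m0 v0. path_word zi q0 w ws \<and>
      v0 \<in> {o'+1..o'+t n} & arranged d o' (A n) (t n) w h (m0 + e1 v0 + sum_list (map e1 ws)) & keys m0 \<subseteq> {o'+1..o'+t n} & even (mdeg m0)"
    if nn: "n \<in> ?Lb" for n o'
  proof -
    have "\<forall>n\<in>?Lb. \<exists>i. Xi i \<in> A n" using b unfolding blocks_def by (elim conjE)
    from bspec[OF this nn] obtain i0 where i0: "Xi i0 \<in> A n" ..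
    have od': "odd (d * t n + card (A n))" using od nn by auto
    have AX: "A n \<subseteq> XY" "t n <= s" using nn Aa AA(3) by auto
    have gen: "B = {} & k = 0 | B = A n & k = t n" if "B \<subseteq> A n" "k <= t n" "val q0 B k = 0" for B k
      using q0(4)[of B k] that AX aligned_block[OF b nn] by (meson le_trans order_trans)
    have c: "card (A n) <= d * t n + 1" using ln[OF nn] od' by presburger
    obtain w ws h m0 v0 where "path_word zi q0 w ws"
      "v0 \<in> {o'+1..o'+t n}" "arranged d o' (A n) (t n) w h (m0 + e1 v0 + sum_list (map e1 ws))" "keys m0 \<subseteq> {o'+1..o'+t n}"
      "mdeg m0 + card (A n) = d * t n + 1"
      apply (rule arranged_block[where b = True, unfolded if_True, where r = q0 and A = "A n" and ?i0.0 = i0 and t = "t n" and d = d and o' = o'])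
             apply (rule lat_Zp[OF l0])
            apply (rule AX(1))
           apply (rule i0)
          using ln[OF nn] apply blast
         apply (rule q0(3)[OF nn])
        apply (rule gen, assumption+)
       apply (rule c)
      apply (rule that, assumption+)
      done
    moreover from this(5) od' have "even (mdeg m0)" by presburger
    ultimately show ?thesis by blast
  qed
  obtain wa wsa ha ma va where a: "path_word zi q0 wa wsa"
      "va \<in> {0+1..0+t a}" "arranged d 0 (A a) (t a) wa ha (ma + e1 va + sum_list (map e1 wsa))" "keys ma \<subseteq> {0+1..0+t a}" "even (mdeg ma)"
    using blk[of a 0] by blast
  obtain wb wsb hb mb vb where b': "path_word zi q0 wb wsb"
      "vb \<in> {0+t a+1..0+t a+t b}" "arranged d (0 + t a) (A b) (t b) wb hb (mb + e1 vb + sum_list (map e1 wsb))" "keys mb \<subseteq> {0+t a+1..0+t a+t b}" "even (mdeg mb)"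
    using blk[of b "0 + t a"] by blast
  note ab' = arranged_append[OF a(3) b'(3) AA(2) Aa(1,2), unfolded AA(1,3)]
  define Sa where "Sa = A a \<union> Zp ` {0+1..0+t a}"
  define Sb where "Sb = A b \<union> Zp ` {0+t a+1..0+t a+t b}"
  have uw: "\<Union>(set wa) = Sa" "\<Union>(set wb) = Sb" using a(3) b'(3) by (simp_all add: arranged_def Sa_def Sb_def)
  have dw: "dword (wa @ wb)" "\<Union>(set (wa @ wb)) = letters s" using ab' by (simp_all add: arranged_def letters_def)
  have SS: "Sa \<union> Sb = letters s" "Sa \<inter> Sb = {}" using dw uw by (auto simp: dword_append)
  have Sb: "Sb = letters s - Sa" using SS by blast
  have fS: "finite Sa" "finite Sb" "Sa ~= {}" "Sb ~= {}" using AA finite_subset[OF Aa(1)] finite_subset[OF Aa(2)] by (auto simp: Sa_def Sb_def)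
  have zca: "zc Sa = t a"
  proof -
    have "Zp v \<notin> A a" for v using Aa by auto
    then have "{v. Zp v \<in> Sa} = {1..t a}" by (auto simp: Sa_def)
    then show ?thesis by (simp add: zc_def)
  qed
  have Sa_side: "Sa \<in> sides s (A a) (t a)"
    unfolding sides_def using zca SS Aa by (auto simp: Sa_def)
  have d2: "dword [Sa, Sb]" using fS SS by simp
  have 1: "pj.pos [Sa, Sb] (ma + mb)"
  proof -
    have SaX: "Sa \<subseteq> letters s" using SS by blast
    have sp: "sum p Sa = 2 * val q1 (A a) (t a)"
      using sum_letter(1)[OF lp SaX] zca Sa_side by (simp add: sides_def p_def val_scale)
    have e: "wc.jump [Sa, Sb] = rat (sum p Sa) (zS (letters s :: ('m, 'n) idx set))"
      unfolding Sb using wc.jump_pair[of Sa] Sa_side SaX by simp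
    have vX: "vars zi (letters s :: ('m, 'n) idx set) = {1..s}" unfolding letters_def by (rule vars_block) simp
    have "keys (ma + mb) \<subseteq> {1..s}"
      using Poly_Mapping.keys_add[of ma mb] a(4) b'(4) AA(3) by fastforce
    moreover have "even (mdeg (ma + mb))" using a(5) b'(5) by (simp add: mdeg_add)
    ultimately show ?thesis unfolding pj.pos_def e
      by (intro mcoeff_rat_pos) (use sp v1 vX in auto)
  qed
  have 2: "pj.pos ([] @ wa @ [Sb]) (ma + mb + e1 va + sum_list (map e1 wsa))"
  proof (rule pj.path_word_pos[OF a(1)])
    show "pj.dom ([] @ wa @ [Sb])" unfolding pj.dom_def using dw uw fS by (auto simp: dword_append)
    show "(0 < sum q0 T --> 0 < sum p T) & (sum q0 T < 0 --> sum p T < 0)" if "T \<subseteq> letters s" for T by (rule sgn0[OF that])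
    fix S T assume ST: "S \<union> T = \<Union>(set wa)" "sum q0 S > 0" "sum q0 T < 0" and dm: "pj.dom ([] @ [S, T] @ [Sb])"
    have X: "S \<subseteq> letters s" "T \<subseteq> letters s" using ST(1) uw SS by blast+
    have pp: "sum p S > 0" "sum p T < 0" using sgn0[OF X(1)] sgn0[OF X(2)] ST by auto
    have "va \<in> vars zi (S \<union> T)" unfolding ST(1) uw Sa_def vars_block[OF Aa(1)] by (rule a(2))
    then have vv: "va \<in> vars zi S | va \<in> vars zi T" by (auto simp: vars_def)
    have "pj.pos ([] @ S # T # [Sb]) (ma + mb + e1 va)"
      by (rule pj.pos_merge) (use dm 1 ST(1) uw pp vv in auto)
    then show "pj.pos ([] @ [S, T] @ [Sb]) (ma + mb + e1 va)" by simp
  qed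
  have 3: "pj.pos (wa @ wb @ []) (ma + mb + e1 va + sum_list (map e1 wsa) + e1 vb + sum_list (map e1 wsb))"
  proof (rule pj.path_word_pos[OF b'(1)])
    show "pj.dom (wa @ wb @ [])" unfolding pj.dom_def using dw by simp
    show "(0 < sum q0 T --> 0 < sum p T) & (sum q0 T < 0 --> sum p T < 0)" if "T \<subseteq> letters s" for T by (rule sgn0[OF that])
    fix S T assume ST: "S \<union> T = \<Union>(set wb)" "sum q0 S > 0" "sum q0 T < 0" and dm: "pj.dom (wa @ [S, T] @ [])"
    have X: "S \<subseteq> letters s" "T \<subseteq> letters s" using ST(1) uw SS by blast+
    have pp: "sum p S > 0" "sum p T < 0" using sgn0[OF X(1)] sgn0[OF X(2)] ST by auto
    have "vb \<in> vars zi (S \<union> T)" unfolding ST(1) uw Sb_def vars_block[OF Aa(2)] by (rule b'(2))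
    then have vv: "vb \<in> vars zi S | vb \<in> vars zi T" by (auto simp: vars_def)
    have "pj.pos (wa @ S # T # []) (ma + mb + e1 va + sum_list (map e1 wsa) + e1 vb)"
      by (rule pj.pos_merge) (use dm 2 ST(1) uw pp vv in auto)
    then show "pj.pos (wa @ [S, T] @ []) (ma + mb + e1 va + sum_list (map e1 wsa) + e1 vb)" by simp
  qed
  have "mcoeff (wc.jump (wa @ wb)) (ma + e1 va + sum_list (map e1 wsa) + (mb + e1 vb + sum_list (map e1 wsb))) > 0"
    using 3 unfolding pj.pos_def by (simp add: ac_simps)
  then have "mcoeff (wc.jump W) Z > 0"
  proof (rule arranged_word0[OF PJ ab' _ xy])
    show "p (Xi i) > 0" "p (Yj j) < 0" for i j using cham_coord(2,3)[OF q1(1)] by (auto simp: p_def)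
  qed
  moreover have "mcoeff (wc.jump W) Z = 0"
    using directional[OF q1 lp] directional[OF q2 lp] by (simp add: wc.jump_def)
  ultimately show False by simp
qed

text \<open>The number of odd blocks is even. For an odd block parity improves the bound from
  \<open>d * t n + 2\<close> to \<open>d * t n + 1\<close>, so two odd blocks may be united without
  violating the bound. This is repeated until no block is odd or only two blocks are left.\<close>

lemma labelled_impossible:
  assumes r: "r \<in> cham s e0" "r (Zp 0) < 0" and par: "even (d * s + card (XY :: ('m, 'n) idx set))"
  shows "~ labelled r Lb A t"
proof (induction "card Lb" arbitrary: Lb A t rule: less_induct)
  case less
  show ?case
  proof
    assume l: "labelled r Lb A t"
    have b: "blocks s Lb A t" using l by (simp add: labelled_def)
    have fL: "finite Lb" using b by (simp add: blocks_def)
    let ?f = "%n. d * t n + card (A n)"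
    have "card (\<Union>n\<in>Lb. A n) = (\<Sum>n\<in>Lb. card (A n))"
    proof (rule card_UN_disjoint[OF fL])
      show "\<forall>n\<in>Lb. finite (A n)" using b unfolding blocks_def by (metis UN_upper finite_XY finite_subset)
      show "\<forall>i\<in>Lb. \<forall>j\<in>Lb. i ~= j --> A i \<inter> A j = {}" using b by (simp add: blocks_def)
    qed
    then have "(\<Sum>n\<in>Lb. ?f n) = d * s + card (XY :: ('m, 'n) idx set)"
      using b by (simp add: sum.distrib blocks_def flip: sum_distrib_left)
    then have "even (card {n\<in>Lb. odd (?f n)})" using par even_sum_iff[OF fL, of ?f] by simp
    then consider "{n\<in>Lb. odd (?f n)} = {}" | "card {n\<in>Lb. odd (?f n)} >= 2"
    proof -
      assume e: "even (card {n\<in>Lb. odd (?f n)})"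
      assume *: "{n\<in>Lb. odd (?f n)} = {} ==> thesis" "card {n\<in>Lb. odd (?f n)} >= 2 ==> thesis"
      show thesis
      proof (cases "card {n\<in>Lb. odd (?f n)} = 0")
        case True
        moreover have "finite {n\<in>Lb. odd (?f n)}" using fL by simp
        ultimately show ?thesis using *(1) card_0_eq by blast
      next
        case False
        then have "card {n\<in>Lb. odd (?f n)} >= 2" using e by presburger
        then show ?thesis by (rule *(2))
      qed
    qed
    then show False
    proof cases
      case 1
      then show False using even_blocks_impossible[OF r l] by blast
    next
      case 2
      then obtain a b' where ab: "a \<in> Lb" "b' \<in> Lb" "a ~= b'" "odd (?f a)" "odd (?f b')"
      proof -
        obtain a where a: "a \<in> {n\<in>Lb. odd (?f n)}" using 2 by (metis card.empty ex_in_conv not_numeral_le_zero)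
        have "~ {n\<in>Lb. odd (?f n)} \<subseteq> {a}"
        proof
          assume "{n\<in>Lb. odd (?f n)} \<subseteq> {a}"
          from card_mono[OF _ this] show False using 2 by simp
        qed
        then show ?thesis using that a by blast
      qed
      show False
      proof (cases "card Lb = 2")
        case True
        have "Lb = {a, b'}" using card_subset_eq[of Lb "{a, b'}"] fL True ab by auto
        then show False using two_odd_blocks_impossible[OF r _ ab(3-5)] l by simp
      next
        case False
        then have c3: "card Lb >= 3" using l by (simp add: labelled_def)
        let ?L = "Lb - {b'}" and ?A = "A(a := A a \<union> A b')" and ?t = "t(a := t a + t b')"
        have cl: "card ?L = card Lb - 1" using ab by (simp add: card_Diff_singleton)
        have "~ labelled r ?L ?A ?t" by (rule less) (use cl c3 in auto)
        moreover have "labelled r ?L ?A ?t"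
        proof -
          have La: "?L = insert a (?L - {a})" "Lb = insert a (insert b' (?L - {a}))" using ab by auto
          have dis: "A n \<inter> A n' = {}" if "n \<in> Lb" "n' \<in> Lb" "n ~= n'" for n n' using b that by (simp add: blocks_def)
          have bl: "blocks s ?L ?A ?t" unfolding blocks_def
          proof (intro conjI ballI impI)
            show "finite ?L" using fL by simp
            show "\<exists>i. Xi i \<in> ?A n" if "n \<in> ?L" for n using b that ab(1) by (auto simp: blocks_def)
            show "?A n \<inter> ?A n' = {}" if "n \<in> ?L" "n' \<in> ?L" "n ~= n'" for n n'
              using dis[of n n'] dis[of b' n] dis[of b' n'] that ab by auto
            show "(\<Union>n\<in>?L. ?A n) = XY"
            proof -
              have "(\<Union>n\<in>?L. ?A n) = (\<Union>n\<in>Lb. A n)" using ab by (auto split: if_splits)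
              then show ?thesis using b by (simp add: blocks_def)
            qed
            have "(\<Sum>n\<in>?L. ?t n) = (t a + t b') + (\<Sum>n\<in>?L - {a}. t n)"
              using fL ab by (subst sum.remove[of _ a]) auto
            also have "... = (\<Sum>n\<in>Lb. t n)"
            proof -
              have "(\<Sum>n\<in>Lb. t n) = t b' + (\<Sum>n\<in>?L. t n)" using fL ab by (subst sum.remove[of _ b']) auto
              also have "(\<Sum>n\<in>?L. t n) = t a + (\<Sum>n\<in>?L - {a}. t n)" using fL ab by (subst sum.remove[of _ a]) auto
              finally show ?thesis by simp
            qed
            finally show "(\<Sum>n\<in>?L. ?t n) = s" using b by (simp add: blocks_def)
          qed
          have fA: "finite (A n)" if "n \<in> Lb" for n
            using b that unfolding blocks_def by (metis UN_upper finite_XY finite_subset)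
          have ln: "val r (A n) (t n) = 0 & t n >= 1 & card (A n) <= d * t n + 2" if "n \<in> Lb" for n
            using l that by (simp add: labelled_def)
          have "val r (A a \<union> A b') (t a + t b') = val r (A a) (t a) + val r (A b') (t b')"
            using dis[OF ab(1-3)] fA ab by (simp add: val_def sum.union_disjoint algebra_simps)
          moreover have "card (A a \<union> A b') = card (A a) + card (A b')"
            using dis[OF ab(1-3)] fA ab by (simp add: card_Un_disjoint)
          moreover have "card (A a) <= d * t a + 1" "card (A b') <= d * t b' + 1"
            using ln[OF ab(1)] ln[OF ab(2)] ab(4,5) by presburger+
          ultimately have "val r (A a \<union> A b') (t a + t b') = 0 & t a + t b' >= 1 & card (A a \<union> A b') <= d * (t a + t b') + 2"
            using ln[OF ab(1)] ln[OF ab(2)] by (simp add: algebra_simps)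
          then show ?thesis unfolding labelled_def using bl cl c3 ln ab by auto
        qed
        ultimately show False by blast
      qed
    qed
  qed
qed

text \<open>The labels that occur are the blocks. Each must contain a letter of \<mu>, all other
  energies being negative, and each must contain a z-letter; regularity and the bound on the count
  enter through the latter.\<close>

theorem no_labelling:
  fixes \<beta> :: "('m, 'n) idx => nat"
  assumes r: "r \<in> cham s e0" "r (Zp 0) < 0" and par: "even (d * s + card (XY :: ('m, 'n) idx set))"
    and zero: "\<And>n. sum r {i \<in> letters s. \<beta> i = n} = 0"
    and cnt: "\<And>n. card {i \<in> letters s. \<beta> i = n} <= Suc d * card {v \<in> {1..s}. \<beta> (Zp v) = n} + 2"
    and ne: "i \<in> letters s" "j \<in> letters s" "\<beta> i ~= \<beta> j"
  shows False
proof -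
  define Lb where "Lb = \<beta> ` letters s"
  define A where "A n = {i \<in> XY. \<beta> i = n}" for n
  define t where "t n = card {v \<in> {1..s}. \<beta> (Zp v) = n}" for n
  note lr = cham_coord(1)[OF r(1)]
  have split: "{i \<in> letters s. \<beta> i = n} = A n \<union> Zp ` {v \<in> {1..s}. \<beta> (Zp v) = n}" for n
    by (auto simp: letters_def A_def)
  have fA: "finite (A n)" "A n \<subseteq> XY" for n by (auto simp: A_def)
  have v0: "val r (A n) (t n) = 0" for n
    using zero[of n] sum_val[OF lr fA(1) _ fA(2), of "{v \<in> {1..s}. \<beta> (Zp v) = n}"] by (simp add: split t_def)
  have c: "card (A n) <= d * t n + 2" for n
  proof -
    have "card {i \<in> letters s. \<beta> i = n} = card (A n) + card (Zp ` {v \<in> {1..s}. \<beta> (Zp v) = n} :: ('m, 'n) idx set)"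
      unfolding split by (rule card_Un_disjoint[OF fA(1) _ Zp_image_disjoint[OF fA(2)]]) simp
    also have "card (Zp ` {v \<in> {1..s}. \<beta> (Zp v) = n} :: ('m, 'n) idx set) = t n"
      unfolding t_def by (rule card_image) (simp add: inj_on_def)
    finally show ?thesis using cnt[of n] by (simp add: t_def)
  qed
  have neg: "r (Yj j) < 0" "r (Zp v) < 0" for j v
    using cham_coord(3)[OF r(1)] lat_Zp[OF lr, of v] r(2) by auto
  have X: "\<exists>i. Xi i \<in> A n" if n: "n \<in> Lb" for n
  proof (rule ccontr)
    assume no: "~ ?thesis"
    have "{i \<in> letters s. \<beta> i = n} ~= {}" using n by (auto simp: Lb_def)
    moreover have "r i < 0" if "i \<in> {i \<in> letters s. \<beta> i = n}" for i
    proof (cases i)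
      case (Xi x)
      then show ?thesis using no that by (auto simp: A_def letters_def)
    qed (use neg that in \<open>auto simp: letters_def XY_def\<close>)
    ultimately have "sum r {i \<in> letters s. \<beta> i = n} < (\<Sum>i\<in>{i \<in> letters s. \<beta> i = n}. 0)"
      by (intro sum_strict_mono) auto
    then show False using zero[of n] by simp
  qed
  have disj: "A n \<inter> A n' = {}" if "n ~= n'" for n n' using that by (auto simp: A_def)
  have two: "\<exists>n'\<in>Lb. n' ~= n" for n
  proof (cases "\<beta> i = n")
    case True
    then show ?thesis using ne by (intro bexI[of _ "\<beta> j"]) (auto simp: Lb_def)
  next
    case False
    then show ?thesis using ne by (intro bexI[of _ "\<beta> i"]) (auto simp: Lb_def)
  qed
  \<comment> \<open>A block with some but not all letters of \<nu> would be mixed, since another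
    block also contains a letter of \<mu>; being balanced, it would put the vector on a
    wall.\<close>
  have Ymix: "(\<forall>j. Yj j \<in> A n) | (\<forall>j. Yj j \<notin> A n)" if n: "n \<in> Lb" for n
  proof (rule ccontr)
    assume no: "~ ?thesis"
    obtain n' where n': "n' \<in> Lb" "n' ~= n" using two by blast
    obtain x where "Xi x \<in> A n'" using X[OF n'(1)] by blast
    then have "Xi x \<notin> A n" using disj[OF n'(2)] by blast
    then have mx: "mixed (A n)" using no X[OF n] fA unfolding mixed_def by blast
    have ts: "t n <= s"
    proof -
      have "card {v \<in> {1..s}. \<beta> (Zp v) = n} <= card {1..s}" by (rule card_mono) auto
      then show ?thesis by (simp add: t_def)
    qed
    have "sgn (val r (A n) (t n)) = sgn (val e0 (A n) (t n))" by (rule cham_coord(5)[OF r(1) mx ts])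
    then have "sgn (val e0 (A n) (t n)) = 0" using v0[of n] by simp
    then have "val e0 (A n) (t n) = 0" by (simp only: sgn_eq_0_iff)
    then show False using reg mx ts by (simp add: regular_def)
  qed
  \<comment> \<open>Without z-letters a block has at most two letters. But it contains a letter of
    \<mu>, for balance one of \<nu>, and then all of \<nu>, of which there are at least two.\<close>
  have t1: "t n >= 1" if n: "n \<in> Lb" for n
  proof (rule ccontr)
    assume "~ ?thesis"
    then have t0: "t n = 0" by simp
    obtain x where x: "Xi x \<in> A n" using X[OF n] by blast
    have "\<exists>j. Yj j \<in> A n"
    proof (rule ccontr)
      assume no: "~ ?thesis"
      have "r i > 0" if "i \<in> A n" for i
        using that no cham_coord(2)[OF r(1)] by (auto simp: A_def XY_def)
      then have "sum r (A n) > 0" using x fA by (intro sum_pos) auto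
      then show False using v0[of n] t0 by (simp add: val_def)
    qed
    then have "insert (Xi x) (range Yj) \<subseteq> A n" using Ymix[OF n] x by blast
    then have "card (insert (Xi x) (range (Yj :: 'n => ('m, 'n) idx))) <= card (A n)" by (rule card_mono[OF fA(1)])
    moreover have "card (insert (Xi x) (range (Yj :: 'n => ('m, 'n) idx))) = Suc (CARD('n))"
      by (subst card_insert_disjoint) (auto simp: card_image inj_on_def)
    ultimately show False using c[of n] t0 n2 by simp
  qed
  have "blocks s Lb A t" unfolding blocks_def
  proof (intro conjI ballI impI)
    show "finite Lb" by (simp add: Lb_def)
    show "(\<Union>n\<in>Lb. A n) = XY" by (auto simp: Lb_def A_def letters_def)
    have "(\<Sum>n\<in>Lb. t n) = card (\<Union>n\<in>Lb. {v \<in> {1..s}. \<beta> (Zp v) = n})"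
      unfolding t_def by (rule card_UN_disjoint[symmetric]) (auto simp: Lb_def)
    also have "(\<Union>n\<in>Lb. {v \<in> {1..s}. \<beta> (Zp v) = n}) = {1..s}" by (auto simp: Lb_def letters_def)
    finally show "(\<Sum>n\<in>Lb. t n) = s" by simp
  qed (use X disj in auto)
  moreover have "card Lb >= 2"
  proof -
    have "{\<beta> i, \<beta> j} \<subseteq> Lb" using ne by (auto simp: Lb_def)
    from card_mono[OF _ this] show ?thesis using ne by (simp add: Lb_def)
  qed
  ultimately have "labelled r Lb A t" using v0 t1 c by (simp add: labelled_def)
  then show False using labelled_impossible[OF r par] by blast
qed

end

section \<open>Transport within a chamber\<close>

lemma fps_inverse_even:
  fixes f g :: "real fps"
  assumes fg: "f * g = 1" and g: "\<And>n. odd n ==> fps_nth g n = 0"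
  shows "odd n ==> fps_nth f n = 0"
proof (induction n rule: less_induct)
  case (less n)
  have g0: "fps_nth g 0 ~= 0" using arg_cong[OF fg, of "%h. fps_nth h 0"] by auto
  have "n ~= 0" using less.prems by (cases n) auto
  then have "0 = fps_nth (f * g) n" unfolding fg by simp
  also have "... = (\<Sum>i=0..n. fps_nth f i * fps_nth g (n - i))" by (rule fps_mult_nth)
  also have "... = fps_nth f n * fps_nth g 0 + (\<Sum>i\<in>{0..n} - {n}. fps_nth f i * fps_nth g (n - i))"
    by (subst sum.remove[of _ n]) auto
  also have "(\<Sum>i\<in>{0..n} - {n}. fps_nth f i * fps_nth g (n - i)) = 0"
  proof (rule sum.neutral, rule ballI)
    fix i assume i: "i \<in> {0..n} - {n}"
    show "fps_nth f i * fps_nth g (n - i) = 0"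
    proof (cases "odd i")
      case True
      then show ?thesis using less.IH[of i] i by auto
    next
      case False
      then have "odd (n - i)" using less.prems i by auto
      then show ?thesis using g by simp
    qed
  qed
  finally show ?case using g0 by simp
qed

lemma mons_irat:
  assumes a: "a ~= 0" and u: "mons u (homog V 1)"
  shows "mons (irat a u) (%m. even (mdeg m))"
proof -
  have "odd n ==> fps_nth (varsigma 1 / varsigma (of_int a)) n = 0" for n
    by (rule fps_inverse_even[OF varsigma_quotient_inverse]) (use a fps_nth_quotient_odd in auto)
  then show ?thesis unfolding irat_def by (intro mons_mono[OF mons_msubst[OF u]]) auto
qed

lemma mons_prefactor:
  assumes "sum p S ~= 0" shows "mons (prefactor s p S) (%m. even (mdeg m))"
proof -
  have z: "mons (zS T) (homog (vars zi T) 1)" for T :: "('a, 'b) idx set" by (rule mons_zsum) simp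
  have r: "mons (rat (sum p S) (zS T)) (%m. even (mdeg m))" for T :: "('a, 'b) idx set"
    by (rule mons_mono[OF mons_rat[OF z]]) simp
  show ?thesis unfolding prefactor_def
    by (intro mons_mult[OF mons_mult[OF mons_irat[OF assms z] mons_irat[OF assms z], where H = "%m. even (mdeg m)"] r])
      (auto simp: mdeg_add)
qed

text \<open>The closing letter of a factor receives the energy that balances
  \<open>S\<close>.\<close>

definition ext :: "('m, 'n) idx set => (('m, 'n) idx => int) => ('m, 'n) idx => int" where
  "ext S u = u(Star := - sum u S)"

lemma Star_letters [simp]: "Star \<notin> letters s" by (auto simp: letters_def)

lemma sum_ext:
  assumes "finite S" "Star \<notin> S" "T \<subseteq> insert Star S"
  shows "sum (ext S u) T = (if Star \<in> T then - sum u (S - T) else sum u T)"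
proof (cases "Star \<in> T")
  case True
  have f: "finite T" using assms finite_subset by blast
  have "sum (ext S u) T = ext S u Star + sum (ext S u) (T - {Star})" using True f by (simp add: sum.remove)
  also have "sum (ext S u) (T - {Star}) = sum u (T - {Star})" by (rule sum.cong) (auto simp: ext_def)
  also have "ext S u Star = - (sum u (S - T) + sum u (T - {Star}))"
  proof -
    have "S = (S - T) \<union> (T - {Star})" using assms by auto
    moreover have "sum u ((S - T) \<union> (T - {Star})) = sum u (S - T) + sum u (T - {Star})"
      by (rule sum.union_disjoint) (use assms f in auto)
    ultimately show ?thesis by (simp add: ext_def)
  qed
  finally show ?thesis using True by simp
next
  case False
  then show ?thesis by (auto simp: ext_def intro: sum.cong)
qed

lemma sum_ext_total: "finite S ==> Star \<notin> S ==> sum (ext S u) (insert Star S) = 0"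
proof -
  assume a: "finite S" "Star \<notin> S"
  have "sum (ext S u) S = sum u S" by (rule sum.cong) (use a in \<open>auto simp: ext_def\<close>)
  then show ?thesis using a by (simp add: ext_def)
qed

lemma cross_multiply: "x0 / y0 <= x / y ==> y0 > 0 ==> y > 0 ==> x0 * y <= x * y0" for x y :: real
  by (simp add: field_simps)

lemma ext_zero: "ext S zero_dir = zero_dir" by (auto simp: ext_def)

lemma lpos_minus: "lpos (- a, - b) = lneg (a, b)" "lneg (- a, - b) = lpos (a, b)" by (auto simp: lpos_def lneg_def)

lemma compat_ext_sign:
  assumes f: "finite S" "Star \<notin> S"
    and sg: "\<And>T. T \<subseteq> S ==> (sum r T > 0 --> ~ sneg q p T) & (sum r T < 0 --> ~ spos q p T)"
    and T: "T \<subseteq> insert Star S"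
  shows "(sum (ext S r) T > 0 --> ~ sneg (ext S q) (ext S p) T) & (sum (ext S r) T < 0 --> ~ spos (ext S q) (ext S p) T)"
proof (cases "Star \<in> T")
  case True
  then show ?thesis using sg[of "S - T"] by (simp add: sum_ext[OF f T] lpos_minus)
next
  case False
  then show ?thesis using sg[of T] T by (auto simp: sum_ext[OF f T])
qed

lemma compat_ext:
  assumes f: "finite S" "Star \<notin> S"
    and sg: "\<And>T. T \<subseteq> S ==> (sum r T > 0 --> ~ sneg q p T) & (sum r T < 0 --> ~ spos q p T)"
    and c: "\<And>T. T \<subseteq> S ==> sum q T = 0 ==> sum p T = 0 ==> sum r T = 0"
  shows "compat (insert Star S) zi (ext S r) (ext S q) (ext S p)"
  unfolding compat_def
proof (intro conjI allI impI)
  fix T assume T: "T \<subseteq> insert Star S"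
  note compat_ext_sign[OF f sg T]
  then show "sum (ext S r) T > 0 ==> ~ sneg (ext S q) (ext S p) T" "sum (ext S r) T < 0 ==> ~ spos (ext S q) (ext S p) T"
    by blast+
next
  fix w1 T T' w2
  assume a: "dword (w1 @ T # T' # w2) & \<Union>(set (w1 @ T # T' # w2)) \<subseteq> insert Star S & total0 (ext S r) (w1 @ T # T' # w2) \<and>
    total0 (ext S q) (w1 @ w2) & total0 (ext S p) (w1 @ w2) & null (ext S q) (ext S p) (T \<union> T') & sum (ext S r) (T \<union> T') ~= 0"
  then have U: "T \<union> T' \<subseteq> insert Star S" by auto
  have False using a c[of "S - (T \<union> T')"] c[of "T \<union> T'"] U
    by (auto simp: null_def sum_ext[OF f U] split: if_splits)
  then show "crat (ext S p) zi T T' * Rw (ext S q) (ext S p) zi (w1 @ w2) = 0" ..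
qed

lemma rat_0: "rat 0 u = 0"
  by (rule mfps_eqI) (simp add: rat_def msubst_def varsigma_def)

text \<open>At k = 0 sets of z-letters have energy zero although \<open>r\<close> need not balance
  them. If the null union does not contain \<open>Star\<close>, it consists of z-letters and its
  central coefficient is \<open>rat 0\<close>, which is zero. If it does, only z-letters can be left
  over; a word of these is nonempty and ends in a letter of energy zero, so its expectation
  vanishes.\<close>

lemma compat_ext_zero_special:
  assumes f: "finite S" "Star \<notin> S"
    and sg: "\<And>T. T \<subseteq> S ==> (sum r T > 0 --> ~ sneg zero_dir p T) & (sum r T < 0 --> ~ spos zero_dir p T)"
    and c: "\<And>T. T \<subseteq> S ==> sum p T = 0 ==> T \<subseteq> range Zp" and p0: "\<And>v. p (Zp v) = 0"
  shows "compat (insert Star S) zi (ext S r) (ext S zero_dir) (ext S p)"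
  unfolding compat_def
proof (intro conjI allI impI)
  fix T assume T: "T \<subseteq> insert Star S"
  note compat_ext_sign[OF f sg T]
  then show "sum (ext S r) T > 0 ==> ~ sneg (ext S zero_dir) (ext S p) T" "sum (ext S r) T < 0 ==> ~ spos (ext S zero_dir) (ext S p) T"
    by blast+
next
  fix w1 T T' w2
  assume a: "dword (w1 @ T # T' # w2) & \<Union>(set (w1 @ T # T' # w2)) \<subseteq> insert Star S & total0 (ext S r) (w1 @ T # T' # w2) \<and>
    total0 (ext S zero_dir) (w1 @ w2) & total0 (ext S p) (w1 @ w2) & null (ext S zero_dir) (ext S p) (T \<union> T') & sum (ext S r) (T \<union> T') ~= 0"
  then have U: "T \<union> T' \<subseteq> insert Star S" by auto
  have n: "sum (ext S p) (T \<union> T') = 0" using a by (simp add: null_def)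
  have zz: "sum (ext S p) A = 0" if "A \<subseteq> range Zp" for A
    by (rule sum.neutral) (use that p0 in \<open>auto simp: ext_def\<close>)
  show "crat (ext S p) zi T T' * Rw (ext S zero_dir) (ext S p) zi (w1 @ w2) = 0"
  proof (cases "Star \<in> T \<union> T'")
    case False
    then have "sum p (T \<union> T') = 0" "T \<union> T' \<subseteq> S" using n U by (auto simp: sum_ext[OF f U])
    then have "T \<subseteq> range Zp" using c[of "T \<union> T'"] by blast
    then show ?thesis using zz[of T] by (simp add: crat_def rat_0)
  next
    case True
    then have "sum p (S - (T \<union> T')) = 0" using n by (simp add: sum_ext[OF f U])
    then have z: "S - (T \<union> T') \<subseteq> range Zp" using c by blast
    have "w1 @ w2 ~= []"
    proof
      assume "w1 @ w2 = []"
      then show False using a by (auto simp: total0_def)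
    qed
    then obtain w V where w: "w1 @ w2 = w @ [V]" by (metis rev_exhaust)
    have "V \<in> set (w1 @ w2)" unfolding w by simp
    then have "V \<inter> (T \<union> T') = {}" "V \<subseteq> insert Star S" using a by (auto simp: dword_append)
    then have "V \<subseteq> S - (T \<union> T')" using True by blast
    then have "sum (ext S p) V = 0" using z zz by blast
    then have "~ sneg (ext S zero_dir) (ext S p) V" by (simp add: ext_zero)
    then show ?thesis unfolding w by (simp only: Rw_last mult_zero_right not_False_eq_True)
  qed
qed

lemma sgn_comb:
  fixes x y a b :: int assumes "a >= 0" "b > 0" "sgn x = sgn y" shows "sgn (a * x + b * y) = sgn y"
proof -
  consider "y > 0" "x > 0" | "y < 0" "x < 0" | "y = 0" "x = 0" using assms(3) by (auto simp: sgn_if split: if_splits)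
  then show ?thesis
  proof cases
    case 1
    then have "a * x >= 0" "b * y > 0" using assms by auto
    then show ?thesis using 1 by (simp add: sgn_if)
  next
    case 2
    then have "a * x <= 0" "b * y < 0" using assms by (auto simp: mult_nonneg_nonpos mult_pos_neg)
    then show ?thesis using 2 by (simp add: sgn_if)
  qed simp
qed

lemma cham_comb:
  fixes a b :: int
  assumes p: "p \<in> cham s e0" and q: "q \<in> cham s e0" and ab: "a >= 0" "b > 0"
  shows "(%i. a * p i + b * q i) \<in> cham s e0" "q (Zp 0) < 0 ==> a * p (Zp 0) + b * q (Zp 0) < 0"
proof -
  have l: "lat s (%i. a * p i + b * q i)"
    using lat_comb[OF lat_scale[OF cham_coord(1)[OF p], of a] lat_scale[OF cham_coord(1)[OF q], of b], of 1] by simp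
  have v: "val (%i. a * p i + b * q i) B k = a * val p B k + b * val q B k" for B k
    by (simp add: val_def sum.distrib sum_distrib_left algebra_simps)
  have "sgn (val (%i. a * p i + b * q i) B k) = sgn (val e0 B k)" if "mixed B" "k <= s" for B k
    unfolding v using sgn_comb[OF ab, of "val p B k" "val q B k"] cham_coord(5)[OF p that] cham_coord(5)[OF q that] by simp
  moreover have "a * p (Xi i) + b * q (Xi i) > 0" for i
    using cham_coord(2)[OF p, of i] cham_coord(2)[OF q, of i] ab by (simp add: add_nonneg_pos)
  moreover have "a * p (Yj j) + b * q (Yj j) < 0" for j
    using cham_coord(3)[OF p, of j] cham_coord(3)[OF q, of j] ab
    by (intro add_nonpos_neg mult_nonneg_nonpos mult_pos_neg) auto
  moreover have "a * p (Zp 0) + b * q (Zp 0) <= 0"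
    using cham_coord(4)[OF p] cham_coord(4)[OF q] ab by (intro add_nonpos_nonpos mult_nonneg_nonpos) auto
  ultimately show "(%i. a * p i + b * q i) \<in> cham s e0" using l by (simp add: cham_def)
  show "q (Zp 0) < 0 ==> a * p (Zp 0) + b * q (Zp 0) < 0"
    using cham_coord(4)[OF p] ab by (intro add_nonpos_neg mult_nonneg_nonpos mult_pos_neg) auto
qed

context chamber_polynomial
begin

definition fw :: "('m, 'n) idx set => ('m, 'n) idx set list" where "fw S = filter (%T. T \<subseteq> S) W"

text \<open>The expectation in the first factor of the formula, regularised in direction
  \<open>q\<close> and without the division by the product of the parts; \<open>H2\<close> is the
  second one.\<close>

definition H1 :: "('m, 'n) idx set => (('m, 'n) idx => int) => (('m, 'n) idx => int) => real mfps" where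
  "H1 S q p = Rw (ext S q) (ext S p) zi (fw S @ [{Star}])"

definition H2 :: "('m, 'n) idx set => (('m, 'n) idx => int) => (('m, 'n) idx => int) => real mfps" where
  "H2 S q p = Rw (ext S q) (ext S p) zi ({Star} # fw S)"

lemma fw_list:
  assumes "S \<subseteq> letters s"
  obtains l where "distinct l" "set l = S" "fw S = map (%i. {i}) l"
proof
  let ?b = "xs @ map Zp [1..<Suc s] @ ys"
  have e: "W = map (%i. {i}) ?b" by (simp add: word0_def del: upt_Suc)
  show "distinct (filter (%i. i \<in> S) ?b)"
    using xy by (auto simp: distinct_map inj_on_def simp del: upt_Suc)
  show "set (filter (%i. i \<in> S) ?b) = S"
    using xy assms by (auto simp: letters_def XY_def simp del: upt_Suc)
  show "fw S = map (%i. {i}) (filter (%i. i \<in> S) ?b)"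
    unfolding fw_def e by (simp add: filter_map o_def del: upt_Suc)
qed

lemma fw_dword:
  assumes S: "S \<subseteq> letters s"
  shows "dword (fw S @ [{Star}])" "\<Union>(set (fw S @ [{Star}])) = insert Star S" "length (fw S) = card S"
    "dword ({Star} # fw S)" "\<Union>(set ({Star} # fw S)) = insert Star S"
proof -
  obtain l where l: "distinct l" "set l = S" "fw S = map (%i. {i}) l" by (rule fw_list[OF S])
  have d: "dword (fw S)" unfolding l(3) by (rule dword_map[OF l(1)]) auto
  have u: "\<Union>(set (fw S)) = S" using l by auto
  have "Star \<notin> S" using S by auto
  then show "dword (fw S @ [{Star}])" "dword ({Star} # fw S)" using d u by (auto simp: dword_append)
  show "\<Union>(set (fw S @ [{Star}])) = insert Star S" "\<Union>(set ({Star} # fw S)) = insert Star S" using u by auto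
  show "length (fw S) = card S" using l distinct_card[OF l(1)] by simp
qed

lemma lab_count:
  assumes S: "S \<subseteq> letters s" and l: "lab_ok (ext S r) zi (fw S @ [{Star}]) \<beta> m" and m: "\<And>v. lookup m v <= lookup Z v"
  shows "card {i\<in>S. \<beta> i = n} + (if \<beta> Star = n then 1 else 0) <= Suc d * card {v\<in>{1..s}. Zp v \<in> S & \<beta> (Zp v) = n} + 2"
    "sum r {i\<in>S. \<beta> i = n} = (if \<beta> Star = n then sum r S else 0)"
proof -
  obtain l where ls: "distinct l" "set l = S" "fw S = map (%i. {i}) l" by (rule fw_list[OF S])
  have St: "Star \<notin> S" and fS: "finite S" using S finite_subset[OF S] by auto
  let ?A = "{i \<in> insert Star S. \<beta> i = n}"
  have "length (filter (%T. \<exists>i\<in>T. \<beta> i = n) (fw S)) = card {i\<in>S. \<beta> i = n}"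
  proof -
    have "length (filter (%T. \<exists>i\<in>T. \<beta> i = n) (fw S)) = length (filter (%i. \<beta> i = n) l)"
      by (simp add: ls filter_map o_def)
    also have "... = card {i\<in>S. \<beta> i = n}" using distinct_length_filter[OF ls(1), of "%i. \<beta> i = n"] ls(2)
      by (simp add: Int_def conj_commute)
    finally show ?thesis .
  qed
  moreover have "length (filter (%T. \<exists>i\<in>T. \<beta> i = n) (fw S @ [{Star}])) <= (\<Sum>i\<in>?A. wt zi m i) + 2"
    using lab_okD(3)[OF l, of n] unfolding fw_dword(2)[OF S] .
  moreover have "(\<Sum>i\<in>?A. wt zi m i) <= Suc d * card {v\<in>{1..s}. Zp v \<in> S & \<beta> (Zp v) = n}"
  proof -
    let ?K = "{v\<in>{1..s}. Zp v \<in> S & \<beta> (Zp v) = n}"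
    have "(\<Sum>i\<in>?A. wt zi m i) <= (\<Sum>i\<in>?A. if i \<in> Zp ` ?K then Suc d else 0)"
    proof (rule sum_mono)
      fix i assume i: "i \<in> ?A"
      show "wt zi m i <= (if i \<in> Zp ` ?K then Suc d else 0)"
      proof (cases i)
        case (Zp v)
        have "v \<in> {1..s}" using i Zp S by (auto simp: letters_def)
        moreover have "lookup Z v <= Suc d" unfolding zmon_zmonomial[symmetric] lookup_zmon by simp
        ultimately show ?thesis using i Zp m[of v] by (auto simp: wt_def)
      qed (auto simp: wt_def)
    qed
    also have "... = (\<Sum>i\<in>?A \<inter> Zp ` ?K. Suc d)" using fS by (subst sum.inter_restrict) auto
    finally have 1: "(\<Sum>i\<in>?A. wt zi m i) <= Suc d * card (?A \<inter> Zp ` ?K)" by (simp add: mult.commute)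
    have "card (?A \<inter> Zp ` ?K) <= card ?K"
    proof -
      have "card (?A \<inter> Zp ` ?K) <= card (Zp ` ?K :: ('m, 'n) idx set)" by (rule card_mono) auto
      also have "... <= card ?K" by (rule card_image_le) simp
      finally show ?thesis .
    qed
    then have "Suc d * card (?A \<inter> Zp ` ?K) <= Suc d * card ?K" by (rule mult_le_mono2)
    with 1 show ?thesis by (rule le_trans)
  qed
  moreover have "length (filter (%T. \<exists>i\<in>T. \<beta> i = n) (fw S @ [{Star}])) =
      length (filter (%T. \<exists>i\<in>T. \<beta> i = n) (fw S)) + (if \<beta> Star = n then 1 else 0)" by simp
  ultimately show "card {i\<in>S. \<beta> i = n} + (if \<beta> Star = n then 1 else 0) <= Suc d * card {v\<in>{1..s}. Zp v \<in> S & \<beta> (Zp v) = n} + 2"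
    by linarith
  have z: "sum (ext S r) ?A = 0" using lab_okD(2)[OF l, of n] unfolding fw_dword(2)[OF S] .
  have A: "?A \<subseteq> insert Star S" by auto
  have z': "(if Star \<in> ?A then - sum r (S - ?A) else sum r ?A) = 0" using z unfolding sum_ext[OF fS St A] .
  show "sum r {i\<in>S. \<beta> i = n} = (if \<beta> Star = n then sum r S else 0)"
  proof (cases "\<beta> Star = n")
    case True
    then have "Star \<in> ?A" by simp
    then have "sum r (S - ?A) = 0" using z' by (simp only: if_True neg_equal_0_iff_equal)
    moreover have "sum r S = sum r (S - ?A) + sum r {i\<in>S. \<beta> i = n}"
    proof -
      have "S = (S - ?A) \<union> {i\<in>S. \<beta> i = n}" by auto
      moreover have "sum r ((S - ?A) \<union> {i\<in>S. \<beta> i = n}) = sum r (S - ?A) + sum r {i\<in>S. \<beta> i = n}"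
        by (rule sum.union_disjoint) (use fS in auto)
      ultimately show ?thesis by simp
    qed
    ultimately show ?thesis using True by simp
  next
    case False
    moreover have "?A = {i\<in>S. \<beta> i = n}" using False by auto
    moreover have "Star \<notin> ?A" using False by simp
    ultimately show ?thesis using z' by (simp only: if_False)
  qed
qed

text \<open>The labellings of the two factors are joined along the blocks of the closing letters.
  Each side then loses its closing letter from the count, and the two surpluses of 2 become the
  single 2 that \<open>no_labelling\<close> allows.\<close>

lemma glue:
  assumes r: "r \<in> cham s e0" "r (Zp 0) < 0" and par: "even (d * s + card (XY :: ('m, 'n) idx set))"
    and S: "S \<subseteq> letters s" "S ~= {}" "letters s - S ~= {}"
    and l1: "lab_ok (ext S r) zi (fw S @ [{Star}]) \<beta>1 m1" and l2: "lab_ok (ext (letters s - S) r) zi (fw (letters s - S) @ [{Star}]) \<beta>2 m2"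
    and m: "\<And>v. lookup m1 v <= lookup Z v" "\<And>v. lookup m2 v <= lookup Z v"
    and nc: "(\<exists>i\<in>S. \<beta>1 i ~= \<beta>1 Star) | (\<exists>i\<in>letters s - S. \<beta>2 i ~= \<beta>2 Star)"
  shows False
proof -
  let ?S' = "letters s - S"
  \<comment> \<open>Label 0 is the joined block, odd labels belong to the first factor and positive
    even labels to the second.\<close>
  define \<beta> where "\<beta> i = (if i \<in> S then (if \<beta>1 i = \<beta>1 Star then 0 else 2 * \<beta>1 i + 1) else (if \<beta>2 i = \<beta>2 Star then 0 else 2 * \<beta>2 i + 2))" for i
  note c1 = lab_count[OF S(1) l1 m(1)]
  have S': "?S' \<subseteq> letters s" by auto
  note c2 = lab_count[OF S' l2 m(2)]
  have fS: "finite S" using finite_subset[OF S(1)] by simp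
  have tot: "sum r S + sum r ?S' = 0"
    using sum.subset_diff[OF S(1), of r] sum_letters[OF cham_coord(1)[OF r(1)]] by simp
  have part: "{i\<in>letters s. \<beta> i = n} = {i\<in>S. \<beta> i = n} \<union> {i\<in>?S'. \<beta> i = n}" for n using S(1) by auto
  have partv: "{v\<in>{1..s}. \<beta> (Zp v) = n} = {v\<in>{1..s}. Zp v \<in> S & \<beta> (Zp v) = n} \<union> {v\<in>{1..s}. Zp v \<in> ?S' & \<beta> (Zp v) = n}" for n
    by (auto simp: letters_def)
  have sp: "sum r {i\<in>letters s. \<beta> i = n} = sum r {i\<in>S. \<beta> i = n} + sum r {i\<in>?S'. \<beta> i = n}"
    "card {i\<in>letters s. \<beta> i = n} = card {i\<in>S. \<beta> i = n} + card {i\<in>?S'. \<beta> i = n}"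
    "card {v\<in>{1..s}. \<beta> (Zp v) = n} = card {v\<in>{1..s}. Zp v \<in> S & \<beta> (Zp v) = n} + card {v\<in>{1..s}. Zp v \<in> ?S' & \<beta> (Zp v) = n}" for n
    unfolding part partv by (rule sum.union_disjoint card_Un_disjoint; use fS in auto)+
  have e1: "{i\<in>S. \<beta> i = 0} = {i\<in>S. \<beta>1 i = \<beta>1 Star}" "{i\<in>?S'. \<beta> i = 0} = {i\<in>?S'. \<beta>2 i = \<beta>2 Star}"
    "{v\<in>{1..s}. Zp v \<in> S & \<beta> (Zp v) = 0} = {v\<in>{1..s}. Zp v \<in> S & \<beta>1 (Zp v) = \<beta>1 Star}"
    "{v\<in>{1..s}. Zp v \<in> ?S' & \<beta> (Zp v) = 0} = {v\<in>{1..s}. Zp v \<in> ?S' & \<beta>2 (Zp v) = \<beta>2 Star}"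
    by (auto simp: \<beta>_def)
  have e2: "{i\<in>S. \<beta> i = 2 * n + 1} = (if n = \<beta>1 Star then {} else {i\<in>S. \<beta>1 i = n})" "{i\<in>?S'. \<beta> i = 2 * n + 1} = {}"
    "{v\<in>{1..s}. Zp v \<in> S & \<beta> (Zp v) = 2 * n + 1} = (if n = \<beta>1 Star then {} else {v\<in>{1..s}. Zp v \<in> S & \<beta>1 (Zp v) = n})"
    "{v\<in>{1..s}. Zp v \<in> ?S' & \<beta> (Zp v) = 2 * n + 1} = {}" for n
    by (auto simp: \<beta>_def; presburger)+
  have e3: "{i\<in>S. \<beta> i = 2 * n + 2} = {}" "{i\<in>?S'. \<beta> i = 2 * n + 2} = (if n = \<beta>2 Star then {} else {i\<in>?S'. \<beta>2 i = n})"
    "{v\<in>{1..s}. Zp v \<in> S & \<beta> (Zp v) = 2 * n + 2} = {}"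
    "{v\<in>{1..s}. Zp v \<in> ?S' & \<beta> (Zp v) = 2 * n + 2} = (if n = \<beta>2 Star then {} else {v\<in>{1..s}. Zp v \<in> ?S' & \<beta>2 (Zp v) = n})" for n
    by (auto simp: \<beta>_def; presburger)+
  have cases: "n = 0 | (\<exists>n'. n = 2 * n' + 1) | (\<exists>n'. n = 2 * n' + 2)" for n :: nat by presburger
  have zero: "sum r {i\<in>letters s. \<beta> i = n} = 0" for n
    using cases[of n]
  proof (elim disjE exE)
    assume "n = 0"
    then show ?thesis unfolding sp(1) using e1(1,2) c1(2)[of "\<beta>1 Star"] c2(2)[of "\<beta>2 Star"] tot by simp
  next
    fix n' assume n: "n = 2 * n' + 1"
    show ?thesis unfolding sp(1) n e2(1,2) using c1(2)[of n'] by simp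
  next
    fix n' assume n: "n = 2 * n' + 2"
    show ?thesis unfolding sp(1) n e3(1,2) using c2(2)[of n'] by simp
  qed
  have cnt: "card {i\<in>letters s. \<beta> i = n} <= Suc d * card {v\<in>{1..s}. \<beta> (Zp v) = n} + 2" for n
    using cases[of n]
  proof (elim disjE exE)
    assume n: "n = 0"
    show ?thesis unfolding sp(2,3) n e1 using c1(1)[of "\<beta>1 Star"] c2(1)[of "\<beta>2 Star"] by (simp add: algebra_simps)
  next
    fix n' assume n: "n = 2 * n' + 1"
    show ?thesis unfolding sp(2,3) n e2 using c1(1)[of n'] by (cases "n' = \<beta>1 Star") simp_all
  next
    fix n' assume n: "n = 2 * n' + 2"
    show ?thesis unfolding sp(2,3) n e3 using c2(1)[of n'] by (cases "n' = \<beta>2 Star") simp_all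
  qed
  from nc show False
  proof
    assume "\<exists>i\<in>S. \<beta>1 i ~= \<beta>1 Star"
    then obtain i where i: "i \<in> S" "\<beta>1 i ~= \<beta>1 Star" by blast
    obtain j where j: "j \<in> ?S'" using S(3) by blast
    have "odd (\<beta> i)" "even (\<beta> j)" using i j by (auto simp: \<beta>_def)
    then have "\<beta> i ~= \<beta> j" by auto
    then show False using no_labelling[OF r par zero cnt, of i j] i j S(1) by auto
  next
    assume "\<exists>i\<in>?S'. \<beta>2 i ~= \<beta>2 Star"
    then obtain j where j: "j \<in> ?S'" "\<beta>2 j ~= \<beta>2 Star" by blast
    obtain i where i: "i \<in> S" using S(2) by blast
    have "\<beta> i = 0 | odd (\<beta> i)" "even (\<beta> j)" "\<beta> j ~= 0" using i j by (auto simp: \<beta>_def)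
    then have "\<beta> i ~= \<beta> j" by auto
    then show False using no_labelling[OF r par zero cnt, of i j] i j S(1) by auto
  qed
qed

abbreviation "coef G S q p \<equiv> mcoeff (G * (H1 S q p * H2 (letters s - S) q p)) Z"

text \<open>The change of the product is the change of one factor times the other factor, twice.
  Every monomial in it needs a labelling of both factors that is nontrivial on at least one side,
  and \<open>glue\<close> excludes this for divisors of the final monomial.\<close>

lemma step:
  assumes r: "r \<in> cham s e0" "r (Zp 0) < 0" and par: "even (d * s + card (XY :: ('m, 'n) idx set))"
    and S: "S \<subseteq> letters s" "S ~= {}" "letters s - S ~= {}"
    and c1: "compat (insert Star S) zi (ext S r) (ext S q) (ext S p)" "compat (insert Star S) zi (ext S r) (ext S q') (ext S p)"
    and c2: "compat (insert Star (letters s - S)) zi (ext (letters s - S) r) (ext (letters s - S) q) (ext (letters s - S) p)"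
      "compat (insert Star (letters s - S)) zi (ext (letters s - S) r) (ext (letters s - S) q') (ext (letters s - S) p)"
  shows "coef G S q p = coef G S q' p"
proof -
  let ?S' = "letters s - S"
  have S': "?S' \<subseteq> letters s" by auto
  have tz: "total0 (ext T u) (fw T @ [{Star}])" "total0 (ext T u) ({Star} # fw T)" if T: "T \<subseteq> letters s" for T u
    unfolding total0_def fw_dword(2,5)[OF T]
    by (rule sum_ext_total; use finite_subset[OF T] T in auto)+
  have g: "good (insert Star T) (ext T r) (ext T q) (ext T p) (fw T @ [{Star}])"
    "good (insert Star T) (ext T r) (ext T q) (ext T p) ({Star} # fw T)" if T: "T \<subseteq> letters s" for T q
    unfolding good_def using fw_dword[OF T] tz[OF T] by auto
  define P1 where "P1 m \<longleftrightarrow> (\<exists>\<beta>. lab_ok (ext S r) zi (fw S @ [{Star}]) \<beta> m)" for m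
  define P2 where "P2 m \<longleftrightarrow> (\<exists>\<beta>. lab_ok (ext ?S' r) zi (fw ?S' @ [{Star}]) \<beta> m)" for m
  define P1' where "P1' m \<longleftrightarrow> (\<exists>\<beta>. lab_ok (ext S r) zi (fw S @ [{Star}]) \<beta> m & (\<exists>i\<in>S. \<beta> i ~= \<beta> Star))" for m
  define P2' where "P2' m \<longleftrightarrow> (\<exists>\<beta>. lab_ok (ext ?S' r) zi (fw ?S' @ [{Star}]) \<beta> m & (\<exists>i\<in>?S'. \<beta> i ~= \<beta> Star))" for m
  have perm: "mset ({Star} # fw ?S') = mset (fw ?S' @ [{Star}])" by simp
  have h1: "mons (H1 S q' p) P1"
    unfolding H1_def by (rule mons_mono[OF Rw_degree[OF c1(2) g(1)[OF S(1)]]]) (simp add: P1_def)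
  have h2: "mons (H2 ?S' q p) P2"
    unfolding H2_def by (rule mons_mono[OF Rw_degree[OF c2(1) g(2)[OF S']]]) (simp add: P2_def lab_ok_perm[OF perm])
  have nc: "\<exists>i\<in>T. \<beta> i ~= \<beta> Star" if "\<exists>i\<in>insert Star T. \<exists>j\<in>insert Star T. \<beta> i ~= \<beta> j" for \<beta> :: "('m, 'n) idx => nat" and T
    using that by (metis insert_iff)
  have d1: "mons (H1 S q p - H1 S q' p) P1'"
    unfolding H1_def
  proof (rule mons_mono[OF Rw_compare[OF c1 g(1)[OF S(1)] tz(1)[OF S(1)]]])
    fix m assume "ok1 (ext S r) zi (fw S @ [{Star}]) m"
    then obtain \<beta> where b: "lab_ok (ext S r) zi (fw S @ [{Star}]) \<beta> m"
      "\<exists>i\<in>insert Star S. \<exists>j\<in>insert Star S. \<beta> i ~= \<beta> j"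
      unfolding ok1_def fw_dword(2)[OF S(1)] by (elim exE conjE)
    show "P1' m" unfolding P1'_def by (intro exI conjI) (rule b(1), rule nc[OF b(2)])
  qed
  have d2: "mons (H2 ?S' q p - H2 ?S' q' p) P2'"
    unfolding H2_def
  proof (rule mons_mono[OF Rw_compare[OF c2 g(2)[OF S'] tz(2)[OF S']]])
    fix m assume "ok1 (ext ?S' r) zi ({Star} # fw ?S') m"
    then have "ok1 (ext ?S' r) zi (fw ?S' @ [{Star}]) m" unfolding ok1_perm[OF perm] .
    then obtain \<beta> where b: "lab_ok (ext ?S' r) zi (fw ?S' @ [{Star}]) \<beta> m"
      "\<exists>i\<in>insert Star ?S'. \<exists>j\<in>insert Star ?S'. \<beta> i ~= \<beta> j"
      unfolding ok1_def fw_dword(2)[OF S'] by (elim exE conjE)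
    show "P2' m" unfolding P2'_def by (intro exI conjI) (rule b(1), rule nc[OF b(2)])
  qed
  let ?Q = "%m. \<exists>m0 m1 m2. m = m0 + (m1 + m2) & (P1' m1 & P2 m2 | P1 m1 & P2' m2)"
  have G: "mons G (%_. True)" by (simp add: mons_def)
  have "mons (G * ((H1 S q p - H1 S q' p) * H2 ?S' q p)) ?Q"
    by (rule mons_mult[OF G mons_mult[OF d1 h2, where H = "%m. \<exists>m1 m2. m = m1 + m2 & P1' m1 & P2 m2"]]) blast+
  moreover have "mons (G * (H1 S q' p * (H2 ?S' q p - H2 ?S' q' p))) ?Q"
    by (rule mons_mult[OF G mons_mult[OF h1 d2, where H = "%m. \<exists>m1 m2. m = m1 + m2 & P1 m1 & P2' m2"]]) blast+
  ultimately have "mons (G * ((H1 S q p - H1 S q' p) * H2 ?S' q p) + G * (H1 S q' p * (H2 ?S' q p - H2 ?S' q' p))) ?Q"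
    by (rule mons_add)
  moreover have "G * ((H1 S q p - H1 S q' p) * H2 ?S' q p) + G * (H1 S q' p * (H2 ?S' q p - H2 ?S' q' p)) =
      G * (H1 S q p * H2 ?S' q p) - G * (H1 S q' p * H2 ?S' q' p)" by (simp add: algebra_simps)
  ultimately have mm: "mons (G * (H1 S q p * H2 ?S' q p) - G * (H1 S q' p * H2 ?S' q' p)) ?Q" by simp
  show ?thesis
  proof (rule ccontr)
    assume "~ ?thesis"
    then have "?Q Z" using mm unfolding mons_def by (simp add: mcoeff_diff)
    then obtain m0 m1 m2 where m: "Z = m0 + (m1 + m2)" "P1' m1 & P2 m2 | P1 m1 & P2' m2" by blast
    have le: "lookup m1 v <= lookup Z v" "lookup m2 v <= lookup Z v" for v unfolding m(1) by (simp_all add: lookup_add)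
    obtain \<beta>1 \<beta>2 where "lab_ok (ext S r) zi (fw S @ [{Star}]) \<beta>1 m1" "lab_ok (ext ?S' r) zi (fw ?S' @ [{Star}]) \<beta>2 m2"
      "(\<exists>i\<in>S. \<beta>1 i ~= \<beta>1 Star) | (\<exists>i\<in>?S'. \<beta>2 i ~= \<beta>2 Star)"
      using m(2) unfolding P1_def P2_def P1'_def P2'_def by blast
    from glue[OF r par S this(1,2) le this(3)] show False .
  qed
qed

text \<open>By \<open>Rw_parity\<close> all monomials of the product have the parity of the number
  of letters, and here the degree of the final monomial has the other one. So the coefficient is
  zero in every direction.\<close>

lemma coef_parity:
  assumes "odd (d * s + card (XY :: ('m, 'n) idx set))" and S: "S \<subseteq> letters s" and G: "mons G (%m. even (mdeg m))"
  shows "coef G S q p = 0"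
proof -
  let ?S' = "letters s - S"
  have S': "?S' \<subseteq> letters s" by auto
  have tz: "total0 (ext T u) (fw T @ [{Star}])" "total0 (ext T u) ({Star} # fw T)" if T: "T \<subseteq> letters s" for T u
    unfolding total0_def fw_dword(2,5)[OF T]
    by (rule sum_ext_total; use finite_subset[OF T] T in auto)+
  have 1: "mons (H1 S q p) (%m. even (mdeg m) = even (card S + 1))"
    unfolding H1_def using Rw_parity[OF fw_dword(1)[OF S] tz(1)[OF S] tz(1)[OF S]] by (simp add: fw_dword(3)[OF S])
  have 2: "mons (H2 ?S' q p) (%m. even (mdeg m) = even (card ?S' + 1))"
    unfolding H2_def using Rw_parity[OF fw_dword(4)[OF S'] tz(2)[OF S'] tz(2)[OF S']] by (simp add: fw_dword(3)[OF S'])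
  have c: "card S + card ?S' = card (XY :: ('m, 'n) idx set) + s"
  proof -
    have "card S + card ?S' = card (letters s :: ('m, 'n) idx set)"
      using card_Diff_subset[OF finite_subset[OF S] S] card_mono[OF _ S] by simp
    also have "... = card (XY :: ('m, 'n) idx set) + card (Zp ` {1..s} :: ('m, 'n) idx set)"
      unfolding letters_def by (rule card_Un_disjoint) auto
    also have "card (Zp ` {1..s} :: ('m, 'n) idx set) = s" by (subst card_image) (auto simp: inj_on_def)
    finally show ?thesis .
  qed
  have "mons (G * (H1 S q p * H2 ?S' q p)) (%m. even (mdeg m) = even (card S + card ?S'))"
    by (rule mons_mult[OF G mons_mult[OF 1 2, where H = "%m. even (mdeg m) = even (card S + card ?S')"]]) (auto simp: mdeg_add)
  moreover have "mdeg Z = Suc d * s" unfolding zmon_zmonomial[symmetric] by (rule mdeg_zmon)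
  ultimately show ?thesis using assms(1) unfolding mons_def c by auto
qed

text \<open>Parts that \<open>p\<close> decides and \<open>q\<close> decides differently or not at
  all; their number drops in each step towards \<open>p\<close>.\<close>

definition discrepancy :: "(('m, 'n) idx => int) => (('m, 'n) idx => int) => ('m, 'n) idx set set" where
  "discrepancy p q = {T. T \<subseteq> letters s & sum p T ~= 0 & sgn (sum q T) ~= sgn (sum p T)}"

lemma finite_discrepancy: "finite (discrepancy p q)"
  by (rule finite_subset[of _ "Pow (letters s)"]) (auto simp: discrepancy_def)

lemma sum_comb: "sum (%i. a * p i + b * q i) T = a * sum p T + b * sum q T" for a b :: int
  by (simp add: sum.distrib sum_distrib_left)

text \<open>On the segment from \<open>q\<close> to \<open>p\<close>, the vector \<open>r\<close>
  marks the first place where a part with opposite signs at the ends becomes balanced, and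
  \<open>q'\<close> lies just beyond it. At \<open>r\<close> every sign is either zero or the one on
  both sides, so that \<open>r\<close> is compatible with \<open>q\<close> as well as with
  \<open>q'\<close>.\<close>

lemma transport_step:
  assumes q: "q \<in> cham s e0" "q (Zp 0) < 0" and p: "p \<in> cham s e0"
    and op: "T1 \<subseteq> letters s" "sum q T1 * sum p T1 < 0"
  obtains r q' where "r \<in> cham s e0" "r (Zp 0) < 0" "q' \<in> cham s e0" "q' (Zp 0) < 0"
    "card (discrepancy p q') < card (discrepancy p q)"
    "\<And>T. T \<subseteq> letters s ==> (sum r T > 0 --> ~ sneg q p T) & (sum r T < 0 --> ~ spos q p T)"
    "\<And>T. T \<subseteq> letters s ==> (sum r T > 0 --> ~ sneg q' p T) & (sum r T < 0 --> ~ spos q' p T)"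
    "\<And>T. sum q T = 0 ==> sum p T = 0 ==> sum r T = 0" "\<And>T. sum q' T = 0 ==> sum p T = 0 ==> sum r T = 0"
proof -
  let ?O = "{T. T \<subseteq> letters s & sum q T * sum p T < 0}"
  \<comment> \<open>The ratio determines the place on the segment where the sum over
    \<open>T\<close> vanishes; its minimum belongs to the first part to become balanced.\<close>
  let ?f = "%T. real_of_int \<bar>sum q T\<bar> / real_of_int \<bar>sum p T\<bar>"
  have fO: "finite ?O" by (rule finite_subset[of _ "Pow (letters s)"]) auto
  have "T1 \<in> ?O" using op by simp
  then have "\<exists>T0\<in>?O. \<forall>T\<in>?O. ?f T0 <= ?f T"
    using arg_min_if_finite[OF fO, of ?f] by (metis (no_types, lifting) empty_iff not_less)
  then obtain T0 where T0: "T0 \<subseteq> letters s" "sum q T0 * sum p T0 < 0"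
    "\<And>T. T \<subseteq> letters s ==> sum q T * sum p T < 0 ==> ?f T0 <= ?f T" by blast
  define a where "a = \<bar>sum q T0\<bar>"
  define b where "b = \<bar>sum p T0\<bar>"
  have nz: "sum q T0 ~= 0" "sum p T0 ~= 0" using T0(2) by auto
  then have ab: "a > 0" "b > 0" by (simp_all add: a_def b_def)
  have mn: "a * \<bar>sum p T\<bar> <= b * \<bar>sum q T\<bar>" if T: "T \<subseteq> letters s" "sum q T * sum p T < 0" for T
  proof -
    have "sum p T ~= 0" using T(2) by auto
    then have y: "real_of_int \<bar>sum p T\<bar> > 0" by (simp only: of_int_0_less_iff zero_less_abs_iff not_False_eq_True)
    have "real_of_int b > 0" using ab by simp
    from cross_multiply[OF T0(3)[OF T, folded a_def b_def] this y]
    have "real_of_int (a * \<bar>sum p T\<bar>) <= real_of_int (\<bar>sum q T\<bar> * b)" by (simp only: of_int_mult)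
    then have "a * \<bar>sum p T\<bar> <= \<bar>sum q T\<bar> * b" by (simp only: of_int_le_iff)
    then show ?thesis by (simp add: mult.commute)
  qed
  define r where "r = (%i. a * p i + b * q i)"
  have rs: "sum r T = a * sum p T + b * sum q T" for T unfolding r_def by (rule sum_comb)
  have r: "r \<in> cham s e0" "r (Zp 0) < 0" using cham_comb[OF p q(1), of a b] ab q(2) by (simp_all add: r_def)
  have sg1: "(sum r T > 0 --> ~ sneg q p T) & (sum r T < 0 --> ~ spos q p T)" if T: "T \<subseteq> letters s" for T
  proof -
    let ?x = "sum q T" and ?y = "sum p T"
    consider "?x > 0" "?y >= 0" | "?x > 0" "?y < 0" | "?x < 0" "?y <= 0" | "?x < 0" "?y > 0" | "?x = 0" by linarith
    then show ?thesis
    proof cases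
      case 1
      then have "a * ?y >= 0" "b * ?x > 0" using ab by auto
      then show ?thesis using 1 unfolding rs by (auto simp: lpos_def lneg_def)
    next
      case 2
      then have "a * \<bar>?y\<bar> <= b * \<bar>?x\<bar>" using mn[OF T] by (simp add: mult_pos_neg)
      then show ?thesis using 2 unfolding rs by (auto simp: lpos_def lneg_def)
    next
      case 3
      then have "a * ?y <= 0" "b * ?x < 0" using ab by (auto simp: mult_nonneg_nonpos mult_pos_neg)
      then show ?thesis using 3 unfolding rs by (auto simp: lpos_def lneg_def)
    next
      case 4
      then have "a * \<bar>?y\<bar> <= b * \<bar>?x\<bar>" using mn[OF T] by (simp add: mult_neg_pos)
      then show ?thesis using 4 unfolding rs by (auto simp: lpos_def lneg_def)
    next
      case 5
      then show ?thesis using ab unfolding rs by (auto simp: lpos_def lneg_def zero_less_mult_iff mult_less_0_iff)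
    qed
  qed
  obtain N0 where N0: "\<And>N B k. N >= N0 ==> B \<subseteq> XY ==> k <= Suc s ==> val r B k ~= 0 ==>
      sgn (val (%i. p i + int N * r i) B k) = sgn (val r B k)" using dominant[of s r p] by blast
  define N where "N = Suc N0"
  \<comment> \<open>A large multiple of \<open>r\<close> fixes all nonzero signs of
    \<open>r\<close>, and the summand \<open>p\<close> decides the parts that \<open>r\<close>
    balances.\<close>
  define q' where "q' = (%i. p i + int N * r i)"
  have q's: "sum q' T = sum p T + int N * sum r T" for T by (simp add: q'_def sum.distrib sum_distrib_left)
  have q': "q' \<in> cham s e0" "q' (Zp 0) < 0" using cham_comb[OF p r(1), of 1 "int N"] r(2) by (simp_all add: q'_def N_def)
  have sg: "sgn (sum q' T) = sgn (sum r T)" if T: "T \<subseteq> letters s" "sum r T ~= 0" for T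
  proof -
    note s1 = sum_letter[OF cham_coord(1)[OF q'(1)] T(1)] and s2 = sum_letter[OF cham_coord(1)[OF r(1)] T(1)]
    have "sgn (val q' (T \<inter> XY) (zc T)) = sgn (val r (T \<inter> XY) (zc T))"
      unfolding q'_def by (rule N0) (use s2 T(2) in \<open>auto simp: N_def\<close>)
    then show ?thesis using s1(1) s2(1) by simp
  qed
  have sub: "discrepancy p q' \<subseteq> discrepancy p q - {T0}"
  proof
    fix T assume "T \<in> discrepancy p q'"
    then have T: "T \<subseteq> letters s" "sum p T ~= 0" "sgn (sum q' T) ~= sgn (sum p T)" by (auto simp: discrepancy_def)
    have rn: "sum r T ~= 0" using T(3) q's[of T] by auto
    have "sgn (sum q T) ~= sgn (sum p T)"
    proof
      assume e: "sgn (sum q T) = sgn (sum p T)"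
      have "sgn (sum r T) = sgn (sum p T)" unfolding rs using sgn_comb[of a b "sum p T" "sum q T"] ab e by simp
      then show False using sg[OF T(1) rn] T(3) by simp
    qed
    moreover have "sum r T0 = 0"
    proof -
      have "sum q T0 > 0 & sum p T0 < 0 | sum q T0 < 0 & sum p T0 > 0" using T0(2) by (auto simp: mult_less_0_iff)
      then show ?thesis unfolding rs a_def b_def by (auto simp: algebra_simps)
    qed
    ultimately show "T \<in> discrepancy p q - {T0}" using T rn by (auto simp: discrepancy_def)
  qed
  have "T0 \<in> discrepancy p q" using T0(1,2) nz by (auto simp: discrepancy_def sgn_if mult_less_0_iff split: if_splits)
  then have "discrepancy p q' \<subset> discrepancy p q" using sub by blast
  then have lt: "card (discrepancy p q') < card (discrepancy p q)" by (rule psubset_card_mono[OF finite_discrepancy])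
  show thesis
  proof (rule that[OF r q' lt sg1])
    show "(sum r T > 0 --> ~ sneg q' p T) & (sum r T < 0 --> ~ spos q' p T)" if "T \<subseteq> letters s" for T
      using sg[OF that] by (auto simp: lpos_def lneg_def sgn_if split: if_splits)
    show "sum r T = 0" if "sum q T = 0" "sum p T = 0" for T using that unfolding rs by simp
    show "sum r T = 0" if "sum q' T = 0" "sum p T = 0" for T using that q's[of T] by (simp add: N_def)
  qed
qed

text \<open>The direction is moved to \<open>p\<close> through finitely many steps, each justified
  by a vector \<open>r\<close> of the chamber. Once no part has opposite signs at \<open>q\<close>
  and \<open>p\<close>, one further step replaces the direction by zero.\<close>

theorem transport:
  assumes q: "q \<in> cham s e0" "q (Zp 0) < 0" and p: "p \<in> cham s e0"
    and S: "S \<in> sides s A t" "mixed A" and G: "mons G (%m. even (mdeg m))"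
  shows "coef G S q p = coef G S zero_dir p"
proof (cases "even (d * s + card (XY :: ('m, 'n) idx set))")
  case False
  have "S \<subseteq> letters s" using S by (simp add: sides_def)
  then show ?thesis using coef_parity[OF False _ G] by simp
next
  case par: True
  have SX: "S \<subseteq> letters s" "S \<inter> XY = A" using S by (auto simp: sides_def)
  let ?S' = "letters s - S"
  have ne: "S ~= {}" "?S' ~= {}"
  proof -
    show "S ~= {}" using S(2) SX by (auto simp: mixed_def)
    obtain x where "Xi x \<notin> A" using S(2) by (auto simp: mixed_def)
    then have "Xi x \<in> ?S'" using SX by (auto simp: letters_def XY_def)
    then show "?S' ~= {}" by blast
  qed
  have fS: "finite S" "Star \<notin> S" "finite ?S'" "Star \<notin> ?S'" using SX finite_subset[OF SX(1)] by auto
  have sub: "T \<subseteq> letters s" if "T \<subseteq> ?S'" for T using that by auto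
  show ?thesis using q
  proof (induction "card (discrepancy p q)" arbitrary: q rule: less_induct)
    case less
    show ?case
    proof (cases "\<exists>T\<subseteq>letters s. sum q T * sum p T < 0")
      case True
      then obtain T1 where T1: "T1 \<subseteq> letters s" "sum q T1 * sum p T1 < 0" by blast
      obtain r q' where h: "r \<in> cham s e0" "r (Zp 0) < 0" "q' \<in> cham s e0" "q' (Zp 0) < 0"
        "card (discrepancy p q') < card (discrepancy p q)"
        "\<And>T. T \<subseteq> letters s ==> (sum r T > 0 --> ~ sneg q p T) & (sum r T < 0 --> ~ spos q p T)"
        "\<And>T. T \<subseteq> letters s ==> (sum r T > 0 --> ~ sneg q' p T) & (sum r T < 0 --> ~ spos q' p T)"
        "\<And>T. sum q T = 0 ==> sum p T = 0 ==> sum r T = 0" "\<And>T. sum q' T = 0 ==> sum p T = 0 ==> sum r T = 0"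
        by (rule transport_step[OF less.prems p T1]) blast
      have "coef G S q p = coef G S q' p"
      proof (rule step[OF h(1,2) par SX(1) ne])
        show "compat (insert Star S) zi (ext S r) (ext S q) (ext S p)"
          by (rule compat_ext[OF fS(1,2)]) (use h(6,8) SX in blast)+
        show "compat (insert Star S) zi (ext S r) (ext S q') (ext S p)"
          by (rule compat_ext[OF fS(1,2)]) (use h(7,9) SX in blast)+
        show "compat (insert Star ?S') zi (ext ?S' r) (ext ?S' q) (ext ?S' p)"
          by (rule compat_ext[OF fS(3,4)]) (use h(6,8) sub in blast)+
        show "compat (insert Star ?S') zi (ext ?S' r) (ext ?S' q') (ext ?S' p)"
          by (rule compat_ext[OF fS(3,4)]) (use h(7,9) sub in blast)+
      qed
      also have "... = coef G S zero_dir p" by (rule less.hyps[OF h(5) h(3,4)])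
      finally show ?thesis .
    next
      case False
      then have no: "~ sum q T * sum p T < 0" if "T \<subseteq> letters s" for T using that by blast
      show ?thesis
      proof (cases "p (Zp 0) < 0")
        case True
        have sg: "(sum p T > 0 --> ~ sneg q p T) & (sum p T < 0 --> ~ spos q p T)" if "T \<subseteq> letters s" for T
          using no[OF that] by (auto simp: lpos_def lneg_def mult_less_0_iff)
        have sg': "(sum p T > 0 --> ~ sneg zero_dir p T) & (sum p T < 0 --> ~ spos zero_dir p T)" for T
          by simp
        show ?thesis
        proof (rule step[OF p True par SX(1) ne])
          show "compat (insert Star S) zi (ext S p) (ext S q) (ext S p)"
            by (rule compat_ext[OF fS(1,2)]) (use sg SX in auto)
          show "compat (insert Star S) zi (ext S p) (ext S zero_dir) (ext S p)"
            by (rule compat_ext[OF fS(1,2)]) (use sg' in auto)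
          show "compat (insert Star ?S') zi (ext ?S' p) (ext ?S' q) (ext ?S' p)"
            by (rule compat_ext[OF fS(3,4)]) (use sg sub in auto)
          show "compat (insert Star ?S') zi (ext ?S' p) (ext ?S' zero_dir) (ext ?S' p)"
            by (rule compat_ext[OF fS(3,4)]) (use sg' in auto)
        qed
      next
        case F: False
        \<comment> \<open>For k = 0 the point itself cannot serve as \<open>r\<close>, since
          \<open>no_labelling\<close> asks for negative energy of the z-letters; the sum with
          \<open>q\<close> has it and no conflicting signs.\<close>
        define r where "r = (%i. 1 * p i + 1 * q i)"
        have rs: "sum r T = sum p T + sum q T" for T unfolding r_def sum_comb by simp
        have r: "r \<in> cham s e0" "r (Zp 0) < 0" using cham_comb[OF p less.prems(1), of 1 1] less.prems(2) by (simp_all add: r_def)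
        have p0: "p (Zp v) = 0" for v using F cham_coord(4)[OF p] lat_Zp[OF cham_coord(1)[OF p], of v] by simp
        have sg: "(sum r T > 0 --> ~ sneg q p T) & (sum r T < 0 --> ~ spos q p T)" if "T \<subseteq> letters s" for T
          using no[OF that] unfolding rs by (auto simp: lpos_def lneg_def mult_less_0_iff)
        have sg': "(sum r T > 0 --> ~ sneg zero_dir p T) & (sum r T < 0 --> ~ spos zero_dir p T)" if "T \<subseteq> letters s" for T
          using no[OF that] unfolding rs by (auto simp: mult_less_0_iff)
        \<comment> \<open>For k = 0 a balanced part of a side consists of z-letters: with mixed
          letters it would put the point on a wall, and with letters of only one kind its energy has
          a strict sign.\<close>
        have zz: "T \<subseteq> range Zp" if T: "T \<subseteq> letters s" "sum p T = 0" and M: "\<exists>i. Xi i \<notin> T" "\<exists>j. Yj j \<notin> T" for T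
        proof (rule ccontr)
          assume nz: "~ T \<subseteq> range Zp"
          let ?B = "T \<inter> XY"
          have v: "sum p ?B = 0" using T sum_letter(1)[OF cham_coord(1)[OF p] T(1)] p0 by (simp add: val_def)
          have "?B ~= {}" using nz T(1) by (auto simp: letters_def)
          have fB: "finite ?B" by simp
          consider "mixed ?B" | "\<forall>i. Xi i \<notin> ?B" | "\<forall>j. Yj j \<notin> ?B" using M unfolding mixed_def by blast
          then show False
          proof cases
            case 1
            have "sgn (val p ?B 0) = sgn (val e0 ?B 0)" by (rule cham_coord(5)[OF p 1]) simp
            moreover have "val p ?B 0 = 0" using v by (simp add: val_def)
            ultimately have "sgn (val e0 ?B 0) = 0" by simp
            then have "val e0 ?B 0 = 0" by (simp only: sgn_eq_0_iff)
            then show False using reg 1 by (simp add: regular_def)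
          next
            case 2
            have "sum p ?B < (\<Sum>i\<in>?B. 0)"
            proof (rule sum_strict_mono[OF fB \<open>?B ~= {}\<close>])
              fix i assume "i \<in> ?B"
              then show "p i < 0" using 2 cham_coord(3)[OF p] by (auto simp: XY_def)
            qed
            then show False using v by simp
          next
            case 3
            have "(\<Sum>i\<in>?B. 0) < sum p ?B"
            proof (rule sum_strict_mono[OF fB \<open>?B ~= {}\<close>])
              fix i assume "i \<in> ?B"
              then show "0 < p i" using 3 cham_coord(2)[OF p] by (auto simp: XY_def)
            qed
            then show False using v by simp
          qed
        qed
        have mS: "\<exists>i. Xi i \<notin> T" "\<exists>j. Yj j \<notin> T" if "T \<subseteq> S" for T
          using S(2) SX that by (auto simp: mixed_def XY_def)
        have mS': "\<exists>i. Xi i \<notin> T" "\<exists>j. Yj j \<notin> T" if "T \<subseteq> ?S'" for T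
          using S(2) SX that by (auto simp: mixed_def XY_def)
        show ?thesis
        proof (rule step[OF r par SX(1) ne])
          show "compat (insert Star S) zi (ext S r) (ext S q) (ext S p)"
            by (rule compat_ext[OF fS(1,2)]) (use sg SX rs in auto)
          show "compat (insert Star S) zi (ext S r) (ext S zero_dir) (ext S p)"
            by (rule compat_ext_zero_special[OF fS(1,2)]) (use sg' SX zz mS p0 in auto)
          show "compat (insert Star ?S') zi (ext ?S' r) (ext ?S' q) (ext ?S' p)"
            by (rule compat_ext[OF fS(3,4)]) (use sg sub rs in auto)
          show "compat (insert Star ?S') zi (ext ?S' r) (ext ?S' zero_dir) (ext ?S' p)"
            by (rule compat_ext_zero_special[OF fS(3,4)]) (use sg' sub zz mS' p0 in auto)
        qed
      qed
    qed
  qed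
qed

end

section \<open>Chambers of real points\<close>

type_synonym ('m, 'n) point = "(real ^ 'm) \<times> (real ^ 'n) \<times> real"

definition wfun :: "'m::finite set => 'n::finite set => nat => ('m, 'n) point => real" where
  "wfun I J t P = (\<Sum>i\<in>I. fst P $ i) - (\<Sum>j\<in>J. fst (snd P) $ j) - snd (snd P) * real t"

definition ids :: "'m set => 'n set => ('m, 'n) idx set" where "ids I J = Xi ` I \<union> Yj ` J"

text \<open>Vectors store energies of operators, which explains the signs at \<nu> and k.\<close>

definition pt :: "(('m::finite, 'n::finite) idx => int) => ('m, 'n) point" where
  "pt e = (\<chi> i. real_of_int (e (Xi i)), \<chi> j. - real_of_int (e (Yj j)), - real_of_int (e (Zp 0)))"

definition proper :: "'m set => 'n set => bool" where
  "proper I J \<longleftrightarrow> I ~= {} & I ~= UNIV & J ~= {} & J ~= UNIV"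

lemma ids_XY: "ids I J \<subseteq> XY" by (auto simp: ids_def XY_def)

lemma ids_cases: "B \<subseteq> XY ==> \<exists>I J. B = ids I J"
  by (rule exI[of _ "{i. Xi i \<in> B}"], rule exI[of _ "{j. Yj j \<in> B}"]) (auto simp: ids_def XY_def)

lemma mem_ids [simp]: "Xi i \<in> ids I J \<longleftrightarrow> i \<in> I" "Yj j \<in> ids I J \<longleftrightarrow> j \<in> J" by (auto simp: ids_def)

lemma mixed_ids: "mixed (ids I J) \<longleftrightarrow> proper I J"
  using ids_XY[of I J] by (auto simp: mixed_def proper_def)

lemma sum_ids: "sum f (ids I J) = (\<Sum>i\<in>I. f (Xi i)) + (\<Sum>j\<in>J. f (Yj j))"
  for I :: "'m::finite set" and J :: "'n::finite set"
proof -
  have "sum f (ids I J) = sum f (Xi ` I) + sum f (Yj ` J)"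
    unfolding ids_def by (rule sum.union_disjoint) auto
  then show ?thesis by (simp add: sum.reindex inj_on_def)
qed

lemma XY_ids: "XY = ids UNIV UNIV" by (simp add: XY_def ids_def)

lemma val_ids: "val e (ids I J) k = (\<Sum>i\<in>I. e (Xi i)) + (\<Sum>j\<in>J. e (Yj j)) + int k * e (Zp 0)"
  for I :: "'m::finite set" and J :: "'n::finite set"
  by (simp add: val_def sum_ids)

lemma wfun_pt: "wfun I J k (pt e) = real_of_int (val e (ids I J) k)"
  by (simp add: wfun_def pt_def val_ids sum_negf)

lemma sgn_wfun_pt: "sgn (wfun I J k (pt e)) = real_of_int (sgn (val e (ids I J) k))"
  unfolding wfun_pt by (simp add: sgn_if)

lemma wall_wfun: "wall s I J t = {P \<in> region s. wfun I J t P = 0}"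
  by (auto simp: wall_def wfun_def)

lemma pt_region:
  assumes "lat s e" "\<And>i. e (Xi i) > 0" "\<And>j. e (Yj j) < 0" "e (Zp 0) <= 0"
  shows "pt e \<in> region s"
proof -
  have "(\<Sum>i\<in>UNIV. e (Xi i)) + (\<Sum>j\<in>UNIV. e (Yj j)) + int s * e (Zp 0) = 0"
    using assms(1) unfolding lat_def XY_ids sum_ids by simp
  then have "real_of_int ((\<Sum>i\<in>UNIV. e (Xi i)) + (\<Sum>j\<in>UNIV. e (Yj j)) + int s * e (Zp 0)) = 0" by simp
  then show ?thesis using assms by (simp add: region_def pt_def sum_negf)
qed

lemma wfun_affine: "wfun I J k ((1 - u) *\<^sub>R P + u *\<^sub>R P') = (1 - u) * wfun I J k P + u * wfun I J k P'"
  by (simp add: wfun_def sum.distrib sum_subtractf sum_distrib_left algebra_simps)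

lemma region_wfun: "P \<in> region s \<longleftrightarrow> (\<forall>i. wfun {i} {} 0 P > 0) & (\<forall>j. wfun {} {j} 0 P < 0) & snd (snd P) >= 0 & wfun UNIV UNIV s P = 0"
  by (cases P) (auto simp: region_def wfun_def algebra_simps)

lemma continuous_wfun: "continuous_on A (wfun I J k)"
  unfolding wfun_def[abs_def] by (intro continuous_intros)

lemma sgn_convex:
  fixes x y u :: real assumes "sgn x = sgn y" "0 <= u" "u <= 1" shows "sgn ((1 - u) * x + u * y) = sgn x"
proof -
  consider "x > 0" "y > 0" | "x < 0" "y < 0" | "x = 0" "y = 0" using assms(1) by (auto simp: sgn_if split: if_splits)
  then show ?thesis
  proof cases
    case 1
    have "(1 - u) * x + u * y > 0"
    proof (cases "u = 0")
      case False
      then have "u * y > 0" "(1 - u) * x >= 0" using 1 assms by auto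
      then show ?thesis by linarith
    qed (use 1 in simp)
    then show ?thesis using 1 by simp
  next
    case 2
    have "(1 - u) * x + u * y < 0"
    proof (cases "u = 0")
      case False
      then have "u * y < 0" "(1 - u) * x <= 0" using 2 assms by (auto simp: mult_pos_neg mult_nonneg_nonpos)
      then show ?thesis by linarith
    qed (use 2 in simp)
    then show ?thesis using 2 by simp
  qed simp
qed

lemma component_wfun:
  assumes C: "C \<in> wall_complement_components s" and P: "P \<in> C"
  shows "P \<in> region s" "proper I J ==> t <= s ==> wfun I J t P ~= 0"
proof -
  have *: "P \<in> region s - \<Union> (walls s)" using C P in_components_subset unfolding wall_complement_components_def by blast
  then show r: "P \<in> region s" by simp
  show "wfun I J t P ~= 0" if "proper I J" "t <= s"
  proof
    assume "wfun I J t P = 0"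
    then have "P \<in> wall s I J t" using r by (simp add: wall_wfun)
    moreover have "wall s I J t \<in> walls s" using that by (auto simp: walls_def proper_def)
    ultimately show False using * by blast
  qed
qed

lemma component_sgn:
  assumes C: "C \<in> wall_complement_components s" and P: "P \<in> C" "P' \<in> C" and I: "proper I J" "t <= s"
  shows "sgn (wfun I J t P) = sgn (wfun I J t P')"
proof -
  have conn: "connected (wfun I J t ` C)"
    using C in_components_connected unfolding wall_complement_components_def
    by (intro connected_continuous_image continuous_wfun) blast
  have nz: "0 \<notin> wfun I J t ` C" using component_wfun(2)[OF C _ I] by auto
  have False if "wfun I J t Q < 0" "wfun I J t Q' > 0" "Q \<in> C" "Q' \<in> C" for Q Q'
    using connectedD_interval[OF conn, of "wfun I J t Q" "wfun I J t Q'" 0] that nz by auto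
  then show ?thesis using component_wfun(2)[OF C P(1) I] component_wfun(2)[OF C P(2) I] P
    by (smt (verit) sgn_real_def)
qed

lemma component_closure:
  assumes C: "C \<in> wall_complement_components s" and P: "P \<in> C" and I: "proper I J" "t <= s"
    and Q: "Q \<in> closure C" "wfun I J t Q ~= 0"
  shows "sgn (wfun I J t Q) = sgn (wfun I J t P)"
proof (cases "wfun I J t P > 0")
  case True
  have "wfun I J t P' >= 0" if "P' \<in> C" for P'
    using component_sgn[OF C P that I] True by (auto simp: sgn_if split: if_splits)
  then have "wfun I J t Q >= 0" by (intro continuous_ge_on_closure[OF continuous_wfun Q(1)])
  then show ?thesis using Q(2) True by (simp add: sgn_if)
next
  case False
  then have n: "wfun I J t P < 0" using component_wfun(2)[OF C P I] by linarith
  have "wfun I J t P' <= 0" if "P' \<in> C" for P'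
    using component_sgn[OF C P that I] n by (auto simp: sgn_if split: if_splits)
  then have "wfun I J t Q <= 0" by (intro continuous_le_on_closure[OF continuous_wfun Q(1)])
  then show ?thesis using Q(2) n by (simp add: sgn_if)
qed

lemma component_same_side:
  assumes C: "C \<in> wall_complement_components s" and P: "P \<in> C" and P': "P' \<in> region s"
    and sg: "\<And>I J t. proper I J ==> t <= s ==> sgn (wfun I J t P') = sgn (wfun I J t P)"
  shows "P' \<in> C"
proof -
  have "closed_segment P P' \<subseteq> region s - \<Union> (walls s)"
  proof
    fix R assume "R \<in> closed_segment P P'"
    then obtain u where u: "0 <= u" "u <= 1" "R = (1 - u) *\<^sub>R P + u *\<^sub>R P'" by (auto simp: closed_segment_def)
    have same: "sgn (wfun I J t R) = sgn (wfun I J t P)" if "sgn (wfun I J t P') = sgn (wfun I J t P)" for I J t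
      unfolding u(3) wfun_affine by (rule sgn_convex) (use that u in auto)
    have p1: "\<And>i. wfun {i} {} 0 P > 0" "\<And>j. wfun {} {j} 0 P < 0" "snd (snd P) >= 0" "wfun UNIV UNIV s P = 0"
      using component_wfun(1)[OF C P] unfolding region_wfun by blast+
    have p2: "\<And>i. wfun {i} {} 0 P' > 0" "\<And>j. wfun {} {j} 0 P' < 0" "snd (snd P') >= 0" "wfun UNIV UNIV s P' = 0"
      using P' unfolding region_wfun by blast+
    have "R \<in> region s" unfolding region_wfun
    proof (intro conjI allI)
      fix i show "wfun {i} {} 0 R > 0" using same[of "{i}" "{}" 0] p1(1)[of i] p2(1)[of i] by (simp add: sgn_1_pos)
    next
      fix j show "wfun {} {j} 0 R < 0" using same[of "{}" "{j}" 0] p1(2)[of j] p2(2)[of j] by (simp add: sgn_1_neg)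
    next
      show "snd (snd R) >= 0" using u p1(3) p2(3) by simp
      show "wfun UNIV UNIV s R = 0" unfolding u(3) wfun_affine using p1(4) p2(4) by simp
    qed
    moreover have "R \<notin> \<Union> (walls s)"
    proof
      assume "R \<in> \<Union> (walls s)"
      then obtain I J t where h: "proper I J" "t <= s" "R \<in> wall s I J t" by (auto simp: walls_def proper_def)
      then have "wfun I J t R = 0" by (simp add: wall_wfun)
      then have "sgn (wfun I J t P) = 0" using same[OF sg[OF h(1,2)]] by simp
      then show False using component_wfun(2)[OF C P h(1,2)] by (simp only: sgn_eq_0_iff)
    qed
    ultimately show "R \<in> region s - \<Union> (walls s)" by simp
  qed
  then have "closed_segment P P' \<subseteq> C"
    using C P by (intro components_maximal[of C "region s - \<Union> (walls s)"]) (auto simp: wall_complement_components_def)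
  then show ?thesis by auto
qed

text \<open>A point of a wall is approximated by lattice points of the same wall: all but two coordinates are rounded.\<close>

lemma wall_lattice_point:
  fixes I :: "'m::finite set" and J :: "'n::finite set" and p0 :: "('m, 'n) point"
  assumes p0: "p0 \<in> region s" "wfun I J t p0 = 0" and I: "proper I J" "t <= s"
  obtains q where "lat s q" "q (Zp 0) < 0" "val q (ids I J) t = 0"
    "\<And>I' J' k. k <= s ==> wfun I' J' k p0 ~= 0 ==> real_of_int (sgn (val q (ids I' J') k)) = sgn (wfun I' J' k p0)"
proof -
  obtain x0 y0 k0 where p0': "p0 = (x0, y0, k0)" by (cases p0)
  \<comment> \<open>\<open>C\<close> bounds the rounding error of a coordinate that is solved for,
    \<open>D\<close> that of any of the forms; the scale \<open>N\<close> is chosen so that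
    \<open>D\<close> is below \<open>N\<close> times the smallest nonzero value of a form at the
    point.\<close>
  define C where "C = real (CARD('m) + CARD('n) + s + 1)"
  define D where "D = real (CARD('m)) * C + real (CARD('n)) * C + real s * C"
  let ?E = "{e. \<exists>I' J' k. k <= s & e = \<bar>wfun (I' :: 'm set) (J' :: 'n set) k p0\<bar> & e ~= 0}"
  have "?E \<subseteq> (%(I', J', k). \<bar>wfun I' J' k p0\<bar>) ` (UNIV \<times> UNIV \<times> {..s})"
  proof
    fix e assume "e \<in> ?E"
    then obtain I' J' k where "k <= s" "e = \<bar>wfun (I' :: 'm set) (J' :: 'n set) k p0\<bar>" by blast
    then show "e \<in> (%(I', J', k). \<bar>wfun I' J' k p0\<bar>) ` (UNIV \<times> UNIV \<times> {..s})"
      by (intro image_eqI[of _ _ "(I', J', k)"]) auto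
  qed
  then have fE: "finite ?E" by (rule finite_subset) simp
  define \<epsilon> where "\<epsilon> = Min (insert 1 ?E)"
  have \<epsilon>: "\<epsilon> > 0" unfolding \<epsilon>_def using fE by (subst Min_gr_iff) auto
  have \<epsilon>le: "\<epsilon> <= \<bar>wfun I' J' k p0\<bar>" if "k <= s" "wfun I' J' k p0 ~= 0" for I' J' k
    unfolding \<epsilon>_def by (rule Min_le) (use fE that in auto)
  obtain N :: nat where N: "real N > D / \<epsilon>" using reals_Archimedean2 by blast
  then have ND: "real N * \<epsilon> > D" using \<epsilon> by (simp add: field_simps)
  obtain i1 i2 where i: "i1 \<in> I" "i2 \<notin> I" using I by (auto simp: proper_def)
  define yy where "yy j = \<lfloor>real N * y0 $ j\<rfloor>" for j
  \<comment> \<open>The added 1 makes k positive also if it is 0 at the given point.\<close>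
  define kk where "kk = \<lfloor>real N * k0\<rfloor> + 1"
  define x' where "x' i = \<lfloor>real N * x0 $ i\<rfloor>" for i
  \<comment> \<open>The coordinate \<open>i1\<close> in \<open>I\<close> is solved from the equation
    of the wall, and \<open>i2\<close> outside \<open>I\<close> from the complementary equation, so
    that the total balance holds as well.\<close>
  define xx where "xx i = (if i = i1 then (\<Sum>j\<in>J. yy j) + int t * kk - (\<Sum>i\<in>I - {i1}. x' i)
    else if i = i2 then (\<Sum>j\<in>- J. yy j) + int (s - t) * kk - (\<Sum>i\<in>- I - {i2}. x' i) else x' i)" for i
  define q :: "('m, 'n) idx => int" where
    "q w = (case w of Xi i => xx i | Yj j => - yy j | Zp v => - kk | Star => 0)" for w
  have q: "q (Xi i) = xx i" "q (Yj j) = - yy j" "q (Zp v) = - kk" "q Star = 0" for i j v by (simp_all add: q_def)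
  have k0: "k0 >= 0" using p0(1) by (simp add: region_def p0')
  then have kk: "kk > 0" by (simp add: kk_def add_nonneg_pos)
  have sI: "(\<Sum>i\<in>I. xx i) = (\<Sum>j\<in>J. yy j) + int t * kk"
  proof -
    have "(\<Sum>i\<in>I. xx i) = xx i1 + (\<Sum>i\<in>I - {i1}. xx i)" using i by (simp add: sum.remove)
    also have "(\<Sum>i\<in>I - {i1}. xx i) = (\<Sum>i\<in>I - {i1}. x' i)" by (rule sum.cong) (use i in \<open>auto simp: xx_def\<close>)
    finally show ?thesis by (simp add: xx_def)
  qed
  have sIc: "(\<Sum>i\<in>- I. xx i) = (\<Sum>j\<in>- J. yy j) + int (s - t) * kk"
  proof -
    have "(\<Sum>i\<in>- I. xx i) = xx i2 + (\<Sum>i\<in>- I - {i2}. xx i)" using i by (simp add: sum.remove)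
    also have "(\<Sum>i\<in>- I - {i2}. xx i) = (\<Sum>i\<in>- I - {i2}. x' i)" by (rule sum.cong) (use i in \<open>auto simp: xx_def\<close>)
    also have "xx i2 = (\<Sum>j\<in>- J. yy j) + int (s - t) * kk - (\<Sum>i\<in>- I - {i2}. x' i)"
      using i by (auto simp: xx_def)
    finally show ?thesis by simp
  qed
  have split: "sum f UNIV = sum f K + sum f (- K)" for f :: "'z::finite => 'r::comm_monoid_add" and K
    using sum.union_disjoint[of K "- K" f] by simp
  have lat: "lat s q"
  proof -
    have "(\<Sum>i\<in>UNIV. xx i) = (\<Sum>j\<in>UNIV. yy j) + int s * kk"
      unfolding split[of xx I] split[of yy J] sI sIc using I(2) by (simp add: of_nat_diff algebra_simps)
    then show ?thesis unfolding lat_def XY_ids sum_ids by (simp add: q sum_negf)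
  qed
  have vz: "val q (ids I J) t = 0" unfolding val_ids by (simp add: q sum_negf sI)
  have ey: "\<bar>real_of_int (yy j) - real N * y0 $ j\<bar> <= 1" for j unfolding yy_def by linarith
  have ek: "\<bar>real_of_int kk - real N * k0\<bar> <= 1" unfolding kk_def by linarith
  have ex': "\<bar>real_of_int (x' i) - real N * x0 $ i\<bar> <= 1" for i unfolding x'_def by linarith
  have bnd: "\<bar>\<Sum>i\<in>K. f i\<bar> <= real (card K) * c" if "\<And>i. \<bar>f i\<bar> <= c" for f :: "'z => real" and K c
  proof -
    have "\<bar>\<Sum>i\<in>K. f i\<bar> <= (\<Sum>i\<in>K. \<bar>f i\<bar>)" by (rule sum_abs)
    also have "... <= (\<Sum>i\<in>K. c)" by (rule sum_mono) (rule that)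
    finally show ?thesis by simp
  qed
  have bnd1: "\<bar>\<Sum>i\<in>K. f i\<bar> <= real (CARD('z))" if "\<And>i. \<bar>f i\<bar> <= 1" for f :: "'z::finite => real" and K
  proof -
    have "\<bar>\<Sum>i\<in>K. f i\<bar> <= real (card K) * 1" by (rule bnd) (rule that)
    also have "... <= real (CARD('z))" using card_mono[of UNIV K] by simp
    finally show ?thesis .
  qed
  have solved: "\<bar>(\<Sum>j\<in>J'. real_of_int (yy j)) + real t' * real_of_int kk - (\<Sum>i\<in>K. real_of_int (x' i)) - real N * v\<bar> <= C"
    if v: "v = (\<Sum>j\<in>J'. y0 $ j) + real t' * k0 - (\<Sum>i\<in>K. x0 $ i)" and t': "t' <= s" for J' t' K v
  proof -
    have "(\<Sum>j\<in>J'. real_of_int (yy j)) + real t' * real_of_int kk - (\<Sum>i\<in>K. real_of_int (x' i)) - real N * v =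
      (\<Sum>j\<in>J'. real_of_int (yy j) - real N * y0 $ j) + real t' * (real_of_int kk - real N * k0) -
      (\<Sum>i\<in>K. real_of_int (x' i) - real N * x0 $ i)"
      unfolding v by (simp add: sum_subtractf sum_distrib_left algebra_simps)
    moreover have "\<bar>\<Sum>j\<in>J'. real_of_int (yy j) - real N * y0 $ j\<bar> <= real CARD('n)" by (rule bnd1) (rule ey)
    moreover have "\<bar>\<Sum>i\<in>K. real_of_int (x' i) - real N * x0 $ i\<bar> <= real CARD('m)" by (rule bnd1) (rule ex')
    moreover have "\<bar>real t' * (real_of_int kk - real N * k0)\<bar> <= real s"
    proof -
      have "\<bar>real t' * (real_of_int kk - real N * k0)\<bar> = real t' * \<bar>real_of_int kk - real N * k0\<bar>" by (simp add: abs_mult)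
      also have "... <= real s * 1" by (rule mult_mono) (use ek t' in auto)
      finally show ?thesis by simp
    qed
    ultimately show ?thesis unfolding C_def by simp
  qed
  have w0: "(\<Sum>i\<in>I. x0 $ i) = (\<Sum>j\<in>J. y0 $ j) + real t * k0" using p0(2) by (simp add: wfun_def p0' algebra_simps)
  have w1: "(\<Sum>i\<in>- I. x0 $ i) = (\<Sum>j\<in>- J. y0 $ j) + real (s - t) * k0"
  proof -
    have "(\<Sum>i\<in>UNIV. x0 $ i) = (\<Sum>j\<in>UNIV. y0 $ j) + real s * k0" using p0(1) by (simp add: region_def p0')
    then show ?thesis unfolding split[of "%i. x0 $ i" I] split[of "%j. y0 $ j" J] w0
      using I(2) by (simp add: of_nat_diff algebra_simps)
  qed
  have ex: "\<bar>real_of_int (xx i) - real N * x0 $ i\<bar> <= C" for i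
  proof -
    have 1: "x0 $ i1 = (\<Sum>j\<in>J. y0 $ j) + real t * k0 - (\<Sum>i\<in>I - {i1}. x0 $ i)"
      using w0 i by (simp add: sum.remove[of I i1])
    have 2: "x0 $ i2 = (\<Sum>j\<in>- J. y0 $ j) + real (s - t) * k0 - (\<Sum>i\<in>- I - {i2}. x0 $ i)"
      using w1 i by (simp add: sum.remove[of "- I" i2])
    have "C >= 1" by (simp add: C_def)
    then show ?thesis using solved[OF 1 I(2)] solved[OF 2] ex'[of i] by (simp add: xx_def)
  qed
  have C1: "C >= 1" by (simp add: C_def)
  have err: "\<bar>real_of_int (val q (ids I' J') k) - real N * wfun I' J' k p0\<bar> <= D" if k: "k <= s" for I' J' k
  proof -
    have "real_of_int (val q (ids I' J') k) - real N * wfun I' J' k p0 =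
      (\<Sum>i\<in>I'. real_of_int (xx i) - real N * x0 $ i) - (\<Sum>j\<in>J'. real_of_int (yy j) - real N * y0 $ j) -
      real k * (real_of_int kk - real N * k0)"
      unfolding val_ids by (simp add: wfun_def p0' q sum_negf sum_subtractf sum_distrib_left algebra_simps)
    moreover have "\<bar>\<Sum>i\<in>I'. real_of_int (xx i) - real N * x0 $ i\<bar> <= real CARD('m) * C"
    proof -
      have "\<bar>\<Sum>i\<in>I'. real_of_int (xx i) - real N * x0 $ i\<bar> <= real (card I') * C" by (rule bnd) (rule ex)
      also have "... <= real CARD('m) * C" by (rule mult_right_mono) (use C1 card_mono[of UNIV I'] in auto)
      finally show ?thesis .
    qed
    moreover have "\<bar>\<Sum>j\<in>J'. real_of_int (yy j) - real N * y0 $ j\<bar> <= real CARD('n) * C"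
    proof -
      have "\<bar>\<Sum>j\<in>J'. real_of_int (yy j) - real N * y0 $ j\<bar> <= real (card J') * C"
        by (rule bnd) (rule order_trans[OF ey C1])
      also have "... <= real CARD('n) * C" by (rule mult_right_mono) (use C1 card_mono[of UNIV J'] in auto)
      finally show ?thesis .
    qed
    moreover have "\<bar>real k * (real_of_int kk - real N * k0)\<bar> <= real s * C"
    proof -
      have "\<bar>real k * (real_of_int kk - real N * k0)\<bar> = real k * \<bar>real_of_int kk - real N * k0\<bar>" by (simp add: abs_mult)
      also have "... <= real s * C" by (rule mult_mono) (use order_trans[OF ek C1] k in auto)
      finally show ?thesis .
    qed
    ultimately show ?thesis unfolding D_def by linarith
  qed
  have sg: "real_of_int (sgn (val q (ids I' J') k)) = sgn (wfun I' J' k p0)" if k: "k <= s" and nz: "wfun I' J' k p0 ~= 0" for I' J' k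
  proof -
    have "real N * \<epsilon> <= real N * \<bar>wfun I' J' k p0\<bar>" using \<epsilon>le[OF k nz] by (intro mult_left_mono) auto
    then have big: "D < real N * \<bar>wfun I' J' k p0\<bar>" using ND by linarith
    show ?thesis
    proof (cases "wfun I' J' k p0 > 0")
      case True
      then have "real_of_int (val q (ids I' J') k) > 0" using big err[OF k, of I' J'] by (simp add: abs_if split: if_splits)
      then show ?thesis using True by simp
    next
      case False
      then have "real_of_int (val q (ids I' J') k) < 0" using big nz err[OF k, of I' J'] by (simp add: abs_if split: if_splits)
      then show ?thesis using False nz by simp
    qed
  qed
  show thesis by (rule that[OF lat _ vz sg]) (use q kk in auto)
qed

section \<open>The wall-crossing formula\<close>

lemma evpoly_prod: "finite A ==> (\<And>i. i \<in> A ==> evpoly (f i) (c i)) ==> evpoly (%j. \<Prod>i\<in>A. f i j) (\<Prod>i\<in>A. c i)"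
  by (induction A rule: finite_induct) (auto intro: evpoly_const evpoly_mult)

lemma evpoly_linear: "evpoly (%j. real_of_int (a + int j * b)) (real_of_int a)"
  by (rule evpolyI[where P = "[:real_of_int a, real_of_int b:]"]) simp_all

lemma evpoly_polynomial_function:
  fixes P :: "'a::euclidean_space => real"
  assumes "real_polynomial_function P"
  shows "evpoly (%j. P (a + real j *\<^sub>R b)) (P a)"
proof -
  have "polynomial_function (%t::real. a + t *\<^sub>R b)"
    by (intro polynomial_function_add polynomial_function_const polynomial_function_bounded_linear bounded_linear_scaleR_left)
  then have "real_polynomial_function (P \<circ> (%t::real. a + t *\<^sub>R b))"
    by (rule real_polynomial_function_compose[OF _ assms])
  then obtain c n where c: "P \<circ> (%t::real. a + t *\<^sub>R b) = (%x. \<Sum>i\<le>n. c i * x ^ i)"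
    unfolding real_polynomial_function_iff_sum by blast
  have e: "P (a + t *\<^sub>R b) = poly (\<Sum>i\<le>n. monom (c i) i) t" for t
    using fun_cong[OF c, of t] by (simp add: poly_sum poly_monom)
  show ?thesis by (rule evpolyI[where P = "\<Sum>i\<le>n. monom (c i) i"]) (use e[of 0] in \<open>simp_all add: e del: of_nat_Suc\<close>)
qed

lemma pt_line: "pt (%i. e i + int j * q i) = pt e + real j *\<^sub>R pt q"
  by (simp add: pt_def vec_eq_iff)

lemma Rw_singletons: "Rw zero_dir e zi (map (%i. {i}) l) = vev (map (%i. Eop (e i) (zvar (zi i))) l)"
proof -
  have "Rw zero_dir e zi (map (%i. {i}) l) = Gv (map (%i. (e i, zvar (zi i))) l)"
    unfolding Rw_def by (subst Rv_static) (auto simp: slet_def o_def)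
  then show ?thesis by (simp add: Gv_def o_def)
qed

lemma filter_sorted_list_of_set: "finite A ==> filter P (sorted_list_of_set A) = sorted_list_of_set {x\<in>A. P x}"
  by (rule sorted_distinct_set_unique) (auto intro: sorted_wrt_filter)

definition xs0 :: "('m::{finite,linorder}, 'n::finite) idx list" where "xs0 = map Xi (sorted_list_of_set UNIV)"
definition ys0 :: "('m::finite, 'n::{finite,linorder}) idx list" where "ys0 = map Yj (sorted_list_of_set UNIV)"

lemma xs0_ys0:
  "distinct xs0" "distinct ys0" "set xs0 = range Xi" "set ys0 = range Yj"
  by (auto simp: xs0_def ys0_def distinct_map inj_on_def)

text \<open>The product of all parts, by which the Hurwitz number has been divided. It is itself
  polynomial, so multiplying by it preserves polynomiality.\<close>

definition weight :: "(('m::finite, 'n::finite) idx => int) => real" where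
  "weight e = (\<Prod>i\<in>UNIV. real_of_int (e (Xi i))) * (\<Prod>j\<in>UNIV. real_of_int (- e (Yj j)))"

lemma prod_list_sub_tuple: "prod_list (sub_tuple x I) = (\<Prod>i\<in>I. x $ i)"
  by (simp add: sub_tuple_def prod.distinct_set_conv_list[symmetric])

definition lv :: "int ^ 'm::finite => int ^ 'n::finite => int => ('m, 'n) idx => int" where
  "lv x y k w = (case w of Xi i => x $ i | Yj j => - (y $ j) | Zp v => - k | Star => 0)"

lemma lv_simps [simp]: "lv x y k (Xi i) = x $ i" "lv x y k (Yj j) = - (y $ j)" "lv x y k (Zp v) = - k" "lv x y k Star = 0"
  by (simp_all add: lv_def)

lemma pt_lv: "pt (lv x y k) = real_point (x, y, k)" by (simp add: pt_def real_point_def)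

lemma lat_lv: "lat s (lv x y k) \<longleftrightarrow> (\<Sum>i\<in>UNIV. x $ i) = (\<Sum>j\<in>UNIV. y $ j) + int s * k"
  unfolding lat_def XY_ids sum_ids by (auto simp: sum_negf)

lemma lat_eq_lv:
  fixes e :: "('m::finite, 'n::finite) idx => int"
  assumes "lat s e" shows "e = lv (\<chi> i. e (Xi i)) (\<chi> j. - e (Yj j)) (- e (Zp 0))"
proof
  fix w show "e w = lv (\<chi> i. e (Xi i)) (\<chi> j. - e (Yj j)) (- e (Zp 0)) w"
    using lat_Zp[OF assms] assms by (cases w) (auto simp: lat_def)
qed

lemma hurwitz_Rw:
  fixes x :: "int ^ 'm::{finite,linorder}" and y :: "int ^ 'n::{finite,linorder}"
  assumes "\<And>i. x $ i > 0" "\<And>j. y $ j > 0"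
  shows "mcoeff (Rw zero_dir (lv x y k) zi (word0 s xs0 ys0)) (zmonomial s r) = weight (lv x y k) * hurwitz r s x y k"
proof -
  have w: "word0 s xs0 ys0 = (map (%i. {i}) (xs0 @ map Zp [1..<Suc s] @ ys0) :: ('m, 'n) idx set list)"
    by (simp add: word0_def del: upt_Suc)
  have z: "zvar None = 0" "zvar (Some v) = mvar v" for v by (simp_all add: zvar_def)
  let ?V = "vev (map (%x. Eop x 0) (sub_tuple x UNIV) @ map (%p. Eop (- k) (mvar p)) [1..<Suc s] @ map (%y. Eop (- y) 0) (sub_tuple y UNIV))"
  have V: "Rw zero_dir (lv x y k) zi (word0 s xs0 ys0) = ?V"
    unfolding w Rw_singletons by (simp add: xs0_def ys0_def sub_tuple_def o_def z del: upt_Suc)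
  have p: "real_of_int (prod_list (sub_tuple x UNIV)) * real_of_int (prod_list (sub_tuple y UNIV)) = weight (lv x y k)"
    unfolding prod_list_sub_tuple by (simp add: weight_def of_int_prod)
  have "weight (lv x y k) ~= 0"
  proof -
    have "x $ i ~= 0" "y $ j ~= 0" for i j using assms(1)[of i] assms(2)[of j] by simp_all
    then show ?thesis by (simp add: weight_def)
  qed
  then show ?thesis unfolding V hurwitz_def H_series_def p mcoeff_mconst_mult by simp
qed

lemma cham_point:
  fixes C :: "((real ^ 'm::finite) \<times> (real ^ 'n::finite) \<times> real) set"
  assumes C: "C \<in> wall_complement_components s" and e0: "pt e0 \<in> C" and e: "e \<in> cham s e0"
  shows "pt e \<in> C"
proof (rule component_same_side[OF C e0])
  show "pt e \<in> region s" using cham_coord[OF e] by (intro pt_region) auto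
  fix I :: "'m set" and J :: "'n set" and t assume "proper I J" "t <= s"
  then show "sgn (wfun I J t (pt e)) = sgn (wfun I J t (pt e0))"
    unfolding sgn_wfun_pt using cham_coord(5)[OF e, of "ids I J" t] by (simp add: mixed_ids)
qed

lemma chamber_polynomial_hurwitz:
  fixes C :: "((real ^ 'm::{finite,linorder}) \<times> (real ^ 'n::{finite,linorder}) \<times> real) set"
  assumes C: "C \<in> wall_complement_components s" and e0: "pt e0 \<in> C"
    and r: "r >= 1" and n2: "CARD('n) >= 2" and P: "real_polynomial_function P"
    and h: "\<And>x y l. (x, y, l) \<in> chamber s C ==> hurwitz r s x y l = P (real_point (x, y, l))"
  shows "chamber_polynomial s r xs0 ys0 e0 (%e. weight e * P (pt e))"
proof
  show "distinct xs0" "distinct ys0" "set xs0 = range Xi" "set ys0 = range Yj" by (rule xs0_ys0)+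
  show "regular s e0" unfolding regular_def
  proof (intro allI impI)
    fix B :: "('m, 'n) idx set" and k assume B: "mixed B" "k <= s"
    obtain I J where "B = ids I J" using B ids_cases unfolding mixed_def by blast
    then show "val e0 B k ~= 0" using component_wfun(2)[OF C e0, of I J k] B by (simp add: mixed_ids wfun_pt)
  qed
  show "evpoly (%j. weight (%i. e i + int j * q i) * P (pt (%i. e i + int j * q i))) (weight e * P (pt e))" for e q
  proof (rule evpoly_mult)
    have "evpoly (%j. real_of_int (- (e (Yj i) + int j * q (Yj i)))) (real_of_int (- e (Yj i)))" for i
      using evpoly_linear[of "- e (Yj i)" "- q (Yj i)"] by simp
    then show "evpoly (%j. weight (%i. e i + int j * q i)) (weight e)"
      unfolding weight_def by (intro evpoly_mult evpoly_prod evpoly_linear) simp_all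
    show "evpoly (%j. P (pt (%i. e i + int j * q i))) (P (pt e))"
      unfolding pt_line by (rule evpoly_polynomial_function[OF P])
  qed
  show "mcoeff (Rw zero_dir e zi (word0 s xs0 ys0)) (zmonomial s r) = weight e * P (pt e)" if e: "e \<in> cham s e0" for e
  proof -
    define x where "x = (\<chi> i. e (Xi i))"
    define y where "y = (\<chi> j. - e (Yj j))"
    define k where "k = - e (Zp 0)"
    have ee: "e = lv x y k" unfolding x_def y_def k_def by (rule lat_eq_lv[OF cham_coord(1)[OF e]])
    have ps: "x $ i > 0" "y $ j > 0" "k >= 0" for i j using cham_coord(2-4)[OF e] by (simp_all add: x_def y_def k_def)
    have "lat s (lv x y k)" using cham_coord(1)[OF e] ee by simp
    then have "(x, y, k) \<in> V_lattice s" using ps by (simp add: V_lattice_def lat_lv)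
    moreover have "real_point (x, y, k) \<in> C" using cham_point[OF C e0 e] unfolding ee pt_lv .
    ultimately have "(x, y, k) \<in> chamber s C" by (simp add: chamber_def)
    from h[OF this] show ?thesis unfolding ee hurwitz_Rw[OF ps(1,2)] pt_lv by simp
  qed
qed (use r n2 in auto)

lemma zS_letters:
  fixes A :: "('m::finite, 'n::finite) idx set"
  assumes "A \<subseteq> XY" "finite K" shows "zS (A \<union> Zp ` K) = z_sum K"
proof -
  have "zS (A \<union> Zp ` K) = zS A + zS (Zp ` K :: ('m, 'n) idx set)"
    by (rule sum.union_disjoint) (use assms finite_subset[OF assms(1)] in auto)
  also have "zS A = 0"
  proof (rule sum.neutral, rule ballI)
    fix i assume "i \<in> A"
    then have "zi i = None" using assms XY_zi by blast
    then show "zvar (zi i) = 0" by (simp add: zvar_def)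
  qed
  also have "zS (Zp ` K :: ('m, 'n) idx set) = z_sum K"
    by (subst sum.reindex) (auto simp: inj_on_def z_sum_def zvar_def)
  finally show ?thesis by simp
qed

lemma bij_sides:
  fixes A :: "('m::finite, 'n::finite) idx set"
  assumes "A \<subseteq> XY"
  shows "bij_betw (%K. A \<union> Zp ` K) {K. K \<subseteq> {1..s} & card K = t} (sides s A t)"
proof (rule bij_betw_byWitness[where f' = "%T. {v. Zp v \<in> T}"])
  have zA: "Zp v \<notin> A" for v using assms by auto
  have inv: "{v. Zp v \<in> A \<union> Zp ` K} = K" for K using zA by auto
  show "\<forall>K\<in>{K. K \<subseteq> {1..s} & card K = t}. {v. Zp v \<in> A \<union> Zp ` K} = K" using inv by blast
  show "\<forall>T\<in>sides s A t. A \<union> Zp ` {v. Zp v \<in> T} = T" by (auto simp: sides_def letters_def)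
  show "(%K. A \<union> Zp ` K) ` {K. K \<subseteq> {1..s} & card K = t} \<subseteq> sides s A t"
    using assms inv by (auto simp: sides_def letters_def zc_def)
  show "(%T. {v. Zp v \<in> T}) ` sides s A t \<subseteq> {K. K \<subseteq> {1..s} & card K = t}"
    by (auto simp: sides_def letters_def zc_def)
qed

context chamber_polynomial
begin

lemma crossing_H:
  assumes wc: "wall_crossing (letters s) zi q1 q2 p F pref" and S: "S \<in> F" "S \<subseteq> letters s" and l: "lat s q1" "lat s p"
  shows "wall_crossing.crossing (letters s) zi q1 p pref S W = pref S * (H1 S q1 p * H2 (letters s - S) q1 p)"
proof -
  interpret w: wall_crossing "letters s" zi q1 q2 p F pref by fact
  let ?S' = "letters s - S"
  have "\<exists>i. T = {i}" if "T \<in> set W" for T using that by (auto simp: word0_def simp del: upt_Suc)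
  moreover have "T \<subseteq> letters s" if "T \<in> set W" for T using that dW(2) by blast
  ultimately have ref: "w.refines W S" unfolding w.refines_def by (metis Diff_iff empty_subsetI insert_subset)
  have sc: "sum u ?S' = - sum u S" if "lat s u" for u
    using sum.subset_diff[OF S(2), of u] sum_letters[OF that] by simp
  have sl: "slet (ext T q1) (ext T p) zi V = slet q1 p zi V" if "V \<in> set (fw T)" "T \<subseteq> letters s" for V T
  proof -
    have "Star \<notin> V" using that by (auto simp: fw_def)
    then show ?thesis by (auto simp: slet_def ext_def intro!: sum.cong)
  qed
  have "w.left S W = H1 S q1 p"
    unfolding w.left_def H1_def Rw_def fw_def[symmetric] w.starm_def
    using sl[OF _ S(2)] by (auto simp: slet_def ext_def zvar_def intro!: arg_cong[where f = Rv])
  moreover have "w.right S W = H2 ?S' q1 p"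
    unfolding w.right_def H2_def Rw_def fw_def[symmetric] w.starp_def
    using sl[of _ ?S'] sc l by (auto simp: slet_def ext_def zvar_def intro!: arg_cong[where f = Rv])
  ultimately show ?thesis using ref by (simp add: w.crossing_def mult.assoc)
qed

end

lemma fw_sorted:
  fixes I :: "'m::{finite,linorder} set" and J :: "'n::{finite,linorder} set"
  assumes "K \<subseteq> {1..s}"
  shows "filter (%T. T \<subseteq> ids I J \<union> Zp ` K) (word0 s xs0 ys0) =
    map (%i. {i}) (map Xi (sorted_list_of_set I) @ map Zp (sorted_list_of_set K) @ map Yj (sorted_list_of_set J))"
proof -
  have w: "word0 s xs0 ys0 = (map (%i. {i}) (xs0 @ map Zp [1..<Suc s] @ ys0) :: ('m, 'n) idx set list)"
    by (simp add: word0_def del: upt_Suc)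
  have u: "[1..<Suc s] = sorted_list_of_set {1..s}"
    by (rule sorted_distinct_set_unique) (auto simp del: upt_Suc)
  have k: "{x. Suc 0 <= x & x <= s & x \<in> K} = K" using assms by auto
  have m: "Xi i \<in> ids I J \<union> Zp ` K \<longleftrightarrow> i \<in> I" "Yj j \<in> ids I J \<union> Zp ` K \<longleftrightarrow> j \<in> J" "Zp v \<in> ids I J \<union> Zp ` K \<longleftrightarrow> v \<in> K" for i j v
    by (auto simp: ids_def)
  show ?thesis
    unfolding w unfolding u xs0_def ys0_def filter_map map_append filter_append
    by (simp add: o_def filter_map m filter_sorted_list_of_set k del: Un_iff)
qed

text \<open>\<delta> occurs once among the entries of each factor. Clearing the two denominators
  therefore gives the product of all parts times \<delta>^2, and the prefactor becomes the quotient
  of sigmas.\<close>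

lemma sum_sides_wc:
  fixes I :: "'m::{finite,linorder} set" and J :: "'n::{finite,linorder} set" and x :: "int ^ 'm::{finite,linorder}" and y :: "int ^ 'n::{finite,linorder}"
  assumes cp: "chamber_polynomial s r (xs0 :: ('m, 'n) idx list) ys0 e0 Q" and l: "lat s (lv x y k)" and t: "t <= s"
    and K: "K \<subseteq> {1..s}" "card K = t" and \<delta>: "\<delta> = wall_delta I J t x y k" "\<delta> ~= 0"
    and nz: "\<And>i. x $ i ~= 0" "\<And>j. y $ j ~= 0"
  shows "prefactor s (lv x y k) (ids I J \<union> Zp ` K) *
      (chamber_polynomial.H1 s xs0 ys0 (ids I J \<union> Zp ` K) zero_dir (lv x y k) *
       chamber_polynomial.H2 s xs0 ys0 (letters s - (ids I J \<union> Zp ` K)) zero_dir (lv x y k)) =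
    mconst (weight (lv x y k)) * wc_summand s I J x y k \<delta> K"
proof -
  interpret chamber_polynomial s r "xs0 :: ('m, 'n) idx list" ys0 e0 Q by fact
  let ?S = "ids I J \<union> Zp ` K" and ?p = "lv x y k" and ?K' = "{1..s} - K"
  let ?S' = "ids (- I) (- J) \<union> Zp ` ?K'"
  have fK: "finite K" using K finite_subset by blast
  have S': "letters s - ?S = ?S'" by (auto simp: letters_def XY_def ids_def)
  have XI: "ids I J \<subseteq> XY" "ids (- I) (- J) \<subseteq> XY" by (rule ids_XY)+
  have cK': "card ?K' = s - t" using card_Diff_subset[OF fK K(1)] K(2) by simp
  have sS: "sum ?p ?S = \<delta>"
    unfolding sum_val[OF l finite_subset[OF XI(1) finite_XY] fK XI(1)] val_ids \<delta>(1) wall_delta_def K(2) by (simp add: sum_negf)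
  have SX: "?S \<subseteq> letters s" using K XI by (auto simp: letters_def)
  have sS': "sum ?p ?S' = - \<delta>"
    using sum.subset_diff[OF SX, of ?p] sum_letters[OF l] sS unfolding S' by simp
  have z: "zvar None = 0" "zvar (Some v) = mvar v" for v by (simp_all add: zvar_def)
  have e: "ext T ?p (Xi i) = x $ i" "ext T ?p (Yj j) = - (y $ j)" "ext T ?p (Zp v) = - k" "ext T ?p Star = - sum ?p T" for T i j v
    by (simp_all add: ext_def)
  let ?V1 = "vev (map (%x. Eop x 0) (sub_tuple x I) @ map (%p. Eop (- k) (mvar p)) (sorted_list_of_set K) @ map (%y. Eop (- y) 0) (sub_tuple y J @ [\<delta>]))"
  let ?V2 = "vev (map (%x. Eop x 0) (\<delta> # sub_tuple x (- I)) @ map (%p. Eop (- k) (mvar p)) (sorted_list_of_set ?K') @ map (%y. Eop (- y) 0) (sub_tuple y (- J)))"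
  have h1: "H1 ?S zero_dir ?p = ?V1"
  proof -
    have "H1 ?S zero_dir ?p = Rw zero_dir (ext ?S ?p) zi (map (%i. {i})
        ((map Xi (sorted_list_of_set I) @ map Zp (sorted_list_of_set K) @ map Yj (sorted_list_of_set J)) @ [Star]))"
      unfolding H1_def fw_def fw_sorted[OF K(1)] ext_zero by simp
    then show ?thesis unfolding Rw_singletons by (simp add: sub_tuple_def o_def z e sS)
  qed
  have h2: "H2 (letters s - ?S) zero_dir ?p = ?V2"
  proof -
    have K': "?K' \<subseteq> {1..s}" by auto
    obtain S2 where S2: "S2 = ?S'" by blast
    have f: "filter (%T. T \<subseteq> S2) W = map (%i. {i})
        (map Xi (sorted_list_of_set (- I)) @ map Zp (sorted_list_of_set ?K') @ map Yj (sorted_list_of_set (- J)))"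
      unfolding S2 by (rule fw_sorted[OF K'])
    have s2: "sum ?p S2 = - \<delta>" unfolding S2 by (rule sS')
    have "H2 S2 zero_dir ?p = Rw zero_dir (ext S2 ?p) zi (map (%i. {i})
        (Star # (map Xi (sorted_list_of_set (- I)) @ map Zp (sorted_list_of_set ?K') @ map Yj (sorted_list_of_set (- J)))))"
      unfolding H2_def fw_def f ext_zero by simp
    then have "H2 S2 zero_dir ?p = ?V2"
      unfolding Rw_singletons by (simp add: sub_tuple_def o_def z e s2)
    then show ?thesis unfolding S' S2 .
  qed
  define a where "a = real_of_int (prod_list (sub_tuple x I)) * real_of_int (prod_list (sub_tuple y J @ [\<delta>]))"
  define b where "b = real_of_int (prod_list (\<delta> # sub_tuple x (- I))) * real_of_int (prod_list (sub_tuple y (- J)))"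
  have ab0: "a ~= 0" "b ~= 0" using nz \<delta>(2) by (simp_all add: a_def b_def prod_list_sub_tuple)
  have ab: "a * b = (real_of_int \<delta>)\<^sup>2 * weight ?p"
  proof -
    have sp: "(\<Prod>i\<in>UNIV. f i) = (\<Prod>i\<in>M. f i) * (\<Prod>i\<in>- M. f i)" for f :: "'z::finite => real" and M
      using prod.union_disjoint[of M "- M" f] by simp
    show ?thesis unfolding a_def b_def weight_def sp[of _ I] sp[of _ J]
      by (simp add: prod_list_sub_tuple power2_eq_square algebra_simps)
  qed
  have pf: "prefactor s ?p ?S = varsigma_ratio 1 \<delta> K * varsigma_ratio 1 \<delta> ?K' * varsigma_ratio \<delta> 1 {1..s}"
  proof -
    have "zS (letters s :: ('m, 'n) idx set) = z_sum {1..s}" unfolding letters_def by (rule zS_letters) auto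
    moreover have "zS ?S' = z_sum ?K'" by (rule zS_letters[OF XI(2)]) simp
    ultimately show ?thesis
      unfolding prefactor_def sS S' irat_def rat_def varsigma_ratio_def zS_letters[OF XI(1) fK] by simp
  qed
  have c1: "mconst a * (mconst (1 / a) * V) = V" if "a ~= 0" for a :: real and V :: "real mfps"
    using that by (simp flip: mult.assoc mconst_mult)
  have "?V1 = mconst a * H_series k (sub_tuple x I) (sub_tuple y J @ [\<delta>]) (sorted_list_of_set K)"
    unfolding H_series_def a_def[symmetric] c1[OF ab0(1)] ..
  moreover have "?V2 = mconst b * H_series k (\<delta> # sub_tuple x (- I)) (sub_tuple y (- J)) (sorted_list_of_set ?K')"
    unfolding H_series_def b_def[symmetric] c1[OF ab0(2)] ..
  moreover have "mconst a * mconst b = mconst (weight ?p) * mconst ((real_of_int \<delta>)\<^sup>2)"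
    unfolding mconst_mult[symmetric] ab by (simp add: mult.commute)
  moreover have "R * ((mconst a * h) * (mconst b * g)) = (mconst a * mconst b) * (R * h * g)" for R h g :: "real mfps"
    by (simp only: ac_simps)
  ultimately have "prefactor s ?p ?S * (?V1 * ?V2) = (mconst (weight ?p) * mconst ((real_of_int \<delta>)\<^sup>2)) *
      (prefactor s ?p ?S * H_series k (sub_tuple x I) (sub_tuple y J @ [\<delta>]) (sorted_list_of_set K) *
       H_series k (\<delta> # sub_tuple x (- I)) (sub_tuple y (- J)) (sorted_list_of_set ?K'))"
    by (simp only:)
  also have "... = mconst (weight ?p) * wc_summand s I J x y k \<delta> K"
    unfolding wc_summand_def pf by (simp only: ac_simps)
  finally show ?thesis unfolding h1 h2 .
qed

lemma blocks_two:
  assumes "proper I J" "t <= s"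
  shows "blocks s {0, 1} (%n. if n = 0 then ids I J else XY - ids I J) (%n. if n = (0::nat) then t else s - t)"
proof -
  obtain i1 i2 where "i1 \<in> I" "i2 \<notin> I" using assms by (auto simp: proper_def)
  then have "Xi i1 \<in> ids I J" "Xi i2 \<in> XY - ids I J" by (auto simp: XY_def)
  then show ?thesis using assms(2) ids_XY[of I J] by (auto simp: blocks_def)
qed

lemma wfun_complement:
  fixes I :: "'m::finite set" and J :: "'n::finite set"
  assumes "P \<in> region s" "t <= s"
  shows "wfun (- I) (- J) (s - t) P = - wfun I J t P"
proof -
  have sp: "(\<Sum>i\<in>UNIV. f i) = (\<Sum>i\<in>M. f i) + (\<Sum>i\<in>- M. f i)" for f :: "'z::finite => real" and M
    using sum.union_disjoint[of M "- M" f] by simp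
  have "wfun UNIV UNIV s P = 0" using assms by (simp add: region_wfun)
  then show ?thesis unfolding wfun_def sp[of _ I] sp[of _ J] using assms(2) by (simp add: of_nat_diff algebra_simps)
qed

lemma eventually_linear_pos: "x > 0 ==> \<forall>\<^sub>F N in sequentially. real N * x + c > 0" for x c :: real
proof -
  assume x: "x > 0"
  obtain n :: nat where n: "- c < real n * x" using reals_Archimedean3[OF x] by blast
  show ?thesis
  proof (rule eventually_sequentiallyI[of n])
    fix N assume "n <= N"
    then have "real n * x <= real N * x" using x by (intro mult_right_mono) auto
    then show "real N * x + c > 0" using n by linarith
  qed
qed

text \<open>Distinct walls are distinct sets: a functional that vanishes on the whole wall is one of the two that define it.\<close>

lemma wall_separation:
  fixes I :: "'m::finite set" and J :: "'n::finite set" and p0 :: "('m, 'n) point"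
  assumes p0: "p0 \<in> wall s I J t" and I: "proper I J" "t <= s" and I': "proper I' J'" "k <= s"
    and only: "\<And>W'. W' \<in> walls s ==> p0 \<in> W' ==> W' = wall s I J t"
    and no: "~ on_wall s (ids I J) t (ids I' J') k"
  shows "wfun I' J' k p0 ~= 0"
proof
  assume z: "wfun I' J' k p0 = 0"
  have r: "p0 \<in> region s" "wfun I J t p0 = 0" using p0 by (auto simp: wall_wfun)
  have "wall s I' J' k \<in> walls s" using I' by (auto simp: walls_def proper_def)
  moreover have "p0 \<in> wall s I' J' k" using r(1) z by (simp add: wall_wfun)
  ultimately have eq: "wall s I' J' k = wall s I J t" by (rule only)
  let ?A = "%n::nat. if n = 0 then ids I J else XY - ids I J" and ?t = "%n::nat. if n = 0 then t else s - t"
  have "~ aligned {0, 1} ?A ?t (ids I' J') k" using aligned_pair[OF blocks_two[OF I] _ ids_XY] no by auto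
  then obtain v where v: "v \<in> flat s {0, 1} ?A ?t" "val v (ids I' J') k ~= 0"
    using flat_witness[OF blocks_two[OF I] ids_XY] unfolding aligned_def by blast
  \<comment> \<open>The sign of \<open>u\<close> is chosen such that adding it does not lower k; so
    the shifted point stays in the region also if k is 0 there.\<close>
  have "\<exists>u. lat s u & val u (ids I J) t = 0 & val u (ids I' J') k ~= 0 & u (Zp 0) <= 0"
  proof (cases "v (Zp 0) <= 0")
    case True
    then show ?thesis using v by (intro exI[of _ v]) (auto simp: flat_def)
  next
    case False
    then show ?thesis using v lat_uminus[of s v] val_scale[of "-1" v]
      by (intro exI[of _ "%i. - v i"]) (auto simp: flat_def)
  qed
  then obtain u where u: "lat s u" "val u (ids I J) t = 0" "val u (ids I' J') k ~= 0" "u (Zp 0) <= 0" by blast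
  have w: "wfun I0 J0 k0 (real N *\<^sub>R p0 + pt u) = real N * wfun I0 J0 k0 p0 + real_of_int (val u (ids I0 J0) k0)" for I0 J0 k0 N
    unfolding wfun_pt[symmetric] by (simp add: wfun_def sum.distrib sum_distrib_left algebra_simps)
  have "\<forall>\<^sub>F N in sequentially. (\<forall>i. real N * wfun {i} {} 0 p0 + real_of_int (val u (ids {i} {}) 0) > 0) \<and>
     (\<forall>j. real N * (- wfun {} {j} 0 p0) + (- real_of_int (val u (ids {} {j}) 0)) > 0)"
    by (intro eventually_conj eventually_all_finite eventually_linear_pos) (use r(1) in \<open>auto simp: region_wfun\<close>)
  then obtain N where N: "\<And>i. real N * wfun {i} {} 0 p0 + real_of_int (val u (ids {i} {}) 0) > 0"
    "\<And>j. real N * (- wfun {} {j} 0 p0) + (- real_of_int (val u (ids {} {j}) 0)) > 0"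
    using eventually_happens'[OF sequentially_bot] by blast
  have vXY: "val u (ids UNIV UNIV) s = 0" using u(1) unfolding lat_def val_def XY_ids by simp
  have "real N *\<^sub>R p0 + pt u \<in> region s"
    unfolding region_wfun w
  proof (intro conjI allI)
    show "real N * wfun {} {j} 0 p0 + real_of_int (val u (ids {} {j}) 0) < 0" for j using N(2)[of j] by simp
    show "snd (snd (real N *\<^sub>R p0 + pt u)) >= 0" 
    proof -
      have "0 <= real N * snd (snd p0)" using r(1) by (simp add: region_wfun)
      moreover have "real_of_int (u (Zp 0)) <= 0" using u(4) by simp
      ultimately show ?thesis by (simp add: pt_def del: of_int_le_0_iff)
    qed
    show "real N * wfun UNIV UNIV s p0 + real_of_int (val u (ids UNIV UNIV) s) = 0" using r(1) vXY by (simp add: region_wfun)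
  qed (use N(1) in auto)
  then have "real N *\<^sub>R p0 + pt u \<in> wall s I J t" unfolding wall_wfun using w r(2) u(2) by simp
  then have "wfun I' J' k (real N *\<^sub>R p0 + pt u) = 0" unfolding eq[symmetric] by (simp add: wall_wfun)
  then show False unfolding w z using u(3) by simp
qed

lemma cham_refl: "lat s e ==> (\<And>i. e (Xi i) > 0) ==> (\<And>j. e (Yj j) < 0) ==> e (Zp 0) <= 0 ==> e \<in> cham s e"
  by (simp add: cham_def)

theorem theorem6p1:
  fixes r s t :: nat
    and I :: "'m::{finite,linorder} set" and J :: "'n::{finite,linorder} set"
    and C1 C2 :: "((real ^ 'm::{finite,linorder}) \<times> (real ^ 'n::{finite,linorder}) \<times> real) set"
    and P1 P2 :: "(real ^ 'm::{finite,linorder}) \<times> (real ^ 'n::{finite,linorder}) \<times> real \<Rightarrow> real"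
    and \<mu> :: "int ^ 'm::{finite,linorder}" and \<nu> :: "int ^ 'n::{finite,linorder}" and k :: int
  assumes "r \<ge> 1"
    and "I \<noteq> {}" "I \<noteq> UNIV" "J \<noteq> {}" "J \<noteq> UNIV" "t \<le> s"
    and "C1 \<in> wall_complement_components s" "C2 \<in> wall_complement_components s"
    and "common_border s (wall s I J t) C1 C2"
    and "\<And>x y l. (x, y, l) \<in> chamber s C1 \<Longrightarrow> wall_delta I J t x y l > 0"
    and "\<And>x y l. (x, y, l) \<in> chamber s C2 \<Longrightarrow> wall_delta I J t x y l < 0"
    and "real_polynomial_function P1" "real_polynomial_function P2"
    and "\<And>x y l. (x, y, l) \<in> chamber s C1 \<Longrightarrow> hurwitz r s x y l = P1 (real_point (x, y, l))"
    and "\<And>x y l. (x, y, l) \<in> chamber s C2 \<Longrightarrow> hurwitz r s x y l = P2 (real_point (x, y, l))"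
    and "(\<mu>, \<nu>, k) \<in> chamber s C1"
  shows "P1 (real_point (\<mu>, \<nu>, k)) - P2 (real_point (\<mu>, \<nu>, k)) =
    mcoeff (\<Sum>K | K \<subseteq> {1..s} \<and> card K = t.
        wc_summand s I J \<mu> \<nu> k (wall_delta I J t \<mu> \<nu> k) K) (zmonomial s r)"
proof -
  note r = assms(1) and ts = assms(6) and C1 = assms(7) and C2 = assms(8)
  have pIJ: "proper I J" using assms(2-5) by (simp add: proper_def)
  let ?A = "ids I J" and ?Z = "zmonomial s r" and ?W = "word0 s xs0 ys0 :: ('m, 'n) idx set list"
  let ?p = "lv \<mu> \<nu> k"
  have A: "?A \<subseteq> XY" "?A ~= {}" "?A ~= XY" "mixed ?A"
  proof -
    obtain i1 i2 where i: "i1 \<in> I" "i2 \<notin> I" using pIJ by (auto simp: proper_def)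
    then have "Xi i1 \<in> ?A" "Xi i2 \<notin> ?A" "Xi i2 \<in> (XY :: ('m, 'n) idx set)" by (simp_all add: XY_def)
    then show "?A ~= {}" "?A ~= XY" by blast+
    show "?A \<subseteq> XY" "mixed ?A" using pIJ mixed_ids ids_XY by blast+
  qed
  have n2: "CARD('n) >= 2"
  proof -
    obtain j1 j2 where "j1 \<in> J" "j2 \<notin> J" using pIJ by (auto simp: proper_def)
    then have "j1 ~= j2" by blast
    then have "card {j1, j2} = 2" by simp
    then show ?thesis using card_mono[of UNIV "{j1, j2}"] by simp
  qed
  have mu: "\<mu> $ i > 0" "\<nu> $ j > 0" "k >= 0" "lat s ?p" "pt ?p \<in> C1" for i j
    using assms(16) by (auto simp: chamber_def V_lattice_def lat_lv pt_lv)
  define \<delta> where "\<delta> = wall_delta I J t \<mu> \<nu> k"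
  have \<delta>: "\<delta> > 0" unfolding \<delta>_def by (rule assms(10)[OF assms(16)])
  have vp: "val ?p ?A t = \<delta>" unfolding val_ids \<delta>_def wall_delta_def by (simp add: sum_negf)
  obtain p0 where p0: "p0 \<in> wall s I J t" "p0 \<in> closure C1" "p0 \<in> closure C2"
    "\<And>W'. W' \<in> walls s ==> p0 \<in> W' ==> W' = wall s I J t"
    using assms(9) unfolding common_border_def by blast
  have p0r: "p0 \<in> region s" "wfun I J t p0 = 0" using p0(1) by (auto simp: wall_wfun)
  have sep: "wfun I' J' l p0 ~= 0" if "proper I' J'" "l <= s" "~ on_wall s ?A t (ids I' J') l" for I' J' l
    by (rule wall_separation[OF p0(1) pIJ ts that(1,2) p0(4) that(3)])
  obtain P2' where P2': "P2' \<in> C2" using C2 in_components_nonempty unfolding wall_complement_components_def by blast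
  have sg1: "sgn (wfun I' J' l (pt ?p)) = sgn (wfun I' J' l p0)" if "proper I' J'" "l <= s" "~ on_wall s ?A t (ids I' J') l" for I' J' l
    using component_closure[OF C1 mu(5) that(1,2) p0(2) sep[OF that]] by simp
  have sg2: "sgn (wfun I' J' l P2') = sgn (wfun I' J' l p0)" if "proper I' J'" "l <= s" "~ on_wall s ?A t (ids I' J') l" for I' J' l
    using component_closure[OF C2 P2' that(1,2) p0(3) sep[OF that]] by simp
  have on: "I' = I & J' = J & l = t | I' = - I & J' = - J & l = s - t"
    if "proper I' J'" "on_wall s ?A t (ids I' J') l" for I' J' l
  proof -
    have inj: "I' = I0 & J' = J0" if "ids I' J' = ids I0 J0" for I0 J0 using that by (auto simp: ids_def)
    have c: "XY - ?A = ids (- I) (- J)" by (auto simp: XY_def ids_def)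
    have "ids I' J' ~= {}" using inj[of "{}" "{}"] that(1) by (auto simp: proper_def ids_def)
    moreover have "ids I' J' ~= XY" using inj[of UNIV UNIV] that(1) by (auto simp: proper_def XY_ids)
    ultimately have "ids I' J' = ids I J & l = t | ids I' J' = ids (- I) (- J) & l = s - t"
      using that(2) unfolding on_wall_def c by simp
    then consider "ids I' J' = ids I J" "l = t" | "ids I' J' = ids (- I) (- J)" "l = s - t" by blast
    then show ?thesis
    proof cases
      case 1
      then show ?thesis using inj[OF 1(1)] by blast
    next
      case 2
      then show ?thesis using inj[OF 2(1)] by blast
    qed
  qed
  \<comment> \<open>The assumption on \<open>C2\<close> speaks only of its lattice points, and none
    is known yet. If the form were positive at this real point, all signs would agree with those at
    the given lattice point, which would then lie in \<open>C2\<close> and have positive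
    \<delta>.\<close>
  have P2neg: "wfun I J t P2' < 0"
  proof (rule ccontr)
    assume "~ ?thesis"
    then have pos: "wfun I J t P2' > 0" using component_wfun(2)[OF C2 P2' pIJ ts] by linarith
    have P2r: "P2' \<in> region s" by (rule component_wfun(1)[OF C2 P2'])
    have wp: "wfun I J t (pt ?p) > 0" unfolding wfun_pt vp using \<delta> by simp
    have pr: "pt ?p \<in> region s" by (rule component_wfun(1)[OF C1 mu(5)])
    have "pt ?p \<in> C2"
    proof (rule component_same_side[OF C2 P2' pr])
      fix I' J' l assume h: "proper (I' :: 'm set) (J' :: 'n set)" "l <= s"
      show "sgn (wfun I' J' l (pt ?p)) = sgn (wfun I' J' l P2')"
      proof (cases "on_wall s ?A t (ids I' J') l")
        case True
        from on[OF h(1) this] show ?thesis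
          using pos wp wfun_complement[OF pr ts, of I J] wfun_complement[OF P2r ts, of I J] by auto
      next
        case False
        then show ?thesis using sg1[OF h False] sg2[OF h False] by simp
      qed
    qed
    then have "(\<mu>, \<nu>, k) \<in> chamber s C2" using assms(16) by (simp add: chamber_def pt_lv)
    from assms(11)[OF this] show False using \<delta> by (simp add: \<delta>_def)
  qed
  obtain q where q: "lat s q" "q (Zp 0) < 0" "val q ?A t = 0"
    "\<And>I' J' l. l <= s ==> wfun I' J' l p0 ~= 0 ==> real_of_int (sgn (val q (ids I' J') l)) = sgn (wfun I' J' l p0)"
    by (rule wall_lattice_point[OF p0r pIJ ts]) blast
  let ?bA = "%n::nat. if n = 0 then ?A else XY - ?A" and ?bt = "%n::nat. if n = 0 then t else s - t"
  obtain u where u: "u \<in> flat s {0, 1} ?bA ?bt" "\<And>B l. B \<subseteq> XY ==> l <= s ==> ~ aligned {0, 1} ?bA ?bt B l ==> val u B l ~= 0"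
    using flat_generic[OF blocks_two[OF pIJ ts]] by blast
  have lu: "lat s u" "val u ?A t = 0" using u(1) by (auto simp: flat_def)
  obtain N where N: "\<And>B l. B \<subseteq> XY ==> l <= Suc s ==> val q B l ~= 0 ==>
      sgn (val (%i. u i + int N * q i) B l) = sgn (val q B l)" using dominant[of s q u] by blast
  \<comment> \<open>A lattice vector of the wall near the common border point which, thanks to the
    generic summand, lies on no other hyperplane of a balanced part.\<close>
  define q0 where "q0 = (%i. u i + int N * q i)"
  have l0: "lat s q0" unfolding q0_def by (rule lat_comb[OF lu(1) q(1)])
  have z0: "val q0 ?A t = 0" unfolding q0_def val_comb using lu(2) q(3) by simp
  have nz0: "val q0 B l ~= 0" if B: "B \<subseteq> XY" "l <= s" "~ on_wall s ?A t B l" for B l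
  proof (cases "val q B l = 0")
    case True
    have "~ aligned {0, 1} ?bA ?bt B l" using aligned_pair[OF blocks_two[OF pIJ ts] _ B(1)] B(3) by auto
    then show ?thesis using u(2)[OF B(1,2)] True unfolding q0_def val_comb by simp
  next
    case False
    then have "sgn (val q0 B l) = sgn (val q B l)" using N[of B l] B by (simp add: q0_def)
    then show ?thesis using False by (metis sgn_eq_0_iff)
  qed
  have sgq: "real_of_int (sgn (val q0 (ids I' J') l)) = sgn (wfun I' J' l p0)" if "l <= s" "wfun I' J' l p0 ~= 0" for I' J' l
  proof -
    have e: "real_of_int (sgn (val q (ids I' J') l)) = sgn (wfun I' J' l p0)" by (rule q(4)[OF that])
    then have "val q (ids I' J') l ~= 0" using that(2) by (auto simp: sgn_eq_0_iff)
    then have "sgn (val q0 (ids I' J') l) = sgn (val q (ids I' J') l)" unfolding q0_def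
      using N[of "ids I' J'" l] ids_XY[of I' J'] that(1) by simp
    then show ?thesis using e by simp
  qed
  obtain v where v: "lat s v" "val v ?A t > 0" using exists_positive_val[OF A(1-3)] by blast
  define v' where "v' = (%i. - v i)"
  have v': "lat s v'" "val v' ?A t < 0" using v lat_uminus val_scale[of "-1" v] by (simp_all add: v'_def)
  obtain N1 where N1: "\<And>N B l. N >= N1 ==> B \<subseteq> XY ==> l <= Suc s ==> val q0 B l ~= 0 ==>
      sgn (val (%i. v i + int N * q0 i) B l) = sgn (val q0 B l)" using dominant[of s q0 v] by blast
  obtain N2 where N2: "\<And>N B l. N >= N2 ==> B \<subseteq> XY ==> l <= Suc s ==> val q0 B l ~= 0 ==>
      sgn (val (%i. v' i + int N * q0 i) B l) = sgn (val q0 B l)" using dominant[of s q0 v'] by blast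
  define M where "M = max N1 N2"
  \<comment> \<open>Displacing a large multiple of \<open>q0\<close> off the wall to either side
    gives directions in the two chambers that differ only in the signs belonging to this
    wall.\<close>
  define q1 where "q1 = (%i. v i + int M * q0 i)"
  define q2 where "q2 = (%i. v' i + int M * q0 i)"
  have l12: "lat s q1" "lat s q2" unfolding q1_def q2_def by (rule lat_comb[OF v(1) l0] lat_comb[OF v'(1) l0])+
  have s1: "sgn (val q1 B l) = sgn (val q0 B l)" if "B \<subseteq> XY" "l <= Suc s" "val q0 B l ~= 0" for B l
    unfolding q1_def by (rule N1) (use that in \<open>auto simp: M_def\<close>)
  have s2: "sgn (val q2 B l) = sgn (val q0 B l)" if "B \<subseteq> XY" "l <= Suc s" "val q0 B l ~= 0" for B l
    unfolding q2_def by (rule N2) (use that in \<open>auto simp: M_def\<close>)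
  have vA: "val q1 ?A t > 0" "val q2 ?A t < 0" using v v' z0 by (simp_all add: q1_def q2_def val_comb)
  have coords: "e (Xi i) > 0 & e (Yj j) < 0 & e (Zp 0) < 0"
    if sg: "\<And>B l. B \<subseteq> XY ==> l <= Suc s ==> val q0 B l ~= 0 ==> sgn (val e B l) = sgn (val q0 B l)" for e i j
  proof -
    have wp: "wfun {i} {} 0 p0 > 0" "wfun {} {j} 0 p0 < 0" using p0r(1) by (auto simp: region_wfun)
    have a: "val f (ids {i} {}) 0 = f (Xi i)" "val f (ids {} {j}) 0 = f (Yj j)" for f :: "('m, 'n) idx => int"
      by (simp_all add: val_ids)
    have "sgn (q0 (Xi i)) = 1" using sgq[of 0 "{i}" "{}"] wp(1) by (simp add: a)
    moreover from this have "q0 (Xi i) ~= 0" by (metis sgn_0 zero_neq_one)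
    ultimately have 1: "sgn (e (Xi i)) = 1" using sg[OF ids_XY, of 0 "{i}" "{}"] by (simp add: a)
    have "real_of_int (sgn (q0 (Yj j))) = -1" using sgq[of 0 "{}" "{j}"] wp(2) by (simp add: a)
    then have "sgn (q0 (Yj j)) = -1" by (simp add: sgn_if split: if_splits)
    moreover from this have "q0 (Yj j) ~= 0" by (metis sgn_0 zero_neq_neg_one)
    ultimately have 2: "sgn (e (Yj j)) = -1" using sg[OF ids_XY, of 0 "{}" "{j}"] by (simp add: a)
    have "sgn (q0 (Zp 0)) = sgn (q (Zp 0))" unfolding q0_def using N[of "{}" "Suc 0"] q(2) by (simp add: val_simps)
    then have "sgn (q0 (Zp 0)) = -1" using q(2) by simp
    moreover from this have "q0 (Zp 0) ~= 0" by (metis sgn_0 zero_neq_neg_one)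
    ultimately have 3: "sgn (e (Zp 0)) = -1" using sg[of "{}" "Suc 0"] by (simp add: val_simps)
    show ?thesis using 1 2 3 by (simp add: sgn_1_pos sgn_1_neg)
  qed
  have q1c: "q1 (Xi i) > 0 & q1 (Yj j) < 0 & q1 (Zp 0) < 0" for i j by (rule coords) (rule s1)
  have q2c: "q2 (Xi i) > 0 & q2 (Yj j) < 0 & q2 (Zp 0) < 0" for i j by (rule coords) (rule s2)
  have q1: "q1 \<in> cham s ?p"
    unfolding cham_def
  proof (intro CollectI conjI allI impI)
    fix B :: "('m, 'n) idx set" and l assume B: "mixed B" "l <= s"
    obtain I' J' where B': "B = ids I' J'" using B ids_cases unfolding mixed_def by blast
    have pr: "proper I' J'" using B mixed_ids unfolding B' by blast
    show "sgn (val q1 B l) = sgn (val ?p B l)"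
    proof (cases "on_wall s ?A t B l")
      case True
      have "B = ?A & l = t | B = XY - ?A & l = s - t"
        using on[OF pr True[unfolded B']] by (auto simp: B' XY_def ids_def)
      then show ?thesis
        using val_complement[OF l12(1) A(1) ts] val_complement[OF mu(4) A(1) ts] vA(1) vp \<delta> by auto
    next
      case False
      have nz: "wfun I' J' l p0 ~= 0" using sep[OF pr B(2)] False by (simp add: B')
      have "val q0 B l ~= 0" using nz0[of B l] B False by (simp add: mixed_def)
      then have "sgn (val q1 B l) = sgn (val q0 B l)" using s1[of B l] B by (simp add: mixed_def)
      moreover have "real_of_int (sgn (val q0 B l)) = real_of_int (sgn (val ?p B l))"
        using sgq[OF B(2) nz] sg1[OF pr B(2)] False unfolding sgn_wfun_pt by (simp add: B')
      ultimately show ?thesis by simp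
    qed
  qed (use l12 q1c in \<open>auto intro: less_imp_le\<close>)
  have q2C: "pt q2 \<in> C2"
  proof (rule component_same_side[OF C2 P2'])
    show reg: "pt q2 \<in> region s" using q2c l12 by (intro pt_region) (auto intro: less_imp_le)
    fix I' J' l assume h: "proper (I' :: 'm set) (J' :: 'n set)" "l <= s"
    show "sgn (wfun I' J' l (pt q2)) = sgn (wfun I' J' l P2')"
    proof (cases "on_wall s ?A t (ids I' J') l")
      case True
      have "wfun I J t (pt q2) < 0" unfolding wfun_pt using vA(2) by simp
      then show ?thesis using on[OF h(1) True] P2neg wfun_complement[OF reg ts, of I J]
          wfun_complement[OF component_wfun(1)[OF C2 P2'] ts, of I J] by auto
    next
      case False
      have nz: "wfun I' J' l p0 ~= 0" by (rule sep[OF h False])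
      have "sgn (val q2 (ids I' J') l) = sgn (val q0 (ids I' J') l)"
        using s2[OF ids_XY] nz0[OF ids_XY h(2) False] h(2) by simp
      then show ?thesis using sgq[OF h(2) nz] sg2[OF h False] unfolding sgn_wfun_pt by simp
    qed
  qed
  have q2: "q2 \<in> cham s q2" by (rule cham_refl) (use l12 q2c in \<open>auto intro: less_imp_le\<close>)
  note cp1 = chamber_polynomial_hurwitz[OF C1 mu(5) r n2 assms(12) assms(14)]
  note cp2 = chamber_polynomial_hurwitz[OF C2 q2C r n2 assms(13) assms(15)]
  interpret c1: chamber_polynomial s r xs0 ys0 ?p "%e. weight e * P1 (pt e)" by (rule cp1)
  interpret c2: chamber_polynomial s r xs0 ys0 q2 "%e. weight e * P2 (pt e)" by (rule cp2)
  have pc: "?p \<in> cham s ?p" by (rule cham_refl) (use mu in auto)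
  have d1: "mcoeff (Rw q1 ?p zi ?W) ?Z = weight ?p * P1 (pt ?p)"
    by (rule c1.directional[OF q1 _ mu(4)]) (use q1c in blast)
  \<comment> \<open>The given point lies in the other chamber; regularisation in a direction of
    \<open>C2\<close> continues the polynomial of \<open>C2\<close> to it.\<close>
  have d2: "mcoeff (Rw q2 ?p zi ?W) ?Z = weight ?p * P2 (pt ?p)"
    by (rule c2.directional[OF q2 _ mu(4)]) (use q2c in blast)
  interpret tb: two_blocks s ?A t q0 q1 q2 ?p
  proof
    show "?A \<subseteq> XY" "?A ~= {}" "?A ~= XY" "t <= s" "lat s q0" "lat s q1" "lat s q2" "lat s ?p" by fact+
    show "val q0 ?A t = 0" "0 < val q1 ?A t" "val q2 ?A t < 0" by fact+
    show "val ?p ?A t ~= 0" using vp \<delta> by simp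
    fix B l assume B: "B \<subseteq> XY" "l <= s" "~ on_wall s ?A t B l"
    then show "val q0 B l ~= 0 & sgn (val q1 B l) = sgn (val q0 B l) & sgn (val q2 B l) = sgn (val q0 B l)"
      using nz0[OF B] s1[OF B(1)] s2[OF B(1)] by simp
  qed
  note WC = tb.wall_crossing
  interpret wc: wall_crossing "letters s" zi q1 q2 ?p "sides s ?A t" "prefactor s ?p" by (rule WC)
  let ?wc = "wc_summand s I J \<mu> \<nu> k \<delta>" and ?Ks = "{K. K \<subseteq> {1..s} & card K = t}"
  have summand: "mcoeff (wc.crossing (?A \<union> Zp ` K) ?W) ?Z = weight ?p * mcoeff (?wc K) ?Z" if K: "K \<in> ?Ks" for K
  proof -
    let ?S = "?A \<union> Zp ` K"
    have S: "?S \<in> sides s ?A t" using bij_betw_apply[OF bij_sides[OF A(1)] K] .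
    then have SX: "?S \<subseteq> letters s" by (simp add: sides_def)
    have "sum ?p ?S = val ?p ?A t" using sum_letter(1)[OF mu(4) SX] S by (simp add: sides_def)
    then have "sum ?p ?S ~= 0" using vp \<delta> by simp
    note G = mons_prefactor[OF this, of s]
    have "mcoeff (wc.crossing ?S ?W) ?Z = mcoeff (prefactor s ?p ?S * (c1.H1 ?S q1 ?p * c1.H2 (letters s - ?S) q1 ?p)) ?Z"
      using c1.crossing_H[OF WC S SX l12(1) mu(4)] by simp
    \<comment> \<open>The direction next to the wall is replaced by the point itself. This uses that
      the final monomial is the one whose coefficient is taken, that the prefactor is even, and that
      the polynomial of \<open>C1\<close> exists.\<close>
    also have "... = mcoeff (prefactor s ?p ?S * (c1.H1 ?S zero_dir ?p * c1.H2 (letters s - ?S) zero_dir ?p)) ?Z"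
      by (rule c1.transport[OF q1 _ pc S A(4) G]) (use q1c in blast)
    also have "prefactor s ?p ?S * (c1.H1 ?S zero_dir ?p * c1.H2 (letters s - ?S) zero_dir ?p) = mconst (weight ?p) * ?wc K"
    proof (rule sum_sides_wc[OF cp1 mu(4) ts _ _ \<delta>_def])
      show "\<mu> $ i ~= 0" "\<nu> $ j ~= 0" for i j using mu(1)[of i] mu(2)[of j] by simp_all
    qed (use K \<delta> in auto)
    finally show ?thesis by (simp add: mcoeff_mconst_mult)
  qed
  have "weight ?p * P1 (pt ?p) - weight ?p * P2 (pt ?p) = mcoeff (Rw q1 ?p zi ?W - Rw q2 ?p zi ?W) ?Z"
    by (simp add: d1 d2 mcoeff_diff)
  also have "... = (\<Sum>S\<in>sides s ?A t. mcoeff (wc.crossing S ?W) ?Z)"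
    unfolding wc.crossing_formula[OF c1.dW] by (simp add: mcoeff_sum)
  also have "... = (\<Sum>K\<in>?Ks. mcoeff (wc.crossing (?A \<union> Zp ` K) ?W) ?Z)"
    by (rule sum.reindex_bij_betw[OF bij_sides[OF A(1)], symmetric])
  also have "... = (\<Sum>K\<in>?Ks. weight ?p * mcoeff (?wc K) ?Z)" by (rule sum.cong[OF refl summand])
  also have "... = weight ?p * mcoeff (\<Sum>K\<in>?Ks. ?wc K) ?Z" by (simp add: mcoeff_sum sum_distrib_left)
  finally have eq: "weight ?p * (P1 (pt ?p) - P2 (pt ?p)) = weight ?p * mcoeff (\<Sum>K\<in>?Ks. ?wc K) ?Z"
    by (simp add: algebra_simps)
  have "\<mu> $ i ~= 0" "\<nu> $ j ~= 0" for i j using mu(1)[of i] mu(2)[of j] by simp_all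
  then have "weight ?p ~= 0" by (simp add: weight_def)
  then show ?thesis using eq by (simp add: pt_lv \<delta>_def)
qed

end
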